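(* Let $m\ge 1$, let $D_1,\dots,D_m$ be classical Cartan domains, and let $D=D_1\times D_2\times\cdots\times D_m$. Then $$\rho_D=\left(\rho_{D_1}^{-2}+\rho_{D_2}^{-2}+\cdots+\rho_{D_m}^{-2}\right)^{-1/2},$$ where, for a bounded, balanced, convex and homogeneous domain $G$, $\rho_G$ denotes the common constant value of the Fridman invariant $e_G$ and the squeezing function $s_G$.
   Context: A domain is a nonempty connected open set. A domain $G\subset\mathbb{C}^n$ is balanced if $z\in G$ and $|\lambda|\le1$ imply $\lambda z\in G$, and homogeneous if its group of biholomorphic automorphisms acts transitively on $G$. $\mathbb{B}^n$ is the open Euclidean unit ball in $\mathbb{C}^n$ centered at $0$, and $r\mathbb{B}^n$ is the ball of radius $r$. $\mathcal{O}_u(G_1,G_2)$ is the set of injective holomorphic maps $G_1\to G_2$. $k_G$ is the Kobayashi (pseudo)distance on $G$, normalized so that on the unit disk $\Delta\subset\mathbb{C}$ one has $k_\Delta(0,z)=\operatorname{artanh}|z|$: $k_G(z,w)$ is the infimum of $\sum_{j=1}^N k_\Delta(a_j,b_j)$ over all chains of holomorphic maps $f_j:\Delta\to G$ with $f_1(a_1)=z$, $f_j(b_j)=f_{j+1}(a_{j+1})$, $f_N(b_N)=w$. For $z\in G$, $r>0$, let $B_G^k(z,r)=\{w\in G:k_G(z,w)<r\}$. For a bounded domain $G\subset\mathbb{C}^n$ and $z\in G$, the Fridman invariant is $$e_G(z)=\sup\{\tanh(r): r>0,\ B_G^k(z,r)\subset f(\mathbb{B}^n) \text{ for some } f\in\mathcal{O}_u(\mathbb{B}^n,G)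 \text{ with } f(0)=z\},$$ and the squeezing function is $$s_G(z)=\sup\{r>0: r\mathbb{B}^n\subset f(G) \text{ for some } f\in\mathcal{O}_u(G,\mathbb{B}^n) \text{ with } f(z)=0\}.$$ Both are invariant under biholomorphisms, hence constant on a bounded homogeneous domain; on a bounded, balanced, convex and homogeneous domain $G$ the two constants coincide, and $\rho_G$ denotes their common value. The classical Cartan domains are the domains of the following four types (each is bounded, balanced, convex and homogeneous, and so are finite products of them), where $Z^*$ is the conjugate transpose, $Z^T$ the transpose, and $>0$ means positive definite: (I) $p\times q$ complex matrices $Z$ with $I_p-ZZ^*>0$ ($p,q\ge1$); (II) $p\times p$ complex skew-symmetric matrices $Z$ with $I_p-ZZ^*>0$ ($p\ge2$); (III) $p\times p$ complex symmetric matrices $Z$ with $I_p-ZZ^*>0$ ($p\ge1$); (IV) row vectors $z\in\mathbb{C}^n$ ($n\ge 1$) with $zz^*<1$ and $1-2zz^*+|zz^T|^2>0$. Matrix spaces in (I)–(III) are regarded as complex Euclidean spaces $\mathbb{C}^N$ via their independent entries, $N$ being the complex dimension. *)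

theory Defs
  imports
    "HOL-Complex_Analysis.Complex_Analysis"
    "Jordan_Normal_Form.Schur_Decomposition"
begin

text \<open>
  For a finite index set \<open>I\<close>, the space $\mathbb{C}^N$ with $N = |I|$ is the set of functions
  vanishing outside \<open>I\<close>, with the topology of the function type (which on this set is the Euclidean
  one). Arbitrary index sets, rather than initial segments of the naturals, let matrix entries and
  finite products be used as coordinates without renumbering.
\<close>

definition cspace :: "'i set \<Rightarrow> ('i \<Rightarrow> complex) set" where
  "cspace I = {x. \<forall>i. i \<notin> I \<longrightarrow> x i = 0}"

definition cnorm :: "'i set \<Rightarrow> ('i \<Rightarrow> complex) \<Rightarrow> real" where
  "cnorm I x = L2_set (\<lambda>i. norm (x i)) I"

definition cball0 :: "'i set \<Rightarrow> real \<Rightarrow> ('i \<Rightarrow> complex) set" where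
  "cball0 I r = {x \<in> cspace I. cnorm I x < r}"


text \<open>
  Holomorphy in several variables, for \<open>G\<close> open in \<open>cspace I\<close> and \<open>f\<close> mapping \<open>G\<close> into \<open>cspace I\<close>:
  every component of \<open>f\<close> has a complex-linear Frechet derivative, with coefficients \<open>c\<close>, at every
  point of \<open>G\<close>.
\<close>

definition holomorphic_map ::
    "'i set \<Rightarrow> ('i \<Rightarrow> complex) set \<Rightarrow> (('i \<Rightarrow> complex) \<Rightarrow> ('i \<Rightarrow> complex)) \<Rightarrow> bool" where
  "holomorphic_map I G f \<longleftrightarrow>
     (\<forall>z\<in>G. \<forall>j\<in>I. \<exists>c :: 'i \<Rightarrow> complex.
        ((\<lambda>w. (f w j - f z j - (\<Sum>i\<in>I. c i * (w i - z i)))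
                / of_real (cnorm I (\<lambda>i. w i - z i))) \<longlongrightarrow> 0) (at z within G))"

definition univalent_maps ::
    "'i set \<Rightarrow> ('i \<Rightarrow> complex) set \<Rightarrow> ('i \<Rightarrow> complex) set
       \<Rightarrow> (('i \<Rightarrow> complex) \<Rightarrow> ('i \<Rightarrow> complex)) set" where
  "univalent_maps I G1 G2 = {f. holomorphic_map I G1 f \<and> inj_on f G1 \<and> f ` G1 \<subseteq> G2}"

definition holomorphic_discs ::
    "'i set \<Rightarrow> ('i \<Rightarrow> complex) set \<Rightarrow> (complex \<Rightarrow> ('i \<Rightarrow> complex)) set" where
  "holomorphic_discs I G =
     {f. (\<forall>i\<in>I. (\<lambda>\<zeta>. f \<zeta> i) holomorphic_on ball 0 1) \<and> f ` ball 0 1 \<subseteq> G}"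


text \<open>
  The value at \<open>a\<close>, \<open>b\<close> is the Moebius-invariant extension of the normalization
  $k_\Delta(0,z) = \mathrm{artanh}\,|z|$.
\<close>

definition poincare_dist :: "complex \<Rightarrow> complex \<Rightarrow> real" where
  "poincare_dist a b = artanh (norm ((a - b) / (1 - cnj a * b)))"

text \<open>Chains are indexed by \<open>0, \<dots>, N - 1\<close>.\<close>

definition kobayashi_chain ::
    "'i set \<Rightarrow> ('i \<Rightarrow> complex) set \<Rightarrow> ('i \<Rightarrow> complex) \<Rightarrow> ('i \<Rightarrow> complex) \<Rightarrow> nat
       \<Rightarrow> (nat \<Rightarrow> complex \<Rightarrow> ('i \<Rightarrow> complex)) \<Rightarrow> (nat \<Rightarrow> complex) \<Rightarrow> (nat \<Rightarrow> complex) \<Rightarrow> bool" where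
  "kobayashi_chain I G z w N f a b \<longleftrightarrow>
     N \<ge> 1 \<and>
     (\<forall>j<N. f j \<in> holomorphic_discs I G \<and> a j \<in> ball 0 1 \<and> b j \<in> ball 0 1) \<and>
     f 0 (a 0) = z \<and>
     (\<forall>j. Suc j < N \<longrightarrow> f j (b j) = f (Suc j) (a (Suc j))) \<and>
     f (N - 1) (b (N - 1)) = w"

definition kobayashi_dist ::
    "'i set \<Rightarrow> ('i \<Rightarrow> complex) set \<Rightarrow> ('i \<Rightarrow> complex) \<Rightarrow> ('i \<Rightarrow> complex) \<Rightarrow> real" where
  "kobayashi_dist I G z w =
     Inf {\<Sum>j<N. poincare_dist (a j) (b j) | N f a b. kobayashi_chain I G z w N f a b}"

definition kobayashi_ball ::
    "'i set \<Rightarrow> ('i \<Rightarrow> complex) set \<Rightarrow> ('i \<Rightarrow> complex) \<Rightarrow> real \<Rightarrow> ('i \<Rightarrow> complex) set" where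
  "kobayashi_ball I G z r = {w \<in> G. kobayashi_dist I G z w < r}"

definition fridman_invariant ::
    "'i set \<Rightarrow> ('i \<Rightarrow> complex) set \<Rightarrow> ('i \<Rightarrow> complex) \<Rightarrow> real" where
  "fridman_invariant I G z =
     Sup {tanh r | r. r > 0 \<and>
       (\<exists>f \<in> univalent_maps I (cball0 I 1) G.
          f (\<lambda>_. 0) = z \<and> kobayashi_ball I G z r \<subseteq> f ` cball0 I 1)}"

definition squeezing_function ::
    "'i set \<Rightarrow> ('i \<Rightarrow> complex) set \<Rightarrow> ('i \<Rightarrow> complex) \<Rightarrow> real" where
  "squeezing_function I G z =
     Sup {r. r > 0 \<and>
       (\<exists>f \<in> univalent_maps I G (cball0 I 1).
          f z = (\<lambda>_. 0) \<and> cball0 I r \<subseteq> f ` G)}"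

text \<open>
  This description is meaningful when both functions are constant on \<open>G\<close>, with the same value, as
  is the case for bounded, balanced, convex and homogeneous domains.
\<close>

definition rho :: "'i set \<Rightarrow> ('i \<Rightarrow> complex) set \<Rightarrow> real" where
  "rho I G = (THE c. \<forall>z\<in>G. fridman_invariant I G z = c \<and> squeezing_function I G z = c)"


text \<open>The strict inequality below is in the partial order on \<open>complex\<close>: real and positive.\<close>

definition positive_definite :: "complex mat \<Rightarrow> bool" where
  "positive_definite A \<longleftrightarrow>
     square_mat A \<and> mat_adjoint A = A \<and>
     (\<forall>v \<in> carrier_vec (dim_row A). v \<noteq> 0\<^sub>v (dim_row A) \<longrightarrow> (A *\<^sub>v v) \<bullet>c v > 0)"

text \<open>
  The coordinates of a matrix are its entries at the positions in \<open>I\<close>; for the four types below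
  these are the independent entries.
\<close>

definition mat_coords :: "(nat \<times> nat) set \<Rightarrow> complex mat \<Rightarrow> (nat \<times> nat \<Rightarrow> complex)" where
  "mat_coords I Z = (\<lambda>ij. if ij \<in> I then Z $$ ij else 0)"

inductive classical_cartan_domain ::
    "(nat \<times> nat) set \<Rightarrow> (nat \<times> nat \<Rightarrow> complex) set \<Rightarrow> bool" where
  type_I:
    "p \<ge> 1 \<Longrightarrow> q \<ge> 1 \<Longrightarrow> I = {..<p} \<times> {..<q} \<Longrightarrow>
     D = mat_coords I ` {Z \<in> carrier_mat p q. positive_definite (1\<^sub>m p - Z * mat_adjoint Z)} \<Longrightarrow>
     classical_cartan_domain I D"
| type_II:
    "p \<ge> 2 \<Longrightarrow> I = {(i, j). i < j \<and> j < p} \<Longrightarrow>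
     D = mat_coords I ` {Z \<in> carrier_mat p p. transpose_mat Z = - Z \<and>
           positive_definite (1\<^sub>m p - Z * mat_adjoint Z)} \<Longrightarrow>
     classical_cartan_domain I D"
| type_III:
    "p \<ge> 1 \<Longrightarrow> I = {(i, j). i \<le> j \<and> j < p} \<Longrightarrow>
     D = mat_coords I ` {Z \<in> carrier_mat p p. transpose_mat Z = Z \<and>
           positive_definite (1\<^sub>m p - Z * mat_adjoint Z)} \<Longrightarrow>
     classical_cartan_domain I D"
| type_IV:
    "n \<ge> 1 \<Longrightarrow> I = {0} \<times> {..<n} \<Longrightarrow>
     D = {z \<in> cspace I. (\<Sum>i\<in>I. (norm (z i))\<^sup>2) < 1 \<and>
           1 - 2 * (\<Sum>i\<in>I. (norm (z i))\<^sup>2) + (norm (\<Sum>i\<in>I. (z i)\<^sup>2))\<^sup>2 > 0} \<Longrightarrow>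
     classical_cartan_domain I D"


definition product_index :: "nat \<Rightarrow> (nat \<Rightarrow> 'i set) \<Rightarrow> (nat \<times> 'i) set" where
  "product_index m I = Sigma {..<m} I"

definition product_domain ::
    "nat \<Rightarrow> (nat \<Rightarrow> 'i set) \<Rightarrow> (nat \<Rightarrow> ('i \<Rightarrow> complex) set) \<Rightarrow> (nat \<times> 'i \<Rightarrow> complex) set" where
  "product_domain m I D =
     {x \<in> cspace (product_index m I). \<forall>l<m. (\<lambda>i. x (l, i)) \<in> D l}"

end

theory Submission
  imports Defs "HOL-Homology.Invariance_of_Domain"
begin

text \<open>
  The domains in question are open unit balls of norms \<open>N\<close>. By the Schwarz lemma, the Kobayashi ball
  of radius \<open>r\<close> about the origin of such a ball is the \<open>N\<close>-ball of radius \<open>tanh r\<close>, and an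
  injective holomorphic map between two unit balls which fixes the origin and whose image contains
  the ball of radius \<open>t\<close> may be replaced by its derivative at the origin. Hence both invariants are
  equal, at the origin, to the supremum of all \<open>t < 1\<close> for which some Hermitian norm \<open>H\<close> satisfies
  \<open>t N \<le> H \<le> N\<close>; homogeneity carries this to all other points.

  For the product, \<open>N\<close> is the maximum of the norms \<open>N\<^sub>l\<close>. Suitably weighted sums of squares of
  Hermitian norms on the factors give one inequality. Conversely, if \<open>t N \<le> H \<le> N\<close> on the product,
  then in each factor there is, up to a factor close to one, a vector with \<open>N\<^sub>l \<le> 1\<close> and
  \<open>H \<ge> t / \<rho>\<^sub>l\<close>; adding these with suitable signs gives a vector with \<open>N \<le> 1\<close> and
  \<open>H\<^sup>2 \<ge> t\<^sup>2 \<Sum> \<rho>\<^sub>l\<^sup>-\<^sup>2\<close>.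

  The types I, II and III are unit balls for the operator norm and type IV is the unit ball of the
  largest absolute value of the pairings with normalized isotropic vectors. All of them are
  homogeneous under Moebius transformations.
\<close>

text \<open>The arrow of exact sequences would make the notation for limits ambiguous.\<close>

no_notation exact_seq_arrow  (\<open>(\<open>indent=3 notation=\<open>mixfix exact_seq\<close>\<close>_ / \<longlongrightarrow>\<index> _)\<close> [1000, 60])

text \<open>The delicate point is the passage from an injective holomorphic map \<open>f\<close> to
  its derivative at the origin. The upper bound is the Schwarz lemma. The lower bound is the Schwarz
  lemma for the inverse, which is continuous by invariance of domain but is shown to be
  differentiable, along a complex line, only where the Jacobian determinant of \<open>f\<close> is
  nonzero. Hence \<open>schwarz_deriv_off_zeros\<close> allows an exceptional zero set. It still
  requires a nonsingular derivative at the base point; an induction on the dimension finds such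
  points in every ball around the origin, and continuity of the partial derivatives carries the
  estimate to the origin itself. Norms enter through families of functionals whose least bound they
  are, so that every estimate concerns functions of one complex variable. Hermitian norms are
  written \<open>cnorm I (lin I A x)\<close> with a square matrix \<open>A\<close>. Restricting one
  of them from the product to a factor gives a rectangular matrix, and a Cholesky factorization
  makes it square again.\<close>

section \<open>Neighbourhoods relative to a set\<close>

lemma tendsto_coordinatewise:
  fixes f :: "'a \<Rightarrow> 'i \<Rightarrow> 'b::topological_space"
  shows "(f \<longlongrightarrow> l) F \<longleftrightarrow> (\<forall>i. ((\<lambda>x. f x i) \<longlongrightarrow> l i) F)"
proof -
  have "(f \<longlongrightarrow> l) F \<longleftrightarrow> limitin (product_topology (\<lambda>i. euclidean) UNIV) f l F"
    by (simp add: euclidean_product_topology)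
  also have "\<dots> \<longleftrightarrow> (\<forall>i. ((\<lambda>x. f x i) \<longlongrightarrow> l i) F)"
    by (subst limitin_componentwise) simp
  finally show ?thesis .
qed

text \<open>Unlike \<open>at z within G\<close>, this filter keeps the point \<open>z\<close> when
  it lies in \<open>G\<close>. Limits along it can therefore be composed with maps that take their
  base value repeatedly.\<close>

abbreviation nhds_rel :: "'a::topological_space set \<Rightarrow> 'a \<Rightarrow> 'a filter" where
  "nhds_rel G z \<equiv> inf (nhds z) (principal G)"

lemma at_within_le_nhds_rel: "at z within G \<le> nhds_rel G z"
  by (simp add: at_within_def le_infI2)

lemma eventually_nhds_rel: "eventually P (nhds_rel G z) \<longleftrightarrow> eventually (\<lambda>w. w \<in> G \<longrightarrow> P w) (nhds z)"
  by (simp add: eventually_inf_principal)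

lemma tendsto_nhds_rel_iff_at: "(f \<longlongrightarrow> f z) (nhds_rel G z) \<longleftrightarrow> (f \<longlongrightarrow> f z) (at z within G)"
proof
  assume *: "(f \<longlongrightarrow> f z) (at z within G)"
  show "(f \<longlongrightarrow> f z) (nhds_rel G z)"
  proof (rule topological_tendstoI)
    fix S assume S: "open S" "f z \<in> S"
    from topological_tendstoD[OF * this] show "\<forall>\<^sub>F x in nhds_rel G z. f x \<in> S"
      unfolding eventually_nhds_rel eventually_at_filter by (rule eventually_mono) (use S in auto)
  qed
qed (rule tendsto_mono[OF at_within_le_nhds_rel])

lemma coord_tendsto_nhds_rel: "((\<lambda>w. w i) \<longlongrightarrow> z i) (nhds_rel G (z :: 'i \<Rightarrow> 'b::topological_space))"
proof -
  have "((\<lambda>w. w) \<longlongrightarrow> z) (nhds_rel G z)" by (simp add: filterlim_def inf.coboundedI1)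
  then show ?thesis unfolding tendsto_coordinatewise by blast
qed

lemma filterlim_nhds_rel:
  assumes "(\<phi> \<longlongrightarrow> y) F" "eventually (\<lambda>w. \<phi> w \<in> H) F"
  shows "filterlim \<phi> (nhds_rel H y) F"
  using assms by (simp add: filterlim_inf filterlim_principal)

subsection \<open>Differentiability\<close>

text \<open>Caratheodory's form of differentiability: the increment of \<open>f\<close> is exactly a
  combination of the coordinate increments, with slopes \<open>q\<close> that tend to
  \<open>c\<close>. The rules for sums, products, inverses and compositions become algebraic
  identities between slopes, without estimates of a remainder.\<close>

definition has_gradient ::
    "'i set \<Rightarrow> ('i \<Rightarrow> complex) set \<Rightarrow> (('i \<Rightarrow> complex) \<Rightarrow> complex) \<Rightarrow> ('i \<Rightarrow> complex) \<Rightarrow> ('i \<Rightarrow> complex) \<Rightarrow> bool" where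
  "has_gradient I G f z c \<longleftrightarrow>
     (\<exists>q. (\<forall>i\<in>I. ((\<lambda>w. q w i) \<longlongrightarrow> c i) (nhds_rel G z)) \<and>
          (\<forall>\<^sub>F w in nhds_rel G z. f w - f z = (\<Sum>i\<in>I. q w i * (w i - z i))))"

definition holo_on :: "'i set \<Rightarrow> ('i \<Rightarrow> complex) set \<Rightarrow> (('i \<Rightarrow> complex) \<Rightarrow> complex) \<Rightarrow> bool" where
  "holo_on I G f \<longleftrightarrow> (\<forall>z\<in>G. \<exists>c. has_gradient I G f z c)"

lemma has_gradient_tendsto:
  assumes "has_gradient I G f z c"
  shows "(f \<longlongrightarrow> f z) (nhds_rel G z)"
proof -
  obtain q where q: "\<And>i. i \<in> I \<Longrightarrow> ((\<lambda>w. q w i) \<longlongrightarrow> c i) (nhds_rel G z)"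
    and e: "\<forall>\<^sub>F w in nhds_rel G z. f w - f z = (\<Sum>i\<in>I. q w i * (w i - z i))"
    using assms unfolding has_gradient_def by blast
  have "((\<lambda>w. f z + (\<Sum>i\<in>I. q w i * (w i - z i))) \<longlongrightarrow> f z + (\<Sum>i\<in>I. c i * (z i - z i))) (nhds_rel G z)"
    by (intro tendsto_intros q coord_tendsto_nhds_rel)
  moreover have "\<forall>\<^sub>F w in nhds_rel G z. f z + (\<Sum>i\<in>I. q w i * (w i - z i)) = f w"
    using e by eventually_elim (simp add: algebra_simps)
  ultimately have "(f \<longlongrightarrow> f z + (\<Sum>i\<in>I. c i * (z i - z i))) (nhds_rel G z)" by (rule Lim_transform_eventually)
  then show ?thesis by simp
qed

lemma has_gradient_subset: "has_gradient I G f z c \<Longrightarrow> G' \<subseteq> G \<Longrightarrow> has_gradient I G' f z c"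
proof -
  assume "has_gradient I G f z c" and G: "G' \<subseteq> G"
  moreover have "nhds_rel G' z \<le> nhds_rel G z" using G by (simp add: le_infI2)
  ultimately show ?thesis unfolding has_gradient_def by (meson filter_leD tendsto_mono)
qed

lemma has_gradient_eventually_cong:
  assumes "has_gradient I G f z c" "\<forall>\<^sub>F w in nhds_rel G z. f w = g w" "f z = g z"
  shows "has_gradient I G g z c"
proof -
  obtain q where q: "\<And>i. i \<in> I \<Longrightarrow> ((\<lambda>w. q w i) \<longlongrightarrow> c i) (nhds_rel G z)"
    and e: "\<forall>\<^sub>F w in nhds_rel G z. f w - f z = (\<Sum>i\<in>I. q w i * (w i - z i))"
    using assms unfolding has_gradient_def by blast
  have "\<forall>\<^sub>F w in nhds_rel G z. g w - g z = (\<Sum>i\<in>I. q w i * (w i - z i))"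
    using e assms(2) by eventually_elim (simp add: assms(3))
  with q show ?thesis unfolding has_gradient_def by blast
qed

lemma has_gradient_const: "has_gradient I G (\<lambda>_. a) z (\<lambda>_. 0)"
  unfolding has_gradient_def by (rule exI[of _ "\<lambda>_ _. 0"]) auto

lemma has_gradient_coord:
  assumes "finite I" "k \<in> I"
  shows "has_gradient I G (\<lambda>w. w k) z (\<lambda>i. if i = k then 1 else 0)"
  unfolding has_gradient_def
  by (rule exI[of _ "\<lambda>w i. if i = k then 1 else 0"]) (use assms in \<open>auto simp: if_distrib [of "\<lambda>x. x * _"] sum.delta cong: if_cong\<close>)

lemma has_gradient_add:
  assumes "has_gradient I G f z c" "has_gradient I G g z d"
  shows "has_gradient I G (\<lambda>w. f w + g w) z (\<lambda>i. c i + d i)"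
proof -
  obtain q where q: "\<And>i. i \<in> I \<Longrightarrow> ((\<lambda>w. q w i) \<longlongrightarrow> c i) (nhds_rel G z)"
    and e: "\<forall>\<^sub>F w in nhds_rel G z. f w - f z = (\<Sum>i\<in>I. q w i * (w i - z i))"
    using assms(1) unfolding has_gradient_def by blast
  obtain r where r: "\<And>i. i \<in> I \<Longrightarrow> ((\<lambda>w. r w i) \<longlongrightarrow> d i) (nhds_rel G z)"
    and e': "\<forall>\<^sub>F w in nhds_rel G z. g w - g z = (\<Sum>i\<in>I. r w i * (w i - z i))"
    using assms(2) unfolding has_gradient_def by blast
  have "\<forall>\<^sub>F w in nhds_rel G z. (f w + g w) - (f z + g z) = (\<Sum>i\<in>I. (q w i + r w i) * (w i - z i))"
    using e e' by eventually_elim (simp add: distrib_right sum.distrib diff_eq_eq)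
  moreover have "\<And>i. i \<in> I \<Longrightarrow> ((\<lambda>w. q w i + r w i) \<longlongrightarrow> c i + d i) (nhds_rel G z)"
    by (intro tendsto_intros q r)
  ultimately show ?thesis unfolding has_gradient_def by (intro exI[of _ "\<lambda>w i. q w i + r w i"]) auto
qed

lemma has_gradient_mult:
  assumes "has_gradient I G f z c" "has_gradient I G g z d"
  shows "has_gradient I G (\<lambda>w. f w * g w) z (\<lambda>i. c i * g z + f z * d i)"
proof -
  obtain q where q: "\<And>i. i \<in> I \<Longrightarrow> ((\<lambda>w. q w i) \<longlongrightarrow> c i) (nhds_rel G z)"
    and e: "\<forall>\<^sub>F w in nhds_rel G z. f w - f z = (\<Sum>i\<in>I. q w i * (w i - z i))"
    using assms(1) unfolding has_gradient_def by blast
  obtain r where r: "\<And>i. i \<in> I \<Longrightarrow> ((\<lambda>w. r w i) \<longlongrightarrow> d i) (nhds_rel G z)"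
    and e': "\<forall>\<^sub>F w in nhds_rel G z. g w - g z = (\<Sum>i\<in>I. r w i * (w i - z i))"
    using assms(2) unfolding has_gradient_def by blast
  have "\<forall>\<^sub>F w in nhds_rel G z. (f w * g w) - (f z * g z) = (\<Sum>i\<in>I. (q w i * g w + f z * r w i) * (w i - z i))"
    using e e'
  proof eventually_elim
    case (elim w)
    have "f w * g w - f z * g z = (f w - f z) * g w + f z * (g w - g z)" by (simp add: algebra_simps)
    also have "\<dots> = (\<Sum>i\<in>I. (q w i * g w + f z * r w i) * (w i - z i))"
      unfolding elim sum_distrib_left sum_distrib_right sum.distrib[symmetric]
      by (rule sum.cong) (auto simp: algebra_simps)
    finally show ?case .
  qed
  moreover have "\<And>i. i \<in> I \<Longrightarrow> ((\<lambda>w. q w i * g w + f z * r w i) \<longlongrightarrow> c i * g z + f z * d i) (nhds_rel G z)"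
    by (intro tendsto_intros q r has_gradient_tendsto[OF assms(2)])
  ultimately show ?thesis unfolding has_gradient_def by (intro exI[of _ "\<lambda>w i. q w i * g w + f z * r w i"]) auto
qed

lemma has_gradient_inverse:
  assumes "has_gradient I G f z c" "f z \<noteq> 0"
  shows "has_gradient I G (\<lambda>w. inverse (f w)) z (\<lambda>i. - c i * inverse (f z) * inverse (f z))"
proof -
  obtain q where q: "\<And>i. i \<in> I \<Longrightarrow> ((\<lambda>w. q w i) \<longlongrightarrow> c i) (nhds_rel G z)"
    and e: "\<forall>\<^sub>F w in nhds_rel G z. f w - f z = (\<Sum>i\<in>I. q w i * (w i - z i))"
    using assms(1) unfolding has_gradient_def by blast
  have nz: "\<forall>\<^sub>F w in nhds_rel G z. f w \<noteq> 0"
    using has_gradient_tendsto[OF assms(1)] assms(2) by (rule tendsto_imp_eventually_ne)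
  have "\<forall>\<^sub>F w in nhds_rel G z. inverse (f w) - inverse (f z) = (\<Sum>i\<in>I. (- q w i * inverse (f w) * inverse (f z)) * (w i - z i))"
    using e nz
  proof eventually_elim
    case (elim w)
    have "inverse (f w) - inverse (f z) = - (f w - f z) * inverse (f w) * inverse (f z)"
      using elim(2) assms(2) by (simp add: field_simps)
    also have "\<dots> = (\<Sum>i\<in>I. (- q w i * inverse (f w) * inverse (f z)) * (w i - z i))"
      unfolding elim sum_distrib_right sum_negf[symmetric]
      by (rule sum.cong) (auto simp: algebra_simps)
    finally show ?case .
  qed
  moreover have "\<And>i. i \<in> I \<Longrightarrow> ((\<lambda>w. - q w i * inverse (f w) * inverse (f z)) \<longlongrightarrow> - c i * inverse (f z) * inverse (f z)) (nhds_rel G z)"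
    by (intro tendsto_intros q has_gradient_tendsto[OF assms(1)] assms(2))
  ultimately show ?thesis unfolding has_gradient_def by (intro exI[of _ "\<lambda>w i. - q w i * inverse (f w) * inverse (f z)"]) auto
qed

text \<open>The slopes of the composition are the matrix product of the slopes of \<open>g\<close>,
  taken at \<open>\<phi> w\<close>, with those of \<open>\<phi>\<close>. The condition outside
  \<open>J\<close> makes \<open>\<phi>\<close> continuous in every coordinate, as the topology of
  the function type demands.\<close>

lemma has_gradient_compose:
  assumes \<phi>: "\<And>k. k \<in> J \<Longrightarrow> has_gradient I G (\<lambda>w. \<phi> w k) z (c k)"
    and out: "\<And>k w. k \<notin> J \<Longrightarrow> w \<in> insert z G \<Longrightarrow> \<phi> w k = 0"
    and im: "\<forall>\<^sub>F w in nhds_rel G z. \<phi> w \<in> H"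
    and g: "has_gradient J H g (\<phi> z) d"
  shows "has_gradient I G (\<lambda>w. g (\<phi> w)) z (\<lambda>i. \<Sum>k\<in>J. d k * c k i)"
proof -
  have inG: "\<forall>\<^sub>F w in nhds_rel G z. w \<in> G" unfolding eventually_nhds_rel by simp
  have cont: "((\<lambda>w. \<phi> w k) \<longlongrightarrow> \<phi> z k) (nhds_rel G z)" for k
  proof (cases "k \<in> J")
    case False
    have "\<forall>\<^sub>F w in nhds_rel G z. 0 = \<phi> w k" using inG by eventually_elim (use out False in auto)
    from Lim_transform_eventually[OF tendsto_const this] show ?thesis using out[OF False, of z] by simp
  qed (use has_gradient_tendsto[OF \<phi>] in auto)
  have fl: "filterlim \<phi> (nhds_rel H (\<phi> z)) (nhds_rel G z)"
    by (rule filterlim_nhds_rel) (use cont im in \<open>auto simp: tendsto_coordinatewise\<close>)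
  have "\<forall>k\<in>J. \<exists>q. (\<forall>i\<in>I. ((\<lambda>w. q w i) \<longlongrightarrow> c k i) (nhds_rel G z)) \<and>
          (\<forall>\<^sub>F w in nhds_rel G z. \<phi> w k - \<phi> z k = (\<Sum>i\<in>I. q w i * (w i - z i)))"
    using \<phi> unfolding has_gradient_def by blast
  from bchoice[OF this] obtain q where qe: "\<forall>k\<in>J. (\<forall>i\<in>I. ((\<lambda>w. q k w i) \<longlongrightarrow> c k i) (nhds_rel G z)) \<and>
          (\<forall>\<^sub>F w in nhds_rel G z. \<phi> w k - \<phi> z k = (\<Sum>i\<in>I. q k w i * (w i - z i)))" ..
  then have q: "\<And>k i. k \<in> J \<Longrightarrow> i \<in> I \<Longrightarrow> ((\<lambda>w. q k w i) \<longlongrightarrow> c k i) (nhds_rel G z)"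
    and e: "\<And>k. k \<in> J \<Longrightarrow> \<forall>\<^sub>F w in nhds_rel G z. \<phi> w k - \<phi> z k = (\<Sum>i\<in>I. q k w i * (w i - z i))"
    by auto
  obtain r where r: "\<And>k. k \<in> J \<Longrightarrow> ((\<lambda>w. r w k) \<longlongrightarrow> d k) (nhds_rel H (\<phi> z))"
    and e': "\<forall>\<^sub>F w in nhds_rel H (\<phi> z). g w - g (\<phi> z) = (\<Sum>k\<in>J. r w k * (w k - \<phi> z k))"
    using g unfolding has_gradient_def by blast
  show ?thesis
  proof (cases "finite J")
    \<comment> \<open>A sum over an infinite set is zero, so here the increment equation says that
      \<open>g\<close> is constant near \<open>\<phi> z\<close>.\<close>
    case False
    have "\<forall>\<^sub>F w in nhds_rel H (\<phi> z). g w = g (\<phi> z)" using e' by eventually_elim (use False in auto)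
    then have "\<forall>\<^sub>F w in nhds_rel G z. g (\<phi> w) = g (\<phi> z)" using fl by (rule eventually_compose_filterlim)
    then have "has_gradient I G (\<lambda>w. g (\<phi> w)) z (\<lambda>_. 0)"
      by (intro has_gradient_eventually_cong[OF has_gradient_const[of I G "g (\<phi> z)"]]) (auto elim: eventually_mono)
    then show ?thesis using False by simp
  next
    case True
    have all: "\<forall>\<^sub>F w in nhds_rel G z. \<forall>k\<in>J. \<phi> w k - \<phi> z k = (\<Sum>i\<in>I. q k w i * (w i - z i))"
      using True e by (simp add: eventually_ball_finite)
    have "\<forall>\<^sub>F w in nhds_rel G z. g (\<phi> w) - g (\<phi> z) = (\<Sum>k\<in>J. r (\<phi> w) k * (\<phi> w k - \<phi> z k))"
      using eventually_compose_filterlim[OF e' fl] .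
    with all have "\<forall>\<^sub>F w in nhds_rel G z. g (\<phi> w) - g (\<phi> z) = (\<Sum>i\<in>I. (\<Sum>k\<in>J. r (\<phi> w) k * q k w i) * (w i - z i))"
    proof eventually_elim
      case (elim w)
      have "(\<Sum>k\<in>J. r (\<phi> w) k * (\<phi> w k - \<phi> z k)) = (\<Sum>k\<in>J. \<Sum>i\<in>I. r (\<phi> w) k * q k w i * (w i - z i))"
        by (rule sum.cong) (use elim(1) in \<open>auto simp: sum_distrib_left mult.assoc\<close>)
      then show ?case unfolding elim(2) by (subst (asm) sum.swap) (simp add: sum_distrib_right)
    qed
    moreover have "\<And>i. i \<in> I \<Longrightarrow> ((\<lambda>w. \<Sum>k\<in>J. r (\<phi> w) k * q k w i) \<longlongrightarrow> (\<Sum>k\<in>J. d k * c k i)) (nhds_rel G z)"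
      by (intro tendsto_intros q filterlim_compose[OF r fl])
    ultimately show ?thesis unfolding has_gradient_def by (intro exI[of _ "\<lambda>w i. \<Sum>k\<in>J. r (\<phi> w) k * q k w i"]) auto
  qed
qed

text \<open>The chain rule for a curve depending on one complex variable. Its conclusion is a
  \<open>has_field_derivative\<close>, which opens the way to the theorems of one-variable complex
  analysis.\<close>

lemma has_gradient_curve:
  assumes \<gamma>: "\<And>i. i \<in> I \<Longrightarrow> ((\<lambda>\<eta>. \<gamma> \<eta> i) has_field_derivative d i) (at \<zeta> within U)"
    and out: "\<And>i \<eta>. i \<notin> I \<Longrightarrow> \<eta> \<in> insert \<zeta> U \<Longrightarrow> \<gamma> \<eta> i = 0"
    and im: "\<forall>\<^sub>F \<eta> in at \<zeta> within U. \<gamma> \<eta> \<in> G"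
    and f: "has_gradient I G f (\<gamma> \<zeta>) c"
  shows "((\<lambda>\<eta>. f (\<gamma> \<eta>)) has_field_derivative (\<Sum>i\<in>I. c i * d i)) (at \<zeta> within U)"
proof -
  have cont: "((\<lambda>\<eta>. \<gamma> \<eta> i) \<longlongrightarrow> \<gamma> \<zeta> i) (at \<zeta> within U)" for i
  proof (cases "i \<in> I")
    case True
    show ?thesis using DERIV_continuous[OF \<gamma>[OF True]] by (simp add: continuous_within)
  next
    case False
    have "\<forall>\<^sub>F w in at \<zeta> within U. 0 = \<gamma> w i" using out[OF False] by (auto simp: eventually_at_filter)
    from Lim_transform_eventually[OF tendsto_const this] show ?thesis using out[OF False, of \<zeta>] by simp
  qed
  have fl: "filterlim \<gamma> (nhds_rel G (\<gamma> \<zeta>)) (at \<zeta> within U)"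
    by (rule filterlim_nhds_rel) (use cont im in \<open>auto simp: tendsto_coordinatewise\<close>)
  obtain r where r: "\<And>k. k \<in> I \<Longrightarrow> ((\<lambda>w. r w k) \<longlongrightarrow> c k) (nhds_rel G (\<gamma> \<zeta>))"
    and e': "\<forall>\<^sub>F w in nhds_rel G (\<gamma> \<zeta>). f w - f (\<gamma> \<zeta>) = (\<Sum>k\<in>I. r w k * (w k - \<gamma> \<zeta> k))"
    using f unfolding has_gradient_def by blast
  have "((\<lambda>\<eta>. \<Sum>k\<in>I. r (\<gamma> \<eta>) k * ((\<gamma> \<eta> k - \<gamma> \<zeta> k) / (\<eta> - \<zeta>))) \<longlongrightarrow> (\<Sum>i\<in>I. c i * d i)) (at \<zeta> within U)"
    using \<gamma> unfolding has_field_derivative_iff by (intro tendsto_intros filterlim_compose[OF r fl]) auto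
  moreover have "\<forall>\<^sub>F \<eta> in at \<zeta> within U. (\<Sum>k\<in>I. r (\<gamma> \<eta>) k * ((\<gamma> \<eta> k - \<gamma> \<zeta> k) / (\<eta> - \<zeta>))) = (f (\<gamma> \<eta>) - f (\<gamma> \<zeta>)) / (\<eta> - \<zeta>)"
    using eventually_compose_filterlim[OF e' fl] by eventually_elim (simp add: sum_divide_distrib)
  ultimately show ?thesis unfolding has_field_derivative_iff by (rule Lim_transform_eventually)
qed

lemma cholI: "(\<And>z. z \<in> G \<Longrightarrow> \<exists>c. has_gradient I G f z c) \<Longrightarrow> holo_on I G f"
  unfolding holo_on_def by blast

lemma holo_on_const: "holo_on I G (\<lambda>_. a)"
  by (rule cholI) (rule exI, rule has_gradient_const)
lemma holo_on_coord: "finite I \<Longrightarrow> k \<in> I \<Longrightarrow> holo_on I G (\<lambda>w. w k)"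
  by (rule cholI) (rule exI, rule has_gradient_coord)
lemma holo_on_add: "holo_on I G f \<Longrightarrow> holo_on I G g \<Longrightarrow> holo_on I G (\<lambda>w. f w + g w)"
  unfolding holo_on_def using has_gradient_add by blast
lemma holo_on_mult: "holo_on I G f \<Longrightarrow> holo_on I G g \<Longrightarrow> holo_on I G (\<lambda>w. f w * g w)"
  unfolding holo_on_def using has_gradient_mult by blast
lemma holo_on_diff: "holo_on I G f \<Longrightarrow> holo_on I G g \<Longrightarrow> holo_on I G (\<lambda>w. f w - g w)"
  using holo_on_add[of I G f "\<lambda>w. (-1) * g w"] holo_on_mult[OF holo_on_const[of I G "-1"], of g] by simp
lemma holo_on_inverse: "holo_on I G f \<Longrightarrow> (\<And>z. z \<in> G \<Longrightarrow> f z \<noteq> 0) \<Longrightarrow> holo_on I G (\<lambda>w. inverse (f w))"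
  unfolding holo_on_def using has_gradient_inverse by blast
lemma holo_on_divide: "holo_on I G f \<Longrightarrow> holo_on I G g \<Longrightarrow> (\<And>z. z \<in> G \<Longrightarrow> g z \<noteq> 0) \<Longrightarrow> holo_on I G (\<lambda>w. f w / g w)"
  unfolding divide_inverse by (intro holo_on_mult holo_on_inverse)
lemma holo_on_sum: "(\<And>k. k \<in> A \<Longrightarrow> holo_on I G (f k)) \<Longrightarrow> holo_on I G (\<lambda>w. \<Sum>k\<in>A. f k w)"
  by (induction A rule: infinite_finite_induct) (auto intro: holo_on_const holo_on_add)
lemma holo_on_prod: "(\<And>k. k \<in> A \<Longrightarrow> holo_on I G (f k)) \<Longrightarrow> holo_on I G (\<lambda>w. \<Prod>k\<in>A. f k w)"
  by (induction A rule: infinite_finite_induct) (auto intro: holo_on_const holo_on_mult)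
lemma holo_on_subset: "holo_on I G f \<Longrightarrow> G' \<subseteq> G \<Longrightarrow> holo_on I G' f"
  unfolding holo_on_def by (meson has_gradient_subset subsetD)

lemma holo_on_compose:
  assumes "\<And>k. k \<in> J \<Longrightarrow> holo_on I G (\<lambda>w. \<phi> w k)" "\<phi> ` G \<subseteq> H" "H \<subseteq> cspace J" "holo_on J H g"
  shows "holo_on I G (\<lambda>w. g (\<phi> w))"
proof (rule cholI)
  fix z assume z: "z \<in> G"
  have "\<forall>k\<in>J. \<exists>c. has_gradient I G (\<lambda>w. \<phi> w k) z c"
    using assms(1) z unfolding holo_on_def by simp
  from bchoice[OF this] obtain c where "\<forall>k\<in>J. has_gradient I G (\<lambda>w. \<phi> w k) z (c k)" ..
  then have c: "\<And>k. k \<in> J \<Longrightarrow> has_gradient I G (\<lambda>w. \<phi> w k) z (c k)" by simp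
  obtain d where d: "has_gradient J H g (\<phi> z) d" using assms(2,4) z unfolding holo_on_def by blast
  have "has_gradient I G (\<lambda>w. g (\<phi> w)) z (\<lambda>i. \<Sum>k\<in>J. d k * c k i)"
  proof (rule has_gradient_compose[OF c _ _ d])
    show "\<phi> w k = 0" if "k \<notin> J" "w \<in> insert z G" for k w
    proof -
      have "\<phi> w \<in> cspace J" using that z assms(2,3) by blast
      then show ?thesis using that by (simp add: cspace_def)
    qed
    show "\<forall>\<^sub>F w in nhds_rel G z. \<phi> w \<in> H" using assms(2) by (auto simp: eventually_nhds_rel intro!: always_eventually)
  qed
  then show "\<exists>c. has_gradient I G (\<lambda>w. g (\<phi> w)) z c" by (rule exI[of "has_gradient I G (\<lambda>w. g (\<phi> w)) z"])
qed

lemma holo_on_continuous_on: "holo_on I G f \<Longrightarrow> continuous_on G f"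
  unfolding continuous_on_def holo_on_def using has_gradient_tendsto tendsto_mono[OF at_within_le_nhds_rel] by blast

lemma holo_on_curve_holomorphic:
  assumes "holo_on I G f" "G \<subseteq> cspace I" "\<And>i. i \<in> I \<Longrightarrow> (\<lambda>\<zeta>. \<gamma> \<zeta> i) holomorphic_on U" "\<gamma> ` U \<subseteq> G"
  shows "(\<lambda>\<zeta>. f (\<gamma> \<zeta>)) holomorphic_on U"
  unfolding holomorphic_on_def field_differentiable_def
proof
  fix \<zeta> assume z: "\<zeta> \<in> U"
  have "\<forall>i\<in>I. \<exists>d. ((\<lambda>\<eta>. \<gamma> \<eta> i) has_field_derivative d) (at \<zeta> within U)"
    using assms(3) z unfolding holomorphic_on_def field_differentiable_def by simp
  from bchoice[OF this] obtain d where "\<forall>i\<in>I. ((\<lambda>\<eta>. \<gamma> \<eta> i) has_field_derivative d i) (at \<zeta> within U)" ..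
  then have d: "\<And>i. i \<in> I \<Longrightarrow> ((\<lambda>\<eta>. \<gamma> \<eta> i) has_field_derivative d i) (at \<zeta> within U)" by simp
  obtain c where c: "has_gradient I G f (\<gamma> \<zeta>) c" using assms(1,4) z unfolding holo_on_def by blast
  have "((\<lambda>\<zeta>. f (\<gamma> \<zeta>)) has_field_derivative (\<Sum>i\<in>I. c i * d i)) (at \<zeta> within U)"
  proof (rule has_gradient_curve[OF d _ _ c])
    show "\<gamma> \<eta> i = 0" if "i \<notin> I" "\<eta> \<in> insert \<zeta> U" for i \<eta>
    proof -
      have "\<gamma> \<eta> \<in> cspace I" using that z assms(2,4) by blast
      then show ?thesis using that by (simp add: cspace_def)
    qed
    show "\<forall>\<^sub>F \<eta> in at \<zeta> within U. \<gamma> \<eta> \<in> G"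
      using assms(4) by (auto simp: eventually_at_filter intro!: always_eventually)
  qed
  then show "\<exists>f'. ((\<lambda>\<zeta>. f (\<gamma> \<zeta>)) has_field_derivative f') (at \<zeta> within U)" ..
qed

subsection \<open>Norm and topology\<close>

lemma cnorm_nonneg: "0 \<le> cnorm I x" by (simp add: cnorm_def L2_set_nonneg)

lemma cnorm_zero [simp]: "cnorm I (\<lambda>_. 0) = 0" by (simp add: cnorm_def L2_set_def)

lemma cnorm_coord_le: "finite I \<Longrightarrow> i \<in> I \<Longrightarrow> norm (x i) \<le> cnorm I x"
  unfolding cnorm_def by (rule member_le_L2_set) auto

lemma cnorm_eq_0_iff: "finite I \<Longrightarrow> cnorm I x = 0 \<longleftrightarrow> (\<forall>i\<in>I. x i = 0)"
  unfolding cnorm_def by (simp add: L2_set_eq_0_iff)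

lemma cnorm_le_sum: "cnorm I x \<le> (\<Sum>i\<in>I. norm (x i))"
  unfolding cnorm_def by (rule L2_set_le_sum) simp

lemma cnorm_power2: "(cnorm I x)\<^sup>2 = (\<Sum>i\<in>I. (norm (x i))\<^sup>2)"
  unfolding cnorm_def L2_set_def by (simp add: sum_nonneg)

lemma cspace_eqI: "x \<in> cspace I \<Longrightarrow> y \<in> cspace I \<Longrightarrow> (\<And>i. i \<in> I \<Longrightarrow> x i = y i) \<Longrightarrow> x = y"
  unfolding cspace_def by (auto simp: fun_eq_iff) metis

lemma zero_cspace [simp]: "(\<lambda>_. 0) \<in> cspace I" by (simp add: cspace_def)

text \<open>The Frechet remainder \<open>R\<close> is distributed over the coordinates: since the
  products \<open>cnj (w i - z i) * (w i - z i)\<close> add up to the squared norm of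
  \<open>w - z\<close>, adding \<open>R w * cnj (w i - z i) / (n w)^2\<close> to \<open>c i\<close>
  gives exact slopes. They tend to \<open>c i\<close> because \<open>cnj (w i - z i) / n w\<close>
  has modulus at most one.\<close>

lemma holomorphic_map_iff:
  fixes G :: "('i \<Rightarrow> complex) set"
  assumes I: "finite I" and G: "G \<subseteq> cspace I"
  shows "holomorphic_map I G f \<longleftrightarrow> (\<forall>j\<in>I. holo_on I G (\<lambda>w. f w j))"
proof -
  have *: "((\<lambda>w. (g w - g z - (\<Sum>i\<in>I. c i * (w i - z i))) / of_real (cnorm I (\<lambda>i. w i - z i))) \<longlongrightarrow> 0) (at z within G)
     \<longleftrightarrow> has_gradient I G g z c" (is "?L \<longleftrightarrow> _") if z: "z \<in> G" for g z c
  proof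
    define R where "R w = g w - g z - (\<Sum>i\<in>I. c i * (w i - z i))" for w
    define n where "n w = complex_of_real (cnorm I (\<lambda>i. w i - z i))" for w
    define q where "q w i = c i + R w * cnj (w i - z i) / (n w)\<^sup>2" for w i
    assume L: ?L
    have n: "n w \<noteq> 0" if "w \<in> G" "w \<noteq> z" for w
      using that z G cspace_eqI[of w I z] unfolding n_def by (auto simp: cnorm_eq_0_iff I subset_iff)
    \<comment> \<open>Division by zero now yields \<open>q z i = c i\<close>, the value that a limit
      along a filter containing \<open>z\<close> requires.\<close>
    have nz: "n z = 0" unfolding n_def by simp
    have "((\<lambda>w. q w i) \<longlongrightarrow> q z i) (at z within G)" if i: "i \<in> I" for i
    proof -
      have "((\<lambda>w. (R w / n w) * (cnj (w i - z i) / n w)) \<longlongrightarrow> 0) (at z within G)"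
      proof (rule Lim_null_comparison)
        show "\<forall>\<^sub>F w in at z within G. norm ((R w / n w) * (cnj (w i - z i) / n w)) \<le> norm (R w / n w)"
        proof (rule eventuallyI)
          fix w
          have "norm (n w) = cnorm I (\<lambda>i. w i - z i)" by (simp add: n_def cnorm_nonneg)
          then have "norm (cnj (w i - z i)) \<le> norm (n w)"
            unfolding complex_mod_cnj using cnorm_coord_le[OF I i, of "\<lambda>i. w i - z i"] by simp
          then have "norm (cnj (w i - z i) / n w) \<le> 1"
            unfolding norm_divide by (cases "n w = 0") (simp_all add: divide_le_eq_1)
          from mult_left_mono[OF this, of "norm (R w / n w)"]
          show "norm ((R w / n w) * (cnj (w i - z i) / n w)) \<le> norm (R w / n w)"
            unfolding norm_mult by (simp only: mult_1_right norm_ge_zero)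
        qed
        show "((\<lambda>w. norm (R w / n w)) \<longlongrightarrow> 0) (at z within G)"
          using L unfolding R_def n_def by (rule tendsto_norm_zero)
      qed
      from tendsto_add[OF tendsto_const[of "c i"] this]
      show ?thesis by (simp add: q_def nz power2_eq_square)
    qed
    then have "((\<lambda>w. q w i) \<longlongrightarrow> c i) (nhds_rel G z)" if "i \<in> I" for i
      using that tendsto_nhds_rel_iff_at[of "\<lambda>w. q w i" z G] by (simp add: q_def nz)
    moreover have "g w - g z = (\<Sum>i\<in>I. q w i * (w i - z i))" if w: "w \<in> G" for w
    proof (cases "w = z")
      case False
      have sq: "(\<Sum>i\<in>I. cnj (w i - z i) * (w i - z i)) = (n w)\<^sup>2"
        unfolding n_def of_real_power[symmetric] cnorm_power2 of_real_sum
        by (rule sum.cong) (auto simp: complex_norm_square[symmetric] mult.commute simp flip: complex_cnj_diff)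
      have "(\<Sum>i\<in>I. q w i * (w i - z i)) = (\<Sum>i\<in>I. c i * (w i - z i)) + (R w / (n w)\<^sup>2) * (\<Sum>i\<in>I. cnj (w i - z i) * (w i - z i))"
        unfolding q_def sum_distrib_left sum.distrib[symmetric] by (rule sum.cong) (simp_all add: distrib_right del: complex_cnj_diff)
      also have "\<dots> = g w - g z" unfolding sq using n[OF w False] by (simp add: R_def)
      finally show ?thesis by simp
    qed simp
    ultimately show "has_gradient I G g z c" unfolding has_gradient_def by (intro exI[of _ q]) (auto simp: eventually_nhds_rel)
  next
    assume "has_gradient I G g z c"
    then obtain q where q: "\<And>i. i \<in> I \<Longrightarrow> ((\<lambda>w. q w i) \<longlongrightarrow> c i) (nhds_rel G z)"
      and e: "\<forall>\<^sub>F w in nhds_rel G z. g w - g z = (\<Sum>i\<in>I. q w i * (w i - z i))"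
      unfolding has_gradient_def by blast
    have "((\<lambda>w. \<Sum>i\<in>I. norm (q w i - c i)) \<longlongrightarrow> (\<Sum>i\<in>I. norm (c i - c i))) (nhds_rel G z)"
      by (intro tendsto_intros q)
    then have lim: "((\<lambda>w. \<Sum>i\<in>I. norm (q w i - c i)) \<longlongrightarrow> 0) (at z within G)"
      by (auto intro: tendsto_mono[OF at_within_le_nhds_rel])
    show ?L
    proof (rule Lim_null_comparison[OF _ lim])
      have "\<forall>\<^sub>F w in at z within G. g w - g z = (\<Sum>i\<in>I. q w i * (w i - z i))"
        using e at_within_le_nhds_rel by (rule filter_leD[rotated])
      then show "\<forall>\<^sub>F w in at z within G. norm ((g w - g z - (\<Sum>i\<in>I. c i * (w i - z i))) / of_real (cnorm I (\<lambda>i. w i - z i)))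
             \<le> (\<Sum>i\<in>I. norm (q w i - c i))"
      proof eventually_elim
        case (elim w)
        have "norm (g w - g z - (\<Sum>i\<in>I. c i * (w i - z i))) = norm (\<Sum>i\<in>I. (q w i - c i) * (w i - z i))"
          unfolding elim by (simp add: algebra_simps sum_subtractf)
        also have "\<dots> \<le> (\<Sum>i\<in>I. norm (q w i - c i) * cnorm I (\<lambda>i. w i - z i))"
          by (rule sum_norm_le) (auto simp: norm_mult intro!: mult_left_mono cnorm_coord_le[OF I, where x = "\<lambda>i. w i - z i"])
        finally have "norm (g w - g z - (\<Sum>i\<in>I. c i * (w i - z i))) \<le> (\<Sum>i\<in>I. norm (q w i - c i)) * cnorm I (\<lambda>i. w i - z i)"
          by (simp add: sum_distrib_right)
        then show ?case
          by (cases "cnorm I (\<lambda>i. w i - z i) = 0")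
            (auto simp: norm_divide cnorm_nonneg sum_nonneg divide_le_eq less_le)
      qed
    qed
  qed
  have "holomorphic_map I G f \<longleftrightarrow> (\<forall>z\<in>G. \<forall>j\<in>I. \<exists>c. has_gradient I G (\<lambda>w. f w j) z c)"
    unfolding holomorphic_map_def
    by (intro ball_cong refl arg_cong[of _ _ Ex] ext *)
  then show ?thesis unfolding holo_on_def by (simp only:) blast
qed

text \<open>A basic open box restricts every coordinate of the function type, but all points of
  \<open>cspace I\<close> agree outside \<open>I\<close>. So the minimum of the finitely many radii
  at \<open>I\<close> is a radius for the whole box.\<close>

lemma eventually_nhds_cspace:
  fixes z :: "'i \<Rightarrow> complex"
  assumes I: "finite I" and z: "z \<in> cspace I"
  shows "eventually P (nhds_rel (cspace I) z) \<longleftrightarrow>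
    (\<exists>e>0. \<forall>w\<in>cspace I. (\<forall>i\<in>I. norm (w i - z i) < e) \<longrightarrow> P w)"
proof
  assume "eventually P (nhds_rel (cspace I) z)"
  then obtain U where U: "open U" "z \<in> U" "\<And>w. w \<in> U \<Longrightarrow> w \<in> cspace I \<Longrightarrow> P w"
    unfolding eventually_nhds_rel eventually_nhds by blast
  then have "openin (product_topology (\<lambda>i. euclidean) UNIV) U" by (simp add: euclidean_product_topology)
  from product_topology_open_contains_basis[OF this U(2)]
  obtain X where X: "z \<in> (\<Pi>\<^sub>E i\<in>UNIV. X i)" "\<And>i. open (X i)" "(\<Pi>\<^sub>E i\<in>UNIV. X i) \<subseteq> U"
    by auto
  have "\<exists>e>0. ball (z i) e \<subseteq> X i" for i using X(1,2) by (metis PiE_mem UNIV_I openE)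
  then obtain e where e: "\<And>i. e i > 0" "\<And>i. ball (z i) (e i) \<subseteq> X i" by metis
  define d where "d = Min (insert 1 (e ` I))"
  have d: "d > 0" "\<And>i. i \<in> I \<Longrightarrow> d \<le> e i" unfolding d_def using I e by (auto simp: Min_le_iff)
  show "\<exists>e>0. \<forall>w\<in>cspace I. (\<forall>i\<in>I. norm (w i - z i) < e) \<longrightarrow> P w"
  proof (intro exI[of _ d] conjI ballI impI d)
    fix w assume w: "w \<in> cspace I" "\<forall>i\<in>I. norm (w i - z i) < d"
    have "w i \<in> X i" for i
    proof (cases "i \<in> I")
      case True
      then show ?thesis using w(2) d(2)[OF True] e(2)[of i] by (fastforce simp: dist_norm norm_minus_commute)
    next
      case False
      have "z i \<in> X i" using X(1) by (auto simp: PiE_iff)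
      then show ?thesis using w(1) z False by (simp add: cspace_def)
    qed
    then have "w \<in> U" using X(3) by auto
    then show "P w" using U w by blast
  qed
next
  assume "\<exists>e>0. \<forall>w\<in>cspace I. (\<forall>i\<in>I. norm (w i - z i) < e) \<longrightarrow> P w"
  then obtain e where e: "e > 0" "\<And>w. w\<in>cspace I \<Longrightarrow> (\<forall>i\<in>I. norm (w i - z i) < e) \<Longrightarrow> P w" by blast
  have "\<forall>\<^sub>F w in nhds_rel (cspace I) z. \<forall>i\<in>I. norm (w i - z i) < e"
    by (intro eventually_ball_finite I ballI)
      (simp only: dist_norm[symmetric], rule tendstoD[OF coord_tendsto_nhds_rel e(1)])
  moreover have "\<forall>\<^sub>F w in nhds_rel (cspace I) z. w \<in> cspace I" by (simp add: eventually_nhds_rel)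
  ultimately show "eventually P (nhds_rel (cspace I) z)" by eventually_elim (use e in auto)
qed

abbreviation copen :: "'i set \<Rightarrow> ('i \<Rightarrow> complex) set \<Rightarrow> bool" where
  "copen I \<equiv> openin (top_of_set (cspace I))"

lemma copen_iff_eventually: "copen I G \<longleftrightarrow> G \<subseteq> cspace I \<and> (\<forall>z\<in>G. eventually (\<lambda>w. w \<in> G) (nhds_rel (cspace I) z))"
proof
  assume "copen I G"
  then obtain U where U: "open U" "G = cspace I \<inter> U" by (auto simp: openin_open)
  then show "G \<subseteq> cspace I \<and> (\<forall>z\<in>G. eventually (\<lambda>w. w \<in> G) (nhds_rel (cspace I) z))"
    by (auto simp: eventually_nhds_rel eventually_nhds intro!: exI[of _ U])
next
  assume G: "G \<subseteq> cspace I \<and> (\<forall>z\<in>G. eventually (\<lambda>w. w \<in> G) (nhds_rel (cspace I) z))"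
  show "copen I G"
  proof (subst openin_subopen, intro ballI)
    fix z assume z: "z \<in> G"
    then have "eventually (\<lambda>w. w \<in> G) (nhds_rel (cspace I) z)" using G by simp
    then obtain U where U: "open U" "z \<in> U" "\<forall>w\<in>U. w \<in> cspace I \<longrightarrow> w \<in> G"
      by (auto simp: eventually_nhds_rel eventually_nhds)
    then have "copen I (cspace I \<inter> U)" "z \<in> cspace I \<inter> U" "cspace I \<inter> U \<subseteq> G" using z G by auto
    then show "\<exists>T. copen I T \<and> z \<in> T \<and> T \<subseteq> G" by blast
  qed
qed

lemma copen_iff:
  assumes "finite I"
  shows "copen I G \<longleftrightarrow> G \<subseteq> cspace I \<and>
    (\<forall>z\<in>G. \<exists>e>0. \<forall>w\<in>cspace I. (\<forall>i\<in>I. norm (w i - z i) < e) \<longrightarrow> w \<in> G)"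
proof -
  have "eventually (\<lambda>w. w \<in> G) (nhds_rel (cspace I) z) \<longleftrightarrow>
     (\<exists>e>0. \<forall>w\<in>cspace I. (\<forall>i\<in>I. norm (w i - z i) < e) \<longrightarrow> w \<in> G)" if "G \<subseteq> cspace I" "z \<in> G" for z
    by (rule eventually_nhds_cspace) (use assms that in auto)
  then show ?thesis unfolding copen_iff_eventually by auto
qed

lemma nhds_rel_copen: "copen I G \<Longrightarrow> z \<in> G \<Longrightarrow> nhds_rel G z = nhds_rel (cspace I) z"
proof (rule antisym)
  assume G: "copen I G" "z \<in> G"
  show "nhds_rel G z \<le> nhds_rel (cspace I) z"
    using openin_imp_subset[OF G(1)] by (intro inf_mono) auto
  have "eventually (\<lambda>w. w \<in> G) (nhds_rel (cspace I) z)" using G by (simp add: copen_iff_eventually)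
  then have "nhds_rel (cspace I) z \<le> principal G" by (simp add: le_principal)
  then show "nhds_rel (cspace I) z \<le> nhds_rel G z" by simp
qed

section \<open>Partial derivatives: continuity, and holomorphy along curves\<close>

definition partial_deriv :: "'i \<Rightarrow> (('i \<Rightarrow> complex) \<Rightarrow> complex) \<Rightarrow> ('i \<Rightarrow> complex) \<Rightarrow> complex" where
  "partial_deriv i f z = deriv (\<lambda>\<eta>. f (z(i := z i + \<eta>))) 0"

lemma fun_upd_cspace: "z \<in> cspace I \<Longrightarrow> i \<in> I \<Longrightarrow> z(i := a) \<in> cspace I"
  unfolding cspace_def by auto

lemma copenD:
  assumes "copen I G" "finite I" "z \<in> G"
  obtains e where "e > 0" "\<And>w. w \<in> cspace I \<Longrightarrow> (\<And>i. i \<in> I \<Longrightarrow> norm (w i - z i) < e) \<Longrightarrow> w \<in> G"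
  using assms copen_iff[of I G] by blast

lemma slice_has_derivative_has_gradient:
  assumes G: "copen I G" and I: "finite I" "i \<in> I" and z: "z(i := z i + \<eta>0) \<in> G"
    and f: "has_gradient I G f (z(i := z i + \<eta>0)) c"
  shows "((\<lambda>\<eta>. f (z(i := z i + \<eta>))) has_field_derivative c i) (at \<eta>0)"
proof -
  define \<gamma> where "\<gamma> \<eta> = z(i := z i + \<eta>)" for \<eta> :: complex
  have zc: "z(i := z i + \<eta>0) \<in> cspace I" using z openin_imp_subset[OF G] by blast
  have zc': "\<gamma> \<eta> \<in> cspace I" for \<eta>
    using fun_upd_cspace[OF zc I(2), of "z i + \<eta>"] by (simp add: \<gamma>_def)
  obtain e where e: "e > 0" "\<And>w. w \<in> cspace I \<Longrightarrow> (\<And>k. k \<in> I \<Longrightarrow> norm (w k - \<gamma> \<eta>0 k) < e) \<Longrightarrow> w \<in> G"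
    using copenD[OF G I(1) z] unfolding \<gamma>_def by blast
  have "((\<lambda>\<eta>. f (\<gamma> \<eta>)) has_field_derivative (\<Sum>k\<in>I. c k * (if k = i then 1 else 0))) (at \<eta>0)"
  proof (rule has_gradient_curve[where \<gamma> = \<gamma> and d = "\<lambda>k. if k = i then 1 else 0" and c = c and f = f and G = G and I = I])
    show "((\<lambda>\<eta>. \<gamma> \<eta> k) has_field_derivative (if k = i then 1 else 0)) (at \<eta>0)" for k
      unfolding \<gamma>_def by (auto intro!: derivative_eq_intros)
    show "\<gamma> \<eta> k = 0" if "k \<notin> I" for \<eta> k using zc'[of \<eta>] that by (simp add: cspace_def)
    have "\<gamma> \<eta> \<in> G" if "dist \<eta> \<eta>0 < e" for \<eta>
      by (rule e(2)[OF zc']) (use that e(1) in \<open>auto simp: \<gamma>_def dist_norm\<close>)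
    then show "\<forall>\<^sub>F \<eta> in at \<eta>0. \<gamma> \<eta> \<in> G"
      unfolding eventually_at using e(1) by blast
    show "has_gradient I G f (\<gamma> \<eta>0) c" unfolding \<gamma>_def by (rule f)
  qed
  then show ?thesis using I by (simp add: \<gamma>_def if_distrib[of "\<lambda>x. _ * x"] cong: if_cong)
qed

text \<open>Slopes are not unique, but on an open set their limits are. The gradient thus becomes a
  function of the point, whose continuity can be discussed.\<close>

lemma has_gradient_coeff_eq_partial_deriv:
  assumes "copen I G" "finite I" "i \<in> I" "z \<in> G" "has_gradient I G f z c"
  shows "c i = partial_deriv i f z"
  unfolding partial_deriv_def
  by (rule DERIV_imp_deriv[symmetric], rule slice_has_derivative_has_gradient[OF assms(1-3)]) (use assms in auto)

lemma has_gradient_partial_deriv: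
  assumes "copen I G" "finite I" "z \<in> G" "holo_on I G f"
  shows "has_gradient I G f z (\<lambda>i. partial_deriv i f z)"
proof -
  obtain c where c: "has_gradient I G f z c" using assms unfolding holo_on_def by blast
  then obtain q where q: "\<And>i. i \<in> I \<Longrightarrow> ((\<lambda>w. q w i) \<longlongrightarrow> c i) (nhds_rel G z)"
    and e: "\<forall>\<^sub>F w in nhds_rel G z. f w - f z = (\<Sum>i\<in>I. q w i * (w i - z i))"
    unfolding has_gradient_def by blast
  have "((\<lambda>w. q w i) \<longlongrightarrow> partial_deriv i f z) (nhds_rel G z)" if "i \<in> I" for i
    using q[OF that] has_gradient_coeff_eq_partial_deriv[OF assms(1,2) that assms(3) c] by simp
  then show ?thesis unfolding has_gradient_def using e by blast
qed

lemma slice_has_derivative: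
  assumes "copen I G" "finite I" "i \<in> I" "z(i := z i + \<eta>) \<in> G" "holo_on I G f"
  shows "((\<lambda>\<eta>. f (z(i := z i + \<eta>))) has_field_derivative partial_deriv i f (z(i := z i + \<eta>))) (at \<eta>)"
  by (rule slice_has_derivative_has_gradient[OF assms(1-4) has_gradient_partial_deriv]) (use assms in auto)

lemma continuous_on_shift_coordinate:
  "continuous_on A (\<lambda>(z, \<eta>). (z :: 'i \<Rightarrow> complex)(i := z i + \<eta>))"
proof (rule continuous_on_coordinatewise_then_product)
  fix k
  have *: "continuous_on A (\<lambda>x :: ('i \<Rightarrow> complex) \<times> complex. fst x k)" for k
    by (rule continuous_on_product_then_coordinatewise) (intro continuous_intros)
  show "continuous_on A (\<lambda>x. (case x of (z, \<eta>) \<Rightarrow> (z :: 'i \<Rightarrow> complex)(i := z i + \<eta>)) k)"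
    by (cases "k = i") (auto simp: case_prod_unfold intro!: continuous_intros *)
qed

text \<open>Cauchy's estimate is applied to the difference of the slices through \<open>z\<close>
  and \<open>z0\<close>. Joint continuity of \<open>f\<close> makes this difference small uniformly
  on a compact disc, hence its derivative at the centre is small as well.\<close>

lemma continuous_on_partial_deriv:
  fixes G :: "('i \<Rightarrow> complex) set"
  assumes G: "copen I G" and I: "finite I" "i \<in> I" and f: "holo_on I G f"
  shows "continuous_on G (partial_deriv i f)"
  unfolding continuous_on_def
proof (rule ballI)
  fix z0 assume z0: "z0 \<in> G"
  obtain e where e: "e > 0" "\<And>w. w \<in> cspace I \<Longrightarrow> (\<And>k. k \<in> I \<Longrightarrow> norm (w k - z0 k) < e) \<Longrightarrow> w \<in> G"
    using copenD[OF G I(1) z0] by blast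
  define U where "U = {z\<in>cspace I. \<forall>k\<in>I. norm (z k - z0 k) < e / 2}"
  define C where "C = cball (0::complex) (e / 4)"
  have z0U: "z0 \<in> U" using z0 e(1) openin_imp_subset[OF G] by (auto simp: U_def)
  have inG: "z(i := z i + \<eta>) \<in> G" if "z \<in> U" "\<eta> \<in> C" for z \<eta>
  proof (rule e(2))
    show "z(i := z i + \<eta>) \<in> cspace I" using that I by (intro fun_upd_cspace) (auto simp: U_def)
    fix k assume k: "k \<in> I"
    have "norm (z i + \<eta> - z0 i) \<le> norm (z i - z0 i) + norm \<eta>"
      using norm_triangle_ineq[of "z i - z0 i" \<eta>] by (simp add: algebra_simps)
    moreover have "norm (z i - z0 i) < e / 2" "norm \<eta> \<le> e / 4" using that I by (auto simp: U_def C_def)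
    moreover have "norm (z k - z0 k) < e / 2" using that k by (auto simp: U_def)
    ultimately show "norm ((z(i := z i + \<eta>)) k - z0 k) < e" using e(1) by auto
  qed
  have contf: "continuous_on (U \<times> C) (\<lambda>(z, \<eta>). f (z(i := z i + \<eta>)))"
  proof -
    have "continuous_on (U \<times> C) (\<lambda>x. f ((\<lambda>(z, \<eta>). z(i := z i + \<eta>)) x))"
      by (rule continuous_on_compose2[OF holo_on_continuous_on[OF f] continuous_on_shift_coordinate]) (use inG in auto)
    then show ?thesis by (simp add: case_prod_unfold)
  qed
  have pdd: "deriv (\<lambda>\<eta>. f (z(i := z i + \<eta>)) - f (z0(i := z0 i + \<eta>))) 0 = partial_deriv i f z - partial_deriv i f z0"
    and hol: "(\<lambda>\<eta>. f (z(i := z i + \<eta>)) - f (z0(i := z0 i + \<eta>))) holomorphic_on C" if z: "z \<in> U" for z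
  proof -
    have d: "((\<lambda>\<eta>. f (z(i := z i + \<eta>)) - f (z0(i := z0 i + \<eta>))) has_field_derivative
       (partial_deriv i f (z(i := z i + \<eta>)) - partial_deriv i f (z0(i := z0 i + \<eta>)))) (at \<eta>)" if "\<eta> \<in> C" for \<eta>
      by (intro DERIV_diff slice_has_derivative[OF G I _ f] inG z z0U that)
    from d[of 0] show "deriv (\<lambda>\<eta>. f (z(i := z i + \<eta>)) - f (z0(i := z0 i + \<eta>))) 0 = partial_deriv i f z - partial_deriv i f z0"
      using e(1) by (auto simp: C_def intro: DERIV_imp_deriv)
    show "(\<lambda>\<eta>. f (z(i := z i + \<eta>)) - f (z0(i := z0 i + \<eta>))) holomorphic_on C"
      unfolding holomorphic_on_def field_differentiable_def using d DERIV_subset by blast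
  qed
  show "(partial_deriv i f \<longlongrightarrow> partial_deriv i f z0) (at z0 within G)"
  proof (rule tendstoI)
    fix \<epsilon> :: real assume \<epsilon>: "\<epsilon> > 0"
    \<comment> \<open>With this bound Cauchy's estimate on the circle of radius \<open>e / 4\<close>
      gives \<open>\<epsilon> / 2\<close>.\<close>
    define B where "B = \<epsilon> * e / 8"
    have cC: "compact C" by (simp add: C_def)
    have B: "B > 0" using \<epsilon> e(1) by (simp add: B_def)
    obtain X0 where X0: "z0 \<in> X0" "open X0"
      "\<forall>z\<in>X0 \<inter> U. \<forall>\<eta>\<in>C. dist ((\<lambda>(z, \<eta>). f (z(i := z i + \<eta>))) (z, \<eta>)) ((\<lambda>(z, \<eta>). f (z(i := z i + \<eta>))) (z0, \<eta>)) \<le> B"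
      by (rule continuous_on_prod_compactE[OF contf cC z0U B]) (rule that)
    have main: "dist (partial_deriv i f z) (partial_deriv i f z0) < \<epsilon>" if z: "z \<in> X0" "z \<in> U" for z
    proof -
      have "norm ((deriv ^^ 1) (\<lambda>\<eta>. f (z(i := z i + \<eta>)) - f (z0(i := z0 i + \<eta>))) 0) \<le> fact 1 * B / (e / 4) ^ 1"
      proof (rule Cauchy_inequality)
        show "(\<lambda>\<eta>. f (z(i := z i + \<eta>)) - f (z0(i := z0 i + \<eta>))) holomorphic_on ball 0 (e / 4)"
          by (rule holomorphic_on_subset[OF hol[OF z(2)]]) (auto simp: C_def)
        show "continuous_on (cball 0 (e / 4)) (\<lambda>\<eta>. f (z(i := z i + \<eta>)) - f (z0(i := z0 i + \<eta>)))"
          using holomorphic_on_imp_continuous_on[OF hol[OF z(2)]] by (simp add: C_def)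
        fix \<eta> :: complex assume "norm (0 - \<eta>) = e / 4"
        then have "\<eta> \<in> C" by (simp add: C_def)
        then show "norm (f (z(i := z i + \<eta>)) - f (z0(i := z0 i + \<eta>))) \<le> B"
          using X0(3) z by (auto simp: dist_norm)
      qed (use e in auto)
      then have "norm (partial_deriv i f z - partial_deriv i f z0) \<le> \<epsilon> / 2" using e(1) pdd[OF z(2)] by (simp add: B_def)
      then show ?thesis using \<epsilon> by (simp add: dist_norm)
    qed
    have "eventually (\<lambda>z. z \<in> U) (nhds_rel (cspace I) z0)"
      by (subst eventually_nhds_cspace[OF I(1)]) (use z0U e(1) in \<open>auto simp: U_def intro!: exI[of _ "e/2"]\<close>)
    then have ev: "eventually (\<lambda>z. z \<in> U) (at z0 within G)"
      by (rule filter_leD[OF at_within_le_nhds_rel[of z0 G, unfolded nhds_rel_copen[OF G z0]]])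
    have "eventually (\<lambda>z. z \<in> X0) (at z0 within G)"
      using X0(1,2) by (auto simp: eventually_at_topological)
    then show "\<forall>\<^sub>F z in at z0 within G. dist (partial_deriv i f z) (partial_deriv i f z0) < \<epsilon>"
      using ev by eventually_elim (rule main)
  qed
qed

text \<open>The difference quotients of \<open>f\<close> in direction \<open>i\<close>, taken along
  the curve, are holomorphic in the parameter and bounded by a bound for the partial derivative on a
  compact set. Montel's theorem gives a subsequence with holomorphic limit, and pointwise that limit
  is the partial derivative.\<close>

lemma partial_deriv_curve_holomorphic:
  fixes G :: "('i \<Rightarrow> complex) set"
  assumes G: "copen I G" and I: "finite I" "i \<in> I" and f: "holo_on I G f"
    and S: "open S" and \<gamma>: "\<And>k. k \<in> I \<Longrightarrow> (\<lambda>\<zeta>. \<gamma> \<zeta> k) holomorphic_on S" and im: "\<gamma> ` S \<subseteq> G"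
  shows "(\<lambda>\<zeta>. partial_deriv i f (\<gamma> \<zeta>)) holomorphic_on S"
proof (rule analytic_imp_holomorphic, unfold analytic_on_def, rule ballI)
  fix \<zeta>0 assume \<zeta>0: "\<zeta>0 \<in> S"
  then have g0: "\<gamma> \<zeta>0 \<in> G" using im by auto
  have Gc: "G \<subseteq> cspace I" by (rule openin_imp_subset[OF G])
  have \<gamma>c: "\<gamma> \<zeta> \<in> cspace I" if "\<zeta> \<in> S" for \<zeta> using that im Gc by auto
  obtain e where e: "e > 0" "\<And>w. w \<in> cspace I \<Longrightarrow> (\<And>k. k \<in> I \<Longrightarrow> norm (w k - \<gamma> \<zeta>0 k) < e) \<Longrightarrow> w \<in> G"
    using copenD[OF G I(1) g0] by blast
  have contk: "continuous_on S (\<lambda>\<zeta>. \<gamma> \<zeta> k)" for k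
  proof (cases "k \<in> I")
    case False
    then have "\<And>\<zeta>. \<zeta> \<in> S \<Longrightarrow> \<gamma> \<zeta> k = 0" using \<gamma>c by (simp add: cspace_def)
    then show ?thesis by (simp cong: continuous_on_cong)
  qed (use \<gamma> holomorphic_on_imp_continuous_on in blast)
  then have cont\<gamma>: "continuous_on S \<gamma>" by (rule continuous_on_coordinatewise_then_product)
  have "\<forall>\<^sub>F \<zeta> in nhds \<zeta>0. \<forall>k\<in>I. dist (\<gamma> \<zeta> k) (\<gamma> \<zeta>0 k) < e / 2"
  proof (intro eventually_ball_finite I ballI)
    fix k assume "k \<in> I"
    have "isCont (\<lambda>\<zeta>. \<gamma> \<zeta> k) \<zeta>0"
      using contk[of k] S \<zeta>0 by (simp add: continuous_on_eq_continuous_at)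
    then have "((\<lambda>\<zeta>. \<gamma> \<zeta> k) \<longlongrightarrow> \<gamma> \<zeta>0 k) (nhds \<zeta>0)"
      unfolding isCont_def tendsto_at_iff_tendsto_nhds[of "\<lambda>\<zeta>. \<gamma> \<zeta> k"] .
    then show "\<forall>\<^sub>F \<zeta> in nhds \<zeta>0. dist (\<gamma> \<zeta> k) (\<gamma> \<zeta>0 k) < e / 2"
      by (rule tendstoD) (use e(1) in simp)
  qed
  moreover have "\<forall>\<^sub>F \<zeta> in nhds \<zeta>0. \<zeta> \<in> S" using S \<zeta>0 by (rule eventually_nhds_in_open)
  ultimately have "\<forall>\<^sub>F \<zeta> in nhds \<zeta>0. \<zeta> \<in> S \<and> (\<forall>k\<in>I. dist (\<gamma> \<zeta> k) (\<gamma> \<zeta>0 k) < e / 2)"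
    by eventually_elim auto
  then obtain r0 where r0: "r0 > 0" "\<And>\<zeta>. dist \<zeta> \<zeta>0 < r0 \<Longrightarrow> \<zeta> \<in> S \<and> (\<forall>k\<in>I. dist (\<gamma> \<zeta> k) (\<gamma> \<zeta>0 k) < e / 2)"
    unfolding eventually_nhds_metric by blast
  define r where "r = r0 / 2"
  have r: "r > 0" using r0 by (simp add: r_def)
  have rS: "\<zeta> \<in> S" "\<And>k. k \<in> I \<Longrightarrow> norm (\<gamma> \<zeta> k - \<gamma> \<zeta>0 k) < e / 2" if "\<zeta> \<in> cball \<zeta>0 r" for \<zeta>
    using r0(2)[of \<zeta>] that r0(1) by (auto simp: r_def dist_commute dist_norm[symmetric])
  define C where "C = cball (0::complex) (e / 4)"
  define K where "K = cball \<zeta>0 r \<times> C"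
  have inG: "(\<gamma> \<zeta>)(i := \<gamma> \<zeta> i + \<eta>) \<in> G" if "\<zeta> \<in> cball \<zeta>0 r" "\<eta> \<in> C" for \<zeta> \<eta>
  proof (rule e(2))
    show "(\<gamma> \<zeta>)(i := \<gamma> \<zeta> i + \<eta>) \<in> cspace I" using \<gamma>c rS that I by (intro fun_upd_cspace) auto
    fix k assume k: "k \<in> I"
    have "norm (\<gamma> \<zeta> i + \<eta> - \<gamma> \<zeta>0 i) \<le> norm (\<gamma> \<zeta> i - \<gamma> \<zeta>0 i) + norm \<eta>"
      using norm_triangle_ineq[of "\<gamma> \<zeta> i - \<gamma> \<zeta>0 i" \<eta>] by (simp add: algebra_simps)
    moreover have "norm (\<gamma> \<zeta> i - \<gamma> \<zeta>0 i) < e / 2" "norm \<eta> \<le> e / 4" using that I rS by (auto simp: C_def)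
    moreover have "norm (\<gamma> \<zeta> k - \<gamma> \<zeta>0 k) < e / 2" using that k rS by auto
    ultimately show "norm (((\<gamma> \<zeta>)(i := \<gamma> \<zeta> i + \<eta>)) k - \<gamma> \<zeta>0 k) < e" using e(1) by auto
  qed
  have contsh: "continuous_on K (\<lambda>x. (\<gamma> (fst x))(i := \<gamma> (fst x) i + snd x))"
  proof -
    have "continuous_on K (\<lambda>x. \<gamma> (fst x))"
      by (rule continuous_on_compose2[OF cont\<gamma>]) (use rS in \<open>auto simp: K_def intro!: continuous_intros\<close>)
    then have "continuous_on K (\<lambda>x. (\<gamma> (fst x), snd x))"
      by (rule continuous_on_Pair) (rule continuous_on_snd[OF continuous_on_id])
    from continuous_on_compose2[OF continuous_on_shift_coordinate[of UNIV i] this]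
    show ?thesis by (simp add: case_prod_unfold)
  qed
  have "continuous_on K (\<lambda>x. partial_deriv i f ((\<gamma> (fst x))(i := \<gamma> (fst x) i + snd x)))"
    by (rule continuous_on_compose2[OF continuous_on_partial_deriv[OF G I f] contsh]) (use inG in \<open>auto simp: K_def\<close>)
  moreover have "compact K" unfolding K_def C_def by (intro compact_Times compact_cball)
  ultimately have "bounded ((\<lambda>x. partial_deriv i f ((\<gamma> (fst x))(i := \<gamma> (fst x) i + snd x))) ` K)"
    using compact_continuous_image compact_imp_bounded by blast
  then obtain B where B: "\<And>\<zeta> \<eta>. \<zeta> \<in> cball \<zeta>0 r \<Longrightarrow> \<eta> \<in> C \<Longrightarrow> norm (partial_deriv i f ((\<gamma> \<zeta>)(i := \<gamma> \<zeta> i + \<eta>))) \<le> B"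
    unfolding bounded_iff K_def by force
  \<comment> \<open>The steps stay in the disc \<open>C\<close>, over which the shifted curve
    remains in \<open>G\<close> and the partial derivative is bounded.\<close>
  define h where "h n = complex_of_real (e / 4 / real (Suc n))" for n
  have hC: "h n \<in> C" for n
  proof -
    have "norm (h n) = e / 4 / real (Suc n)" unfolding h_def norm_of_real using e(1) by simp
    also have "\<dots> \<le> e / 4 / 1" by (rule divide_left_mono) (use e(1) in auto)
    finally show ?thesis by (simp add: C_def)
  qed
  have h0: "h n \<noteq> 0" for n unfolding h_def of_real_eq_0_iff using e(1) by simp
  have hlim: "h \<longlonglongrightarrow> 0"
  proof -
    have "(\<lambda>n. complex_of_real (e / 4 * inverse (real (Suc n)))) \<longlonglongrightarrow> complex_of_real (e / 4 * 0)"
      by (intro tendsto_intros LIMSEQ_inverse_real_of_nat)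
    then show ?thesis unfolding h_def by (simp only: divide_inverse mult_zero_right of_real_0)
  qed
  define q where "q n \<zeta> = (f ((\<gamma> \<zeta>)(i := \<gamma> \<zeta> i + h n)) - f (\<gamma> \<zeta>)) / h n" for n \<zeta>
  have qlim: "(\<lambda>n. q n \<zeta>) \<longlonglongrightarrow> partial_deriv i f (\<gamma> \<zeta>)" if z: "\<zeta> \<in> cball \<zeta>0 r" for \<zeta>
  proof -
    have "((\<lambda>\<eta>. f ((\<gamma> \<zeta>)(i := \<gamma> \<zeta> i + \<eta>))) has_field_derivative partial_deriv i f ((\<gamma> \<zeta>)(i := \<gamma> \<zeta> i + 0))) (at 0)"
      by (rule slice_has_derivative[OF G I _ f]) (use inG[OF z, of 0] e(1) in \<open>auto simp: C_def\<close>)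
    then have "((\<lambda>\<eta>. (f ((\<gamma> \<zeta>)(i := \<gamma> \<zeta> i + \<eta>)) - f (\<gamma> \<zeta>)) / \<eta>) \<longlongrightarrow> partial_deriv i f (\<gamma> \<zeta>)) (at 0)"
      by (simp add: has_field_derivative_iff)
    moreover have "filterlim h (at 0) sequentially"
      using hlim h0 by (auto simp: filterlim_at)
    ultimately show ?thesis unfolding q_def by (rule filterlim_compose)
  qed
  have qhol: "q n holomorphic_on ball \<zeta>0 r" for n
  proof -
    have "(\<lambda>\<zeta>. f ((\<gamma> \<zeta>)(i := \<gamma> \<zeta> i + h n))) holomorphic_on ball \<zeta>0 r"
    proof (rule holo_on_curve_holomorphic[OF f Gc])
      fix k assume k: "k \<in> I"
      have *: "(\<lambda>\<zeta>. \<gamma> \<zeta> k) holomorphic_on ball \<zeta>0 r" if "k \<in> I" for k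
        by (rule holomorphic_on_subset[OF \<gamma>[OF that]]) (use rS in auto)
      show "(\<lambda>\<zeta>. ((\<gamma> \<zeta>)(i := \<gamma> \<zeta> i + h n)) k) holomorphic_on ball \<zeta>0 r"
        by (cases "k = i") (use k in \<open>auto intro!: holomorphic_intros *\<close>)
    qed (use inG hC in auto)
    moreover have "(\<lambda>\<zeta>. f (\<gamma> \<zeta>)) holomorphic_on ball \<zeta>0 r"
      by (rule holo_on_curve_holomorphic[OF f Gc]) (use rS im in \<open>auto intro!: holomorphic_on_subset[OF \<gamma>]\<close>)
    ultimately show ?thesis unfolding q_def by (intro holomorphic_intros) (use h0 in auto)
  qed
  have qB: "norm (q n \<zeta>) \<le> B" if z: "\<zeta> \<in> cball \<zeta>0 r" for n \<zeta>
  proof -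
    have "norm (f ((\<gamma> \<zeta>)(i := \<gamma> \<zeta> i + h n)) - f ((\<gamma> \<zeta>)(i := \<gamma> \<zeta> i + 0))) \<le> B * norm (h n - 0)"
    proof (rule field_differentiable_bound[where S = C])
      show "convex C" by (simp add: C_def)
      show "((\<lambda>\<eta>. f ((\<gamma> \<zeta>)(i := \<gamma> \<zeta> i + \<eta>))) has_field_derivative partial_deriv i f ((\<gamma> \<zeta>)(i := \<gamma> \<zeta> i + \<eta>))) (at \<eta> within C)" if "\<eta> \<in> C" for \<eta>
        by (rule has_field_derivative_at_within, rule slice_has_derivative[OF G I inG[OF z that] f])
    qed (use B z hC e(1) in \<open>auto simp: C_def\<close>)
    then show ?thesis using h0[of n] by (simp add: q_def norm_divide divide_le_eq)
  qed
  obtain g t where g: "g holomorphic_on ball \<zeta>0 r" and t: "strict_mono (t :: nat \<Rightarrow> nat)"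
    and lim: "\<And>x. x \<in> ball \<zeta>0 r \<Longrightarrow> (\<lambda>n. q (t n) x) \<longlonglongrightarrow> g x"
  proof (rule Montel[of "ball \<zeta>0 r" "range q" q])
    show "\<exists>B. \<forall>h\<in>range q. \<forall>z\<in>K. norm (h z) \<le> B" if "K \<subseteq> ball \<zeta>0 r" for K
      using qB that by (intro exI[of _ B]) auto
  qed (use qhol in auto)
  have "g \<zeta> = partial_deriv i f (\<gamma> \<zeta>)" if "\<zeta> \<in> ball \<zeta>0 r" for \<zeta>
    using LIMSEQ_unique[OF lim[OF that] LIMSEQ_subseq_LIMSEQ[OF qlim[of \<zeta>] t, unfolded o_def]] that by auto
  then have "(\<lambda>\<zeta>. partial_deriv i f (\<gamma> \<zeta>)) holomorphic_on ball \<zeta>0 r"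
    by (rule holomorphic_transform[OF g])
  then show "\<exists>\<epsilon>>0. (\<lambda>\<zeta>. partial_deriv i f (\<gamma> \<zeta>)) holomorphic_on ball \<zeta>0 \<epsilon>" using r by blast
qed

section \<open>Injective holomorphic maps have a nonsingular derivative somewhere\<close>

text \<open>If all partial derivatives vanished on \<open>G\<close>, then \<open>f\<close> would be
  constant on a small disc in one coordinate direction.\<close>

lemma injective_holomorphic_nonconstant:
  assumes G: "copen I G" "G \<noteq> {}" and I: "finite I" "I \<noteq> {}"
    and f: "\<And>j. j \<in> J \<Longrightarrow> holo_on I G (\<lambda>w. f w j)" and im: "f ` G \<subseteq> cspace J" and inj: "inj_on f G"
  obtains a i j where "a \<in> G" "i \<in> I" "j \<in> J" "partial_deriv i (\<lambda>w. f w j) a \<noteq> 0"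
proof -
  have "\<exists>a\<in>G. \<exists>i\<in>I. \<exists>j\<in>J. partial_deriv i (\<lambda>w. f w j) a \<noteq> 0"
  proof (rule ccontr)
    assume "\<not> (\<exists>a\<in>G. \<exists>i\<in>I. \<exists>j\<in>J. partial_deriv i (\<lambda>w. f w j) a \<noteq> 0)"
    then have z: "\<And>a i j. a \<in> G \<Longrightarrow> i \<in> I \<Longrightarrow> j \<in> J \<Longrightarrow> partial_deriv i (\<lambda>w. f w j) a = 0" by auto
    obtain a i where a: "a \<in> G" and i: "i \<in> I" using G I by auto
    obtain e where e: "e > 0" "\<And>w. w \<in> cspace I \<Longrightarrow> (\<And>k. k \<in> I \<Longrightarrow> norm (w k - a k) < e) \<Longrightarrow> w \<in> G"
      using copenD[OF G(1) I(1) a] by blast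
    have inG: "a(i := a i + \<eta>) \<in> G" if "\<eta> \<in> ball 0 e" for \<eta>
      by (rule e(2)) (use that e(1) i a openin_imp_subset[OF G(1)] in \<open>auto intro!: fun_upd_cspace\<close>)
    have h: "complex_of_real (e / 2) \<in> ball 0 e" using e(1) by simp
    have "f (a(i := a i + complex_of_real (e / 2))) j = f (a(i := a i + 0)) j" if j: "j \<in> J" for j
    proof -
      have "norm (f (a(i := a i + complex_of_real (e / 2))) j - f (a(i := a i + 0)) j) \<le> 0 * norm (complex_of_real (e / 2) - 0)"
      proof (rule field_differentiable_bound[where S = "ball 0 e"])
        show "((\<lambda>\<eta>. f (a(i := a i + \<eta>)) j) has_field_derivative partial_deriv i (\<lambda>w. f w j) (a(i := a i + \<eta>))) (at \<eta> within ball 0 e)"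
          if "\<eta> \<in> ball 0 e" for \<eta>
          by (rule has_field_derivative_at_within, rule slice_has_derivative[OF G(1) I(1) i inG[OF that] f[OF j]])
      qed (use z inG i j h e(1) in auto)
      then show ?thesis by simp
    qed
    then have "f (a(i := a i + complex_of_real (e / 2))) = f (a(i := a i + 0))"
      using im inG[OF h] inG[of 0] e(1) by (intro cspace_eqI[of _ J]) auto
    then have "a(i := a i + complex_of_real (e / 2)) = a(i := a i + 0)"
      using inj inG[OF h] inG[of 0] e(1) by (auto dest: inj_onD)
    then have "complex_of_real (e / 2) = 0" by (metis add_left_cancel fun_upd_same)
    then show False using e(1) by simp
  qed
  then show ?thesis using that by blast
qed

text \<open>The function \<open>\<phi>\<close> is obtained pointwise from Banach's fixed point theorem.\<close>

lemma implicit_function: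
  fixes G :: "('i \<Rightarrow> complex) set"
  assumes G: "copen I G" and I: "finite I" "i \<in> I" and F: "holo_on I G F" and a: "a \<in> G"
    and nz: "partial_deriv i F a \<noteq> 0"
  obtains G' \<phi> where "copen (I - {i}) G'" "G' \<noteq> {}"
    "\<And>x. x \<in> G' \<Longrightarrow> x(i := \<phi> x) \<in> G \<and> F (x(i := \<phi> x)) = F a \<and> partial_deriv i F (x(i := \<phi> x)) \<noteq> 0"
    "\<And>x. x \<in> G' \<Longrightarrow> has_gradient (I - {i}) G' \<phi> x (\<lambda>k. - partial_deriv k F (x(i := \<phi> x)) / partial_deriv i F (x(i := \<phi> x)))"
proof -
  define c where "c = partial_deriv i F a"
  define I' where "I' = I - {i}"
  have c: "norm c > 0" using nz by (simp add: c_def)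
  have Gc: "G \<subseteq> cspace I" by (rule openin_imp_subset[OF G])
  have ac: "a \<in> cspace I" using a Gc by blast
  have "(partial_deriv i F \<longlongrightarrow> partial_deriv i F a) (nhds_rel (cspace I) a)"
    using continuous_on_partial_deriv[OF G I F] a unfolding continuous_on_def tendsto_nhds_rel_iff_at[symmetric] nhds_rel_copen[OF G a, symmetric]
    by blast
  from tendstoD[OF this, of "norm c / 2"] c
  have "\<forall>\<^sub>F w in nhds_rel (cspace I) a. dist (partial_deriv i F w) c < norm c / 2" by (simp add: c_def)
  moreover have "\<forall>\<^sub>F w in nhds_rel (cspace I) a. w \<in> G" using G a by (simp add: copen_iff_eventually)
  ultimately have "\<forall>\<^sub>F w in nhds_rel (cspace I) a. w \<in> G \<and> dist (partial_deriv i F w) c < norm c / 2"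
    by eventually_elim simp
  \<comment> \<open>Keeping the partial derivative within \<open>norm c / 2\<close> of
    \<open>c\<close> makes the iteration \<open>T\<close> below a contraction with constant
    1/2.\<close>
  then obtain e where e: "e > 0"
    and eV: "\<And>w. w \<in> cspace I \<Longrightarrow> \<forall>k\<in>I. norm (w k - a k) < e \<Longrightarrow> w \<in> G \<and> dist (partial_deriv i F w) c < norm c / 2"
    unfolding eventually_nhds_cspace[OF I(1) ac] by blast
  have "(F \<longlongrightarrow> F a) (nhds_rel (cspace I) a)"
    using holo_on_continuous_on[OF F] a unfolding continuous_on_def tendsto_nhds_rel_iff_at[symmetric] nhds_rel_copen[OF G a, symmetric]
    by blast
  \<comment> \<open>This bound on the change of \<open>F\<close> lets one application of
    \<open>T\<close> move the centre by at most \<open>e / 4\<close>. The contraction adds at most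
    \<open>e / 4\<close> more, so the closed disc of radius \<open>e / 2\<close> is mapped into
    itself.\<close>
  from tendstoD[OF this, of "norm c * e / 4"] c e
  have "\<forall>\<^sub>F w in nhds_rel (cspace I) a. dist (F w) (F a) < norm c * e / 4" by simp
  then obtain d where d: "d > 0"
    and dV: "\<And>w. w \<in> cspace I \<Longrightarrow> \<forall>k\<in>I. norm (w k - a k) < d \<Longrightarrow> dist (F w) (F a) < norm c * e / 4"
    unfolding eventually_nhds_cspace[OF I(1) ac] by blast
  define \<delta> where "\<delta> = min d e"
  have \<delta>: "\<delta> > 0" "\<delta> \<le> d" "\<delta> \<le> e" using d e by (auto simp: \<delta>_def)
  define G' where "G' = {x \<in> cspace I'. \<forall>k\<in>I'. norm (x k - a k) < \<delta>}"
  have xi: "x i = 0" if "x \<in> G'" for x using that by (auto simp: G'_def cspace_def I'_def)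
  have updc: "x(i := \<eta>) \<in> cspace I" if "x \<in> G'" for x \<eta>
    using that I by (auto simp: G'_def cspace_def I'_def)
  have updV: "\<forall>k\<in>I. norm ((x(i := \<eta>)) k - a k) < e" if "x \<in> G'" "\<eta> \<in> ball (a i) e" for x \<eta>
    using that \<delta> by (force simp: G'_def I'_def dist_norm norm_minus_commute)
  have V: "x(i := \<eta>) \<in> G \<and> dist (partial_deriv i F (x(i := \<eta>))) c < norm c / 2" if "x \<in> G'" "\<eta> \<in> ball (a i) e" for x \<eta>
    by (rule eV[OF updc[OF that(1)] updV[OF that]])
  have lip: "norm (F (x(i := \<eta>1)) - F (x(i := \<eta>2)) - c * (\<eta>1 - \<eta>2)) \<le> norm c / 2 * norm (\<eta>1 - \<eta>2)"
    if x: "x \<in> G'" and \<eta>: "\<eta>1 \<in> ball (a i) e" "\<eta>2 \<in> ball (a i) e" for x \<eta>1 \<eta>2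
  proof -
    have "norm ((F (x(i := \<eta>1)) - c * \<eta>1) - (F (x(i := \<eta>2)) - c * \<eta>2)) \<le> norm c / 2 * norm (\<eta>1 - \<eta>2)"
    proof (rule field_differentiable_bound[where S = "ball (a i) e"])
      fix \<eta> assume \<eta>: "\<eta> \<in> ball (a i) e"
      have "((\<lambda>\<eta>. F (x(i := x i + \<eta>))) has_field_derivative partial_deriv i F (x(i := x i + \<eta>))) (at \<eta>)"
        by (rule slice_has_derivative[OF G I _ F]) (use V[OF x \<eta>] xi[OF x] in simp)
      then have "((\<lambda>\<eta>. F (x(i := \<eta>))) has_field_derivative partial_deriv i F (x(i := \<eta>))) (at \<eta> within ball (a i) e)"
        by (simp add: xi[OF x] has_field_derivative_at_within)
      from DERIV_diff[OF this DERIV_cmult_Id[of c]]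
      show "((\<lambda>\<eta>. F (x(i := \<eta>)) - c * \<eta>) has_field_derivative partial_deriv i F (x(i := \<eta>)) - c) (at \<eta> within ball (a i) e)" .
      show "norm (partial_deriv i F (x(i := \<eta>)) - c) \<le> norm c / 2" using V[OF x \<eta>] by (simp add: dist_norm)
    qed (use \<eta> in auto)
    then show ?thesis by (simp add: algebra_simps)
  qed
  \<comment> \<open>Growth of \<open>F\<close> in direction \<open>i\<close> from below. Later it
    bounds \<open>\<phi> x - \<phi> y\<close> by a change of \<open>F\<close> at the fixed height
    \<open>\<phi> y\<close>, which proves that \<open>\<phi>\<close> is continuous.\<close>
  have lower: "norm c / 2 * norm (\<eta>1 - \<eta>2) \<le> norm (F (x(i := \<eta>1)) - F (x(i := \<eta>2)))"
    if x: "x \<in> G'" and \<eta>: "\<eta>1 \<in> ball (a i) e" "\<eta>2 \<in> ball (a i) e" for x \<eta>1 \<eta>2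
    using lip[OF that] norm_triangle_ineq2[of "c * (\<eta>1 - \<eta>2)" "c * (\<eta>1 - \<eta>2) - (F (x(i := \<eta>1)) - F (x(i := \<eta>2)))"]
    by (simp add: norm_mult norm_minus_commute)
  have K: "cball (a i) (e / 2) \<subseteq> ball (a i) e" using e by auto
  have ai: "a i \<in> cball (a i) (e / 2)" using e by auto
  have "\<forall>x\<in>G'. \<exists>\<eta>. \<eta> \<in> cball (a i) (e / 2) \<and> F (x(i := \<eta>)) = F a"
  proof
    fix x assume x: "x \<in> G'"
    \<comment> \<open>Newton's iteration for \<open>F = F a\<close>, with the derivative frozen at
      \<open>c\<close>.\<close>
    define T where "T \<eta> = \<eta> - (F (x(i := \<eta>)) - F a) / c" for \<eta>
    have Tl: "dist (T \<eta>1) (T \<eta>2) \<le> 1 / 2 * dist \<eta>1 \<eta>2" if "\<eta>1 \<in> cball (a i) (e/2)" "\<eta>2 \<in> cball (a i) (e/2)" for \<eta>1 \<eta>2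
    proof -
      have "T \<eta>1 - T \<eta>2 = - (F (x(i := \<eta>1)) - F (x(i := \<eta>2)) - c * (\<eta>1 - \<eta>2)) / c"
        using c by (auto simp: T_def field_simps)
      then have "norm (T \<eta>1 - T \<eta>2) = norm (F (x(i := \<eta>1)) - F (x(i := \<eta>2)) - c * (\<eta>1 - \<eta>2)) / norm c"
        by (simp add: norm_divide norm_minus_commute)
      also have "\<dots> \<le> (norm c / 2 * norm (\<eta>1 - \<eta>2)) / norm c"
        by (rule divide_right_mono[OF lip[OF x]]) (use that K in auto)
      finally show ?thesis using c by (simp add: dist_norm)
    qed
    have "dist (F (x(i := a i))) (F a) < norm c * e / 4"
      by (rule dV[OF updc[OF x]]) (use x \<delta> in \<open>force simp: G'_def I'_def\<close>)
    then have T0: "dist (T (a i)) (a i) \<le> e / 4"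
      using c by (simp add: T_def dist_norm norm_divide divide_le_eq mult.commute)
    have "\<exists>!\<eta>\<in>cball (a i) (e / 2). T \<eta> = \<eta>"
    proof (rule Banach_fix)
      show "T ` cball (a i) (e / 2) \<subseteq> cball (a i) (e / 2)"
      proof (rule image_subsetI)
        fix \<eta> assume \<eta>: "\<eta> \<in> cball (a i) (e / 2)"
        have "dist (T \<eta>) (a i) \<le> dist (T \<eta>) (T (a i)) + dist (T (a i)) (a i)" by (rule dist_triangle)
        also have "\<dots> \<le> 1 / 2 * (e / 2) + e / 4"
          using Tl[OF \<eta> ai] T0 \<eta> by (auto simp: dist_commute)
        finally show "T \<eta> \<in> cball (a i) (e / 2)" by (simp add: dist_commute)
      qed
      show "dist (T x) (T y) \<le> 1 / 2 * dist x y" if "x \<in> cball (a i) (e / 2)" "y \<in> cball (a i) (e / 2)" for x y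
        using Tl that by blast
    qed (use e in \<open>auto simp: complete_eq_closed\<close>)
    then obtain \<eta> where "\<eta> \<in> cball (a i) (e / 2)" "T \<eta> = \<eta>" by blast
    then show "\<exists>\<eta>. \<eta> \<in> cball (a i) (e / 2) \<and> F (x(i := \<eta>)) = F a" using c by (auto simp: T_def)
  qed
  from bchoice[OF this] obtain \<phi> where \<phi>: "\<forall>x\<in>G'. \<phi> x \<in> cball (a i) (e / 2) \<and> F (x(i := \<phi> x)) = F a" ..
  have \<phi>b: "\<phi> x \<in> ball (a i) e" if "x \<in> G'" for x using \<phi> K that by blast
  have \<phi>F: "F (x(i := \<phi> x)) = F a" if "x \<in> G'" for x using \<phi> that by blast
  have \<phi>G: "x(i := \<phi> x) \<in> G" if "x \<in> G'" for x using V[OF that \<phi>b[OF that]] by simp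
  have \<phi>nz: "partial_deriv i F (x(i := \<phi> x)) \<noteq> 0" if "x \<in> G'" for x using V[OF that \<phi>b[OF that]] c by auto
  have I': "finite I'" using I by (simp add: I'_def)
  have G'o: "copen I' G'"
  proof (subst copen_iff[OF I'], intro conjI ballI)
    fix z assume z: "z \<in> G'"
    define \<epsilon> where "\<epsilon> = Min (insert 1 ((\<lambda>k. \<delta> - norm (z k - a k)) ` I'))"
    have "\<epsilon> > 0" using z I' by (auto simp: \<epsilon>_def G'_def)
    moreover have "w \<in> G'" if "w \<in> cspace I'" "\<forall>k\<in>I'. norm (w k - z k) < \<epsilon>" for w
    proof -
      have "norm (w k - a k) < \<delta>" if k: "k \<in> I'" for k
      proof -
        have "\<epsilon> \<le> \<delta> - norm (z k - a k)" using k I' by (auto simp: \<epsilon>_def)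
        moreover have "norm (w k - z k) < \<epsilon>" using \<open>\<forall>k\<in>I'. norm (w k - z k) < \<epsilon>\<close> k by blast
        moreover have "norm (w k - a k) \<le> norm (w k - z k) + norm (z k - a k)"
          using norm_triangle_ineq[of "w k - z k" "z k - a k"] by simp
        ultimately show ?thesis by linarith
      qed
      then show ?thesis using that by (simp add: G'_def)
    qed
    ultimately show "\<exists>e>0. \<forall>w\<in>cspace I'. (\<forall>i\<in>I'. cmod (w i - z i) < e) \<longrightarrow> w \<in> G'" by blast
  qed (auto simp: G'_def)
  have "a(i := 0) \<in> G'" using ac \<delta> by (auto simp: G'_def I'_def cspace_def)
  then have G'ne: "G' \<noteq> {}" by blast
  have inG': "\<forall>\<^sub>F x in nhds_rel G' y. x \<in> G'" for y by (simp add: eventually_nhds_rel)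
  have updlim: "((\<lambda>x. x(i := \<psi> x)) \<longlongrightarrow> y(i := l)) (nhds_rel G' y)" if "(\<psi> \<longlongrightarrow> l) (nhds_rel G' y)" for \<psi> y l
    unfolding tendsto_coordinatewise
  proof
    fix k show "((\<lambda>x. (x(i := \<psi> x)) k) \<longlongrightarrow> (y(i := l)) k) (nhds_rel G' y)"
      by (cases "k = i") (use that coord_tendsto_nhds_rel[of k y G'] in auto)
  qed
  have \<phi>cont: "(\<phi> \<longlongrightarrow> \<phi> y) (nhds_rel G' y)" if y: "y \<in> G'" for y
  proof -
    have "filterlim (\<lambda>x. x(i := \<phi> y)) (nhds_rel G (y(i := \<phi> y))) (nhds_rel G' y)"
      by (rule filterlim_nhds_rel[OF updlim[OF tendsto_const]])
        (use inG' in \<open>eventually_elim, use V \<phi>b[OF y] in blast\<close>)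
    moreover obtain cf where "has_gradient I G F (y(i := \<phi> y)) cf" using F \<phi>G[OF y] unfolding holo_on_def by blast
    ultimately have "((\<lambda>x. F (x(i := \<phi> y))) \<longlongrightarrow> F (y(i := \<phi> y))) (nhds_rel G' y)"
      using has_gradient_tendsto filterlim_compose by blast
    then have "((\<lambda>x. norm (F a - F (x(i := \<phi> y))) * (2 / norm c)) \<longlongrightarrow> norm (F a - F a) * (2 / norm c)) (nhds_rel G' y)"
      unfolding \<phi>F[OF y] by (intro tendsto_intros)
    then have lim: "((\<lambda>x. norm (F a - F (x(i := \<phi> y))) * (2 / norm c)) \<longlongrightarrow> 0) (nhds_rel G' y)" by simp
    have "\<forall>\<^sub>F x in nhds_rel G' y. norm (\<phi> x - \<phi> y) \<le> norm (F a - F (x(i := \<phi> y))) * (2 / norm c)"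
      using inG'
    proof eventually_elim
      case (elim x)
      from lower[OF elim \<phi>b[OF elim] \<phi>b[OF y]] show ?case using c by (simp add: \<phi>F[OF elim] field_simps)
    qed
    from Lim_null_comparison[OF this lim] show ?thesis by (simp add: LIM_zero_iff)
  qed
  have \<phi>d: "has_gradient I' G' \<phi> y (\<lambda>k. - partial_deriv k F (y(i := \<phi> y)) / partial_deriv i F (y(i := \<phi> y)))" if y: "y \<in> G'" for y
  proof -
    define P where "P = y(i := \<phi> y)"
    have PG: "P \<in> G" using \<phi>G[OF y] by (simp add: P_def)
    have fl: "filterlim (\<lambda>x. x(i := \<phi> x)) (nhds_rel G P) (nhds_rel G' y)"
      unfolding P_def by (rule filterlim_nhds_rel[OF updlim[OF \<phi>cont[OF y]]]) (use inG' in \<open>eventually_elim, use \<phi>G in blast\<close>)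
    obtain q where q: "\<And>k. k \<in> I \<Longrightarrow> ((\<lambda>w. q w k) \<longlongrightarrow> partial_deriv k F P) (nhds_rel G P)"
      and qe: "\<forall>\<^sub>F w in nhds_rel G P. F w - F P = (\<Sum>k\<in>I. q w k * (w k - P k))"
      using has_gradient_partial_deriv[OF G I(1) PG F] unfolding has_gradient_def by blast
    \<comment> \<open>On the graph of \<open>\<phi>\<close> the function \<open>F\<close> is
      constant. Its increment equation can therefore be solved for
      \<open>\<phi> x - \<phi> y\<close>; the slope in direction \<open>i\<close>, by which one
      divides, is eventually nonzero.\<close>
    define q' where "q' x k = - q (x(i := \<phi> x)) k / q (x(i := \<phi> x)) i" for x k
    have nzP: "partial_deriv i F P \<noteq> 0" using \<phi>nz[OF y] by (simp add: P_def)
    have qlim: "((\<lambda>x. q (x(i := \<phi> x)) k) \<longlongrightarrow> partial_deriv k F P) (nhds_rel G' y)" if "k \<in> I" for k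
      by (rule filterlim_compose[OF q[OF that] fl])
    have "((\<lambda>x. q' x k) \<longlongrightarrow> - partial_deriv k F P / partial_deriv i F P) (nhds_rel G' y)" if "k \<in> I'" for k
      unfolding q'_def using that I by (intro tendsto_intros qlim nzP) (auto simp: I'_def)
    moreover have "\<forall>\<^sub>F x in nhds_rel G' y. \<phi> x - \<phi> y = (\<Sum>k\<in>I'. q' x k * (x k - y k))"
      using eventually_compose_filterlim[OF qe fl] inG' tendsto_imp_eventually_ne[OF qlim[OF I(2)] nzP]
    proof eventually_elim
      case (elim x)
      let ?q = "q (x(i := \<phi> x))"
      have "0 = (\<Sum>k\<in>I. ?q k * ((x(i := \<phi> x)) k - P k))"
        using elim(1) \<phi>F[OF elim(2)] \<phi>F[OF y] by (simp add: P_def)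
      also have "\<dots> = ?q i * (\<phi> x - \<phi> y) + (\<Sum>k\<in>I'. ?q k * ((x(i := \<phi> x)) k - P k))"
        unfolding I'_def by (subst sum.remove[OF I]) (simp add: P_def)
      also have "(\<Sum>k\<in>I'. ?q k * ((x(i := \<phi> x)) k - P k)) = (\<Sum>k\<in>I'. ?q k * (x k - y k))"
        by (rule sum.cong) (auto simp: P_def I'_def)
      finally have "?q i * (\<phi> x - \<phi> y) = - (\<Sum>k\<in>I'. ?q k * (x k - y k))"
        by (simp only: eq_neg_iff_add_eq_0)
      moreover have "\<phi> x - \<phi> y = (?q i * (\<phi> x - \<phi> y)) / ?q i" using elim(3) by simp
      ultimately have "\<phi> x - \<phi> y = - (\<Sum>k\<in>I'. ?q k * (x k - y k)) / ?q i" by (simp only:)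
      also have "\<dots> = (\<Sum>k\<in>I'. q' x k * (x k - y k))"
        unfolding q'_def sum_negf[symmetric] sum_divide_distrib by (rule sum.cong) auto
      finally show ?case .
    qed
    ultimately show ?thesis unfolding has_gradient_def P_def[symmetric] by blast
  qed
  show ?thesis
    by (rule that[of G' \<phi>]) (use G'o G'ne \<phi>G \<phi>F \<phi>nz \<phi>d in \<open>simp_all only: I'_def\<close>, auto)
qed

text \<open>Induction on the dimension. Some component \<open>F = f j\<close> has a nonzero
  derivative in a direction \<open>i\<close>, and its level set is a graph over the other
  coordinates. On it the remaining components form an injective map in one dimension less. A vector
  killed by the derivative of \<open>f\<close> is tangent to the level set, so the induction
  hypothesis makes it zero. Applied to small open sets \<open>G\<close>, this gives nonsingular
  points arbitrarily close to a given one.\<close>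

proposition injective_holomorphic_nondegenerate:
  fixes f :: "('i \<Rightarrow> complex) \<Rightarrow> ('j \<Rightarrow> complex)"
  assumes "copen I G" "G \<noteq> {}" "finite I" "finite J" "card I = card J"
    "\<And>j. j \<in> J \<Longrightarrow> holo_on I G (\<lambda>w. f w j)" "f ` G \<subseteq> cspace J" "inj_on f G"
  shows "\<exists>z\<in>G. \<forall>v. (\<forall>j\<in>J. (\<Sum>i\<in>I. partial_deriv i (\<lambda>w. f w j) z * v i) = 0) \<longrightarrow> (\<forall>i\<in>I. v i = 0)"
  using assms
proof (induction "card I" arbitrary: I J G f)
  case 0
  then show ?case by auto
next
  case (Suc n)
  note G = Suc.prems(1,2) and I = Suc.prems(3) and J = Suc.prems(4) and IJ = Suc.prems(5)
    and f = Suc.prems(6) and im = Suc.prems(7) and inj = Suc.prems(8)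
  have "I \<noteq> {}" using Suc.hyps(2) by auto
  then obtain a i j where a: "a \<in> G" and i: "i \<in> I" and j: "j \<in> J" and nz: "partial_deriv i (\<lambda>w. f w j) a \<noteq> 0"
    using injective_holomorphic_nonconstant[OF G I _ f im inj] by blast
  define F where "F w = f w j" for w
  define I' where "I' = I - {i}"
  define J' where "J' = J - {j}"
  have F: "holo_on I G F" using f[OF j] by (simp add: F_def[abs_def])
  obtain G' \<phi> where G': "copen I' G'" "G' \<noteq> {}"
    and \<phi>: "\<And>x. x \<in> G' \<Longrightarrow> x(i := \<phi> x) \<in> G \<and> F (x(i := \<phi> x)) = F a \<and> partial_deriv i F (x(i := \<phi> x)) \<noteq> 0"
    and \<phi>d: "\<And>x. x \<in> G' \<Longrightarrow> has_gradient I' G' \<phi> x (\<lambda>k. - partial_deriv k F (x(i := \<phi> x)) / partial_deriv i F (x(i := \<phi> x)))"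
    using implicit_function[OF G(1) I i F a] nz unfolding I'_def F_def by blast
  have I': "finite I'" and J': "finite J'" and card: "card I' = card J'" and n: "n = card I'"
    using I J i j IJ Suc.hyps(2) by (auto simp: I'_def J'_def)
  have G'c: "G' \<subseteq> cspace I'" by (rule openin_imp_subset[OF G'(1)])
  have Gc: "G \<subseteq> cspace I" by (rule openin_imp_subset[OF G(1)])
  define \<Psi> where "\<Psi> x = x(i := \<phi> x)" for x
  have \<Psi>G: "\<Psi> x \<in> G" if "x \<in> G'" for x using \<phi>[OF that] by (simp add: \<Psi>_def)
  define c where "c x l k = (if l = i then - partial_deriv k F (\<Psi> x) / partial_deriv i F (\<Psi> x) else if k = l then 1 else 0)" for x l k
  have \<Psi>d: "has_gradient I' G' (\<lambda>w. \<Psi> w l) x (c x l)" if "x \<in> G'" "l \<in> I" for x l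
  proof (cases "l = i")
    case True
    then show ?thesis using \<phi>d[OF that(1)] by (simp add: \<Psi>_def c_def[abs_def])
  next
    case False
    then show ?thesis using has_gradient_coord[OF I', of l G' x] that(2) by (simp add: \<Psi>_def c_def[abs_def] I'_def)
  qed
  have fd: "has_gradient I' G' (\<lambda>w. f (\<Psi> w) m) x (\<lambda>k. \<Sum>l\<in>I. partial_deriv l (\<lambda>w. f w m) (\<Psi> x) * c x l k)" if x: "x \<in> G'" and m: "m \<in> J" for x m
  proof (rule has_gradient_compose[OF \<Psi>d[OF x] _ _ has_gradient_partial_deriv[OF G(1) I \<Psi>G[OF x] f[OF m]]])
    show "\<Psi> w l = 0" if "l \<notin> I" "w \<in> insert x G'" for l w
    proof -
      have "\<Psi> w \<in> cspace I" using that x \<Psi>G Gc by blast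
      then show ?thesis using that(1) by (simp add: cspace_def)
    qed
    show "\<forall>\<^sub>F w in nhds_rel G' x. \<Psi> w \<in> G" using \<Psi>G by (simp add: eventually_nhds_rel)
  qed
  \<comment> \<open>Component \<open>j\<close> is constant on the level set; replacing it by 0 puts
    the map into \<open>cspace J'\<close> and preserves injectivity.\<close>
  define f' where "f' x = (f (\<Psi> x))(j := 0)" for x
  have f'm: "f' x m = f (\<Psi> x) m" if "m \<in> J'" for x m using that by (simp add: f'_def J'_def)
  have hol': "holo_on I' G' (\<lambda>w. f' w m)" if "m \<in> J'" for m
    unfolding f'm[OF that] using fd that by (intro cholI) (auto simp: J'_def)
  have im': "f' ` G' \<subseteq> cspace J'"
    using im \<Psi>G by (force simp: f'_def J'_def cspace_def)
  have inj': "inj_on f' G'"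
  proof (rule inj_onI)
    fix x y assume x: "x \<in> G'" and y: "y \<in> G'" and eq: "f' x = f' y"
    have "f (\<Psi> x) j = f (\<Psi> y) j" using \<phi>[OF x] \<phi>[OF y] by (simp add: \<Psi>_def F_def)
    then have "f (\<Psi> x) = f (\<Psi> y)" using eq unfolding f'_def by (metis fun_upd_triv fun_upd_upd)
    then have "\<Psi> x = \<Psi> y" using inj \<Psi>G x y by (auto dest: inj_onD)
    moreover have "x i = 0" "y i = 0" using x y G'c by (auto simp: cspace_def I'_def)
    ultimately show "x = y" unfolding \<Psi>_def by (metis fun_upd_triv fun_upd_upd)
  qed
  obtain y where y: "y \<in> G'"
    and ynd: "\<And>v. (\<forall>m\<in>J'. (\<Sum>k\<in>I'. partial_deriv k (\<lambda>w. f' w m) y * v k) = 0) \<Longrightarrow> (\<forall>k\<in>I'. v k = 0)"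
    using Suc.hyps(1)[OF n G' I' J' card hol' im' inj'] by blast
  have coef: "partial_deriv k (\<lambda>w. f' w m) y = (\<Sum>l\<in>I. partial_deriv l (\<lambda>w. f w m) (\<Psi> y) * c y l k)" if "k \<in> I'" "m \<in> J'" for k m
    by (rule has_gradient_coeff_eq_partial_deriv[OF G'(1) I' that(1) y, symmetric])
      (use fd[OF y] f'm[OF that(2)] that(2) in \<open>auto simp: J'_def\<close>)
  show ?case
  proof (rule bexI[OF _ \<Psi>G[OF y]], intro allI impI)
    fix v assume v: "\<forall>m\<in>J. (\<Sum>l\<in>I. partial_deriv l (\<lambda>w. f w m) (\<Psi> y) * v l) = 0"
    have "partial_deriv i F (\<Psi> y) * v i + (\<Sum>k\<in>I'. partial_deriv k F (\<Psi> y) * v k) = 0"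
      using v j unfolding F_def I'_def by (subst (asm) sum.remove[OF I i]) auto
    moreover have nzP: "partial_deriv i F (\<Psi> y) \<noteq> 0" using \<phi>[OF y] by (simp add: \<Psi>_def)
    \<comment> \<open>The equation of component \<open>j\<close> says that \<open>v\<close> is
      tangent to the graph: its entry at \<open>i\<close> is determined by the others through the
      derivative of \<open>\<phi>\<close>.\<close>
    ultimately have vi: "v i = (\<Sum>k\<in>I'. c y i k * v k)"
      by (simp add: c_def sum_divide_distrib[symmetric] sum_negf eq_divide_eq add_eq_0_iff mult.commute)
    have vl: "(\<Sum>k\<in>I'. c y l k * v k) = v l" if "l \<in> I" for l
    proof (cases "l = i")
      case False
      then have "(\<Sum>k\<in>I'. c y l k * v k) = (\<Sum>k\<in>I'. if k = l then v k else 0)"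
        by (intro sum.cong) (auto simp: c_def)
      then show ?thesis using I' that False by (simp add: I'_def)
    qed (use vi in simp)
    have "(\<Sum>k\<in>I'. partial_deriv k (\<lambda>w. f' w m) y * v k) = 0" if m: "m \<in> J'" for m
    proof -
      have "(\<Sum>k\<in>I'. partial_deriv k (\<lambda>w. f' w m) y * v k) = (\<Sum>k\<in>I'. \<Sum>l\<in>I. partial_deriv l (\<lambda>w. f w m) (\<Psi> y) * (c y l k * v k))"
        by (rule sum.cong) (use coef m in \<open>auto simp: sum_distrib_right mult.assoc\<close>)
      also have "\<dots> = (\<Sum>l\<in>I. partial_deriv l (\<lambda>w. f w m) (\<Psi> y) * v l)"
        by (subst sum.swap, rule sum.cong) (use vl in \<open>auto simp: sum_distrib_left[symmetric]\<close>)
      also have "\<dots> = 0" using v m by (simp add: J'_def)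
      finally show ?thesis .
    qed
    then have "\<forall>k\<in>I'. v k = 0" using ynd by blast
    then show "\<forall>l\<in>I. v l = 0" using vl by (metis (no_types, lifting) mult_zero_right sum.neutral)
  qed
qed

subsection \<open>A Schwarz lemma off a zero set\<close>

text \<open>Let \<open>Q\<close> be \<open>u \<zeta> / \<zeta>\<close>, and apply the maximum
  principle to \<open>Q ^ k * H\<close> on the set where \<open>H\<close> is nonzero. At a frontier
  point either \<open>norm \<zeta> = R\<close>, where \<open>Q\<close> is at most
  \<open>M / R\<close>, or \<open>H\<close> vanishes. The resulting bound holds for every
  \<open>k\<close>, and comparing growth in \<open>k\<close> eliminates \<open>H\<close>.\<close>

lemma schwarz_deriv_off_zeros:
  fixes u H :: "complex \<Rightarrow> complex"
  assumes R: "R > 0" and contu: "continuous_on (cball 0 R) u" and contH: "continuous_on (cball 0 R) H"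
    and holu: "u holomorphic_on {\<zeta> \<in> ball 0 R. H \<zeta> \<noteq> 0}" and holH: "H holomorphic_on {\<zeta> \<in> ball 0 R. H \<zeta> \<noteq> 0}"
    and u0: "u 0 = 0" and H0: "H 0 \<noteq> 0" and M: "M > 0" and bound: "\<And>\<zeta>. \<zeta> \<in> cball 0 R \<Longrightarrow> norm (u \<zeta>) \<le> M"
  shows "norm (deriv u 0) \<le> M / R"
proof (rule ccontr)
  assume "\<not> norm (deriv u 0) \<le> M / R"
  define U where "U = {\<zeta> \<in> ball 0 R. H \<zeta> \<noteq> 0}"
  have "open (ball 0 R \<inter> H -` (- {0}))"
    using contH by (intro continuous_open_preimage) (auto intro: continuous_on_subset)
  moreover have "ball 0 R \<inter> H -` (- {0}) = U" by (auto simp: U_def)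
  ultimately have U: "open U" by simp
  have U0: "0 \<in> U" using R H0 by (simp add: U_def)
  define Q where "Q \<zeta> = (if \<zeta> = 0 then deriv u 0 else u \<zeta> / \<zeta>)" for \<zeta>
  have holQ: "Q holomorphic_on U"
    unfolding Q_def by (rule pole_theorem_open_0[of u U 0]) (use holu U u0 in \<open>auto simp: U_def\<close>)
  have contQ: "continuous_on (cball 0 R) Q"
    unfolding continuous_on_eq_continuous_within
  proof
    fix z :: complex assume z: "z \<in> cball 0 R"
    show "continuous (at z within cball 0 R) Q"
    proof (cases "z = 0")
      case True
      have "isCont Q 0"
        using holomorphic_on_imp_continuous_on[OF holQ] U U0 by (simp add: continuous_on_eq_continuous_at)
      then show ?thesis using True continuous_at_imp_continuous_within by blast
    next
      case False
      have "continuous (at z within cball 0 R) (\<lambda>\<zeta>. u \<zeta> / \<zeta>)"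
        using contu z False by (intro continuous_intros) (auto simp: continuous_on_eq_continuous_within)
      then show ?thesis
        by (rule continuous_transform_within[where \<delta> = "norm z"]) (use False z in \<open>auto simp: Q_def\<close>)
    qed
  qed
  have "compact (H ` cball 0 R)" using contH by (intro compact_continuous_image compact_cball)
  then have "bounded (H ` cball 0 R)" by (rule compact_imp_bounded)
  then obtain B where "\<forall>y\<in>H ` cball 0 R. norm y \<le> B" unfolding bounded_iff ..
  then have B: "\<And>\<zeta>. \<zeta> \<in> cball 0 R \<Longrightarrow> norm (H \<zeta>) \<le> B" by simp
  have B0: "B \<ge> 0" using B[of 0] R by (meson centre_in_cball less_imp_le norm_ge_zero order_trans)
  have key: "norm (Q 0) ^ k * norm (H 0) \<le> (M / R) ^ k * B" for k
  proof -
    have "norm (Q 0 ^ k * H 0) \<le> (M / R) ^ k * B"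
    proof (rule maximum_modulus_frontier[where S = U and f = "\<lambda>\<zeta>. Q \<zeta> ^ k * H \<zeta>"])
      show "(\<lambda>\<zeta>. Q \<zeta> ^ k * H \<zeta>) holomorphic_on interior U"
        using U holQ holH by (auto simp: interior_open U_def intro!: holomorphic_intros)
      have sub: "closure U \<subseteq> cball 0 R"
        by (rule closure_minimal) (auto simp: U_def)
      then show "continuous_on (closure U) (\<lambda>\<zeta>. Q \<zeta> ^ k * H \<zeta>)"
        by (intro continuous_intros continuous_on_subset[OF contQ] continuous_on_subset[OF contH])
      show "bounded U" by (rule bounded_subset[of "ball 0 R"]) (auto simp: U_def)
      fix z assume z: "z \<in> frontier U"
      then have zc: "z \<in> cball 0 R" and zU: "z \<notin> U" using sub U by (auto simp: frontier_def interior_open)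
      show "norm (Q z ^ k * H z) \<le> (M / R) ^ k * B"
      proof (cases "norm z = R")
        case True
        then have "norm (Q z) \<le> M / R" using bound[OF zc] R by (auto simp: Q_def norm_divide divide_right_mono)
        then show ?thesis unfolding norm_mult norm_power
          using B[OF zc] B0 M R by (intro mult_mono power_mono) auto
      next
        case False
        then have "H z = 0" using zc zU by (auto simp: U_def)
        then show ?thesis using M R B0 by simp
      qed
    qed (rule U0)
    then show ?thesis by (simp add: norm_mult norm_power)
  qed
  define x where "x = norm (Q 0) / (M / R)"
  have "x > 1" using \<open>\<not> norm (deriv u 0) \<le> M / R\<close> M R by (simp add: x_def Q_def field_simps)
  then obtain k where "B / norm (H 0) < x ^ k" using real_arch_pow by blast
  moreover have "x ^ k * norm (H 0) \<le> B"
    using key[of k] M R unfolding x_def power_divide by (simp add: field_simps)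
  ultimately show False using H0 by (simp add: divide_less_eq)
qed

subsection \<open>Invariance of domain\<close>

lemma euclidean_space_eq: "Euclidean_space n = top_of_set {x. \<forall>i\<ge>n. x i = 0}"
  by (simp add: Euclidean_space_def euclidean_product_topology)

text \<open>Transport of the real theorem: with an enumeration \<open>e\<close> of \<open>I\<close>,
  the real and imaginary parts of coordinate \<open>e k\<close> are put in the positions
  \<open>2 * k\<close> and \<open>2 * k + 1\<close>.\<close>

lemma invariance_of_domain_cspace:
  fixes f :: "('i \<Rightarrow> complex) \<Rightarrow> ('i \<Rightarrow> complex)"
  assumes I: "finite I" and G: "copen I G" and f: "continuous_on G f" "f ` G \<subseteq> cspace I" "inj_on f G"
  shows "copen I (f ` G)"
proof -
  obtain e where e: "bij_betw e {..<card I} I"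
    using I by (metis atLeast0LessThan ex_bij_betw_nat_finite)
  define N where "N = card I"
  define e' where "e' = the_inv_into {..<N} e"
  have e': "e' i < N" "e (e' i) = i" if "i \<in> I" for i
    using that e the_inv_into_into[of e "{..<N}" i "{..<N}"]
    by (auto simp: e'_def N_def bij_betw_def f_the_inv_into_f)
  have ee: "e k \<in> I" "e' (e k) = k" if "k < N" for k
    using that e by (auto simp: e'_def N_def bij_betw_def the_inv_into_f_f)
  define E where "E = {x :: nat \<Rightarrow> real. \<forall>i\<ge>2*N. x i = 0}"
  define \<Phi> where "\<Phi> x k = (if k < 2*N then if even k then Re (x (e (k div 2))) else Im (x (e (k div 2))) else 0)" for x k
  define \<Psi> where "\<Psi> y i = (if i \<in> I then Complex (y (2 * e' i)) (y (2 * e' i + 1)) else 0)" for y i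
  have to_coords: "continuous_on A (\<lambda>x. x i)" for i and A :: "('k \<Rightarrow> 'l::topological_space) set"
    by (rule continuous_on_product_then_coordinatewise) (rule continuous_on_id)
  have c\<Phi>: "continuous_on A \<Phi>" for A
  proof (rule continuous_on_coordinatewise_then_product)
    show "continuous_on A (\<lambda>x. \<Phi> x k)" for k
      unfolding \<Phi>_def by (cases "k < 2 * N"; cases "even k") (auto intro!: continuous_intros to_coords)
  qed
  have c\<Psi>: "continuous_on A \<Psi>" for A
  proof (rule continuous_on_coordinatewise_then_product)
    show "continuous_on A (\<lambda>x. \<Psi> x k)" for k
      unfolding \<Psi>_def by (cases "k \<in> I") (auto intro!: continuous_intros to_coords)
  qed
  have \<Psi>\<Phi>: "\<Psi> (\<Phi> x) = x" if "x \<in> cspace I" for x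
  proof
    fix i show "\<Psi> (\<Phi> x) i = x i"
      using that e'[of i] by (cases "i \<in> I") (auto simp: \<Psi>_def \<Phi>_def cspace_def)
  qed
  have \<Phi>\<Psi>: "\<Phi> (\<Psi> y) = y" if "y \<in> E" for y
  proof
    fix k show "\<Phi> (\<Psi> y) k = y k"
    proof (cases "k < 2 * N")
      case True
      then have k: "k div 2 < N" by auto
      show ?thesis
      proof (cases "even k")
        case False
        then have "Suc (2 * (k div 2)) = k" by presburger
        then show ?thesis using True ee[OF k] False by (simp add: \<Phi>_def \<Psi>_def)
      qed (use True ee[OF k] in \<open>simp add: \<Phi>_def \<Psi>_def\<close>)
    qed (use that in \<open>simp add: \<Phi>_def E_def\<close>)
  qed
  have hom: "homeomorphism (cspace I) E \<Phi> \<Psi>"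
    unfolding homeomorphism_def
  proof (intro conjI)
    show "\<Phi> ` cspace I = E"
    proof
      show "E \<subseteq> \<Phi> ` cspace I"
      proof
        fix y assume "y \<in> E"
        then have "y = \<Phi> (\<Psi> y)" by (simp add: \<Phi>\<Psi>)
        moreover have "\<Psi> y \<in> cspace I" by (simp add: \<Psi>_def cspace_def)
        ultimately show "y \<in> \<Phi> ` cspace I" by blast
      qed
    qed (auto simp: \<Phi>_def E_def)
    show "\<Psi> ` E = cspace I"
    proof
      show "cspace I \<subseteq> \<Psi> ` E"
      proof
        fix x :: "'i \<Rightarrow> complex" assume "x \<in> cspace I"
        then have "x = \<Psi> (\<Phi> x)" by (simp add: \<Psi>\<Phi>)
        moreover have "\<Phi> x \<in> E" by (simp add: \<Phi>_def E_def)
        ultimately show "x \<in> \<Psi> ` E" by blast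
      qed
    qed (auto simp: \<Psi>_def cspace_def)
  qed (use \<Phi>\<Psi> \<Psi>\<Phi> c\<Phi> c\<Psi> in auto)
  have Gc: "G \<subseteq> cspace I" by (rule openin_imp_subset[OF G])
  have U: "openin (top_of_set E) (\<Phi> ` G)" by (rule homeomorphism_imp_open_map[OF hom G])
  define h where "h = \<Phi> \<circ> f \<circ> \<Psi>"
  have \<Psi>G: "\<Psi> ` \<Phi> ` G = G" using Gc \<Psi>\<Phi> by (force simp: image_image)
  have "openin (Euclidean_space (2*N)) (h ` (\<Phi> ` G))"
  proof (rule invariance_of_domain_Euclidean_space)
    show "openin (Euclidean_space (2*N)) (\<Phi> ` G)" using U by (simp add: euclidean_space_eq E_def)
    have sub: "\<Phi> ` G \<subseteq> E" by (rule openin_imp_subset[OF U])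
    have "continuous_on (\<Phi> ` G) h"
      unfolding h_def by (intro continuous_on_compose c\<Psi> c\<Phi>) (simp only: \<Psi>G f)
    then show "continuous_map (subtopology (Euclidean_space (2*N)) (\<Phi> ` G)) (Euclidean_space (2*N)) h"
      using sub unfolding euclidean_space_eq E_def[symmetric]
      by (simp add: subtopology_subtopology Int_absorb1 continuous_map_in_subtopology)
        (auto simp: h_def \<Phi>_def E_def)
    show "inj_on h (\<Phi> ` G)"
      unfolding h_def
    proof (intro comp_inj_on)
      show "inj_on \<Psi> (\<Phi> ` G)" by (rule inj_on_inverseI[of _ \<Phi>]) (use sub \<Phi>\<Psi> in blast)
      show "inj_on f (\<Psi> ` \<Phi> ` G)" using f(3) \<Psi>G by simp
      show "inj_on \<Phi> (f ` \<Psi> ` \<Phi> ` G)" unfolding \<Psi>G by (rule inj_on_inverseI[of _ \<Psi>]) (use f(2) \<Psi>\<Phi> in blast)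
    qed
  qed
  then have "openin (top_of_set E) (h ` (\<Phi> ` G))" by (simp add: euclidean_space_eq E_def)
  from homeomorphism_imp_open_map[OF homeomorphism_symD[OF hom] this]
  have "copen I (\<Psi> ` h ` \<Phi> ` G)" .
  moreover have "\<Psi> ` h ` \<Phi> ` G = f ` G"
  proof -
    have "\<Psi> (h (\<Phi> x)) = f x" if "x \<in> G" for x
      using that Gc f(2) by (auto simp: h_def \<Psi>\<Phi> subset_iff)
    then show ?thesis by (simp add: image_image)
  qed
  ultimately show ?thesis by simp
qed

subsection \<open>Determinants over a finite index set\<close>

text \<open>Here the entries are given as a function of the indices, so they may depend on a
  parameter. The Leibniz formula then yields limits, continuity and holomorphy in that
  parameter.\<close>

definition fun_det :: "nat \<Rightarrow> (nat \<Rightarrow> nat \<Rightarrow> complex) \<Rightarrow> complex" where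
  "fun_det n a = det (mat n n (\<lambda>(i, j). a i j))"

lemma fun_det_expand: "fun_det n a = (\<Sum>p | p permutes {0..<n}. signof p * (\<Prod>i = 0..<n. a i (p i)))"
proof -
  have "(\<Prod>i = 0..<n. mat n n (\<lambda>(i, j). a i j) $$ (i, p i)) = (\<Prod>i = 0..<n. a i (p i))"
    if "p permutes {0..<n}" for p
    using that by (intro prod.cong) (auto dest: permutes_in_image)
  then show ?thesis unfolding fun_det_def by (subst det_def'[of _ n]) (auto intro!: sum.cong)
qed

lemma tendsto_fun_det:
  assumes "\<And>i j. i < n \<Longrightarrow> j < n \<Longrightarrow> ((\<lambda>x. a x i j) \<longlongrightarrow> b i j) F"
  shows "((\<lambda>x. fun_det n (a x)) \<longlongrightarrow> fun_det n b) F"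
  unfolding fun_det_expand
  by (intro tendsto_intros assms) (auto dest: permutes_in_image)

lemma continuous_on_fun_det:
  assumes "\<And>i j. i < n \<Longrightarrow> j < n \<Longrightarrow> continuous_on A (\<lambda>x. a x i j)"
  shows "continuous_on A (\<lambda>x. fun_det n (a x))"
  using assms unfolding continuous_on_def by (intro ballI tendsto_fun_det) auto

lemma holomorphic_on_fun_det:
  assumes "\<And>i j. i < n \<Longrightarrow> j < n \<Longrightarrow> (\<lambda>x. a x i j) holomorphic_on A"
  shows "(\<lambda>x. fun_det n (a x)) holomorphic_on A"
  unfolding fun_det_expand
  by (intro holomorphic_intros assms) (auto dest: permutes_in_image)

lemma holo_on_fun_det:
  assumes "\<And>i j. i < n \<Longrightarrow> j < n \<Longrightarrow> holo_on I G (\<lambda>x. a x i j)"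
  shows "holo_on I G (\<lambda>x. fun_det n (a x))"
  unfolding fun_det_expand
  by (intro holo_on_sum holo_on_mult holo_on_const holo_on_prod assms) (auto dest: permutes_in_image)

text \<open>Cramer's rule in the form without division, which can be divided at the moment when the
  determinant is known to be nonzero, for instance eventually along a filter.\<close>

lemma fun_det_cramer:
  assumes "\<And>i. i < n \<Longrightarrow> (\<Sum>j<n. a i j * v j) = w i" "l < n"
  shows "v l * fun_det n a = fun_det n (\<lambda>i j. if j = l then w i else a i j)"
proof -
  let ?A = "mat n n (\<lambda>(i, j). a i j)"
  have "det (replace_col ?A (?A *\<^sub>v vec n v) l) = vec n v $ l * det ?A"
    by (rule cramer_lemma_mat) (use assms in auto)
  moreover have "?A *\<^sub>v vec n v = vec n w"
    using assms(1) by (intro eq_vecI) (auto simp: scalar_prod_def atLeast0LessThan)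
  moreover have "replace_col ?A (vec n w) l = mat n n (\<lambda>(i, j). if j = l then w i else a i j)"
    unfolding replace_col_def by (intro eq_matI) auto
  ultimately show ?thesis using assms(2) by (simp add: fun_det_def)
qed

lemma fun_det_eq_0_iff:
  "fun_det n a = 0 \<longleftrightarrow> (\<exists>v. (\<exists>i<n. v i \<noteq> 0) \<and> (\<forall>i<n. (\<Sum>j<n. a i j * v j) = 0))"
proof -
  let ?A = "mat n n (\<lambda>(i, j). a i j)"
  have "fun_det n a = 0 \<longleftrightarrow> (\<exists>v. v \<in> carrier_vec n \<and> v \<noteq> 0\<^sub>v n \<and> ?A *\<^sub>v v = 0\<^sub>v n)"
    unfolding fun_det_def by (rule det_0_iff_vec_prod_zero) simp
  also have "\<dots> \<longleftrightarrow> (\<exists>v. (\<exists>i<n. v i \<noteq> 0) \<and> (\<forall>i<n. (\<Sum>j<n. a i j * v j) = 0))"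
  proof
    assume "\<exists>v. v \<in> carrier_vec n \<and> v \<noteq> 0\<^sub>v n \<and> ?A *\<^sub>v v = 0\<^sub>v n"
    then obtain v where v: "v \<in> carrier_vec n" "v \<noteq> 0\<^sub>v n" "?A *\<^sub>v v = 0\<^sub>v n" by blast
    have "\<exists>i<n. v $ i \<noteq> 0"
    proof (rule ccontr)
      assume "\<not> (\<exists>i<n. v $ i \<noteq> 0)"
      then have "v = 0\<^sub>v n" using v(1) by (intro eq_vecI) auto
      with v(2) show False by simp
    qed
    moreover have "(\<Sum>j<n. a i j * v $ j) = 0" if "i < n" for i
    proof -
      have "(?A *\<^sub>v v) $ i = 0" using v(3) that by simp
      then show ?thesis using that v(1) by (simp add: scalar_prod_def atLeast0LessThan)
    qed
    ultimately show "\<exists>v. (\<exists>i<n. v i \<noteq> 0) \<and> (\<forall>i<n. (\<Sum>j<n. a i j * v j) = 0)" by blast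
  next
    assume "\<exists>v. (\<exists>i<n. v i \<noteq> 0) \<and> (\<forall>i<n. (\<Sum>j<n. a i j * v j) = 0)"
    then obtain v i where v: "i < n" "v i \<noteq> 0" "\<forall>i<n. (\<Sum>j<n. a i j * v j) = 0" by blast
    have "vec n v $ i \<noteq> 0\<^sub>v n $ i" using v(1,2) by simp
    then have "vec n v \<noteq> 0\<^sub>v n" by auto
    moreover have "?A *\<^sub>v vec n v = 0\<^sub>v n"
      using v(3) by (intro eq_vecI) (auto simp: scalar_prod_def atLeast0LessThan)
    ultimately show "\<exists>v. v \<in> carrier_vec n \<and> v \<noteq> 0\<^sub>v n \<and> ?A *\<^sub>v v = 0\<^sub>v n"
      by (intro exI[of _ "vec n v"]) auto
  qed
  finally show ?thesis .
qed

subsection \<open>Norms on coordinate space given by families of linear functionals\<close>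

definition pairing :: "'i set \<Rightarrow> ('i \<Rightarrow> complex) \<Rightarrow> ('i \<Rightarrow> complex) \<Rightarrow> complex" where
  "pairing I l x = (\<Sum>i\<in>I. l i * x i)"

definition lin :: "'i set \<Rightarrow> ('i \<Rightarrow> 'i \<Rightarrow> complex) \<Rightarrow> ('i \<Rightarrow> complex) \<Rightarrow> ('i \<Rightarrow> complex)" where
  "lin I A x = (\<lambda>i. if i \<in> I then \<Sum>j\<in>I. A i j * x j else 0)"

lemma lin_cspace [simp]: "lin I A x \<in> cspace I"
  by (simp add: lin_def cspace_def)

lemma lin_scale: "lin I A (\<lambda>i. a * x i) = (\<lambda>i. a * lin I A x i)"
  unfolding lin_def by (auto simp: sum_distrib_left algebra_simps)

text \<open>The norm is the least bound of the pairings with \<open>\<Lambda>\<close>, expressed by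
  two inequalities. A map into the unit ball thus gives scalar functions into the disc, and an
  estimate for all of these gives back an estimate for the norm. Comparison with the Euclidean norm
  provides definiteness and continuity.\<close>

locale cnormed =
  fixes I :: "'i set" and \<Lambda> :: "('i \<Rightarrow> complex) set" and N :: "('i \<Rightarrow> complex) \<Rightarrow> real"
  assumes fin: "finite I" and ne: "I \<noteq> {}"
    and pairing_le: "\<And>x l. x \<in> cspace I \<Longrightarrow> l \<in> \<Lambda> \<Longrightarrow> norm (pairing I l x) \<le> N x"
    and N_le: "\<And>x b. x \<in> cspace I \<Longrightarrow> (\<And>l. l \<in> \<Lambda> \<Longrightarrow> norm (pairing I l x) \<le> b) \<Longrightarrow> N x \<le> b"
    and N_lower: "\<exists>c>0. \<forall>x\<in>cspace I. c * cnorm I x \<le> N x"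
    and N_upper: "\<exists>C. \<forall>x\<in>cspace I. N x \<le> C * cnorm I x"
begin

definition unit_ball :: "('i \<Rightarrow> complex) set" where
  "unit_ball = {x \<in> cspace I. N x < 1}"

lemma pairing_scale: "pairing I l (\<lambda>i. a * x i) = a * pairing I l x"
  unfolding pairing_def sum_distrib_left by (rule sum.cong) auto

lemma scale_cspace: "x \<in> cspace I \<Longrightarrow> (\<lambda>i. a * x i) \<in> cspace I"
  by (simp add: cspace_def)

lemma N_nonneg: "x \<in> cspace I \<Longrightarrow> 0 \<le> N x"
proof -
  assume x: "x \<in> cspace I"
  obtain c where "c > 0" "\<forall>x\<in>cspace I. c * cnorm I x \<le> N x" using N_lower by blast
  then show ?thesis using x cnorm_nonneg[of I x] by (meson mult_nonneg_nonneg less_imp_le order_trans)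
qed

lemma N_scale_le: "x \<in> cspace I \<Longrightarrow> N (\<lambda>i. a * x i) \<le> norm a * N x"
  by (rule N_le) (auto simp: scale_cspace pairing_scale norm_mult intro!: mult_left_mono pairing_le)

lemma N_scale: "x \<in> cspace I \<Longrightarrow> N (\<lambda>i. a * x i) = norm a * N x"
proof (rule antisym[OF N_scale_le])
  assume x: "x \<in> cspace I"
  show "norm a * N x \<le> N (\<lambda>i. a * x i)"
  proof (cases "a = 0")
    case False
    have "N (\<lambda>i. inverse a * (a * x i)) \<le> norm (inverse a) * N (\<lambda>i. a * x i)"
      by (rule N_scale_le) (rule scale_cspace[OF x])
    then have "N x \<le> norm (inverse a) * N (\<lambda>i. a * x i)" using False by (simp add: mult.assoc[symmetric])
    then show ?thesis using False by (simp add: norm_inverse norm_divide field_simps)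
  qed (use N_nonneg[OF zero_cspace] in simp)
qed

lemma N_zero [simp]: "N (\<lambda>_. 0) = 0"
  using N_scale[OF zero_cspace, of 0] by simp

lemma N_eq_0: "x \<in> cspace I \<Longrightarrow> N x = 0 \<longleftrightarrow> x = (\<lambda>_. 0)"
proof
  assume x: "x \<in> cspace I" "N x = 0"
  obtain c where c: "c > 0" "\<forall>x\<in>cspace I. c * cnorm I x \<le> N x" using N_lower by blast
  then have "cnorm I x = 0" using x cnorm_nonneg[of I x] by (metis mult_le_0_iff order_antisym not_le)
  then show "x = (\<lambda>_. 0)" using x fin by (intro cspace_eqI[of _ I]) (auto simp: cnorm_eq_0_iff)
qed simp

lemma N_pos: "x \<in> cspace I \<Longrightarrow> x \<noteq> (\<lambda>_. 0) \<Longrightarrow> 0 < N x"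
  using N_nonneg[of x] N_eq_0[of x] by linarith

lemma N_triangle: "x \<in> cspace I \<Longrightarrow> y \<in> cspace I \<Longrightarrow> N (\<lambda>i. x i + y i) \<le> N x + N y"
proof (rule N_le)
  assume xy: "x \<in> cspace I" "y \<in> cspace I"
  then show "(\<lambda>i. x i + y i) \<in> cspace I" by (simp add: cspace_def)
  fix l assume l: "l \<in> \<Lambda>"
  have "pairing I l (\<lambda>i. x i + y i) = pairing I l x + pairing I l y"
    unfolding pairing_def by (simp add: algebra_simps sum.distrib)
  then show "norm (pairing I l (\<lambda>i. x i + y i)) \<le> N x + N y"
    using pairing_le[OF xy(1) l] pairing_le[OF xy(2) l] norm_triangle_ineq[of "pairing I l x" "pairing I l y"] by simp
qed

lemma N_tendsto:
  assumes "\<And>i. i \<in> I \<Longrightarrow> ((\<lambda>t. x t i) \<longlongrightarrow> y i) F" "\<And>t. x t \<in> cspace I" "y \<in> cspace I"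
  shows "((\<lambda>t. N (x t)) \<longlongrightarrow> N y) F"
proof -
  obtain C where C: "\<forall>x\<in>cspace I. N x \<le> C * cnorm I x" using N_upper by blast
  have C': "N x \<le> \<bar>C\<bar> * (\<Sum>i\<in>I. norm (x i))" if "x \<in> cspace I" for x
  proof -
    have "N x \<le> C * cnorm I x" using C that by blast
    also have "\<dots> \<le> \<bar>C\<bar> * (\<Sum>i\<in>I. norm (x i))"
      by (intro mult_mono cnorm_le_sum) (auto simp: cnorm_nonneg)
    finally show ?thesis .
  qed
  have dc: "(\<lambda>i. a i - b i) \<in> cspace I" if "a \<in> cspace I" "b \<in> cspace I" for a b :: "'i \<Rightarrow> complex"
    using that by (simp add: cspace_def)
  have b: "norm (N (x t) - N y) \<le> \<bar>C\<bar> * (\<Sum>i\<in>I. norm (x t i - y i))" for t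
  proof -
    have "N (x t) \<le> N (\<lambda>i. x t i - y i) + N y"
      using N_triangle[OF dc[OF assms(2)[of t] assms(3)] assms(3)] by simp
    moreover have "N y \<le> N (\<lambda>i. y i - x t i) + N (x t)"
      using N_triangle[OF dc[OF assms(3) assms(2)[of t]] assms(2)[of t]] by simp
    moreover have "N (\<lambda>i. x t i - y i) \<le> \<bar>C\<bar> * (\<Sum>i\<in>I. norm (x t i - y i))"
      by (rule C'[OF dc[OF assms(2,3)]])
    moreover have "N (\<lambda>i. y i - x t i) \<le> \<bar>C\<bar> * (\<Sum>i\<in>I. norm (x t i - y i))"
      using C'[OF dc[OF assms(3,2)], of t] by (simp add: norm_minus_commute)
    ultimately show ?thesis by (simp add: abs_le_iff)
  qed
  have "((\<lambda>t. \<bar>C\<bar> * (\<Sum>i\<in>I. norm (x t i - y i))) \<longlongrightarrow> \<bar>C\<bar> * (\<Sum>i\<in>I. norm (y i - y i))) F"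
    by (intro tendsto_intros assms(1))
  then have lim: "((\<lambda>t. \<bar>C\<bar> * (\<Sum>i\<in>I. norm (x t i - y i))) \<longlongrightarrow> 0) F" by simp
  have "((\<lambda>t. N (x t) - N y) \<longlongrightarrow> 0) F"
    by (rule Lim_null_comparison[OF always_eventually lim]) (use b in blast)
  then show ?thesis by (simp only: LIM_zero_iff)
qed

lemma copen_N_ball: "copen I {x \<in> cspace I. N x < r}"
proof (subst copen_iff_eventually, intro conjI ballI)
  fix z assume z: "z \<in> {x \<in> cspace I. N x < r}"
  define x where "x w = (if w \<in> cspace I then w else z)" for w
  have "((\<lambda>w. x w i) \<longlongrightarrow> z i) (nhds_rel (cspace I) z)" for i
    by (rule Lim_transform_eventually[OF coord_tendsto_nhds_rel]) (auto simp: eventually_nhds_rel x_def)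
  then have "((\<lambda>w. N (x w)) \<longlongrightarrow> N z) (nhds_rel (cspace I) z)"
    using z by (intro N_tendsto) (auto simp: x_def)
  then have "\<forall>\<^sub>F w in nhds_rel (cspace I) z. N (x w) < r" by (rule order_tendstoD) (use z in auto)
  moreover have "\<forall>\<^sub>F w in nhds_rel (cspace I) z. w \<in> cspace I" by (simp add: eventually_nhds_rel)
  ultimately show "\<forall>\<^sub>F w in nhds_rel (cspace I) z. w \<in> {x \<in> cspace I. N x < r}"
    by eventually_elim (auto simp: x_def)
qed auto

lemma copen_unit_ball: "copen I unit_ball"
  unfolding unit_ball_def by (rule copen_N_ball)

lemma zero_unit_ball [simp]: "(\<lambda>_. 0) \<in> unit_ball"
  by (simp add: unit_ball_def)

lemma unit_ball_cspace: "unit_ball \<subseteq> cspace I"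
  by (auto simp: unit_ball_def)

lemma exists_nonzero: "\<exists>x\<in>cspace I. N x = 1"
proof -
  obtain i where i: "i \<in> I" using ne by blast
  define x where "x k = (if k = i then 1 else 0 :: complex)" for k
  have x: "x \<in> cspace I" "x i \<noteq> 0" using i by (auto simp: x_def cspace_def)
  then have p: "N x > 0" by (intro N_pos) auto
  have "N (\<lambda>k. complex_of_real (1 / N x) * x k) = 1" using N_scale[OF x(1), of "complex_of_real (1 / N x)"] p by (simp add: norm_divide)
  then show ?thesis using scale_cspace[OF x(1)] by blast
qed

end

lemma pairing_holo_on:
  "finite I \<Longrightarrow> (\<And>i. i \<in> I \<Longrightarrow> holo_on J G (\<lambda>w. f w i)) \<Longrightarrow> holo_on J G (\<lambda>w. pairing I l (f w))"
  unfolding pairing_def by (intro holo_on_sum holo_on_mult holo_on_const) auto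

section \<open>The derivative at the origin of an injective map between unit balls\<close>

definition jacobian :: "(('i \<Rightarrow> complex) \<Rightarrow> ('i \<Rightarrow> complex)) \<Rightarrow> ('i \<Rightarrow> complex) \<Rightarrow> 'i \<Rightarrow> 'i \<Rightarrow> complex" where
  "jacobian f z = (\<lambda>j i. partial_deriv i (\<lambda>w. f w j) z)"

text \<open>Both norms are kept general because the roles change: for the squeezing function the
  target norm is the Euclidean one, for the Fridman invariant the source norm is.\<close>

locale two_cnormed = A: cnormed I \<Lambda> N + B: cnormed I \<Lambda>' N'
  for I :: "'i set" and \<Lambda> N \<Lambda>' N' +
  fixes f :: "('i \<Rightarrow> complex) \<Rightarrow> ('i \<Rightarrow> complex)"
  assumes uni: "f \<in> univalent_maps I A.unit_ball B.unit_ball" and f0: "f (\<lambda>_. 0) = (\<lambda>_. 0)"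
begin

lemma f_holo_on: "j \<in> I \<Longrightarrow> holo_on I A.unit_ball (\<lambda>w. f w j)"
  using uni A.fin A.unit_ball_cspace by (simp add: univalent_maps_def holomorphic_map_iff)

lemma f_inj: "inj_on f A.unit_ball" and f_im: "f ` A.unit_ball \<subseteq> B.unit_ball"
  using uni by (auto simp: univalent_maps_def)

lemma f_imc: "f ` A.unit_ball \<subseteq> cspace I"
  using f_im B.unit_ball_cspace by blast

text \<open>The one-variable Schwarz lemma for \<open>\<zeta>\<close> mapped to the pairing of
  \<open>l\<close> with \<open>f (\<zeta> w)\<close>, where \<open>w = v / N v\<close> and
  \<open>l\<close> runs through the functionals of the target norm.\<close>

lemma derivative_contracts:
  assumes v: "v \<in> cspace I"
  shows "N' (lin I (jacobian f (\<lambda>_. 0)) v) \<le> N v"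
proof (cases "v = (\<lambda>_. 0)")
  case True
  then have "lin I (jacobian f (\<lambda>_. 0)) v = (\<lambda>_. 0)" by (auto simp: lin_def)
  then show ?thesis using True by simp
next
  case False
  then have p: "N v > 0" by (rule A.N_pos[OF v])
  define w where "w i = v i / complex_of_real (N v)" for i
  have w: "w \<in> cspace I" "N w = 1"
    using A.N_scale[OF v, of "inverse (complex_of_real (N v))"] A.scale_cspace[OF v, of "inverse (complex_of_real (N v))"] p
    by (simp_all add: w_def[abs_def] divide_inverse mult.commute norm_inverse)
  define \<gamma> where "\<gamma> \<zeta> = (\<lambda>i. \<zeta> * w i)" for \<zeta> :: complex
  have \<gamma>G: "\<gamma> \<zeta> \<in> A.unit_ball" if "\<zeta> \<in> ball 0 1" for \<zeta>
    using that w A.N_scale[OF w(1), of \<zeta>] A.scale_cspace[OF w(1), of \<zeta>] by (simp add: \<gamma>_def A.unit_ball_def)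
  show ?thesis
  proof (rule B.N_le[OF lin_cspace])
    fix l assume l: "l \<in> \<Lambda>'"
    define u where "u \<zeta> = pairing I l (f (\<gamma> \<zeta>))" for \<zeta>
    have ch: "holo_on I A.unit_ball (\<lambda>w. pairing I l (f w))" by (rule pairing_holo_on[OF A.fin f_holo_on])
    have hol: "u holomorphic_on ball 0 1"
      unfolding u_def
      by (rule holo_on_curve_holomorphic[OF ch A.unit_ball_cspace]) (use \<gamma>G in \<open>auto simp: \<gamma>_def intro!: holomorphic_intros\<close>)
    have lt: "norm (u \<zeta>) < 1" if "norm \<zeta> < 1" for \<zeta>
    proof -
      have "f (\<gamma> \<zeta>) \<in> B.unit_ball" using f_im \<gamma>G[of \<zeta>] that by auto
      then show ?thesis using B.pairing_le[OF _ l, of "f (\<gamma> \<zeta>)"] by (auto simp: u_def B.unit_ball_def)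
    qed
    have \<gamma>0: "\<gamma> 0 = (\<lambda>_. 0)" by (simp add: \<gamma>_def)
    have u0: "u 0 = 0" by (simp add: u_def \<gamma>0 f0 pairing_def)
    have d1: "norm (deriv u 0) \<le> 1" using Schwarz_Lemma(2)[OF hol u0 lt, of 0] by simp
    have "((\<lambda>\<zeta>. f (\<gamma> \<zeta>) j) has_field_derivative (\<Sum>i\<in>I. partial_deriv i (\<lambda>w. f w j) (\<gamma> 0) * w i)) (at 0)" if j: "j \<in> I" for j
    proof (rule has_gradient_curve[where \<gamma> = \<gamma>])
      show "((\<lambda>\<zeta>. \<gamma> \<zeta> i) has_field_derivative w i) (at 0)" for i
        unfolding \<gamma>_def by (auto intro!: derivative_eq_intros)
      show "\<gamma> \<eta> i = 0" if "i \<notin> I" for i \<eta> using w(1) that by (simp add: \<gamma>_def cspace_def)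
      show "\<forall>\<^sub>F \<eta> in at 0. \<gamma> \<eta> \<in> A.unit_ball"
        unfolding eventually_at by (rule exI[of _ 1]) (use \<gamma>G in \<open>auto simp: dist_norm\<close>)
      show "has_gradient I A.unit_ball (\<lambda>w. f w j) (\<gamma> 0) (\<lambda>i. partial_deriv i (\<lambda>w. f w j) (\<gamma> 0))"
        by (rule has_gradient_partial_deriv[OF A.copen_unit_ball A.fin _ f_holo_on[OF j]]) (simp add: \<gamma>0)
    qed
    then have "(u has_field_derivative (\<Sum>j\<in>I. l j * (\<Sum>i\<in>I. partial_deriv i (\<lambda>w. f w j) (\<gamma> 0) * w i))) (at 0)"
      unfolding u_def pairing_def by (intro DERIV_sum DERIV_cmult)
    then have "deriv u 0 = (\<Sum>j\<in>I. l j * (\<Sum>i\<in>I. partial_deriv i (\<lambda>w. f w j) (\<gamma> 0) * w i))" by (rule DERIV_imp_deriv)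
    also have "\<dots> = pairing I l (lin I (jacobian f (\<lambda>_. 0)) v) / N v"
      unfolding \<gamma>0 pairing_def lin_def jacobian_def w_def
      by (simp add: sum_divide_distrib[symmetric] cong: sum.cong)
    finally have "norm (pairing I l (lin I (jacobian f (\<lambda>_. 0)) v)) / N v \<le> 1"
      using d1 p by (simp add: norm_divide)
    then show "norm (pairing I l (lin I (jacobian f (\<lambda>_. 0)) v)) \<le> N v" using p by (simp add: divide_le_eq)
  qed
qed

text \<open>A Schwarz estimate for the inverse along the line \<open>p + \<zeta> w\<close>, where
  \<open>p = f x0\<close> and \<open>w\<close> is the normalized image \<open>J\<close> of
  \<open>v\<close> under the derivative. The line stays in the image of \<open>f\<close> for
  \<open>norm \<zeta> < t - N' p\<close>; a functional of the lifted line minus its value at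
  \<open>x0\<close> is bounded by \<open>1 + N x0\<close> and has derivative
  \<open>pairing I l v / N' J\<close> at 0. The base point is general because nonsingularity is
  known at some points only.\<close>

lemma derivative_expands_at:
  assumes t: "{y \<in> cspace I. N' y < t} \<subseteq> f ` A.unit_ball"
    and x0: "x0 \<in> A.unit_ball" "N' (f x0) < t"
    and nd: "\<And>v. (\<forall>j\<in>I. (\<Sum>i\<in>I. jacobian f x0 j i * v i) = 0) \<Longrightarrow> (\<forall>i\<in>I. v i = 0)"
    and v: "v \<in> cspace I"
  shows "(t - N' (f x0)) * N v \<le> (1 + N x0) * N' (lin I (jacobian f x0) v)"
proof (cases "v = (\<lambda>_. 0)")
  case True
  then have "lin I (jacobian f x0) v = (\<lambda>_. 0)" by (auto simp: lin_def)
  then show ?thesis using True by simp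
next
  case False
  define G where "G = A.unit_ball"
  have Gc: "G \<subseteq> cspace I" and Go: "copen I G" and fin: "finite I"
    using A.unit_ball_cspace A.copen_unit_ball A.fin by (auto simp: G_def)
  have fch: "holo_on I G (\<lambda>w. f w j)" if "j \<in> I" for j using f_holo_on[OF that] by (simp add: G_def)
  define g where "g = the_inv_into G f"
  have gf: "g (f x) = x" if "x \<in> G" for x using that f_inj by (simp add: g_def the_inv_into_f_f G_def)
  have gG: "g y \<in> G" "f (g y) = y" if "y \<in> f ` G" for y using that gf by auto
  have fcont: "continuous_on G f"
  proof (rule continuous_on_coordinatewise_then_product)
    fix j show "continuous_on G (\<lambda>x. f x j)"
    proof (cases "j \<in> I")
      case False
      then have "\<And>x. x \<in> G \<Longrightarrow> f x j = 0" using f_imc by (auto simp: cspace_def G_def)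
      then show ?thesis by (simp cong: continuous_on_cong)
    qed (use fch holo_on_continuous_on in blast)
  qed
  \<comment> \<open>Invariance of domain makes \<open>f\<close> an open map, which is continuity of
    its inverse \<open>g\<close>.\<close>
  have fopen: "copen I (f ` V)" if "copen I V" "V \<subseteq> G" for V
    by (rule invariance_of_domain_cspace[OF fin that(1)])
      (use that f_imc f_inj continuous_on_subset[OF fcont] in \<open>auto simp: G_def intro: inj_on_subset\<close>)
  have gcont: "continuous_on (f ` G) g"
  proof (rule continuous_on_open_gen[THEN iffD2])
    show "g \<in> f ` G \<rightarrow> G" using gG by auto
    show "\<forall>U. openin (top_of_set G) U \<longrightarrow> openin (top_of_set (f ` G)) (f ` G \<inter> g -` U)"
    proof (intro allI impI)
      fix U assume U: "openin (top_of_set G) U"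
      then have UG: "U \<subseteq> G" by (rule openin_imp_subset)
      have "f ` G \<inter> g -` U = f ` U" using UG gf gG by force
      moreover have "copen I (f ` U)" using fopen[OF openin_trans[OF U Go] UG] .
      ultimately show "openin (top_of_set (f ` G)) (f ` G \<inter> g -` U)"
        using UG f_imc by (auto simp: G_def intro!: openin_subset_trans[of "cspace I" "f ` U"])
    qed
  qed
  define p where "p = f x0"
  define J where "J = lin I (jacobian f x0) v"
  have pc: "p \<in> cspace I" using x0(1) f_imc by (auto simp: p_def)
  have x0G: "x0 \<in> G" using x0 by (simp add: G_def)
  have x0c: "x0 \<in> cspace I" using x0G Gc by auto
  have "J \<noteq> (\<lambda>_. 0)"
  proof
    assume "J = (\<lambda>_. 0)"
    then have "\<forall>j\<in>I. (\<Sum>i\<in>I. jacobian f x0 j i * v i) = 0" unfolding J_def lin_def by (metis (mono_tags, lifting))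
    from nd[OF this] have "v = (\<lambda>_. 0)" using v by (intro cspace_eqI[of _ I]) auto
    with False show False by simp
  qed
  then have NJ: "N' J > 0" unfolding J_def by (intro B.N_pos lin_cspace)
  define w where "w i = J i / complex_of_real (N' J)" for i
  have Jc: "J \<in> cspace I" by (simp add: J_def)
  have w: "w \<in> cspace I" "N' w = 1"
    using B.N_scale[OF Jc, of "inverse (complex_of_real (N' J))"] B.scale_cspace[OF Jc, of "inverse (complex_of_real (N' J))"] NJ
    by (simp_all add: w_def[abs_def] divide_inverse mult.commute norm_inverse)
  define line where "line \<zeta> = (\<lambda>i. p i + \<zeta> * w i)" for \<zeta> :: complex
  have linec: "line \<zeta> \<in> cspace I" for \<zeta> using pc w by (simp add: line_def cspace_def)
  have line0: "line 0 = p" by (simp add: line_def)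
  have line_in: "line \<zeta> \<in> f ` G" if "norm \<zeta> \<le> R" "R < t - N' p" for \<zeta> R
  proof -
    have "N' (line \<zeta>) \<le> N' p + N' (\<lambda>i. \<zeta> * w i)"
      unfolding line_def by (rule B.N_triangle[OF pc B.scale_cspace[OF w(1)]])
    also have "\<dots> \<le> N' p + R" using B.N_scale[OF w(1), of \<zeta>] w(2) that by simp
    also have "\<dots> < t" using that by simp
    finally show ?thesis using t linec by (auto simp: G_def)
  qed
  define \<gamma> where "\<gamma> \<zeta> = g (line \<zeta>)" for \<zeta>
  have \<gamma>0: "\<gamma> 0 = x0" using gf[OF x0G] by (simp add: \<gamma>_def line0 p_def)
  obtain e where e: "bij_betw e {..<card I} I"
    using fin by (metis atLeast0LessThan ex_bij_betw_nat_finite)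
  define n where "n = card I"
  have eI: "e k \<in> I" if "k < n" for k using e that by (auto simp: bij_betw_def n_def)
  have sum_e: "(\<Sum>i\<in>I. h i) = (\<Sum>k<n. h (e k))" for h :: "'i \<Rightarrow> complex"
    unfolding n_def by (rule sum.reindex_bij_betw[OF e, symmetric])
  define D where "D x = fun_det n (\<lambda>k l. jacobian f x (e k) (e l))" for x
  have D0: "D x0 \<noteq> 0"
  proof
    assume "D x0 = 0"
    then obtain u where u: "\<exists>i<n. u i \<noteq> 0" "\<forall>i<n. (\<Sum>j<n. jacobian f x0 (e i) (e j) * u j) = 0"
      unfolding D_def fun_det_eq_0_iff by blast
    define u' where "u' i = u (the_inv_into {..<n} e i)" for i
    have u'e: "u' (e k) = u k" if "k < n" for k
      using that e by (simp add: u'_def bij_betw_def the_inv_into_f_f n_def)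
    have "(\<Sum>i\<in>I. jacobian f x0 j i * u' i) = 0" if "j \<in> I" for j
    proof -
      have "j \<in> e ` {..<n}" using that e by (simp add: bij_betw_def n_def)
      then obtain k where "k < n" "j = e k" by auto
      then show ?thesis using u(2) u'e by (simp add: sum_e)
    qed
    then have "\<forall>i\<in>I. u' i = 0" using nd by blast
    then show False using u(1) u'e eI by metis
  qed
  have bnd: "norm (pairing I l v) * R \<le> (1 + N x0) * N' J" if l: "l \<in> \<Lambda>" and R: "0 < R" "R < t - N' p" for l R
  proof -
    have lin: "line \<zeta> \<in> f ` G" if "\<zeta> \<in> cball 0 R" for \<zeta> using line_in[of \<zeta> R] that R by simp
    have \<gamma>G: "\<gamma> \<zeta> \<in> G" "f (\<gamma> \<zeta>) = line \<zeta>" if "\<zeta> \<in> cball 0 R" for \<zeta> using gG[OF lin[OF that]] by (auto simp: \<gamma>_def)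
    have contline: "continuous_on A line" for A
      unfolding line_def by (rule continuous_on_coordinatewise_then_product) (intro continuous_intros)
    have cont\<gamma>: "continuous_on (cball 0 R) \<gamma>"
      unfolding \<gamma>_def by (rule continuous_on_compose2[OF gcont contline]) (use lin in auto)
    \<comment> \<open>The Jacobian determinant along the lifted line: \<open>\<gamma>\<close> is
      continuous on the whole disc and will be differentiable where \<open>H\<close> is
      nonzero.\<close>
    define H where "H \<zeta> = D (\<gamma> \<zeta>)" for \<zeta>
    define u where "u \<zeta> = pairing I l (\<gamma> \<zeta>) - pairing I l x0" for \<zeta>
    define U where "U = {\<zeta> \<in> ball 0 R. H \<zeta> \<noteq> 0}"
    have contpd: "continuous_on (cball 0 R) (\<lambda>\<zeta>. jacobian f (\<gamma> \<zeta>) j i)" if "i \<in> I" "j \<in> I" for i j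
      unfolding jacobian_def
      by (rule continuous_on_compose2[OF continuous_on_partial_deriv[OF Go fin that(1) fch[OF that(2)]] cont\<gamma>]) (use \<gamma>G in auto)
    have contH: "continuous_on (cball 0 R) H"
      unfolding H_def D_def by (rule continuous_on_fun_det) (use contpd eI in auto)
    have cont\<gamma>i: "continuous_on (cball 0 R) (\<lambda>\<zeta>. \<gamma> \<zeta> i)" for i
      by (rule continuous_on_product_then_coordinatewise[OF cont\<gamma>])
    have contu: "continuous_on (cball 0 R) u"
      unfolding u_def pairing_def by (intro continuous_intros cont\<gamma>i)
    have Uopen: "open U"
    proof -
      have "open (ball 0 R \<inter> H -` (- {0}))"
        using contH by (intro continuous_open_preimage) (auto intro: continuous_on_subset)
      moreover have "ball 0 R \<inter> H -` (- {0}) = U" by (auto simp: U_def)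
      ultimately show ?thesis by simp
    qed
    \<comment> \<open>In terms of slopes, \<open>f (\<gamma> \<zeta>) = line \<zeta>\<close> is a
      linear system for the difference quotients of \<open>\<gamma>\<close>. Cramer's rule writes
      them as \<open>T' / T\<close>, and this has a limit since \<open>T\<close> tends to
      \<open>H \<zeta>0\<close>.\<close>
    have \<gamma>diff: "\<exists>d. ((\<lambda>\<zeta>. \<gamma> \<zeta> i) has_field_derivative d) (at \<zeta>0)" if z: "\<zeta>0 \<in> U" and i: "i \<in> I" for \<zeta>0 i
    proof -
      have zb: "\<zeta>0 \<in> cball 0 R" and zH: "H \<zeta>0 \<noteq> 0" using z by (auto simp: U_def)
      have nearG: "\<forall>\<^sub>F \<zeta> in at \<zeta>0. \<zeta> \<in> cball 0 R"
        using z by (intro eventually_at_in_open'[THEN eventually_mono, of "ball 0 R"]) (auto simp: U_def)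
      have \<gamma>lim: "((\<lambda>\<zeta>. \<gamma> \<zeta> k) \<longlongrightarrow> \<gamma> \<zeta>0 k) (at \<zeta>0)" for k
      proof -
        have "continuous_on (ball 0 R) (\<lambda>\<zeta>. \<gamma> \<zeta> k)" by (rule continuous_on_subset[OF cont\<gamma>i]) auto
        then have "isCont (\<lambda>\<zeta>. \<gamma> \<zeta> k) \<zeta>0" using z by (simp add: continuous_on_eq_continuous_at U_def)
        then show ?thesis by (simp add: isCont_def)
      qed
      have fl: "filterlim \<gamma> (nhds_rel G (\<gamma> \<zeta>0)) (at \<zeta>0)"
        by (rule filterlim_nhds_rel) (use \<gamma>lim nearG \<gamma>G in \<open>auto simp: tendsto_coordinatewise elim!: eventually_mono\<close>)
      have "\<forall>j\<in>I. \<exists>q. (\<forall>i\<in>I. ((\<lambda>w. q w i) \<longlongrightarrow> jacobian f (\<gamma> \<zeta>0) j i) (nhds_rel G (\<gamma> \<zeta>0))) \<and>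
          (\<forall>\<^sub>F w in nhds_rel G (\<gamma> \<zeta>0). f w j - f (\<gamma> \<zeta>0) j = (\<Sum>i\<in>I. q w i * (w i - \<gamma> \<zeta>0 i)))"
        using has_gradient_partial_deriv[OF Go fin \<gamma>G(1)[OF zb] fch] unfolding has_gradient_def jacobian_def by blast
      from bchoice[OF this] obtain q where q: "\<forall>j\<in>I. (\<forall>i\<in>I. ((\<lambda>w. q j w i) \<longlongrightarrow> jacobian f (\<gamma> \<zeta>0) j i) (nhds_rel G (\<gamma> \<zeta>0))) \<and>
          (\<forall>\<^sub>F w in nhds_rel G (\<gamma> \<zeta>0). f w j - f (\<gamma> \<zeta>0) j = (\<Sum>i\<in>I. q j w i * (w i - \<gamma> \<zeta>0 i)))" ..
      have qlim: "((\<lambda>\<zeta>. q j (\<gamma> \<zeta>) i) \<longlongrightarrow> jacobian f (\<gamma> \<zeta>0) j i) (at \<zeta>0)" if "j \<in> I" "i \<in> I" for i j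
        by (rule filterlim_compose[OF _ fl]) (use q that in auto)
      have "\<forall>\<^sub>F w in nhds_rel G (\<gamma> \<zeta>0). \<forall>j\<in>I. f w j - f (\<gamma> \<zeta>0) j = (\<Sum>i\<in>I. q j w i * (w i - \<gamma> \<zeta>0 i))"
        using q fin by (intro eventually_ball_finite) auto
      from eventually_compose_filterlim[OF this fl]
      have qe: "\<forall>\<^sub>F \<zeta> in at \<zeta>0. \<forall>j\<in>I. f (\<gamma> \<zeta>) j - f (\<gamma> \<zeta>0) j = (\<Sum>i\<in>I. q j (\<gamma> \<zeta>) i * (\<gamma> \<zeta> i - \<gamma> \<zeta>0 i))" .
      have "i \<in> e ` {..<n}" using i e by (simp add: bij_betw_def n_def)
      then obtain l where l: "l < n" "i = e l" by auto
      define T where "T \<zeta> = fun_det n (\<lambda>k m. q (e k) (\<gamma> \<zeta>) (e m))" for \<zeta>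
      define T' where "T' \<zeta> = fun_det n (\<lambda>k m. if m = l then w (e k) else q (e k) (\<gamma> \<zeta>) (e m))" for \<zeta>
      have Tlim: "(T \<longlongrightarrow> H \<zeta>0) (at \<zeta>0)"
        unfolding T_def H_def D_def by (rule tendsto_fun_det) (use qlim eI in auto)
      have T'lim: "(T' \<longlongrightarrow> fun_det n (\<lambda>k m. if m = l then w (e k) else jacobian f (\<gamma> \<zeta>0) (e k) (e m))) (at \<zeta>0)"
        unfolding T'_def by (rule tendsto_fun_det) (use qlim eI in auto)
      have "\<forall>\<^sub>F \<zeta> in at \<zeta>0. T' \<zeta> / T \<zeta> = (\<gamma> \<zeta> i - \<gamma> \<zeta>0 i) / (\<zeta> - \<zeta>0)"
        using qe nearG tendsto_imp_eventually_ne[OF Tlim zH] eventually_neq_at_within[of \<zeta>0 \<zeta>0]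
      proof eventually_elim
        case (elim \<zeta>)
        have eq: "(\<Sum>m<n. q (e k) (\<gamma> \<zeta>) (e m) * ((\<gamma> \<zeta> (e m) - \<gamma> \<zeta>0 (e m)) / (\<zeta> - \<zeta>0))) = w (e k)" if k: "k < n" for k
        proof -
          have "(\<zeta> - \<zeta>0) * w (e k) = (\<Sum>m<n. q (e k) (\<gamma> \<zeta>) (e m) * (\<gamma> \<zeta> (e m) - \<gamma> \<zeta>0 (e m)))"
            using elim(1) eI[OF k] \<gamma>G(2)[OF elim(2)] \<gamma>G(2)[OF zb] by (simp add: sum_e line_def algebra_simps)
          then have "w (e k) = (\<Sum>m<n. q (e k) (\<gamma> \<zeta>) (e m) * (\<gamma> \<zeta> (e m) - \<gamma> \<zeta>0 (e m))) / (\<zeta> - \<zeta>0)"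
            using elim(4) by (simp add: eq_divide_eq mult.commute)
          then show ?thesis by (simp add: sum_divide_distrib)
        qed
        have "(\<gamma> \<zeta> (e l) - \<gamma> \<zeta>0 (e l)) / (\<zeta> - \<zeta>0) * T \<zeta> = T' \<zeta>"
          unfolding T_def T'_def by (rule fun_det_cramer[OF eq l(1)])
        then show ?case unfolding l(2) by (simp only: nonzero_divide_eq_eq[OF elim(3)])
      qed
      from Lim_transform_eventually[OF tendsto_divide[OF T'lim Tlim zH] this]
      show ?thesis unfolding has_field_derivative_iff by blast
    qed
    have \<gamma>hol: "(\<lambda>\<zeta>. \<gamma> \<zeta> i) holomorphic_on U" if "i \<in> I" for i
      unfolding holomorphic_on_open[OF Uopen] using \<gamma>diff that by blast
    have \<gamma>UG: "\<gamma> ` U \<subseteq> G" using \<gamma>G by (auto simp: U_def)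
    have holH: "H holomorphic_on U"
      unfolding H_def D_def jacobian_def
      by (rule holomorphic_on_fun_det) (intro partial_deriv_curve_holomorphic[OF Go fin _ fch Uopen \<gamma>hol \<gamma>UG] eI)
    have holu: "u holomorphic_on U"
      unfolding u_def pairing_def by (intro holomorphic_intros \<gamma>hol)
    have ub: "norm (u \<zeta>) \<le> 1 + N x0" if "\<zeta> \<in> cball 0 R" for \<zeta>
    proof -
      have "N (\<gamma> \<zeta>) < 1" "\<gamma> \<zeta> \<in> cspace I" using \<gamma>G(1)[OF that] by (auto simp: G_def A.unit_ball_def)
      then have "norm (pairing I l (\<gamma> \<zeta>)) \<le> 1" using A.pairing_le[OF _ l, of "\<gamma> \<zeta>"] by simp
      moreover have "norm (pairing I l x0) \<le> N x0" by (rule A.pairing_le[OF x0c l])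
      ultimately show ?thesis unfolding u_def using norm_triangle_ineq4[of "pairing I l (\<gamma> \<zeta>)" "pairing I l x0"] by linarith
    qed
    have U0: "0 \<in> U" using D0 R(1) by (simp add: U_def H_def \<gamma>0)
    have "norm (deriv u 0) \<le> (1 + N x0) / R"
      by (rule schwarz_deriv_off_zeros[OF R(1) contu contH])
        (use holu holH ub U0 A.N_nonneg[OF x0c] in \<open>auto simp: U_def u_def \<gamma>0\<close>)
    \<comment> \<open>The derivative of \<open>\<gamma>\<close> at 0 and the vector
      \<open>v / N' J\<close> are both sent to \<open>w\<close> by the derivative of
      \<open>f\<close> at \<open>x0\<close>, which is injective by \<open>nd\<close>.\<close>
    moreover have "deriv u 0 = pairing I l v / N' J"
    proof -
      have "\<forall>i\<in>I. \<exists>d. ((\<lambda>\<zeta>. \<gamma> \<zeta> i) has_field_derivative d) (at 0)" using \<gamma>diff[OF U0] by blast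
      from bchoice[OF this] obtain d where d: "\<forall>i\<in>I. ((\<lambda>\<zeta>. \<gamma> \<zeta> i) has_field_derivative d i) (at 0)" ..
      have dj: "(\<Sum>i\<in>I. jacobian f x0 j i * d i) = w j" if j: "j \<in> I" for j
      proof -
        have "((\<lambda>\<zeta>. f (\<gamma> \<zeta>) j) has_field_derivative (\<Sum>i\<in>I. jacobian f x0 j i * d i)) (at 0 within U)"
        proof (rule has_gradient_curve[where \<gamma> = \<gamma> and G = G])
          show "((\<lambda>\<zeta>. \<gamma> \<zeta> i) has_field_derivative d i) (at 0 within U)" if "i \<in> I" for i
            using d that by (auto intro: has_field_derivative_at_within)
          show "\<gamma> \<eta> i = 0" if "i \<notin> I" "\<eta> \<in> insert 0 U" for i \<eta>
          proof -
            have "\<gamma> \<eta> \<in> cspace I" using that U0 \<gamma>UG Gc by blast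
            then show ?thesis using that by (simp add: cspace_def)
          qed
          show "\<forall>\<^sub>F \<eta> in at 0 within U. \<gamma> \<eta> \<in> G" using \<gamma>UG by (auto simp: eventually_at_filter intro!: always_eventually)
          show "has_gradient I G (\<lambda>w. f w j) (\<gamma> 0) (jacobian f x0 j)"
            using has_gradient_partial_deriv[OF Go fin x0G fch[OF j]] by (simp add: \<gamma>0 jacobian_def)
        qed
        moreover have "((\<lambda>\<zeta>. f (\<gamma> \<zeta>) j) has_field_derivative w j) (at 0 within U)"
        proof (rule has_field_derivative_transform_within[where d = R and f = "\<lambda>\<zeta>. line \<zeta> j"])
          show "((\<lambda>\<zeta>. line \<zeta> j) has_field_derivative w j) (at 0 within U)"
            unfolding line_def by (auto intro!: derivative_eq_intros)
          show "line \<zeta> j = f (\<gamma> \<zeta>) j" if "\<zeta> \<in> U" for \<zeta>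
          proof -
            have "\<zeta> \<in> cball 0 R" using that by (simp add: U_def)
            then show ?thesis using \<gamma>G(2) by simp
          qed
        qed (use R U0 in simp_all)
        ultimately show ?thesis unfolding at_within_open[OF U0 Uopen] by (rule DERIV_unique)
      qed
      have "(\<Sum>i\<in>I. jacobian f x0 j i * (d i - v i / N' J)) = 0" if j: "j \<in> I" for j
      proof -
        have "(\<Sum>i\<in>I. jacobian f x0 j i * (d i - v i / N' J)) =
            (\<Sum>i\<in>I. jacobian f x0 j i * d i) - (\<Sum>i\<in>I. jacobian f x0 j i * v i) / N' J"
          unfolding right_diff_distrib sum_subtractf sum_divide_distrib times_divide_eq_right ..
        also have "(\<Sum>i\<in>I. jacobian f x0 j i * v i) = J j" using j by (simp add: J_def lin_def)
        also have "(\<Sum>i\<in>I. jacobian f x0 j i * d i) = w j" by (rule dj[OF j])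
        finally have "(\<Sum>i\<in>I. jacobian f x0 j i * (d i - v i / N' J)) = w j - J j / N' J" .
        then show ?thesis by (simp add: w_def)
      qed
      then have "\<forall>i\<in>I. d i - v i / N' J = 0" by (intro nd[of "\<lambda>i. d i - v i / N' J"] ballI)
      then have dv: "\<And>i. i \<in> I \<Longrightarrow> d i = v i / N' J" by simp
      have "((\<lambda>\<zeta>. l i * \<gamma> \<zeta> i) has_field_derivative l i * d i) (at 0)" if "i \<in> I" for i
        using bspec[OF d that] by (rule DERIV_cmult)
      then have "((\<lambda>\<zeta>. \<Sum>i\<in>I. l i * \<gamma> \<zeta> i) has_field_derivative (\<Sum>i\<in>I. l i * d i)) (at 0)"
        by (rule DERIV_sum)
      from DERIV_diff[OF this DERIV_const]
      have "(u has_field_derivative ((\<Sum>i\<in>I. l i * d i) - 0)) (at 0)"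
        unfolding u_def pairing_def .
      then have "deriv u 0 = (\<Sum>i\<in>I. l i * d i) - 0" by (rule DERIV_imp_deriv)
      also have "\<dots> = (\<Sum>i\<in>I. l i * v i / N' J)" using dv by simp
      finally show ?thesis by (simp only: pairing_def sum_divide_distrib)
    qed
    ultimately have "norm (pairing I l v) / N' J \<le> (1 + N x0) / R" using NJ by (simp add: norm_divide)
    then show ?thesis using NJ R(1) by (simp add: field_simps)
  qed
  have tp: "t - N' p > 0" using x0(2) by (simp add: p_def)
  have "N v * R \<le> (1 + N x0) * N' J" if R: "0 < R" "R < t - N' p" for R
  proof -
    have "N v \<le> (1 + N x0) * N' J / R"
      by (rule A.N_le[OF v]) (use bnd R in \<open>simp add: le_divide_eq\<close>)
    then show ?thesis using R by (simp add: le_divide_eq)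
  qed
  then have "(t - N' p) * N v \<le> (1 + N x0) * N' J"
  proof -
    assume *: "\<And>R. 0 < R \<Longrightarrow> R < t - N' p \<Longrightarrow> N v * R \<le> (1 + N x0) * N' J"
    have Nv: "N v > 0" by (rule A.N_pos[OF v False])
    have "t - N' p \<le> (1 + N x0) * N' J / N v"
    proof (rule dense_le_bounded[OF tp])
      show "R \<le> (1 + N x0) * N' J / N v" if "0 < R" "R < t - N' p" for R
        using *[OF that] Nv by (simp add: le_divide_eq mult.commute)
    qed
    then show ?thesis using Nv by (simp add: le_divide_eq)
  qed
  then show ?thesis by (simp add: p_def J_def)
qed

text \<open>Nonsingular points \<open>x n\<close> are chosen with
  \<open>N (x n) < 1 / Suc n\<close>. In the estimates at \<open>x n\<close> all terms converge,
  \<open>N (x n)\<close> and \<open>N' (f (x n))\<close> to zero, and the limit is the estimate at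
  the origin.\<close>

proposition derivative_expands:
  assumes t0: "t > 0" and t: "{y \<in> cspace I. N' y < t} \<subseteq> f ` A.unit_ball" and v: "v \<in> cspace I"
  shows "t * N v \<le> N' (lin I (jacobian f (\<lambda>_. 0)) v)"
proof -
  let ?G = "A.unit_ball"
  have Go: "copen I ?G" and Gc: "?G \<subseteq> cspace I" and fin: "finite I"
    using A.copen_unit_ball A.unit_ball_cspace A.fin by auto
  have "\<exists>x. x \<in> ?G \<and> N x < 1 / real (Suc n) \<and>
     (\<forall>v. (\<forall>j\<in>I. (\<Sum>i\<in>I. jacobian f x j i * v i) = 0) \<longrightarrow> (\<forall>i\<in>I. v i = 0))" for n
  proof -
    let ?V = "{x \<in> cspace I. N x < 1 / real (Suc n)}"
    have VG: "?V \<subseteq> ?G"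
    proof
      fix x assume x: "x \<in> ?V"
      have "1 / real (Suc n) \<le> 1" by simp
      moreover have "x \<in> cspace I" "N x < 1 / real (Suc n)" using x unfolding mem_Collect_eq by blast+
      ultimately have "x \<in> cspace I" "N x < 1" by linarith+
      then show "x \<in> ?G" unfolding A.unit_ball_def by blast
    qed
    have "(\<lambda>_. 0) \<in> ?V" by simp
    then have "?V \<noteq> {}" by blast
    then have "\<exists>z\<in>?V. \<forall>v. (\<forall>j\<in>I. (\<Sum>i\<in>I. partial_deriv i (\<lambda>w. f w j) z * v i) = 0) \<longrightarrow> (\<forall>i\<in>I. v i = 0)"
    proof (rule injective_holomorphic_nondegenerate[OF A.copen_N_ball _ fin fin refl])
      show "holo_on I ?V (\<lambda>w. f w j)" if "j \<in> I" for j
        by (rule holo_on_subset[OF f_holo_on[OF that] VG])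
      show "f ` ?V \<subseteq> cspace I" using f_imc VG by auto
      show "inj_on f ?V" by (rule inj_on_subset[OF f_inj VG])
    qed
    then obtain z where zV: "z \<in> ?V" and znd: "\<forall>v. (\<forall>j\<in>I. (\<Sum>i\<in>I. jacobian f z j i * v i) = 0) \<longrightarrow> (\<forall>i\<in>I. v i = 0)"
      unfolding jacobian_def by (rule bexE)
    have "N z < 1 / real (Suc n)" using zV unfolding mem_Collect_eq by blast
    with subsetD[OF VG zV] znd show ?thesis by (intro exI[of _ z] conjI)
  qed
  then have "\<forall>n. \<exists>x. x \<in> ?G \<and> N x < 1 / real (Suc n) \<and>
     (\<forall>v. (\<forall>j\<in>I. (\<Sum>i\<in>I. jacobian f x j i * v i) = 0) \<longrightarrow> (\<forall>i\<in>I. v i = 0))" by (rule allI)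
  from choice[OF this] obtain x where x: "\<forall>n. x n \<in> ?G \<and> N (x n) < 1 / real (Suc n) \<and>
     (\<forall>v. (\<forall>j\<in>I. (\<Sum>i\<in>I. jacobian f (x n) j i * v i) = 0) \<longrightarrow> (\<forall>i\<in>I. v i = 0))" ..
  have xG: "x n \<in> ?G" and xN: "N (x n) < 1 / real (Suc n)" for n
    using spec[OF x, of n] by (simp_all only:)
  have xnd: "\<forall>i\<in>I. v i = 0" if "\<forall>j\<in>I. (\<Sum>i\<in>I. jacobian f (x n) j i * v i) = 0" for n v
    by (rule mp[OF spec[OF conjunct2[OF conjunct2[OF spec[OF x, of n]]], of v]]) (rule that)
  have xc: "x n \<in> cspace I" for n using xG Gc by blast
  obtain c where c: "c > 0" "\<forall>x\<in>cspace I. c * cnorm I x \<le> N x" using A.N_lower by blast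
  have inv0: "(\<lambda>n. 1 / real (Suc n)) \<longlonglongrightarrow> 0"
    using LIMSEQ_inverse_real_of_nat by (simp add: inverse_eq_divide)
  have Nx0: "(\<lambda>n. N (x n)) \<longlonglongrightarrow> 0"
    by (rule tendsto_sandwich[OF _ _ tendsto_const inv0]) (use xN A.N_nonneg[OF xc] in \<open>auto intro!: always_eventually less_imp_le\<close>)
  have xi: "(\<lambda>n. x n i) \<longlonglongrightarrow> 0" for i
  proof (cases "i \<in> I")
    case True
    have "norm (x n i) \<le> N (x n) / c" for n
    proof -
      have "c * norm (x n i) \<le> c * cnorm I (x n)"
        using cnorm_coord_le[OF fin True] c(1) by (intro mult_left_mono) auto
      also have "\<dots> \<le> N (x n)" using c(2) xc[of n] by (rule bspec)
      finally show ?thesis using c(1) by (simp add: le_divide_eq mult.commute)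
    qed
    then have le: "\<forall>n. norm (x n i) \<le> N (x n) / c" ..
    have "c \<noteq> 0" using c(1) by simp
    from tendsto_divide[OF Nx0 tendsto_const this]
    have l: "(\<lambda>n. N (x n) / c) \<longlonglongrightarrow> 0" by (simp only: div_0)
    show ?thesis by (rule Lim_null_comparison[OF always_eventually[OF le] l])
  next
    case False
    have "x n i = 0" for n using xc[of n] False by (simp add: cspace_def)
    then show ?thesis by simp
  qed
  have fl: "filterlim x (nhds_rel ?G (\<lambda>_. 0)) sequentially"
    by (rule filterlim_nhds_rel) (use xi xG in \<open>auto simp: tendsto_coordinatewise\<close>)
  have jlim: "(\<lambda>n. jacobian f (x n) j i) \<longlonglongrightarrow> jacobian f (\<lambda>_. 0) j i" if "i \<in> I" "j \<in> I" for i j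
  proof -
    have "(partial_deriv i (\<lambda>w. f w j) \<longlongrightarrow> partial_deriv i (\<lambda>w. f w j) (\<lambda>_. 0)) (nhds_rel ?G (\<lambda>_. 0))"
      using continuous_on_partial_deriv[OF Go fin that(1) f_holo_on[OF that(2)]]
      unfolding continuous_on_def tendsto_nhds_rel_iff_at[symmetric] using A.zero_unit_ball by blast
    then show ?thesis unfolding jacobian_def by (rule filterlim_compose[OF _ fl])
  qed
  have flim: "(\<lambda>n. f (x n) j) \<longlonglongrightarrow> 0" if j: "j \<in> I" for j
  proof -
    have "((\<lambda>w. f w j) \<longlongrightarrow> f (\<lambda>_. 0) j) (nhds_rel ?G (\<lambda>_. 0))"
      using has_gradient_tendsto[OF has_gradient_partial_deriv[OF Go fin A.zero_unit_ball f_holo_on[OF j]]] .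
    then show ?thesis unfolding f0 by (rule filterlim_compose[OF _ fl])
  qed
  have Nf: "(\<lambda>n. N' (f (x n))) \<longlonglongrightarrow> N' (\<lambda>_. 0)"
    by (rule B.N_tendsto) (use flim f_imc xG in auto)
  have Nl: "(\<lambda>n. N' (lin I (jacobian f (x n)) v)) \<longlonglongrightarrow> N' (lin I (jacobian f (\<lambda>_. 0)) v)"
  proof (rule B.N_tendsto)
    show "(\<lambda>n. lin I (jacobian f (x n)) v j) \<longlonglongrightarrow> lin I (jacobian f (\<lambda>_. 0)) v j" if "j \<in> I" for j
      using that unfolding lin_def by (simp only: if_True) (intro tendsto_intros jlim)
  qed (rule lin_cspace)+
  have l1: "(\<lambda>n. (t - N' (f (x n))) * N v) \<longlonglongrightarrow> (t - N' (\<lambda>_. 0)) * N v"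
    by (intro tendsto_intros Nf)
  have l2: "(\<lambda>n. (1 + N (x n)) * N' (lin I (jacobian f (x n)) v)) \<longlonglongrightarrow> (1 + 0) * N' (lin I (jacobian f (\<lambda>_. 0)) v)"
    by (intro tendsto_intros Nx0 Nl)
  have "\<forall>\<^sub>F n in sequentially. N' (f (x n)) < t"
    using order_tendstoD(2)[OF Nf, of t] t0 by simp
  then have "\<forall>\<^sub>F n in sequentially. (t - N' (f (x n))) * N v \<le> (1 + N (x n)) * N' (lin I (jacobian f (x n)) v)"
    by eventually_elim (rule derivative_expands_at[OF t xG _ xnd v])
  from tendsto_le[OF _ l2 l1 this] show ?thesis by simp
qed

end

subsection \<open>The Kobayashi distance from the origin of a unit ball\<close>

lemma tanh_artanh_real:
  assumes "-1 < (x::real)" "x < 1"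
  shows "tanh (artanh x) = x"
proof -
  let ?u = "(1 + x) / (1 - x)"
  have u: "?u > 0" using assms by simp
  have "artanh x = ln (sqrt ?u)" using u by (simp add: artanh_def ln_sqrt)
  then have "tanh (artanh x) = ((sqrt ?u)\<^sup>2 - 1) / ((sqrt ?u)\<^sup>2 + 1)"
    using u by (simp only: tanh_ln_real real_sqrt_gt_zero)
  also have "\<dots> = (?u - 1) / (?u + 1)" using u by (simp only: real_sqrt_pow2 less_imp_le)
  also have "\<dots> = x" using assms by (simp add: field_simps)
  finally show ?thesis .
qed

text \<open>The triangle inequality for the hyperbolic distance from 0. After clearing denominators
  both squares are affine in \<open>s = Re (cnj \<alpha> * \<omega>)\<close> and agree at
  \<open>s = x * r\<close>; as \<open>s \<le> x * r\<close>, it remains to compare the slopes, that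
  is \<open>x + r\<close> with \<open>1 + x * r\<close>.\<close>

lemma moebius_norm_bound:
  fixes \<alpha> \<omega> :: complex
  assumes a: "norm \<alpha> < 1" and w: "norm \<omega> < 1"
  shows "norm (Moebius_function 0 (- \<alpha>) \<omega>) \<le> (norm \<alpha> + norm \<omega>) / (1 + norm \<alpha> * norm \<omega>)"
proof -
  define x r s where "x = norm \<alpha>" and "r = norm \<omega>" and "s = Re (cnj \<alpha> * \<omega>)"
  have xr: "0 \<le> x" "x < 1" "0 \<le> r" "r < 1" using a w by (auto simp: x_def r_def)
  have s: "s \<le> x * r" unfolding s_def x_def r_def by (metis complex_Re_le_cmod complex_mod_cnj norm_mult)
  have sq1: "(norm (\<omega> + \<alpha>))\<^sup>2 = r\<^sup>2 + x\<^sup>2 + 2 * s"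
    unfolding cmod_power2 x_def r_def s_def by (simp add: power2_eq_square algebra_simps)
  have sq2: "(norm (1 + cnj \<alpha> * \<omega>))\<^sup>2 = 1 + 2 * s + x\<^sup>2 * r\<^sup>2"
  proof -
    have "x\<^sup>2 * r\<^sup>2 = (norm (cnj \<alpha> * \<omega>))\<^sup>2" by (simp add: x_def r_def norm_mult power_mult_distrib)
    then show ?thesis unfolding s_def cmod_power2 by (simp add: power2_eq_square algebra_simps)
  qed
  have pos: "1 + x * r > 0" using xr by (simp add: add_pos_nonneg)
  have slope: "(x + r)\<^sup>2 \<le> (1 + x * r)\<^sup>2"
  proof (rule power_mono)
    have "0 \<le> (1 - x) * (1 - r)" using xr by simp
    then show "x + r \<le> 1 + x * r" by (simp add: algebra_simps)
  qed (use xr in simp)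
  have "(norm (\<omega> + \<alpha>) * (1 + x * r))\<^sup>2 \<le> ((x + r) * norm (1 + cnj \<alpha> * \<omega>))\<^sup>2"
  proof -
    have "0 \<le> 2 * (x * r - s) * ((1 + x * r)\<^sup>2 - (x + r)\<^sup>2)"
      using s slope by (intro mult_nonneg_nonneg) auto
    also have "\<dots> = ((x + r) * norm (1 + cnj \<alpha> * \<omega>))\<^sup>2 - (norm (\<omega> + \<alpha>) * (1 + x * r))\<^sup>2"
      unfolding power_mult_distrib sq1 sq2 by (simp add: power2_eq_square algebra_simps)
    finally show ?thesis by simp
  qed
  then have le: "norm (\<omega> + \<alpha>) * (1 + x * r) \<le> (x + r) * norm (1 + cnj \<alpha> * \<omega>)"
    using xr by (auto intro: power2_le_imp_le)
  have "norm (cnj \<alpha> * \<omega>) < 1" using mult_strict_mono[OF a w] a by (simp add: norm_mult)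
  then have nz: "1 + cnj \<alpha> * \<omega> \<noteq> 0" by (metis add_eq_0_iff less_irrefl norm_minus_cancel norm_one)
  have "Moebius_function 0 (- \<alpha>) \<omega> = (\<omega> + \<alpha>) / (1 + cnj \<alpha> * \<omega>)" by (simp add: Moebius_function_simple)
  then show ?thesis using le nz pos by (simp add: norm_divide divide_le_eq le_divide_eq x_def r_def mult.commute)
qed

text \<open>Moebius transformations before and after \<open>\<phi>\<close> move both base points to
  0, where the Schwarz lemma applies.\<close>

lemma schwarz_pick:
  assumes hol: "\<phi> holomorphic_on ball 0 1" and im: "\<And>z. norm z < 1 \<Longrightarrow> norm (\<phi> z) < 1"
    and a: "norm a < 1" and b: "norm b < 1"
  shows "norm (Moebius_function 0 (\<phi> a) (\<phi> b)) \<le> norm (Moebius_function 0 a b)"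
proof -
  define \<psi> where "\<psi> z = Moebius_function 0 (\<phi> a) (\<phi> (Moebius_function 0 (- a) z))" for z
  have M: "norm (Moebius_function 0 (- a) z) < 1" if "norm z < 1" for z
    by (rule Moebius_function_norm_lt_1) (use a that in auto)
  have "\<psi> holomorphic_on ball 0 1"
  proof -
    have h1: "Moebius_function 0 (- a) holomorphic_on ball 0 1" by (rule Moebius_function_holomorphic) (use a in simp)
    have h2: "(\<phi> \<circ> Moebius_function 0 (- a)) holomorphic_on ball 0 1"
      by (rule holomorphic_on_compose_gen[OF h1 hol]) (use M in auto)
    have "(Moebius_function 0 (\<phi> a) \<circ> (\<phi> \<circ> Moebius_function 0 (- a))) holomorphic_on ball 0 1"
      by (rule holomorphic_on_compose_gen[OF h2 Moebius_function_holomorphic[OF im[OF a]]]) (use M im in auto)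
    then show ?thesis by (simp add: \<psi>_def[abs_def] o_def)
  qed
  moreover have "\<psi> 0 = 0" by (simp add: \<psi>_def Moebius_function_of_zero Moebius_function_eq_zero)
  moreover have "norm (\<psi> z) < 1" if "norm z < 1" for z
    unfolding \<psi>_def by (intro Moebius_function_norm_lt_1 im M a that)
  moreover have "norm (Moebius_function 0 a b) < 1" by (intro Moebius_function_norm_lt_1 a b)
  ultimately have "norm (\<psi> (Moebius_function 0 a b)) \<le> norm (Moebius_function 0 a b)"
    by (rule Schwarz_Lemma(1))
  moreover have "Moebius_function 0 (- a) (Moebius_function 0 a b) = b"
    by (rule Moebius_function_compose) (use a b in auto)
  ultimately show ?thesis by (simp add: \<psi>_def)
qed

lemma poincare_dist_Moebius: "poincare_dist a b = artanh (norm (Moebius_function 0 a b))"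
  by (simp add: poincare_dist_def Moebius_function_simple norm_divide norm_minus_commute)

text \<open>One link of a chain: the hyperbolic distance from 0 grows at most by the length of the
  link. The bound is written \<open>tanh S\<close> so that the lengths simply add up in
  \<open>S\<close>.\<close>

lemma disc_step:
  assumes hol: "\<phi> holomorphic_on ball 0 1" and im: "\<And>z. norm z < 1 \<Longrightarrow> norm (\<phi> z) < 1"
    and a: "norm a < 1" and b: "norm b < 1" and S: "norm (\<phi> a) \<le> tanh S"
  shows "norm (\<phi> b) \<le> tanh (S + poincare_dist a b)"
proof -
  define \<omega> where "\<omega> = Moebius_function 0 (\<phi> a) (\<phi> b)"
  define \<delta> where "\<delta> = norm (Moebius_function 0 a b)"
  have \<delta>: "0 \<le> \<delta>" "\<delta> < 1" unfolding \<delta>_def by (auto intro: Moebius_function_norm_lt_1 a b)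
  have \<omega>\<delta>: "norm \<omega> \<le> \<delta>" unfolding \<omega>_def \<delta>_def by (rule schwarz_pick[OF hol im a b])
  have \<omega>: "norm \<omega> < 1" using \<omega>\<delta> \<delta> by linarith
  have "\<phi> b = Moebius_function 0 (- \<phi> a) \<omega>"
    unfolding \<omega>_def by (rule Moebius_function_compose[symmetric]) (use im a b in auto)
  then have 1: "norm (\<phi> b) \<le> (norm (\<phi> a) + norm \<omega>) / (1 + norm (\<phi> a) * norm \<omega>)"
    using moebius_norm_bound[OF im[OF a] \<omega>] by simp
  have mono: "(x + y) / (1 + x * y) \<le> (x' + y) / (1 + x' * y)" if "0 \<le> x" "x \<le> x'" "0 \<le> y" "y \<le> 1" for x x' y :: real
  proof -
    have p: "1 + x * y > 0" "1 + x' * y > 0" using that by (auto intro!: add_pos_nonneg)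
    have "0 \<le> (x' - x) * (1 - y * y)" using that mult_le_one[of y y] by (intro mult_nonneg_nonneg) auto
    also have "\<dots> = (x' + y) * (1 + x * y) - (x + y) * (1 + x' * y)" by (simp add: algebra_simps)
    finally have "(x + y) * (1 + x' * y) \<le> (x' + y) * (1 + x * y)" by simp
    then show ?thesis using p by (simp add: divide_le_eq le_divide_eq mult.commute)
  qed
  have "(norm (\<phi> a) + norm \<omega>) / (1 + norm (\<phi> a) * norm \<omega>) \<le> (tanh S + norm \<omega>) / (1 + tanh S * norm \<omega>)"
    by (rule mono) (use S \<omega> in auto)
  also have "\<dots> = (norm \<omega> + tanh S) / (1 + norm \<omega> * tanh S)" by (simp add: ac_simps)
  also have "\<dots> \<le> (\<delta> + tanh S) / (1 + \<delta> * tanh S)"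
    by (rule mono) (use \<omega>\<delta> S tanh_real_lt_1[of S] order_trans[OF norm_ge_zero S] in auto)
  also have "\<dots> = tanh (S + poincare_dist a b)"
  proof -
    have t: "tanh (poincare_dist a b) = \<delta>"
      unfolding poincare_dist_Moebius \<delta>_def[symmetric] by (rule tanh_artanh_real) (use \<delta> in auto)
    have "tanh (S + poincare_dist a b) = (tanh S + tanh (poincare_dist a b)) / (1 + tanh S * tanh (poincare_dist a b))"
      by (rule tanh_add) (use cosh_real_pos[of S] cosh_real_pos[of "poincare_dist a b"] in linarith)+
    then show ?thesis unfolding t by (simp add: ac_simps)
  qed
  finally show ?thesis using 1 by linarith
qed

context cnormed
begin

text \<open>The functional \<open>l\<close> maps a chain in the unit ball to a chain in the disc
  that starts at 0; \<open>disc_step\<close> is applied link by link.\<close>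

lemma chain_bound:
  assumes ch: "kobayashi_chain I unit_ball (\<lambda>_. 0) w n f a b" and l: "l \<in> \<Lambda>"
  shows "norm (pairing I l w) \<le> tanh (\<Sum>j<n. poincare_dist (a j) (b j))"
proof -
  have n: "n \<ge> 1" and f: "\<And>j. j < n \<Longrightarrow> f j \<in> holomorphic_discs I unit_ball"
    and ab: "\<And>j. j < n \<Longrightarrow> norm (a j) < 1 \<and> norm (b j) < 1"
    and f0: "f 0 (a 0) = (\<lambda>_. 0)" and fs: "\<And>j. Suc j < n \<Longrightarrow> f j (b j) = f (Suc j) (a (Suc j))"
    and fn: "f (n - 1) (b (n - 1)) = w"
    using ch by (auto simp: kobayashi_chain_def)
  define \<phi> where "\<phi> j \<zeta> = pairing I l (f j \<zeta>)" for j \<zeta>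
  have hol: "\<phi> j holomorphic_on ball 0 1" if "j < n" for j
    unfolding \<phi>_def pairing_def using f[OF that] by (intro holomorphic_intros) (simp add: holomorphic_discs_def)
  have im: "norm (\<phi> j z) < 1" if "j < n" "norm z < 1" for j z
  proof -
    have "f j z \<in> unit_ball" using f[OF that(1)] that(2) by (auto simp: holomorphic_discs_def)
    then show ?thesis unfolding \<phi>_def using pairing_le[OF _ l, of "f j z"] by (auto simp: unit_ball_def)
  qed
  have step: "norm (\<phi> k (b k)) \<le> tanh (\<Sum>j<Suc k. poincare_dist (a j) (b j))"
    if "k < n" "norm (\<phi> k (a k)) \<le> tanh (\<Sum>j<k. poincare_dist (a j) (b j))" for k
    using disc_step[OF hol[OF that(1)] im[OF that(1)] _ _ that(2), of "b k"] ab[OF that(1)] by simp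
  have "norm (\<phi> k (b k)) \<le> tanh (\<Sum>j<Suc k. poincare_dist (a j) (b j))" if "k < n" for k
    using that
  proof (induction k)
    case 0
    show ?case by (rule step[OF 0]) (simp add: \<phi>_def f0 pairing_def)
  next
    case (Suc k)
    then have "norm (\<phi> k (b k)) \<le> tanh (\<Sum>j<Suc k. poincare_dist (a j) (b j))" by simp
    then show ?case by (intro step[OF Suc.prems]) (simp add: \<phi>_def fs[OF Suc.prems])
  qed
  from this[of "n - 1"] show ?thesis using n fn by (simp add: \<phi>_def)
qed

text \<open>The infimum is attained by a chain of one linear disc in the direction of
  \<open>w\<close>; \<open>chain_bound\<close>, used for all functionals, shows that no chain is
  shorter.\<close>

lemma kobayashi_dist_zero:
  assumes w: "w \<in> unit_ball"
  shows "kobayashi_dist I unit_ball (\<lambda>_. 0) w = artanh (N w)"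
proof -
  have wc: "w \<in> cspace I" and w1: "N w < 1" using w by (auto simp: unit_ball_def)
  have w0: "0 \<le> N w" by (rule N_nonneg[OF wc])
  let ?S = "{\<Sum>j<n. poincare_dist (a j) (b j) | n f a b. kobayashi_chain I unit_ball (\<lambda>_. 0) w n f a b}"
  have lower: "artanh (N w) \<le> s" if s: "s \<in> ?S" for s
  proof -
    obtain n f a b where ch: "kobayashi_chain I unit_ball (\<lambda>_. 0) w n f a b"
      and seq: "s = (\<Sum>j<n. poincare_dist (a j) (b j))" using s by blast
    have "N w \<le> tanh s" unfolding seq by (rule N_le[OF wc chain_bound[OF ch]])
    then have "tanh (artanh (N w)) \<le> tanh s" using tanh_artanh_real[of "N w"] w0 w1 by simp
    then show ?thesis by simp
  qed
  have mem: "artanh (N w) \<in> ?S"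
  proof -
    \<comment> \<open>For \<open>w = 0\<close> division by zero makes this the zero vector, and the
      disc is constant.\<close>
    define u where "u = (\<lambda>i. w i / complex_of_real (N w))"
    have "\<exists>f a b. kobayashi_chain I unit_ball (\<lambda>_. 0) w 1 (\<lambda>_. f) (\<lambda>_. a) (\<lambda>_. b) \<and> poincare_dist a b = artanh (N w)"
    proof (intro exI conjI)
      let ?f = "\<lambda>\<zeta> i. \<zeta> * u i"
      have uc: "u \<in> cspace I" using wc by (simp add: u_def cspace_def)
      have Nu: "N u \<le> 1"
        using N_scale[OF wc, of "inverse (complex_of_real (N w))"] w0
        by (cases "N w = 0") (simp_all add: u_def divide_inverse mult.commute norm_inverse)
      have im: "?f \<zeta> \<in> unit_ball" if "norm \<zeta> < 1" for \<zeta>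
      proof -
        have "N (?f \<zeta>) = norm \<zeta> * N u" by (rule N_scale[OF uc])
        also have "\<dots> \<le> norm \<zeta> * 1" using Nu by (intro mult_left_mono) auto
        finally show ?thesis using that scale_cspace[OF uc] by (auto simp: unit_ball_def)
      qed
      have "?f (complex_of_real (N w)) = w"
        using N_eq_0[OF wc] by (cases "N w = 0") (auto simp: u_def)
      then show "kobayashi_chain I unit_ball (\<lambda>_. 0) w 1 (\<lambda>_. ?f) (\<lambda>_. 0) (\<lambda>_. complex_of_real (N w))"
        unfolding kobayashi_chain_def holomorphic_discs_def using im w0 w1
        by (auto intro!: holomorphic_intros)
      show "poincare_dist 0 (complex_of_real (N w)) = artanh (N w)" using w0 by (simp add: poincare_dist_def)
    qed
    then obtain f a b where *: "kobayashi_chain I unit_ball (\<lambda>_. 0) w 1 (\<lambda>_. f) (\<lambda>_. a) (\<lambda>_. b)"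
      and **: "poincare_dist a b = artanh (N w)" by blast
    have "artanh (N w) = (\<Sum>j<(1::nat). poincare_dist ((\<lambda>_. a) j) ((\<lambda>_. b) j))" using ** by simp
    with * show ?thesis unfolding mem_Collect_eq
      by (intro exI[of _ "1::nat"] exI[of _ "\<lambda>_. f"] exI[of _ "\<lambda>_. a"] exI[of _ "\<lambda>_. b"] conjI)
  qed
  show ?thesis
    unfolding kobayashi_dist_def by (rule cInf_eq_minimum[OF mem lower])
qed

lemma kobayashi_ball_zero:
  shows "kobayashi_ball I unit_ball (\<lambda>_. 0) r = {w \<in> cspace I. N w < tanh r}"
proof -
  have "kobayashi_dist I unit_ball (\<lambda>_. 0) w < r \<longleftrightarrow> N w < tanh r" if w: "w \<in> unit_ball" for w
  proof -
    have "0 \<le> N w" "N w < 1" using w N_nonneg by (auto simp: unit_ball_def)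
    then have "tanh (artanh (N w)) = N w" by (intro tanh_artanh_real) auto
    then show ?thesis using tanh_real_less_iff[of "artanh (N w)" r] by (simp add: kobayashi_dist_zero[OF w])
  qed
  moreover have "N w < 1" if "N w < tanh r" for w using that tanh_real_lt_1[of r] by linarith
  ultimately show ?thesis unfolding kobayashi_ball_def by (auto simp: unit_ball_def)
qed

end

subsection \<open>Invariance under automorphisms\<close>

text \<open>An automorphism travels together with its inverse, and holomorphy is part of the
  requirement for both.\<close>

definition aut_pair :: "'i set \<Rightarrow> ('i \<Rightarrow> complex) set \<Rightarrow> (('i \<Rightarrow> complex) \<Rightarrow> ('i \<Rightarrow> complex)) \<Rightarrow> (('i \<Rightarrow> complex) \<Rightarrow> ('i \<Rightarrow> complex)) \<Rightarrow> bool" where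
  "aut_pair I G \<phi> \<psi> \<longleftrightarrow> (\<forall>j\<in>I. holo_on I G (\<lambda>x. \<phi> x j)) \<and> (\<forall>j\<in>I. holo_on I G (\<lambda>x. \<psi> x j)) \<and>
     \<phi> ` G \<subseteq> G \<and> \<psi> ` G \<subseteq> G \<and> (\<forall>x\<in>G. \<psi> (\<phi> x) = x) \<and> (\<forall>x\<in>G. \<phi> (\<psi> x) = x)"

text \<open>For a set containing the origin this is transitivity, since automorphisms can be
  inverted and composed.\<close>

definition homogeneous :: "'i set \<Rightarrow> ('i \<Rightarrow> complex) set \<Rightarrow> bool" where
  "homogeneous I G \<longleftrightarrow> (\<forall>z\<in>G. \<exists>\<phi> \<psi>. aut_pair I G \<phi> \<psi> \<and> \<phi> (\<lambda>_. 0) = z)"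

lemma aut_pair_sym: "aut_pair I G \<phi> \<psi> \<Longrightarrow> aut_pair I G \<psi> \<phi>"
  by (auto simp: aut_pair_def)

lemma aut_pair_compose:
  assumes G: "G \<subseteq> cspace I" and 1: "aut_pair I G \<phi> \<psi>" and 2: "aut_pair I G \<phi>' \<psi>'"
  shows "aut_pair I G (\<lambda>x. \<phi> (\<phi>' x)) (\<lambda>x. \<psi>' (\<psi> x))"
proof -
  have h: "holo_on I G (\<lambda>x. p x j)" if "j \<in> I" "(p, p') \<in> {(\<phi>, \<psi>), (\<psi>, \<phi>), (\<phi>', \<psi>'), (\<psi>', \<phi>')}" for j p p'
    using that 1 2 by (auto simp: aut_pair_def)
  have i: "\<phi> ` G \<subseteq> G" "\<psi> ` G \<subseteq> G" "\<phi>' ` G \<subseteq> G" "\<psi>' ` G \<subseteq> G"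
    and inv: "\<And>x. x \<in> G \<Longrightarrow> \<psi> (\<phi> x) = x" "\<And>x. x \<in> G \<Longrightarrow> \<phi> (\<psi> x) = x" "\<And>x. x \<in> G \<Longrightarrow> \<psi>' (\<phi>' x) = x" "\<And>x. x \<in> G \<Longrightarrow> \<phi>' (\<psi>' x) = x"
    using 1 2 by (auto simp: aut_pair_def)
  have c1: "holo_on I G (\<lambda>x. \<phi> (\<phi>' x) j)" if "j \<in> I" for j
    by (rule holo_on_compose[OF _ i(3) G]) (use h that in auto)
  have c2: "holo_on I G (\<lambda>x. \<psi>' (\<psi> x) j)" if "j \<in> I" for j
    by (rule holo_on_compose[OF _ i(2) G]) (use h that in auto)
  have im: "\<phi> x \<in> G" "\<psi> x \<in> G" "\<phi>' x \<in> G" "\<psi>' x \<in> G" if "x \<in> G" for x using i that by auto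
  show ?thesis unfolding aut_pair_def using c1 c2 im inv by (simp add: image_subset_iff)
qed

lemma kobayashi_chain_map:
  assumes G: "G \<subseteq> cspace I" and \<phi>: "\<And>j. j \<in> I \<Longrightarrow> holo_on I G (\<lambda>x. \<phi> x j)" "\<phi> ` G \<subseteq> G"
    and ch: "kobayashi_chain I G z w n f a b"
  shows "kobayashi_chain I G (\<phi> z) (\<phi> w) n (\<lambda>j \<zeta>. \<phi> (f j \<zeta>)) a b"
proof -
  have "(\<lambda>\<zeta>. \<phi> (f j \<zeta>)) \<in> holomorphic_discs I G" if "f j \<in> holomorphic_discs I G" for j
  proof -
    have "\<forall>i\<in>I. (\<lambda>\<zeta>. f j \<zeta> i) holomorphic_on ball 0 1" "f j ` ball 0 1 \<subseteq> G"
      using that by (auto simp: holomorphic_discs_def)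
    then have "(\<lambda>\<zeta>. \<phi> (f j \<zeta>) i) holomorphic_on ball 0 1" if "i \<in> I" for i
      by (intro holo_on_curve_holomorphic[OF \<phi>(1)[OF that] G]) simp_all
    moreover have "(\<lambda>\<zeta>. \<phi> (f j \<zeta>)) ` ball 0 1 \<subseteq> G"
      using image_mono[OF \<open>f j ` ball 0 1 \<subseteq> G\<close>, of \<phi>] \<phi>(2) by (simp add: image_image)
    ultimately show ?thesis by (simp add: holomorphic_discs_def)
  qed
  then show ?thesis using ch unfolding kobayashi_chain_def by simp
qed

lemma kobayashi_dist_aut:
  assumes G: "G \<subseteq> cspace I" and a: "aut_pair I G \<phi> \<psi>" and z: "z \<in> G" and w: "w \<in> G"
  shows "kobayashi_dist I G (\<phi> z) (\<phi> w) = kobayashi_dist I G z w"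
proof -
  have inv: "\<psi> (\<phi> z) = z" "\<psi> (\<phi> w) = w" using a z w by (auto simp: aut_pair_def)
  have 1: "\<exists>f'. kobayashi_chain I G (\<phi> z) (\<phi> w) n f' c d" if "kobayashi_chain I G z w n f c d" for n f c d
    using kobayashi_chain_map[OF G _ _ that, of \<phi>] a unfolding aut_pair_def by blast
  have 2: "\<exists>f'. kobayashi_chain I G z w n f' c d" if "kobayashi_chain I G (\<phi> z) (\<phi> w) n f c d" for n f c d
    using kobayashi_chain_map[OF G _ _ that, of \<psi>] a unfolding aut_pair_def inv by blast
  have "(\<exists>n f c d. s = (\<Sum>j<n. poincare_dist (c j) (d j)) \<and> kobayashi_chain I G (\<phi> z) (\<phi> w) n f c d) \<longleftrightarrow>
        (\<exists>n f c d. s = (\<Sum>j<n. poincare_dist (c j) (d j)) \<and> kobayashi_chain I G z w n f c d)" for s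
  proof
    assume "\<exists>n f c d. s = (\<Sum>j<n. poincare_dist (c j) (d j)) \<and> kobayashi_chain I G (\<phi> z) (\<phi> w) n f c d"
    then obtain n f c d where s: "s = (\<Sum>j<n. poincare_dist (c j) (d j))"
      and "kobayashi_chain I G (\<phi> z) (\<phi> w) n f c d" by (elim exE conjE)
    from 2[OF this(2)] obtain f' where "kobayashi_chain I G z w n f' c d" ..
    with s show "\<exists>n f c d. s = (\<Sum>j<n. poincare_dist (c j) (d j)) \<and> kobayashi_chain I G z w n f c d"
      by (intro exI conjI)
  next
    assume "\<exists>n f c d. s = (\<Sum>j<n. poincare_dist (c j) (d j)) \<and> kobayashi_chain I G z w n f c d"
    then obtain n f c d where s: "s = (\<Sum>j<n. poincare_dist (c j) (d j))"
      and "kobayashi_chain I G z w n f c d" by (elim exE conjE)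
    from 1[OF this(2)] obtain f' where "kobayashi_chain I G (\<phi> z) (\<phi> w) n f' c d" ..
    with s show "\<exists>n f c d. s = (\<Sum>j<n. poincare_dist (c j) (d j)) \<and> kobayashi_chain I G (\<phi> z) (\<phi> w) n f c d"
      by (intro exI conjI)
  qed
  then show ?thesis unfolding kobayashi_dist_def by simp
qed

lemma kobayashi_ball_aut:
  assumes G: "G \<subseteq> cspace I" and a: "aut_pair I G \<phi> \<psi>" and z: "z \<in> G"
  shows "kobayashi_ball I G (\<phi> z) r = \<phi> ` kobayashi_ball I G z r"
proof -
  have i: "\<phi> ` G \<subseteq> G" "\<psi> ` G \<subseteq> G" and inv: "\<And>x. x \<in> G \<Longrightarrow> \<phi> (\<psi> x) = x" using a by (auto simp: aut_pair_def)
  show ?thesis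
  proof
    show "kobayashi_ball I G (\<phi> z) r \<subseteq> \<phi> ` kobayashi_ball I G z r"
    proof
      fix w assume "w \<in> kobayashi_ball I G (\<phi> z) r"
      then have w: "w \<in> G" "kobayashi_dist I G (\<phi> z) w < r" by (auto simp: kobayashi_ball_def)
      have "\<psi> w \<in> G" using i w by auto
      moreover have "kobayashi_dist I G z (\<psi> w) < r"
        using kobayashi_dist_aut[OF G a z \<open>\<psi> w \<in> G\<close>] w inv by simp
      ultimately have "\<psi> w \<in> kobayashi_ball I G z r" by (simp add: kobayashi_ball_def)
      then show "w \<in> \<phi> ` kobayashi_ball I G z r" using inv[OF w(1)] by (metis imageI)
    qed
    show "\<phi> ` kobayashi_ball I G z r \<subseteq> kobayashi_ball I G (\<phi> z) r"
      using kobayashi_dist_aut[OF G a z] i by (auto simp: kobayashi_ball_def)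
  qed
qed

lemma univalent_maps_iff:
  "finite I \<Longrightarrow> G \<subseteq> cspace I \<Longrightarrow>
    f \<in> univalent_maps I G H \<longleftrightarrow> (\<forall>j\<in>I. holo_on I G (\<lambda>x. f x j)) \<and> inj_on f G \<and> f ` G \<subseteq> H"
  by (simp add: univalent_maps_def holomorphic_map_iff)

lemma aut_inj: "aut_pair I G \<phi> \<psi> \<Longrightarrow> inj_on \<phi> G"
  by (rule inj_on_inverseI[of _ \<psi>]) (auto simp: aut_pair_def)

lemma aut_image: "aut_pair I G \<phi> \<psi> \<Longrightarrow> \<phi> ` G = G"
  unfolding aut_pair_def by (metis image_subset_iff rev_image_eqI subsetI subset_antisym)

text \<open>Precomposition with \<open>\<phi>\<close> turns competitors at \<open>\<phi> z\<close>
  into competitors at \<open>z\<close> with the same image. The reverse inclusion is this lemma for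
  the inverse automorphism.\<close>

lemma squeezing_aut_subset:
  assumes I: "finite I" and G: "G \<subseteq> cspace I" and a: "aut_pair I G \<phi> \<psi>" and z: "z \<in> G"
  shows "{r. r > 0 \<and> (\<exists>f \<in> univalent_maps I G (cball0 I 1). f (\<phi> z) = (\<lambda>_. 0) \<and> cball0 I r \<subseteq> f ` G)}
     \<subseteq> {r. r > 0 \<and> (\<exists>f \<in> univalent_maps I G (cball0 I 1). f z = (\<lambda>_. 0) \<and> cball0 I r \<subseteq> f ` G)}"
proof (rule subsetI)
  fix r assume "r \<in> {r. r > 0 \<and> (\<exists>f \<in> univalent_maps I G (cball0 I 1). f (\<phi> z) = (\<lambda>_. 0) \<and> cball0 I r \<subseteq> f ` G)}"
  then obtain f where r: "r > 0" and f: "f \<in> univalent_maps I G (cball0 I 1)" "f (\<phi> z) = (\<lambda>_. 0)" "cball0 I r \<subseteq> f ` G"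
    by blast
  have im: "(\<lambda>x. f (\<phi> x)) ` G = f ` G" using aut_image[OF a] by (metis image_image)
  have fc: "\<forall>j\<in>I. holo_on I G (\<lambda>x. f x j)" "inj_on f G" "f ` G \<subseteq> cball0 I 1"
    using f(1) by (simp_all add: univalent_maps_iff[OF I G])
  have "holo_on I G (\<lambda>x. f (\<phi> x) j)" if "j \<in> I" for j
    by (rule holo_on_compose[OF _ _ G]) (use a fc that in \<open>auto simp: aut_pair_def\<close>)
  moreover have "inj_on (\<lambda>x. f (\<phi> x)) G"
    using comp_inj_on[OF aut_inj[OF a]] fc(2) aut_image[OF a] by (simp add: o_def)
  ultimately have "(\<lambda>x. f (\<phi> x)) \<in> univalent_maps I G (cball0 I 1)"
    unfolding univalent_maps_iff[OF I G] using im fc(3) by simp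
  then show "r \<in> {r. r > 0 \<and> (\<exists>f \<in> univalent_maps I G (cball0 I 1). f z = (\<lambda>_. 0) \<and> cball0 I r \<subseteq> f ` G)}"
    using r f im by (intro CollectI conjI bexI[of _ "\<lambda>x. f (\<phi> x)"]) simp_all
qed

lemma squeezing_function_aut:
  assumes "finite I" "G \<subseteq> cspace I" "aut_pair I G \<phi> \<psi>" "z \<in> G"
  shows "squeezing_function I G (\<phi> z) = squeezing_function I G z"
proof -
  have "\<phi> z \<in> G" "\<psi> (\<phi> z) = z" using assms by (auto simp: aut_pair_def)
  then show ?thesis unfolding squeezing_function_def
    using squeezing_aut_subset[OF assms] squeezing_aut_subset[OF assms(1,2) aut_pair_sym[OF assms(3)], of "\<phi> z"]
    by (intro arg_cong[of _ _ Sup] antisym) auto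
qed

lemma cball0_cspace: "cball0 I r \<subseteq> cspace I"
  by (auto simp: cball0_def)

lemma fridman_aut_subset:
  assumes I: "finite I" and G: "G \<subseteq> cspace I" and a: "aut_pair I G \<phi> \<psi>" and z: "z \<in> G"
  shows "{tanh r | r. r > 0 \<and> (\<exists>f \<in> univalent_maps I (cball0 I 1) G. f (\<lambda>_. 0) = z \<and> kobayashi_ball I G z r \<subseteq> f ` cball0 I 1)}
     \<subseteq> {tanh r | r. r > 0 \<and> (\<exists>f \<in> univalent_maps I (cball0 I 1) G. f (\<lambda>_. 0) = \<phi> z \<and> kobayashi_ball I G (\<phi> z) r \<subseteq> f ` cball0 I 1)}"
proof (rule subsetI)
  fix s assume "s \<in> {tanh r | r. r > 0 \<and> (\<exists>f \<in> univalent_maps I (cball0 I 1) G. f (\<lambda>_. 0) = z \<and> kobayashi_ball I G z r \<subseteq> f ` cball0 I 1)}"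
  then obtain r f where s: "s = tanh r" and r: "r > 0" and f: "f \<in> univalent_maps I (cball0 I 1) G"
    "kobayashi_ball I G z r \<subseteq> f ` cball0 I 1" and zf: "f (\<lambda>_. 0) = z"
    by blast
  have fc: "\<forall>j\<in>I. holo_on I (cball0 I 1) (\<lambda>x. f x j)" "inj_on f (cball0 I 1)" "f ` cball0 I 1 \<subseteq> G"
    using f(1) by (simp_all add: univalent_maps_iff[OF I cball0_cspace])
  have "holo_on I (cball0 I 1) (\<lambda>x. \<phi> (f x) j)" if "j \<in> I" for j
    by (rule holo_on_compose[OF _ fc(3) G]) (use a fc that in \<open>auto simp: aut_pair_def\<close>)
  moreover have "inj_on (\<lambda>x. \<phi> (f x)) (cball0 I 1)"
    using comp_inj_on[OF fc(2) inj_on_subset[OF aut_inj[OF a] fc(3)]] by (simp add: o_def)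
  moreover have "(\<lambda>x. \<phi> (f x)) ` cball0 I 1 \<subseteq> G"
    using image_mono[OF fc(3), of \<phi>] aut_image[OF a] by (simp add: image_image)
  ultimately have u: "(\<lambda>x. \<phi> (f x)) \<in> univalent_maps I (cball0 I 1) G"
    unfolding univalent_maps_iff[OF I cball0_cspace] by simp
  have "kobayashi_ball I G (\<phi> z) r \<subseteq> (\<lambda>x. \<phi> (f x)) ` cball0 I 1"
    unfolding kobayashi_ball_aut[OF G a z] using image_mono[OF f(2), of \<phi>] by (simp add: image_image)
  then show "s \<in> {tanh r | r. r > 0 \<and> (\<exists>f \<in> univalent_maps I (cball0 I 1) G. f (\<lambda>_. 0) = \<phi> z \<and> kobayashi_ball I G (\<phi> z) r \<subseteq> f ` cball0 I 1)}"
    unfolding mem_Collect_eq using s r u zf by (intro exI[of _ r] conjI bexI[of _ "\<lambda>x. \<phi> (f x)"]) simp_all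
qed

lemma fridman_invariant_aut:
  assumes "finite I" "G \<subseteq> cspace I" "aut_pair I G \<phi> \<psi>" "z \<in> G"
  shows "fridman_invariant I G (\<phi> z) = fridman_invariant I G z"
proof -
  have "\<phi> z \<in> G" "\<psi> (\<phi> z) = z" using assms by (auto simp: aut_pair_def)
  then show ?thesis unfolding fridman_invariant_def
    using fridman_aut_subset[OF assms] fridman_aut_subset[OF assms(1,2) aut_pair_sym[OF assms(3)], of "\<phi> z"]
    by (intro arg_cong[of _ _ Sup] antisym) auto
qed

subsection \<open>Linear maps\<close>

lemma lin_holo_on: "finite I \<Longrightarrow> j \<in> I \<Longrightarrow> holo_on I G (\<lambda>x. lin I A x j)"
  unfolding lin_def by (simp only: if_True) (intro holo_on_sum holo_on_mult holo_on_const holo_on_coord)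

lemma lin_zero: "lin I A (\<lambda>_. 0) = (\<lambda>_. 0)"
  by (auto simp: lin_def)

lemma lin_smult: "lin I (\<lambda>i j. a * A i j) x = (\<lambda>i. a * lin I A x i)"
  unfolding lin_def by (auto simp: sum_distrib_left mult.assoc)

text \<open>An enumeration of \<open>I\<close> turns \<open>A\<close> into an ordinary square
  matrix, and the adjugate divided by the determinant is carried back.\<close>

lemma lin_invertible:
  assumes I: "finite I" and inj: "\<And>x. x \<in> cspace I \<Longrightarrow> lin I A x = (\<lambda>_. 0) \<Longrightarrow> x = (\<lambda>_. 0)"
  obtains B where "\<And>x. x \<in> cspace I \<Longrightarrow> lin I B (lin I A x) = x" "\<And>x. x \<in> cspace I \<Longrightarrow> lin I A (lin I B x) = x"
proof -
  obtain e where e: "bij_betw e {..<card I} I"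
    using I by (metis atLeast0LessThan ex_bij_betw_nat_finite)
  define n where "n = card I"
  define e' where "e' = the_inv_into {..<n} e"
  have ee: "e' (e k) = k" "e k \<in> I" if "k < n" for k
    using that e by (auto simp: e'_def n_def bij_betw_def the_inv_into_f_f)
  have e'I: "e' i < n" "e (e' i) = i" if "i \<in> I" for i
  proof -
    have "i \<in> e ` {..<n}" using that e by (simp add: bij_betw_def n_def)
    then obtain k where "k < n" "i = e k" by auto
    then show "e' i < n" "e (e' i) = i" using ee by auto
  qed
  have sum_e: "(\<Sum>i\<in>I. h i) = (\<Sum>k<n. h (e k))" for h :: "'a \<Rightarrow> complex"
    unfolding n_def by (rule sum.reindex_bij_betw[OF e, symmetric])
  define M where "M = mat n n (\<lambda>(k, l). A (e k) (e l))"
  have "fun_det n (\<lambda>k l. A (e k) (e l)) \<noteq> 0"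
  proof
    assume "fun_det n (\<lambda>k l. A (e k) (e l)) = 0"
    then obtain v where v: "\<exists>i<n. v i \<noteq> 0" "\<forall>i<n. (\<Sum>j<n. A (e i) (e j) * v j) = 0"
      unfolding fun_det_eq_0_iff by blast
    define x where "x i = (if i \<in> I then v (e' i) else 0)" for i
    have lx: "lin I A x = (\<lambda>_. 0)"
    proof
      fix i show "lin I A x i = 0"
        using v(2) e'I[of i] ee by (auto simp: lin_def sum_e x_def)
    qed
    have "x \<in> cspace I" by (simp add: x_def cspace_def)
    then have x0: "x = (\<lambda>_. 0)" using lx by (rule inj)
    obtain k where "k < n" "v k \<noteq> 0" using v(1) by blast
    then have "x (e k) \<noteq> 0" using ee[of k] by (simp add: x_def)
    then show False using x0 by simp
  qed
  then have d: "det M \<noteq> 0" by (simp add: fun_det_def M_def)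
  have MM: "M \<in> carrier_mat n n" by (simp add: M_def)
  define Q where "Q = adj_mat M"
  have Q: "Q \<in> carrier_mat n n" "M * Q = det M \<cdot>\<^sub>m 1\<^sub>m n" "Q * M = det M \<cdot>\<^sub>m 1\<^sub>m n"
    using adj_mat[OF MM] by (auto simp: Q_def)
  define B where "B i j = Q $$ (e' i, e' j) / det M" for i j
  have MQ: "(\<Sum>m<n. A (e k) (e m) * B (e m) (e l)) = (if k = l then 1 else 0)" if "k < n" "l < n" for k l
  proof -
    have "(M * Q) $$ (k, l) = (\<Sum>m<n. A (e k) (e m) * Q $$ (m, l))"
      using that Q(1) MM by (simp add: scalar_prod_def M_def atLeast0LessThan)
    then have "(\<Sum>m<n. A (e k) (e m) * Q $$ (m, l)) = (if k = l then det M else 0)"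
      using that by (cases "k = l") (simp_all add: Q(2))
    then have "(\<Sum>m<n. A (e k) (e m) * Q $$ (m, l)) / det M = (if k = l then 1 else 0)" using d by simp
    then show ?thesis using that ee by (simp add: B_def sum_divide_distrib)
  qed
  have QM: "(\<Sum>m<n. B (e k) (e m) * A (e m) (e l)) = (if k = l then 1 else 0)" if "k < n" "l < n" for k l
  proof -
    have "(Q * M) $$ (k, l) = (\<Sum>m<n. Q $$ (k, m) * A (e m) (e l))"
      using that Q(1) MM by (simp add: scalar_prod_def M_def atLeast0LessThan)
    then have "(\<Sum>m<n. Q $$ (k, m) * A (e m) (e l)) = (if k = l then det M else 0)"
      using that by (cases "k = l") (simp_all add: Q(3))
    then have "(\<Sum>m<n. Q $$ (k, m) * A (e m) (e l)) / det M = (if k = l then 1 else 0)" using d by simp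
    then show ?thesis using that ee by (simp add: B_def sum_divide_distrib)
  qed
  have factor_of: "lin I X (lin I Y x) = x" if x: "x \<in> cspace I"
    and XY: "\<And>k l. k < n \<Longrightarrow> l < n \<Longrightarrow> (\<Sum>m<n. X (e k) (e m) * Y (e m) (e l)) = (if k = l then 1 else 0)" for X Y x
  proof (rule cspace_eqI[OF lin_cspace x])
    fix i assume i: "i \<in> I"
    define k where "k = e' i"
    have k: "k < n" "e k = i" using e'I[OF i] by (auto simp: k_def)
    have "lin I X (lin I Y x) i = (\<Sum>m<n. X i (e m) * (\<Sum>l<n. Y (e m) (e l) * x (e l)))"
      using i ee by (simp add: lin_def sum_e)
    also have "\<dots> = (\<Sum>l<n. (\<Sum>m<n. X i (e m) * Y (e m) (e l)) * x (e l))"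
      unfolding sum_distrib_left sum_distrib_right by (subst sum.swap) (simp add: mult.assoc)
    also have "\<dots> = (\<Sum>l<n. if k = l then x (e l) else 0)"
      by (rule sum.cong) (use XY[OF k(1)] k(2) in auto)
    also have "\<dots> = x i" using k by simp
    finally show "lin I X (lin I Y x) i = x i" .
  qed
  show ?thesis by (rule that[of B]) (use factor_of QM MQ in blast)+
qed

subsection \<open>The Euclidean ball\<close>

lemma cauchy_schwarz_pairing: "norm (pairing I l x) \<le> cnorm I l * cnorm I x"
proof -
  have "norm (pairing I l x) \<le> (\<Sum>i\<in>I. \<bar>norm (l i)\<bar> * \<bar>norm (x i)\<bar>)"
    unfolding pairing_def by (rule order_trans[OF norm_sum]) (simp add: norm_mult)
  also have "\<dots> \<le> cnorm I l * cnorm I x" unfolding cnorm_def by (rule L2_set_mult_ineq)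
  finally show ?thesis .
qed

lemma cnorm_scale: "cnorm I (\<lambda>i. a * x i) = norm a * cnorm I x"
  unfolding cnorm_def by (simp add: norm_mult L2_set_right_distrib)

text \<open>The Euclidean norm is its own dual; the extremal functional at \<open>x\<close> is the
  conjugate of \<open>x\<close>, normalized.\<close>

lemma cnormed_cnorm:
  assumes I: "finite I" "I \<noteq> {}"
  shows "cnormed I {l. cnorm I l \<le> 1} (cnorm I)"
proof
  fix x assume x: "x \<in> cspace I"
  show "norm (pairing I l x) \<le> cnorm I x" if "l \<in> {l. cnorm I l \<le> 1}" for l
    using cauchy_schwarz_pairing[of I l x] mult_right_mono[of "cnorm I l" 1 "cnorm I x"] that cnorm_nonneg[of I x] by simp
  fix b assume b: "\<And>l. l \<in> {l. cnorm I l \<le> 1} \<Longrightarrow> norm (pairing I l x) \<le> b"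
  show "cnorm I x \<le> b"
  proof (cases "cnorm I x = 0")
    case True
    have "norm (pairing I (\<lambda>_. 0) x) \<le> b" by (rule b) simp
    then show ?thesis using True by (simp add: pairing_def)
  next
    case False
    define c where "c = complex_of_real (1 / cnorm I x)"
    have nc: "norm c = 1 / cnorm I x" unfolding c_def norm_of_real using cnorm_nonneg[of I x] by simp
    have pos: "cnorm I x > 0" using False cnorm_nonneg[of I x] by simp
    have "cnorm I (\<lambda>i. cnj (x i)) = cnorm I x" by (simp add: cnorm_def)
    then have "cnorm I (\<lambda>i. c * cnj (x i)) = 1" unfolding cnorm_scale nc using pos by simp
    then have le: "norm (pairing I (\<lambda>i. c * cnj (x i)) x) \<le> b" by (intro b) simp
    have "pairing I (\<lambda>i. c * cnj (x i)) x = c * (\<Sum>i\<in>I. cnj (x i) * x i)"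
      by (simp add: pairing_def sum_distrib_left mult.assoc)
    also have "(\<Sum>i\<in>I. cnj (x i) * x i) = complex_of_real ((cnorm I x)\<^sup>2)"
      unfolding cnorm_power2 of_real_sum by (rule sum.cong) (simp_all only: complex_norm_square mult.commute)
    finally have "norm (pairing I (\<lambda>i. c * cnj (x i)) x) = norm c * (cnorm I x)\<^sup>2"
      by (simp only: norm_mult norm_of_real) simp
    also have "\<dots> = cnorm I x" unfolding nc using pos by (simp add: power2_eq_square)
    finally show ?thesis using le by simp
  qed
next
  show "\<exists>c>0. \<forall>x\<in>cspace I. c * cnorm I x \<le> cnorm I x" by (rule exI[of _ 1]) simp
  show "\<exists>C. \<forall>x\<in>cspace I. cnorm I x \<le> C * cnorm I x" by (rule exI[of _ 1]) simp
qed (use I in auto)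

subsection \<open>The common value of the two invariants as a Banach-Mazur type constant\<close>

text \<open>The supremum of this set is the reciprocal of the Banach-Mazur distance from
  \<open>N\<close> to a Hilbert norm. Requiring \<open>t < 1\<close> keeps \<open>artanh t\<close>
  meaningful for every member.\<close>

definition hilbert_ratios :: "'i set \<Rightarrow> (('i \<Rightarrow> complex) \<Rightarrow> real) \<Rightarrow> real set" where
  "hilbert_ratios I N = {t. 0 < t \<and> t < 1 \<and>
     (\<exists>A. \<forall>x\<in>cspace I. t * N x \<le> cnorm I (lin I A x) \<and> cnorm I (lin I A x) \<le> N x)}"

context cnormed
begin

sublocale ball: cnormed I "{l. cnorm I l \<le> 1}" "cnorm I"
  by (rule cnormed_cnorm[OF fin ne])

lemma euclidean_ball: "ball.unit_ball = cball0 I 1"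
  by (simp add: ball.unit_ball_def cball0_def)

lemma expanding_lin_invertible:
  assumes "t > 0" "\<And>x. x \<in> cspace I \<Longrightarrow> t * N x \<le> M (lin I A x)" "M (\<lambda>_. 0) = 0"
  shows "\<exists>B. \<forall>x\<in>cspace I. lin I B (lin I A x) = x \<and> lin I A (lin I B x) = x"
proof (rule lin_invertible[OF fin])
  fix x assume x: "x \<in> cspace I" "lin I A x = (\<lambda>_. 0)"
  have "t * N x \<le> 0" using assms(2)[OF x(1)] x(2) assms(3) by simp
  then have "N x \<le> 0" using assms(1) by (simp add: mult_le_0_iff)
  then have "N x = 0" using N_nonneg[OF x(1)] by simp
  then show "x = (\<lambda>_. 0)" using N_eq_0[OF x(1)] by simp
qed blast

lemma hilbert_ratios_downward: "t \<in> hilbert_ratios I N \<Longrightarrow> 0 < s \<Longrightarrow> s \<le> t \<Longrightarrow> s \<in> hilbert_ratios I N"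
proof -
  assume t: "t \<in> hilbert_ratios I N" and s: "0 < s" "s \<le> t"
  obtain A where "\<forall>x\<in>cspace I. t * N x \<le> cnorm I (lin I A x) \<and> cnorm I (lin I A x) \<le> N x" and t1: "t < 1"
    using t by (auto simp: hilbert_ratios_def)
  moreover have "s * N x \<le> t * N x" if "x \<in> cspace I" for x using s N_nonneg[OF that] by (intro mult_right_mono) auto
  ultimately have "\<forall>x\<in>cspace I. s * N x \<le> cnorm I (lin I A x) \<and> cnorm I (lin I A x) \<le> N x" by (meson order_trans)
  then show ?thesis using s t1 by (auto simp: hilbert_ratios_def)
qed

lemma hilbert_ratios_le:
  assumes "\<forall>x\<in>cspace I. t * N x \<le> M x \<and> M x \<le> N x"
  shows "t \<le> 1"
proof -
  obtain x where x: "x \<in> cspace I" "N x = 1" using exists_nonzero by blast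
  then show ?thesis using assms by (metis mult.right_neutral order_trans)
qed

lemma hilbert_ratios_nonempty: "hilbert_ratios I N \<noteq> {}"
proof -
  obtain c where c: "c > 0" "\<forall>x\<in>cspace I. c * cnorm I x \<le> N x" using N_lower by blast
  obtain C where C: "\<forall>x\<in>cspace I. N x \<le> C * cnorm I x" using N_upper by blast
  define C' where "C' = max C 1"
  have C': "C' > 0" "N x \<le> C' * cnorm I x" if "x \<in> cspace I" for x
    using C that mult_right_mono[of C C' "cnorm I x"] cnorm_nonneg[of I x] by (auto simp: C'_def intro: order_trans)
  define t where "t = min (c / C') (1 / 2)"
  have t: "0 < t" "t < 1" "t \<le> c / C'" using c C'(1)[OF zero_cspace] by (auto simp: t_def)
  define A where "A i j = (if i = j then complex_of_real c else 0)" for i j :: 'i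
  have lin: "lin I A x = (\<lambda>i. complex_of_real c * x i)" if "x \<in> cspace I" for x
    using that fin by (auto simp: lin_def A_def cspace_def if_distrib[of "\<lambda>y. y * _"] cong: if_cong)
  have nl: "cnorm I (lin I A x) = c * cnorm I x" if "x \<in> cspace I" for x
    unfolding lin[OF that] cnorm_scale using c(1) by simp
  have lo: "t * N x \<le> c * cnorm I x" if "x \<in> cspace I" for x
  proof -
    have "t * N x \<le> (c / C') * (C' * cnorm I x)"
      using t C'[OF that] N_nonneg[OF that] c(1) by (intro mult_mono) auto
    also have "\<dots> = c * cnorm I x" using C'(1)[OF that] by simp
    finally show ?thesis .
  qed
  have "t \<in> hilbert_ratios I N"
    unfolding hilbert_ratios_def mem_Collect_eq
    by (intro conjI t exI[of _ A] ballI) (use nl lo c in auto)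
  then show ?thesis by blast
qed

lemma hilbert_ratios_bdd: "bdd_above (hilbert_ratios I N)"
  by (rule bdd_aboveI[of _ 1]) (auto simp: hilbert_ratios_def)

lemma Sup_hilbert_ratios_pos: "0 < Sup (hilbert_ratios I N)" and Sup_hilbert_ratios_le: "Sup (hilbert_ratios I N) \<le> 1"
proof -
  obtain t where "t \<in> hilbert_ratios I N" using hilbert_ratios_nonempty by blast
  then show "0 < Sup (hilbert_ratios I N)"
    using cSup_upper[OF _ hilbert_ratios_bdd, of t] by (auto simp: hilbert_ratios_def)
  show "Sup (hilbert_ratios I N) \<le> 1"
    by (rule cSup_least[OF hilbert_ratios_nonempty]) (auto simp: hilbert_ratios_def)
qed

lemma below_Sup_hilbert_ratios:
  assumes "0 < t" "t < Sup (hilbert_ratios I N)"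
  shows "t \<in> hilbert_ratios I N"
proof -
  obtain s where "s \<in> hilbert_ratios I N" "t < s" using assms(2) less_cSupD[OF hilbert_ratios_nonempty] by blast
  then show ?thesis using hilbert_ratios_downward assms(1) by simp
qed

text \<open>The value \<open>t = 1\<close> occurs when \<open>N\<close> is itself Hermitian; it is
  reached from below by smaller ratios.\<close>

lemma ratio_le_Sup:
  assumes t: "0 < t" and A: "\<forall>x\<in>cspace I. t * N x \<le> cnorm I (lin I A x) \<and> cnorm I (lin I A x) \<le> N x"
  shows "t \<le> Sup (hilbert_ratios I N)"
proof (rule dense_le_bounded[OF t])
  fix s assume s: "0 < s" "s < t"
  have t1: "t \<le> 1" by (rule hilbert_ratios_le[OF A])
  have "s * N x \<le> t * N x" if "x \<in> cspace I" for x using s N_nonneg[OF that] by (intro mult_right_mono) auto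
  then have "\<forall>x\<in>cspace I. s * N x \<le> cnorm I (lin I A x) \<and> cnorm I (lin I A x) \<le> N x"
    using A by (meson order_trans)
  then have "s \<in> hilbert_ratios I N" using s t1 by (auto simp: hilbert_ratios_def)
  then show "s \<le> Sup (hilbert_ratios I N)" by (rule cSup_upper[OF _ hilbert_ratios_bdd])
qed

lemma univalent_unit_ball_iff:
  "f \<in> univalent_maps I unit_ball H \<longleftrightarrow> (\<forall>j\<in>I. holo_on I unit_ball (\<lambda>x. f x j)) \<and> inj_on f unit_ball \<and> f ` unit_ball \<subseteq> H"
  by (rule univalent_maps_iff[OF fin unit_ball_cspace])

text \<open>A competing map gives its derivative at 0 as the matrix \<open>A\<close>; conversely an
  admissible matrix is itself a competing map.\<close>

lemma squeezing_zero: "squeezing_function I unit_ball (\<lambda>_. 0) = Sup (hilbert_ratios I N)"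
proof -
  define S where "S = {r. r > 0 \<and> (\<exists>f \<in> univalent_maps I unit_ball (cball0 I 1). f (\<lambda>_. 0) = (\<lambda>_. 0) \<and> cball0 I r \<subseteq> f ` unit_ball)}"
  have upper: "r \<le> Sup (hilbert_ratios I N)" if rS: "r \<in> S" for r
  proof -
    obtain f where r: "r > 0" and f: "f \<in> univalent_maps I unit_ball (cball0 I 1)" "f (\<lambda>_. 0) = (\<lambda>_. 0)" "cball0 I r \<subseteq> f ` unit_ball"
      using rS unfolding S_def by blast
    interpret two_cnormed I \<Lambda> N "{l. cnorm I l \<le> 1}" "cnorm I" f
      by unfold_locales (use f euclidean_ball in auto)
    have sub: "{y \<in> cspace I. cnorm I y < r} \<subseteq> f ` unit_ball" using f(3) by (simp add: cball0_def)
    show ?thesis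
      by (rule ratio_le_Sup[OF r]) (use derivative_expands[OF r sub] derivative_contracts in blast)
  qed
  have lower: "t \<in> S" if "t \<in> hilbert_ratios I N" for t
  proof -
    obtain A where t: "0 < t" "t < 1" and A: "\<And>x. x \<in> cspace I \<Longrightarrow> t * N x \<le> cnorm I (lin I A x)" "\<And>x. x \<in> cspace I \<Longrightarrow> cnorm I (lin I A x) \<le> N x"
      using \<open>t \<in> hilbert_ratios I N\<close> by (auto simp: hilbert_ratios_def)
    obtain B where "\<forall>x\<in>cspace I. lin I B (lin I A x) = x \<and> lin I A (lin I B x) = x"
      using expanding_lin_invertible[where M = "cnorm I", OF t(1) A(1) cnorm_zero] by (rule exE)
    then have B: "\<And>x. x \<in> cspace I \<Longrightarrow> lin I B (lin I A x) = x" "\<And>x. x \<in> cspace I \<Longrightarrow> lin I A (lin I B x) = x" by auto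
    have "inj_on (lin I A) unit_ball" by (rule inj_on_inverseI[of _ "lin I B"]) (use B unit_ball_cspace in blast)
    moreover have "lin I A ` unit_ball \<subseteq> cball0 I 1"
    proof
      fix y assume "y \<in> lin I A ` unit_ball"
      then obtain x where x: "x \<in> cspace I" "N x < 1" "y = lin I A x" by (auto simp: unit_ball_def)
      then show "y \<in> cball0 I 1" using A(2)[OF x(1)] by (simp add: cball0_def)
    qed
    ultimately have u: "lin I A \<in> univalent_maps I unit_ball (cball0 I 1)"
      unfolding univalent_unit_ball_iff using lin_holo_on[OF fin] by blast
    have "cball0 I t \<subseteq> lin I A ` unit_ball"
    proof
      fix y assume "y \<in> cball0 I t"
      then have y: "y \<in> cspace I" "cnorm I y < t" by (auto simp: cball0_def)
      have "t * N (lin I B y) < t * 1" using A(1)[OF lin_cspace, of B y] B(2)[OF y(1)] y(2) by simp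
      then have "N (lin I B y) < 1" using t(1) by (simp only: mult_less_cancel_left_pos)
      then have "lin I B y \<in> unit_ball" by (simp add: unit_ball_def)
      then show "y \<in> lin I A ` unit_ball" using B(2)[OF y(1)] by (metis imageI)
    qed
    then show ?thesis unfolding S_def using t(1) u lin_zero by blast
  qed
  have "Sup S = Sup (hilbert_ratios I N)"
  proof (rule antisym)
    have "S \<noteq> {}" using lower hilbert_ratios_nonempty by blast
    then show "Sup S \<le> Sup (hilbert_ratios I N)" by (rule cSup_least) (rule upper)
    have "bdd_above S" using upper by (intro bdd_aboveI) 
    then show "Sup (hilbert_ratios I N) \<le> Sup S"
      by (intro cSup_subset_mono hilbert_ratios_nonempty) (use lower in auto)
  qed
  then show ?thesis by (simp add: squeezing_function_def S_def)
qed

text \<open>Here the competitors go from the Euclidean ball into the unit ball, so the derivative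
  \<open>A\<close> satisfies \<open>s * cnorm I x \<le> N (lin I A x) \<le> cnorm I x\<close>. Its
  inverse times \<open>s\<close> is the matrix required in \<open>hilbert_ratios\<close>, with the
  same ratio.\<close>

lemma fridman_zero: "fridman_invariant I unit_ball (\<lambda>_. 0) = Sup (hilbert_ratios I N)"
proof -
  define S where "S = {tanh r | r. r > 0 \<and> (\<exists>f \<in> univalent_maps I (cball0 I 1) unit_ball. f (\<lambda>_. 0) = (\<lambda>_. 0) \<and> kobayashi_ball I unit_ball (\<lambda>_. 0) r \<subseteq> f ` cball0 I 1)}"
  have upper: "s \<le> Sup (hilbert_ratios I N)" if sS: "s \<in> S" for s
  proof -
    obtain r f where s: "s = tanh r" and r: "r > 0"
      and f: "f \<in> univalent_maps I (cball0 I 1) unit_ball" "f (\<lambda>_. 0) = (\<lambda>_. 0)" "kobayashi_ball I unit_ball (\<lambda>_. 0) r \<subseteq> f ` cball0 I 1"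
      using sS unfolding S_def by blast
    have s0: "s > 0" using r by (simp add: s)
    interpret F: two_cnormed I "{l. cnorm I l \<le> 1}" "cnorm I" \<Lambda> N f
      by unfold_locales (use f euclidean_ball in auto)
    have sub: "{y \<in> cspace I. N y < s} \<subseteq> f ` ball.unit_ball"
      using f(3) unfolding kobayashi_ball_zero s euclidean_ball .
    define A where "A = jacobian f (\<lambda>_. 0)"
    have A: "s * cnorm I x \<le> N (lin I A x)" "N (lin I A x) \<le> cnorm I x" if "x \<in> cspace I" for x
      using F.derivative_expands[OF s0 sub that] F.derivative_contracts[OF that] by (auto simp: A_def)
    obtain B where "\<forall>x\<in>cspace I. lin I B (lin I A x) = x \<and> lin I A (lin I B x) = x"
      using cnormed.expanding_lin_invertible[where M = N, OF cnormed_cnorm[OF fin ne] s0 A(1) N_zero] by (rule exE)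
    then have B: "\<And>x. x \<in> cspace I \<Longrightarrow> lin I B (lin I A x) = x" "\<And>x. x \<in> cspace I \<Longrightarrow> lin I A (lin I B x) = x" by auto
    show ?thesis
    proof (rule ratio_le_Sup[OF s0, of "\<lambda>i j. complex_of_real s * B i j"], intro ballI conjI)
      fix x assume x: "x \<in> cspace I"
      have eq: "cnorm I (lin I (\<lambda>i j. complex_of_real s * B i j) x) = s * cnorm I (lin I B x)"
        unfolding lin_smult cnorm_scale using s0 by simp
      show "s * N x \<le> cnorm I (lin I (\<lambda>i j. complex_of_real s * B i j) x)"
        unfolding eq using A(2)[OF lin_cspace, of B x] B(2)[OF x] s0 by simp
      show "cnorm I (lin I (\<lambda>i j. complex_of_real s * B i j) x) \<le> N x"
        unfolding eq using A(1)[OF lin_cspace, of B x] B(2)[OF x] by simp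
    qed
  qed
  have lower: "t \<in> S" if "t \<in> hilbert_ratios I N" for t
  proof -
    obtain A where t: "0 < t" "t < 1" and A: "\<And>x. x \<in> cspace I \<Longrightarrow> t * N x \<le> cnorm I (lin I A x)" "\<And>x. x \<in> cspace I \<Longrightarrow> cnorm I (lin I A x) \<le> N x"
      using \<open>t \<in> hilbert_ratios I N\<close> by (auto simp: hilbert_ratios_def)
    obtain B where "\<forall>x\<in>cspace I. lin I B (lin I A x) = x \<and> lin I A (lin I B x) = x"
      using expanding_lin_invertible[where M = "cnorm I", OF t(1) A(1) cnorm_zero] by (rule exE)
    then have B: "\<And>x. x \<in> cspace I \<Longrightarrow> lin I B (lin I A x) = x" "\<And>x. x \<in> cspace I \<Longrightarrow> lin I A (lin I B x) = x" by auto
    \<comment> \<open>The same exchange in the opposite direction: \<open>t\<close> times the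
      inverse of an admissible matrix maps the Euclidean ball into the unit ball and covers the
      \<open>N\<close>-ball of radius \<open>t\<close>.\<close>
    define T where "T = lin I (\<lambda>i j. complex_of_real t * B i j)"
    have Tx: "T x = (\<lambda>i. complex_of_real t * lin I B x i)" for x by (simp add: T_def lin_smult)
    have NT: "N (T x) = t * N (lin I B x)" for x unfolding Tx using N_scale[OF lin_cspace, of "complex_of_real t" B x] t(1) by simp
    have LT: "lin I A (T x) = (\<lambda>i. complex_of_real t * x i)" if "x \<in> cspace I" for x
      unfolding Tx lin_scale B(2)[OF that] ..
    have inj: "inj_on T (cball0 I 1)"
    proof (rule inj_onI)
      fix x y assume xy: "x \<in> cball0 I 1" "y \<in> cball0 I 1" "T x = T y"
      then have "(\<lambda>i. complex_of_real t * x i) = (\<lambda>i. complex_of_real t * y i)"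
        using LT[of x] LT[of y] by (simp add: cball0_def)
      then show "x = y" using t(1) by (auto simp: fun_eq_iff)
    qed
    have im: "T ` cball0 I 1 \<subseteq> unit_ball"
    proof
      fix y assume "y \<in> T ` cball0 I 1"
      then obtain x where x: "x \<in> cspace I" "cnorm I x < 1" "y = T x" by (auto simp: cball0_def)
      have "t * N (lin I B x) \<le> cnorm I x" using A(1)[OF lin_cspace, of B x] B(2)[OF x(1)] by simp
      then show "y \<in> unit_ball" using x NT[of x] by (simp add: unit_ball_def T_def)
    qed
    have u: "T \<in> univalent_maps I (cball0 I 1) unit_ball"
      unfolding univalent_maps_iff[OF fin cball0_cspace] using inj im lin_holo_on[OF fin] unfolding T_def by blast
    have t': "tanh (artanh t) = t" "artanh t > 0"
      using tanh_artanh_real[of t] tanh_real_pos_iff[of "artanh t"] t by auto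
    have "kobayashi_ball I unit_ball (\<lambda>_. 0) (artanh t) \<subseteq> T ` cball0 I 1"
    proof
      fix y assume "y \<in> kobayashi_ball I unit_ball (\<lambda>_. 0) (artanh t)"
      then have y: "y \<in> cspace I" "N y < t" unfolding kobayashi_ball_zero t' by auto
      define x where "x = (\<lambda>i. inverse (complex_of_real t) * lin I A y i)"
      have xc: "x \<in> cspace I" unfolding x_def by (rule scale_cspace[OF lin_cspace])
      have "norm (inverse (complex_of_real t)) = inverse t" using t(1) by (simp add: norm_inverse)
      then have "cnorm I x = inverse t * cnorm I (lin I A y)" unfolding x_def cnorm_scale by simp
      also have "\<dots> \<le> inverse t * N y" using A(2)[OF y(1)] t(1) by (intro mult_left_mono) auto
      also have "\<dots> < inverse t * t" using y(2) t(1) by (intro mult_strict_left_mono) auto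
      finally have "cnorm I x < 1" using t(1) by simp
      then have "x \<in> cball0 I 1" using xc by (simp add: cball0_def)
      moreover have "T x = y" unfolding Tx unfolding x_def lin_scale B(1)[OF y(1)] using t(1) by (auto simp: mult.assoc[symmetric])
      ultimately show "y \<in> T ` cball0 I 1" by blast
    qed
    moreover have "T (\<lambda>_. 0) = (\<lambda>_. 0)" unfolding T_def by (rule lin_zero)
    ultimately show ?thesis unfolding S_def mem_Collect_eq
      by (intro exI[of _ "artanh t"] conjI bexI[OF _ u]) (use t' in auto)
  qed
  have "Sup S = Sup (hilbert_ratios I N)"
  proof (rule antisym)
    have "S \<noteq> {}" using lower hilbert_ratios_nonempty by blast
    then show "Sup S \<le> Sup (hilbert_ratios I N)" by (rule cSup_least) (rule upper)
    have "bdd_above S" using upper by (intro bdd_aboveI)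
    then show "Sup (hilbert_ratios I N) \<le> Sup S"
      by (intro cSup_subset_mono hilbert_ratios_nonempty) (use lower in auto)
  qed
  then show ?thesis by (simp add: fridman_invariant_def S_def)
qed

proposition rho_unit_ball:
  assumes "homogeneous I unit_ball"
  shows "rho I unit_ball = Sup (hilbert_ratios I N)"
proof -
  have *: "fridman_invariant I unit_ball z = Sup (hilbert_ratios I N) \<and> squeezing_function I unit_ball z = Sup (hilbert_ratios I N)"
    if z: "z \<in> unit_ball" for z
  proof -
    obtain \<phi> \<psi> where a: "aut_pair I unit_ball \<phi> \<psi>" and "\<phi> (\<lambda>_. 0) = z"
      using assms z unfolding homogeneous_def by blast
    then show ?thesis
      using squeezing_function_aut[OF fin unit_ball_cspace a zero_unit_ball] fridman_invariant_aut[OF fin unit_ball_cspace a zero_unit_ball]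
      by (simp add: squeezing_zero fridman_zero)
  qed
  show ?thesis unfolding rho_def
  proof (rule the_equality)
    fix c assume "\<forall>z\<in>unit_ball. fridman_invariant I unit_ball z = c \<and> squeezing_function I unit_ball z = c"
    from bspec[OF this zero_unit_ball] show "c = Sup (hilbert_ratios I N)" using *[OF zero_unit_ball] by simp
  qed (use * in blast)
qed

end

subsection \<open>Cholesky factorization\<close>

text \<open>Induction on the index set. Splitting off the pivot \<open>a = h p p\<close> leaves the
  Schur complement \<open>h'\<close>, whose form at \<open>x\<close> is the form of \<open>h\<close>
  at a suitable extension of \<open>x\<close> to \<open>p\<close> and is therefore positive.\<close>

lemma cholesky:
  fixes h :: "'i \<Rightarrow> 'i \<Rightarrow> complex"
  assumes "finite I" "\<And>i j. i \<in> I \<Longrightarrow> j \<in> I \<Longrightarrow> h j i = cnj (h i j)"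
    "\<And>x. \<exists>i\<in>I. x i \<noteq> 0 \<Longrightarrow> Re (\<Sum>i\<in>I. \<Sum>j\<in>I. cnj (x i) * h i j * x j) > 0"
  shows "\<exists>A. \<forall>i\<in>I. \<forall>j\<in>I. (\<Sum>k\<in>I. cnj (A k i) * A k j) = h i j"
  using assms
proof (induction I arbitrary: h rule: finite_induct)
  case empty
  then show ?case by simp
next
  case (insert p F)
  \<comment> \<open>The local fact \<open>partial_deriv\<close> is positive definiteness of
    \<open>h\<close>.\<close>
  note herm = insert.prems(1) and partial_deriv = insert.prems(2)
  define a where "a = Re (h p p)"
  have "h p p = cnj (h p p)" by (rule herm) auto
  then have hpp: "h p p = complex_of_real a" by (auto simp: a_def complex_eq_iff)
  have ex: "(\<Sum>i\<in>insert p F. \<Sum>j\<in>insert p F. cnj (x i) * h i j * x j) =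
     cnj (x p) * h p p * x p + cnj (x p) * (\<Sum>j\<in>F. h p j * x j) + cnj (\<Sum>j\<in>F. h p j * x j) * x p
      + (\<Sum>i\<in>F. \<Sum>j\<in>F. cnj (x i) * h i j * x j)" for x
  proof -
    have "(\<Sum>i\<in>F. cnj (x i) * h i p * x p) = cnj (\<Sum>j\<in>F. h p j * x j) * x p"
      unfolding cnj_sum sum_distrib_right by (rule sum.cong) (use herm[of p] in \<open>auto simp: mult.commute\<close>)
    then show ?thesis using insert.hyps
      by (simp add: sum.distrib sum_distrib_left mult.assoc)
  qed
  have a: "a > 0"
  proof -
    define x where "x i = (if i = p then 1 else 0 :: complex)" for i
    have z: "x j = 0" if "j \<in> F" for j using that insert.hyps by (auto simp: x_def)
    have "Re (\<Sum>i\<in>insert p F. \<Sum>j\<in>insert p F. cnj (x i) * h i j * x j) > 0"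
      by (rule partial_deriv) (auto simp: x_def)
    then show ?thesis unfolding ex using z by (simp add: x_def a_def)
  qed
  define h' where "h' i j = h i j - cnj (h p i) * h p j / complex_of_real a" for i j
  have "\<exists>A. \<forall>i\<in>F. \<forall>j\<in>F. (\<Sum>k\<in>F. cnj (A k i) * A k j) = h' i j"
  proof (rule insert.IH)
    show "h' j i = cnj (h' i j)" if "i \<in> F" "j \<in> F" for i j
      using herm[of i j] that by (simp add: h'_def)
    fix x :: "'i \<Rightarrow> complex" assume x: "\<exists>i\<in>F. x i \<noteq> 0"
    define m where "m = (\<Sum>j\<in>F. h p j * x j)"
    \<comment> \<open>Completing the square: among all extensions of \<open>x\<close> to
      \<open>p\<close> this one minimizes the form.\<close>
    define y where "y = x(p := - m / complex_of_real a)"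
    have yF: "y j = x j" if "j \<in> F" for j using that insert.hyps by (auto simp: y_def)
    have "Re (\<Sum>i\<in>insert p F. \<Sum>j\<in>insert p F. cnj (y i) * h i j * y j) > 0"
      by (rule partial_deriv) (use x yF in auto)
    also have "(\<Sum>i\<in>insert p F. \<Sum>j\<in>insert p F. cnj (y i) * h i j * y j) =
       (\<Sum>i\<in>F. \<Sum>j\<in>F. cnj (x i) * h i j * x j) - cnj m * m / complex_of_real a"
    proof -
      have 1: "(\<Sum>j\<in>F. h p j * y j) = m" unfolding m_def by (rule sum.cong) (simp_all add: yF)
      have 2: "(\<Sum>i\<in>F. \<Sum>j\<in>F. cnj (y i) * h i j * y j) = (\<Sum>i\<in>F. \<Sum>j\<in>F. cnj (x i) * h i j * x j)"
        by (intro sum.cong refl) (simp add: yF)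
      have 3: "y p = - m / complex_of_real a" "cnj (y p) = - cnj m / complex_of_real a" by (simp_all add: y_def)
      show ?thesis unfolding ex hpp 1 2 3 using a by (simp add: field_simps)
    qed
    also have "cnj m * m / complex_of_real a = (\<Sum>i\<in>F. \<Sum>j\<in>F. cnj (x i) * (cnj (h p i) * h p j / complex_of_real a) * x j)"
      unfolding m_def cnj_sum sum_product sum_divide_distrib by (intro sum.cong refl) simp
    also have "(\<Sum>i\<in>F. \<Sum>j\<in>F. cnj (x i) * h i j * x j) - \<dots> = (\<Sum>i\<in>F. \<Sum>j\<in>F. cnj (x i) * h' i j * x j)"
      unfolding sum_subtractf[symmetric] h'_def by (intro sum.cong refl) (simp add: algebra_simps)
    finally show "Re (\<Sum>i\<in>F. \<Sum>j\<in>F. cnj (x i) * h' i j * x j) > 0" .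
  qed
  then obtain A where A: "\<And>i j. i \<in> F \<Longrightarrow> j \<in> F \<Longrightarrow> (\<Sum>k\<in>F. cnj (A k i) * A k j) = h' i j" by blast
  \<comment> \<open>The rank-one term subtracted in \<open>h'\<close> becomes row \<open>p\<close>;
    the other rows are those of the factor of \<open>h'\<close>, extended by zero in column
    \<open>p\<close>.\<close>
  define B where "B k j = (if k = p then h p j / complex_of_real (sqrt a) else if j = p then 0 else A k j)" for k j
  have sq: "complex_of_real (sqrt a) * complex_of_real (sqrt a) = complex_of_real a"
    using a unfolding of_real_mult[symmetric] by simp
  have "(\<Sum>k\<in>insert p F. cnj (B k i) * B k j) = h i j" if i: "i \<in> insert p F" and j: "j \<in> insert p F" for i j
  proof -
    have "(\<Sum>k\<in>insert p F. cnj (B k i) * B k j) = cnj (h p i) * h p j / complex_of_real a + (\<Sum>k\<in>F. cnj (B k i) * B k j)"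
      using insert.hyps sq by (simp add: B_def)
    also have "(\<Sum>k\<in>F. cnj (B k i) * B k j) = (if i = p \<or> j = p then 0 else h' i j)"
    proof (cases "i = p \<or> j = p")
      case True
      have "cnj (B k i) * B k j = 0" if "k \<in> F" for k using that True insert.hyps by (auto simp: B_def)
      then show ?thesis using True by simp
    next
      case False
      then have "i \<in> F" "j \<in> F" using i j by auto
      have "(\<Sum>k\<in>F. cnj (B k i) * B k j) = (\<Sum>k\<in>F. cnj (A k i) * A k j)"
        by (rule sum.cong) (use False insert.hyps in \<open>auto simp: B_def\<close>)
      then show ?thesis using A[OF \<open>i \<in> F\<close> \<open>j \<in> F\<close>] False by simp
    qed
    also have "cnj (h p i) * h p j / complex_of_real a + (if i = p \<or> j = p then 0 else h' i j) = h i j"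
      using herm[of p i] i a by (auto simp: h'_def hpp)
    finally show ?thesis .
  qed
  then show ?case by blast
qed

subsection \<open>Products\<close>

text \<open>The row index set \<open>K\<close> may differ from \<open>I\<close>: in this way the
  Gram matrix of a rectangular matrix is handed to \<open>cholesky\<close>.\<close>

lemma gram_form:
  fixes x :: "'i \<Rightarrow> complex"
  shows "(\<Sum>i\<in>I. \<Sum>j\<in>I. cnj (x i) * (\<Sum>p\<in>K. cnj (C p i) * C p j) * x j) =
    complex_of_real (\<Sum>p\<in>K. (norm (\<Sum>i\<in>I. C p i * x i))\<^sup>2)"
proof -
  have "(\<Sum>i\<in>I. \<Sum>j\<in>I. cnj (x i) * (\<Sum>p\<in>K. cnj (C p i) * C p j) * x j) =
     (\<Sum>i\<in>I. \<Sum>j\<in>I. \<Sum>p\<in>K. (cnj (C p i) * cnj (x i)) * (C p j * x j))"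
    by (intro sum.cong refl) (simp add: sum_distrib_left sum_distrib_right mult.assoc mult.left_commute)
  also have "\<dots> = (\<Sum>i\<in>I. \<Sum>p\<in>K. \<Sum>j\<in>I. (cnj (C p i) * cnj (x i)) * (C p j * x j))"
    by (intro sum.cong refl) (rule sum.swap)
  also have "\<dots> = (\<Sum>p\<in>K. \<Sum>i\<in>I. \<Sum>j\<in>I. (cnj (C p i) * cnj (x i)) * (C p j * x j))"
    by (rule sum.swap)
  also have "\<dots> = (\<Sum>p\<in>K. cnj (\<Sum>i\<in>I. C p i * x i) * (\<Sum>i\<in>I. C p i * x i))"
    by (intro sum.cong refl) (simp add: cnj_sum sum_product)
  also have "\<dots> = complex_of_real (\<Sum>p\<in>K. (norm (\<Sum>i\<in>I. C p i * x i))\<^sup>2)"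
    unfolding of_real_sum by (intro sum.cong refl) (simp only: complex_norm_square mult.commute)
  finally show ?thesis .
qed

lemma parallelogram_cnorm:
  "(cnorm K (\<lambda>k. x k + y k))\<^sup>2 + (cnorm K (\<lambda>k. x k - y k))\<^sup>2 = 2 * (cnorm K x)\<^sup>2 + 2 * (cnorm K y)\<^sup>2"
proof -
  have "(norm (a + b))\<^sup>2 + (norm (a - b))\<^sup>2 = 2 * (norm a)\<^sup>2 + 2 * (norm b)\<^sup>2" for a b :: complex
    unfolding cmod_power2 by (simp add: power2_eq_square algebra_simps)
  then show ?thesis unfolding cnorm_power2 sum.distrib[symmetric] sum_distrib_left by simp
qed

text \<open>Choosing the signs one after the other makes all cross terms nonnegative.\<close>

lemma exists_signs:
  fixes y :: "nat \<Rightarrow> 'k \<Rightarrow> complex"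
  shows "\<exists>\<sigma>. (\<forall>l. \<sigma> l = 1 \<or> \<sigma> l = -1) \<and>
    (\<Sum>l<m. (cnorm K (y l))\<^sup>2) \<le> (cnorm K (\<lambda>k. \<Sum>l<m. \<sigma> l * y l k))\<^sup>2"
proof (induction m)
  case 0
  show ?case by (rule exI[of _ "\<lambda>_. 1"]) simp
next
  case (Suc m)
  then obtain \<sigma> where \<sigma>: "\<forall>l. \<sigma> l = 1 \<or> \<sigma> l = -1"
    and le: "(\<Sum>l<m. (cnorm K (y l))\<^sup>2) \<le> (cnorm K (\<lambda>k. \<Sum>l<m. \<sigma> l * y l k))\<^sup>2" by blast
  define s where "s k = (\<Sum>l<m. \<sigma> l * y l k)" for k
  have up: "(\<Sum>l<Suc m. (\<sigma>(m := \<epsilon>)) l * y l k) = s k + \<epsilon> * y m k" for \<epsilon> k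
    by (simp add: s_def)
  have "(cnorm K s)\<^sup>2 + (cnorm K (y m))\<^sup>2 \<le> (cnorm K (\<lambda>k. s k + 1 * y m k))\<^sup>2 \<or>
        (cnorm K s)\<^sup>2 + (cnorm K (y m))\<^sup>2 \<le> (cnorm K (\<lambda>k. s k + (-1) * y m k))\<^sup>2"
    using parallelogram_cnorm[of K s "y m"] by (simp, linarith)
  then obtain \<epsilon> :: complex where \<epsilon>: "\<epsilon> = 1 \<or> \<epsilon> = -1"
    and le': "(cnorm K s)\<^sup>2 + (cnorm K (y m))\<^sup>2 \<le> (cnorm K (\<lambda>k. s k + \<epsilon> * y m k))\<^sup>2" by blast
  have "(\<Sum>l<Suc m. (cnorm K (y l))\<^sup>2) \<le> (cnorm K s)\<^sup>2 + (cnorm K (y m))\<^sup>2"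
    using le by (simp add: s_def[abs_def])
  also note le'
  also have "(\<lambda>k. s k + \<epsilon> * y m k) = (\<lambda>k. \<Sum>l<Suc m. (\<sigma>(m := \<epsilon>)) l * y l k)" by (simp only: up)
  finally show ?case using \<sigma> \<epsilon> by (intro exI[of _ "\<sigma>(m := \<epsilon>)"]) auto
qed

definition factor_of :: "(nat \<times> 'i \<Rightarrow> complex) \<Rightarrow> nat \<Rightarrow> 'i \<Rightarrow> complex" where
  "factor_of x l = (\<lambda>i. x (l, i))"

definition embed :: "nat \<Rightarrow> ('i \<Rightarrow> complex) \<Rightarrow> nat \<times> 'i \<Rightarrow> complex" where
  "embed l y = (\<lambda>(k, i). if k = l then y i else 0)"

locale cnormed_family =
  fixes m :: nat and I :: "nat \<Rightarrow> 'i set" and \<Lambda> :: "nat \<Rightarrow> ('i \<Rightarrow> complex) set" and N :: "nat \<Rightarrow> ('i \<Rightarrow> complex) \<Rightarrow> real"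
  assumes m: "m \<ge> 1" and cn: "\<And>l. l < m \<Longrightarrow> cnormed (I l) (\<Lambda> l) (N l)"
begin

abbreviation "J \<equiv> product_index m I"

definition "product_norm x = Max ((\<lambda>l. N l (factor_of x l)) ` {..<m})"

text \<open>A maximum of norms is the least bound for the functionals of the single factors, each
  extended by zero to the product.\<close>

definition "product_functionals = (\<Union>l<m. embed l ` \<Lambda> l)"

lemma finI: "l < m \<Longrightarrow> finite (I l)"
  using cn cnormed.fin by blast

lemma sum_J: "(\<Sum>p\<in>J. h p) = (\<Sum>l<m. \<Sum>i\<in>I l. h (l, i))"
  unfolding product_index_def by (subst sum.Sigma) (auto simp: finI)

lemma sum_embed: "l < m \<Longrightarrow> (\<Sum>k<m. \<Sum>i\<in>I k. (if k = l then g k i else 0)) = (\<Sum>i\<in>I l. g l i)"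
proof -
  assume l: "l < m"
  have "(\<Sum>k<m. \<Sum>i\<in>I k. (if k = l then g k i else 0)) = (\<Sum>k<m. if k = l then \<Sum>i\<in>I k. g k i else 0)"
    by (rule sum.cong) auto
  then show ?thesis using l by simp
qed

lemma factor_of_cspace: "x \<in> cspace J \<Longrightarrow> l < m \<Longrightarrow> factor_of x l \<in> cspace (I l)"
  by (auto simp: factor_of_def cspace_def product_index_def)

lemma embed_cspace: "y \<in> cspace (I l) \<Longrightarrow> l < m \<Longrightarrow> embed l y \<in> cspace J"
  by (auto simp: embed_def cspace_def product_index_def)

lemma factor_of_embed: "factor_of (embed l y) k = (if k = l then y else (\<lambda>_. 0))"
  by (auto simp: factor_of_def embed_def)

lemma pairing_embed: "l < m \<Longrightarrow> pairing J (embed l f) x = pairing (I l) f (factor_of x l)"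
proof -
  assume l: "l < m"
  have "pairing J (embed l f) x = (\<Sum>k<m. \<Sum>i\<in>I k. if k = l then f i * x (k, i) else 0)"
    unfolding pairing_def sum_J by (intro sum.cong refl) (simp add: embed_def)
  then show ?thesis unfolding sum_embed[OF l] by (simp add: pairing_def factor_of_def)
qed

lemma cnorm_J: "(cnorm J x)\<^sup>2 = (\<Sum>l<m. (cnorm (I l) (factor_of x l))\<^sup>2)"
  unfolding cnorm_power2 sum_J by (simp add: factor_of_def)

lemma product_norm_ge: "l < m \<Longrightarrow> N l (factor_of x l) \<le> product_norm x"
  unfolding product_norm_def by (rule Max_ge) auto

lemma product_norm_le: "(\<And>l. l < m \<Longrightarrow> N l (factor_of x l) \<le> b) \<Longrightarrow> product_norm x \<le> b"
  unfolding product_norm_def using m by (intro Max.boundedI) (auto simp: lessThan_empty_iff)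

lemma product_norm_less: "product_norm x < b \<longleftrightarrow> (\<forall>l<m. N l (factor_of x l) < b)"
  unfolding product_norm_def using m by (subst Max_less_iff) (auto simp: lessThan_empty_iff)

lemma cnorm_factor_of_le: "l < m \<Longrightarrow> cnorm (I l) (factor_of x l) \<le> cnorm J x"
proof -
  assume l: "l < m"
  have "(cnorm (I l) (factor_of x l))\<^sup>2 \<le> (cnorm J x)\<^sup>2"
    unfolding cnorm_J by (rule member_le_sum) (use l in auto)
  then show ?thesis by (rule power2_le_imp_le) (rule cnorm_nonneg)
qed

lemma cnorm_J_le_sum: "cnorm J x \<le> (\<Sum>l<m. cnorm (I l) (factor_of x l))"
proof -
  have "cnorm J x = sqrt (\<Sum>l<m. (cnorm (I l) (factor_of x l))\<^sup>2)"
    unfolding cnorm_J[symmetric] using cnorm_nonneg[of J x] by simp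
  also have "\<dots> \<le> (\<Sum>l<m. cnorm (I l) (factor_of x l))"
    using L2_set_le_sum[of "{..<m}" "\<lambda>l. cnorm (I l) (factor_of x l)"] by (simp add: L2_set_def cnorm_nonneg)
  finally show ?thesis .
qed

lemma cnormed_product: "cnormed J product_functionals product_norm"
proof
  show "finite J" unfolding product_index_def using finI by auto
  have "I 0 \<noteq> {}" using cn[of 0] m cnormed.ne by fastforce
  then obtain i where "i \<in> I 0" by blast
  then have "(0, i) \<in> J" using m by (simp add: product_index_def)
  then show "J \<noteq> {}" by blast
  fix x assume x: "x \<in> cspace J"
  show "norm (pairing J f x) \<le> product_norm x" if "f \<in> product_functionals" for f
  proof -
    obtain l g where l: "l < m" and g: "g \<in> \<Lambda> l" and f: "f = embed l g" using \<open>f \<in> product_functionals\<close> by (auto simp: product_functionals_def)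
    have "norm (pairing (I l) g (factor_of x l)) \<le> N l (factor_of x l)"
      by (rule cnormed.pairing_le[OF cn[OF l] factor_of_cspace[OF x l] g])
    also have "\<dots> \<le> product_norm x" by (rule product_norm_ge[OF l])
    finally show ?thesis unfolding f pairing_embed[OF l] .
  qed
  fix b assume b: "\<And>f. f \<in> product_functionals \<Longrightarrow> norm (pairing J f x) \<le> b"
  show "product_norm x \<le> b"
  proof (rule product_norm_le)
    fix l assume l: "l < m"
    show "N l (factor_of x l) \<le> b"
    proof (rule cnormed.N_le[OF cn[OF l] factor_of_cspace[OF x l]])
      fix g assume "g \<in> \<Lambda> l"
      then have "embed l g \<in> product_functionals" using l by (auto simp: product_functionals_def)
      from b[OF this] show "norm (pairing (I l) g (factor_of x l)) \<le> b" unfolding pairing_embed[OF l] .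
    qed
  qed
next
  have "\<forall>l\<in>{..<m}. \<exists>c>0. \<forall>x\<in>cspace (I l). c * cnorm (I l) x \<le> N l x" using cn cnormed.N_lower by blast
  from bchoice[OF this] obtain c where c: "\<forall>l\<in>{..<m}. c l > 0 \<and> (\<forall>x\<in>cspace (I l). c l * cnorm (I l) x \<le> N l x)" ..
  \<comment> \<open>The factor at \<open>l\<close> has Euclidean norm at most
    \<open>product_norm x / c l\<close>; \<open>d\<close> collects these contributions.\<close>
  define d where "d = (\<Sum>l<m. 1 / c l)"
  have d: "d > 0" unfolding d_def using m c by (intro sum_pos) (auto simp: lessThan_empty_iff)
  have "1 / d * cnorm J x \<le> product_norm x" if x: "x \<in> cspace J" for x
  proof -
    have "cnorm J x \<le> (\<Sum>l<m. cnorm (I l) (factor_of x l))" by (rule cnorm_J_le_sum)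
    also have "\<dots> \<le> (\<Sum>l<m. 1 / c l * product_norm x)"
    proof (rule sum_mono)
      fix l assume "l \<in> {..<m}"
      then have l: "l < m" and cl: "c l > 0" "c l * cnorm (I l) (factor_of x l) \<le> N l (factor_of x l)"
        using c factor_of_cspace[OF x, of l] by auto
      then have "c l * cnorm (I l) (factor_of x l) \<le> product_norm x" using product_norm_ge[OF l, of x] by linarith
      then show "cnorm (I l) (factor_of x l) \<le> 1 / c l * product_norm x" using cl(1) by (simp add: le_divide_eq mult.commute)
    qed
    also have "\<dots> = d * product_norm x" by (simp add: d_def sum_distrib_right)
    finally show ?thesis using d by (simp add: divide_le_eq mult.commute)
  qed
  then show "\<exists>c>0. \<forall>x\<in>cspace J. c * cnorm J x \<le> product_norm x" using d by (intro exI[of _ "1 / d"]) auto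
next
  have "\<forall>l\<in>{..<m}. \<exists>C. \<forall>x\<in>cspace (I l). N l x \<le> C * cnorm (I l) x" using cn cnormed.N_upper by blast
  from bchoice[OF this] obtain C where C: "\<forall>l\<in>{..<m}. \<forall>x\<in>cspace (I l). N l x \<le> C l * cnorm (I l) x" ..
  have "product_norm x \<le> (\<Sum>l<m. \<bar>C l\<bar>) * cnorm J x" if x: "x \<in> cspace J" for x
  proof (rule product_norm_le)
    fix l assume l: "l < m"
    have "N l (factor_of x l) \<le> C l * cnorm (I l) (factor_of x l)" using C l factor_of_cspace[OF x l] by simp
    also have "\<dots> \<le> (\<Sum>l<m. \<bar>C l\<bar>) * cnorm J x"
    proof (rule mult_mono)
      have "\<bar>C l\<bar> \<le> (\<Sum>l<m. \<bar>C l\<bar>)" by (rule member_le_sum) (use l in auto)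
      then show "C l \<le> (\<Sum>l<m. \<bar>C l\<bar>)" by linarith
    qed (auto simp: cnorm_nonneg sum_nonneg cnorm_factor_of_le[OF l])
    finally show "N l (factor_of x l) \<le> (\<Sum>l<m. \<bar>C l\<bar>) * cnorm J x" .
  qed
  then show "\<exists>C. \<forall>x\<in>cspace J. product_norm x \<le> C * cnorm J x" by blast
qed

sublocale P: cnormed J product_functionals product_norm by (rule cnormed_product)

definition "R l = Sup (hilbert_ratios (I l) (N l))"

lemma R_pos: "l < m \<Longrightarrow> 0 < R l"
  unfolding R_def by (rule cnormed.Sup_hilbert_ratios_pos[OF cn])

lemma unit_ball_product: "P.unit_ball = product_domain m I (\<lambda>l. cnormed.unit_ball (I l) (N l))"
  using factor_of_cspace
  by (auto simp: P.unit_ball_def product_domain_def product_norm_less cnormed.unit_ball_def[OF cn] factor_of_def)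

lemma lin_embed: "l < m \<Longrightarrow> p \<in> J \<Longrightarrow> lin J A (embed l y) p = (\<Sum>i\<in>I l. A p (l, i) * y i)"
proof -
  assume l: "l < m" and p: "p \<in> J"
  have "lin J A (embed l y) p = (\<Sum>k<m. \<Sum>i\<in>I k. if k = l then A p (k, i) * y i else 0)"
    using p unfolding lin_def sum_J by (simp, intro sum.cong refl) (simp add: embed_def)
  then show ?thesis unfolding sum_embed[OF l] .
qed

text \<open>Block \<open>l\<close> receives the weight \<open>T / t l\<close>. This makes the lower
  bound of each block equal to \<open>T\<close> times its norm, while the squared upper bounds add
  up to \<open>T\<^sup>2 * s = 1\<close>.\<close>

lemma block_ratio:
  assumes t: "\<And>l. l < m \<Longrightarrow> t l \<in> hilbert_ratios (I l) (N l)"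
  shows "1 / sqrt (\<Sum>l<m. 1 / (t l)\<^sup>2) \<le> Sup (hilbert_ratios J product_norm)"
proof -
  have "\<forall>l\<in>{..<m}. \<exists>A. \<forall>x\<in>cspace (I l). t l * N l x \<le> cnorm (I l) (lin (I l) A x) \<and> cnorm (I l) (lin (I l) A x) \<le> N l x"
    using t by (auto simp: hilbert_ratios_def)
  from bchoice[OF this] obtain A where A: "\<forall>l\<in>{..<m}. \<forall>x\<in>cspace (I l).
     t l * N l x \<le> cnorm (I l) (lin (I l) (A l) x) \<and> cnorm (I l) (lin (I l) (A l) x) \<le> N l x" ..
  have t0: "t l > 0" if "l < m" for l using t[OF that] by (simp add: hilbert_ratios_def)
  define s where "s = (\<Sum>l<m. 1 / (t l)\<^sup>2)"
  have s: "s > 0" unfolding s_def using m by (intro sum_pos) (auto simp: lessThan_empty_iff dest: t0)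
  define T where "T = 1 / sqrt s"
  have T: "T > 0" "T\<^sup>2 * s = 1" using s by (simp_all add: T_def power_divide)
  define B where "B p q = (if fst p = fst q then complex_of_real (T / t (fst p)) * A (fst p) (snd p) (snd q) else 0)" for p q
  have lB: "factor_of (lin J B x) l = (\<lambda>i. complex_of_real (T / t l) * lin (I l) (A l) (factor_of x l) i)" if l: "l < m" for x l
  proof
    fix i
    show "factor_of (lin J B x) l i = complex_of_real (T / t l) * lin (I l) (A l) (factor_of x l) i"
    proof (cases "i \<in> I l")
      case False
      then show ?thesis by (simp add: factor_of_def lin_def product_index_def)
    next
      case True
      then have "factor_of (lin J B x) l i = (\<Sum>k<m. \<Sum>j\<in>I k. B (l, i) (k, j) * x (k, j))"
        using l by (simp add: factor_of_def lin_def sum_J) (simp add: product_index_def)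
      also have "\<dots> = (\<Sum>k<m. \<Sum>j\<in>I k. if k = l then complex_of_real (T / t l) * A l i j * x (k, j) else 0)"
        by (intro sum.cong refl) (auto simp: B_def)
      also have "\<dots> = (\<Sum>j\<in>I l. complex_of_real (T / t l) * A l i j * x (l, j))" by (rule sum_embed[OF l])
      also have "\<dots> = complex_of_real (T / t l) * lin (I l) (A l) (factor_of x l) i"
        using True by (simp add: lin_def factor_of_def sum_distrib_left mult.assoc)
      finally show ?thesis .
    qed
  qed
  have cB: "(cnorm J (lin J B x))\<^sup>2 = (\<Sum>l<m. (T / t l)\<^sup>2 * (cnorm (I l) (lin (I l) (A l) (factor_of x l)))\<^sup>2)" for x
    unfolding cnorm_J
  proof (rule sum.cong[OF refl])
    fix l assume "l \<in> {..<m}"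
    then have l: "l < m" by simp
    have "norm (complex_of_real (T / t l)) = T / t l" unfolding norm_of_real using T(1) t0[OF l] by simp
    then show "(cnorm (I l) (factor_of (lin J B x) l))\<^sup>2 = (T / t l)\<^sup>2 * (cnorm (I l) (lin (I l) (A l) (factor_of x l)))\<^sup>2"
      unfolding lB[OF l] cnorm_scale power_mult_distrib by (simp only:)
  qed
  have "T \<le> Sup (hilbert_ratios J product_norm)"
  proof (rule P.ratio_le_Sup[OF T(1), of B], intro ballI conjI)
    fix x assume x: "x \<in> cspace J"
    have PN0: "0 \<le> product_norm x" by (rule P.N_nonneg[OF x])
    have a: "t l * N l (factor_of x l) \<le> cnorm (I l) (lin (I l) (A l) (factor_of x l))"
      "cnorm (I l) (lin (I l) (A l) (factor_of x l)) \<le> product_norm x" if l: "l < m" for l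
      using A l factor_of_cspace[OF x l] product_norm_ge[OF l, of x] by (auto intro: order_trans)
    have "product_norm x \<le> cnorm J (lin J B x) / T"
    proof (rule product_norm_le)
      fix l assume l: "l < m"
      have "((T / t l) * (t l * N l (factor_of x l)))\<^sup>2 \<le> ((T / t l) * cnorm (I l) (lin (I l) (A l) (factor_of x l)))\<^sup>2"
        using a(1)[OF l] T(1) t0[OF l] cnormed.N_nonneg[OF cn[OF l] factor_of_cspace[OF x l]]
        by (intro power_mono mult_left_mono) auto
      also have "\<dots> \<le> (cnorm J (lin J B x))\<^sup>2"
        unfolding cB power_mult_distrib
        by (rule member_le_sum[where f = "\<lambda>l. (T / t l)\<^sup>2 * (cnorm (I l) (lin (I l) (A l) (factor_of x l)))\<^sup>2"]) (use l in auto)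
      finally have "(T / t l) * (t l * N l (factor_of x l)) \<le> cnorm J (lin J B x)"
        by (rule power2_le_imp_le) (rule cnorm_nonneg)
      then show "N l (factor_of x l) \<le> cnorm J (lin J B x) / T" using t0[OF l] T(1) by (simp add: le_divide_eq mult.commute)
    qed
    then show "T * product_norm x \<le> cnorm J (lin J B x)" using T(1) by (simp add: le_divide_eq mult.commute)
    have "(cnorm J (lin J B x))\<^sup>2 \<le> (\<Sum>l<m. (T / t l)\<^sup>2 * (product_norm x)\<^sup>2)"
      unfolding cB by (intro sum_mono mult_left_mono power_mono a cnorm_nonneg) auto
    also have "\<dots> = T\<^sup>2 * s * (product_norm x)\<^sup>2" by (simp add: s_def sum_distrib_left sum_distrib_right power_divide)
    also have "\<dots> = (product_norm x)\<^sup>2" using T(2) by simp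
    finally show "cnorm J (lin J B x) \<le> product_norm x" by (rule power2_le_imp_le) (rule PN0)
  qed
  then show ?thesis by (simp add: T_def s_def)
qed

text \<open>Otherwise the Hermitian norm restricted to the factor and divided by \<open>b\<close>
  would lie between \<open>t / b * N l x\<close> and \<open>N l x\<close>, whereas
  \<open>t / b = R l / \<eta>\<close> exceeds the supremum \<open>R l\<close>. The factor
  \<open>\<eta>\<close> gives room for an argument without an extremal vector.\<close>

lemma component_almost_extremal:
  assumes t: "0 < t" and A: "\<forall>x\<in>cspace J. t * product_norm x \<le> cnorm J (lin J A x) \<and> cnorm J (lin J A x) \<le> product_norm x"
    and l: "l < m" and \<eta>: "0 < \<eta>" "\<eta> < 1"
  shows "\<exists>x\<in>cspace (I l). N l x \<le> 1 \<and> \<eta> * (t / R l) \<le> cnorm J (lin J A (embed l x))"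
proof (rule ccontr)
  interpret C: cnormed "I l" "\<Lambda> l" "N l" by (rule cn[OF l])
  define b where "b = \<eta> * (t / R l)"
  have b: "b > 0" using \<eta> t R_pos[OF l] by (simp add: b_def)
  assume "\<not> (\<exists>x\<in>cspace (I l). N l x \<le> 1 \<and> \<eta> * (t / R l) \<le> cnorm J (lin J A (embed l x)))"
  then have lt: "cnorm J (lin J A (embed l x)) \<le> b" if "x \<in> cspace (I l)" "N l x \<le> 1" for x
    using that by (force simp: b_def)
  have PNe: "product_norm (embed l x) = N l x" if "x \<in> cspace (I l)" for x
  proof (rule antisym)
    show "product_norm (embed l x) \<le> N l x"
    proof (rule product_norm_le)
      fix k assume k: "k < m"
      show "N k (factor_of (embed l x) k) \<le> N l x"
        using cnormed.N_zero[OF cn[OF k]] C.N_nonneg[OF that] by (simp add: factor_of_embed)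
    qed
    show "N l x \<le> product_norm (embed l x)" using product_norm_ge[OF l, of "embed l x"] by (simp add: factor_of_embed)
  qed
  have lo: "t * N l x \<le> cnorm J (lin J A (embed l x))" if "x \<in> cspace (I l)" for x
    using A embed_cspace[OF that l] PNe[OF that] by force
  have embed_scale: "embed l (\<lambda>i. a * x i) = (\<lambda>p. a * embed l x p)" for a x by (auto simp: embed_def)
  have hi: "cnorm J (lin J A (embed l x)) \<le> b * N l x" if x: "x \<in> cspace (I l)" for x
  proof (cases "N l x = 0")
    case True
    then have "x = (\<lambda>_. 0)" using C.N_eq_0[OF x] by simp
    then have "embed l x = (\<lambda>_. 0)" by (auto simp: embed_def)
    then show ?thesis using True by (simp add: lin_zero)
  next
    case False
    define c where "c = complex_of_real (1 / N l x)"
    have p: "N l x > 0" using False C.N_nonneg[OF x] by simp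
    have nc: "norm c = 1 / N l x" unfolding c_def norm_of_real using p by simp
    have "cnorm J (lin J A (embed l (\<lambda>i. c * x i))) \<le> b"
      by (rule lt[OF C.scale_cspace[OF x]]) (use C.N_scale[OF x, of c] nc p in simp)
    then have "1 / N l x * cnorm J (lin J A (embed l x)) \<le> b"
      unfolding embed_scale lin_scale cnorm_scale nc .
    then show ?thesis using p by (simp add: divide_le_eq mult.commute)
  qed
  \<comment> \<open>The Gram matrix of the columns of \<open>A\<close> that belong to factor
    \<open>l\<close>. These columns have length \<open>J\<close>, so the square matrix
    \<open>B\<close> on \<open>I l\<close> is recovered by a Cholesky factorization.\<close>
  define h where "h i j = (\<Sum>p\<in>J. cnj (A p (l, i)) * A p (l, j))" for i j
  have form: "(\<Sum>i\<in>I l. \<Sum>j\<in>I l. cnj (x i) * h i j * x j) = complex_of_real ((cnorm J (lin J A (embed l x)))\<^sup>2)" for x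
    unfolding h_def gram_form cnorm_power2 by (intro arg_cong[of _ _ complex_of_real] sum.cong refl) (simp add: lin_embed[OF l])
  have "\<exists>B. \<forall>i\<in>I l. \<forall>j\<in>I l. (\<Sum>k\<in>I l. cnj (B k i) * B k j) = h i j"
  proof (rule cholesky[OF C.fin])
    show "h j i = cnj (h i j)" for i j unfolding h_def by (simp add: cnj_sum mult.commute)
    fix x :: "'i \<Rightarrow> complex" assume x: "\<exists>i\<in>I l. x i \<noteq> 0"
    define y where "y i = (if i \<in> I l then x i else 0)" for i
    have y: "y \<in> cspace (I l)" by (simp add: y_def cspace_def)
    have "y \<noteq> (\<lambda>_. 0)" using x by (auto simp: y_def fun_eq_iff)
    then have "0 < t * N l y" using C.N_pos[OF y] t by simp
    then have "cnorm J (lin J A (embed l y)) > 0" using lo[OF y] by linarith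
    moreover have "(\<Sum>i\<in>I l. \<Sum>j\<in>I l. cnj (x i) * h i j * x j) = (\<Sum>i\<in>I l. \<Sum>j\<in>I l. cnj (y i) * h i j * y j)"
      by (intro sum.cong refl) (simp add: y_def)
    ultimately show "Re (\<Sum>i\<in>I l. \<Sum>j\<in>I l. cnj (x i) * h i j * x j) > 0" unfolding form by simp
  qed
  then obtain B where B: "\<forall>i\<in>I l. \<forall>j\<in>I l. (\<Sum>k\<in>I l. cnj (B k i) * B k j) = h i j" ..
  have nB: "cnorm (I l) (lin (I l) B x) = cnorm J (lin J A (embed l x))" for x
  proof -
    have "complex_of_real ((cnorm (I l) (lin (I l) B x))\<^sup>2) = (\<Sum>i\<in>I l. \<Sum>j\<in>I l. cnj (x i) * (\<Sum>k\<in>I l. cnj (B k i) * B k j) * x j)"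
      unfolding gram_form cnorm_power2 by (simp add: lin_def)
    also have "\<dots> = (\<Sum>i\<in>I l. \<Sum>j\<in>I l. cnj (x i) * h i j * x j)"
      by (intro sum.cong refl) (use B in simp)
    finally have "(cnorm (I l) (lin (I l) B x))\<^sup>2 = (cnorm J (lin J A (embed l x)))\<^sup>2"
      unfolding form of_real_eq_iff .
    then show ?thesis using cnorm_nonneg[of "I l" "lin (I l) B x"] cnorm_nonneg[of J "lin J A (embed l x)"] by simp
  qed
  have nb: "norm (complex_of_real (1 / b)) = 1 / b" unfolding norm_of_real using b by simp
  have "t / b \<le> Sup (hilbert_ratios (I l) (N l))"
  proof (rule C.ratio_le_Sup[of _ "\<lambda>i j. complex_of_real (1 / b) * B i j"], use t b in simp, intro ballI conjI)
    fix x assume x: "x \<in> cspace (I l)"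
    show "t / b * N l x \<le> cnorm (I l) (lin (I l) (\<lambda>i j. complex_of_real (1 / b) * B i j) x)"
      unfolding lin_smult cnorm_scale nB nb using lo[OF x] b by (simp add: divide_right_mono)
    show "cnorm (I l) (lin (I l) (\<lambda>i j. complex_of_real (1 / b) * B i j) x) \<le> N l x"
      unfolding lin_smult cnorm_scale nB nb using hi[OF x] b by (simp add: divide_le_eq mult.commute)
  qed
  moreover have "t / b = R l / \<eta>" using t R_pos[OF l] \<eta> by (simp add: b_def)
  moreover have "R l / \<eta> > R l" using R_pos[OF l] \<eta> by (simp add: less_divide_eq)
  ultimately show False by (simp add: R_def)
qed

text \<open>Signs change no factor norm, so the signed sum of the almost extremal vectors has
  product norm at most one and its image has length at most one.\<close>

lemma sum_components_le:
  assumes t: "t \<in> hilbert_ratios J product_norm" and \<eta>: "0 < \<eta>" "\<eta> < 1"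
  shows "\<eta>\<^sup>2 * t\<^sup>2 * (\<Sum>l<m. 1 / (R l)\<^sup>2) \<le> 1"
proof -
  obtain A where A: "\<forall>x\<in>cspace J. t * product_norm x \<le> cnorm J (lin J A x) \<and> cnorm J (lin J A x) \<le> product_norm x" and t0: "t > 0"
    using t by (auto simp: hilbert_ratios_def)
  have "\<forall>l\<in>{..<m}. \<exists>x. x \<in> cspace (I l) \<and> N l x \<le> 1 \<and> \<eta> * (t / R l) \<le> cnorm J (lin J A (embed l x))"
    using component_almost_extremal[OF t0 A _ \<eta>] by blast
  from bchoice[OF this] obtain y where y: "\<forall>l\<in>{..<m}. y l \<in> cspace (I l) \<and> N l (y l) \<le> 1 \<and>
     \<eta> * (t / R l) \<le> cnorm J (lin J A (embed l (y l)))" ..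
  obtain \<sigma> :: "nat \<Rightarrow> complex" where \<sigma>: "\<forall>l. \<sigma> l = 1 \<or> \<sigma> l = -1"
    and le: "(\<Sum>l<m. (cnorm J (lin J A (embed l (y l))))\<^sup>2) \<le> (cnorm J (\<lambda>p. \<Sum>l<m. \<sigma> l * lin J A (embed l (y l)) p))\<^sup>2"
    using exists_signs[of J "\<lambda>l. lin J A (embed l (y l))" m] by blast
  define x where "x = (\<lambda>(l, i). if l < m then \<sigma> l * y l i else 0)"
  have xc: "x \<in> cspace J" using y by (auto simp: x_def cspace_def product_index_def)
  have "product_norm x \<le> 1"
  proof (rule product_norm_le)
    fix l assume l: "l < m"
    have "factor_of x l = (\<lambda>i. \<sigma> l * y l i)" using l by (simp add: factor_of_def x_def)
    then have "N l (factor_of x l) = norm (\<sigma> l) * N l (y l)"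
      using cnormed.N_scale[OF cn[OF l]] y l by simp
    also have "norm (\<sigma> l) = 1" using \<sigma>[rule_format, of l] by auto
    finally show "N l (factor_of x l) \<le> 1" using y l by simp
  qed
  then have c1: "cnorm J (lin J A x) \<le> 1" using A xc by (meson order_trans)
  have lx: "lin J A x = (\<lambda>p. \<Sum>l<m. \<sigma> l * lin J A (embed l (y l)) p)"
  proof
    fix p
    show "lin J A x p = (\<Sum>l<m. \<sigma> l * lin J A (embed l (y l)) p)"
    proof (cases "p \<in> J")
      case True
      have "lin J A x p = (\<Sum>l<m. \<Sum>i\<in>I l. A p (l, i) * (\<sigma> l * y l i))"
        using True by (simp add: lin_def sum_J x_def)
      also have "\<dots> = (\<Sum>l<m. \<sigma> l * lin J A (embed l (y l)) p)"
      proof (rule sum.cong[OF refl])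
        fix l assume "l \<in> {..<m}"
        then have l: "l < m" by simp
        show "(\<Sum>i\<in>I l. A p (l, i) * (\<sigma> l * y l i)) = \<sigma> l * lin J A (embed l (y l)) p"
          unfolding lin_embed[OF l True] sum_distrib_left by (rule sum.cong[OF refl]) (simp add: mult.left_commute)
      qed
      finally show ?thesis .
    qed (simp add: lin_def)
  qed
  have "\<eta>\<^sup>2 * t\<^sup>2 * (\<Sum>l<m. 1 / (R l)\<^sup>2) = (\<Sum>l<m. (\<eta> * (t / R l))\<^sup>2)"
    by (simp add: sum_distrib_left power_mult_distrib power_divide mult.assoc)
  also have "\<dots> \<le> (\<Sum>l<m. (cnorm J (lin J A (embed l (y l))))\<^sup>2)"
    using y \<eta> t0 R_pos by (intro sum_mono power_mono) (auto intro!: mult_nonneg_nonneg divide_nonneg_nonneg less_imp_le)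
  also have "\<dots> \<le> (cnorm J (lin J A x))\<^sup>2" unfolding lx by (rule le)
  also have "\<dots> \<le> 1\<^sup>2" by (intro power_mono c1 cnorm_nonneg)
  finally show ?thesis by simp
qed

lemma scaled_le_imp_le:
  assumes "\<And>\<eta>::real. 0 < \<eta> \<Longrightarrow> \<eta> < 1 \<Longrightarrow> \<eta>\<^sup>2 * a \<le> b" "0 < a"
  shows "a \<le> b"
proof -
  have "((\<lambda>\<eta>::real. \<eta>\<^sup>2 * a) \<longlongrightarrow> 1\<^sup>2 * a) (at_left 1)" by (intro tendsto_intros)
  moreover have "(0::real) < 1" by simp
  then have "\<forall>\<^sub>F \<eta> in at_left (1::real). \<eta> \<in> {0<..<1}" by (rule eventually_at_left_real)
  then have "\<forall>\<^sub>F \<eta> in at_left (1::real). \<eta>\<^sup>2 * a \<le> b"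
    by eventually_elim (use assms in auto)
  ultimately have "1\<^sup>2 * a \<le> b" by (rule tendsto_upperbound) simp
  then show ?thesis by simp
qed

text \<open>Every supremum is approached through factors \<open>\<eta>\<close> or
  \<open>\<theta>\<close> below one, because it need not belong to its set of ratios.\<close>

proposition Sup_hilbert_ratios_product:
  "1 / (Sup (hilbert_ratios J product_norm))\<^sup>2 = (\<Sum>l<m. 1 / (R l)\<^sup>2)"
proof -
  define S where "S = Sup (hilbert_ratios J product_norm)"
  define s where "s = (\<Sum>l<m. 1 / (R l)\<^sup>2)"
  have S: "S > 0" unfolding S_def by (rule P.Sup_hilbert_ratios_pos)
  have s: "s > 0" unfolding s_def using m by (intro sum_pos) (auto simp: lessThan_empty_iff dest: R_pos)
  have "1 / S\<^sup>2 \<le> s"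
  proof (rule scaled_le_imp_le)
    fix \<eta> :: real assume \<eta>: "0 < \<eta>" "\<eta> < 1"
    have "\<eta> * R l \<in> hilbert_ratios (I l) (N l)" if l: "l < m" for l
      by (rule cnormed.below_Sup_hilbert_ratios[OF cn[OF l]]) (use \<eta> R_pos[OF l] in \<open>simp_all add: R_def[symmetric]\<close>)
    then have "1 / sqrt (\<Sum>l<m. 1 / (\<eta> * R l)\<^sup>2) \<le> S" unfolding S_def by (rule block_ratio)
    also have "(\<Sum>l<m. 1 / (\<eta> * R l)\<^sup>2) = s / \<eta>\<^sup>2" by (simp add: s_def power_mult_distrib sum_divide_distrib mult.commute)
    also have "sqrt (s / \<eta>\<^sup>2) = sqrt s / \<eta>" using \<eta> by (simp add: real_sqrt_divide)
    finally have "\<eta> / sqrt s \<le> S" by simp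
    then have "\<eta> \<le> S * sqrt s" using s by (simp add: divide_le_eq)
    then have "\<eta>\<^sup>2 \<le> (S * sqrt s)\<^sup>2" using \<eta> by (intro power_mono) auto
    also have "\<dots> = s * S\<^sup>2" using s by (simp add: power_mult_distrib)
    finally show "\<eta>\<^sup>2 * (1 / S\<^sup>2) \<le> s" using S by (simp add: divide_le_eq)
  qed (use S in simp)
  moreover have "s \<le> 1 / S\<^sup>2"
  proof (rule scaled_le_imp_le[OF _ s])
    fix \<eta> :: real assume \<eta>: "0 < \<eta>" "\<eta> < 1"
    have "S\<^sup>2 * (\<eta>\<^sup>2 * s) \<le> 1"
    proof (rule scaled_le_imp_le)
      fix \<theta> :: real assume \<theta>: "0 < \<theta>" "\<theta> < 1"
      have "\<theta> * S \<in> hilbert_ratios J product_norm"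
        by (rule P.below_Sup_hilbert_ratios) (use \<theta> S in \<open>simp_all add: S_def[symmetric]\<close>)
      from sum_components_le[OF this \<eta>] show "\<theta>\<^sup>2 * (S\<^sup>2 * (\<eta>\<^sup>2 * s)) \<le> 1"
        by (simp add: s_def power_mult_distrib mult.assoc mult.left_commute)
    qed (use S s \<eta> in simp)
    then show "\<eta>\<^sup>2 * s \<le> 1 / S\<^sup>2" using S by (simp add: le_divide_eq mult.commute)
  qed
  ultimately show ?thesis by (simp add: S_def s_def)
qed

lemma homogeneous_product:
  assumes h: "\<And>l. l < m \<Longrightarrow> homogeneous (I l) (cnormed.unit_ball (I l) (N l))"
  shows "homogeneous J P.unit_ball"
  unfolding homogeneous_def
proof
  fix z assume z: "z \<in> P.unit_ball"
  define G where "G l = cnormed.unit_ball (I l) (N l)" for l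
  have Gc: "G l \<subseteq> cspace (I l)" if "l < m" for l unfolding G_def by (rule cnormed.unit_ball_cspace[OF cn[OF that]])
  have mem: "x \<in> P.unit_ball \<longleftrightarrow> x \<in> cspace J \<and> (\<forall>l<m. factor_of x l \<in> G l)" for x
    unfolding unit_ball_product product_domain_def G_def factor_of_def by simp
  have "\<forall>l\<in>{..<m}. \<exists>p. aut_pair (I l) (G l) (fst p) (snd p) \<and> fst p (\<lambda>_. 0) = factor_of z l"
  proof
    fix l assume "l \<in> {..<m}"
    then have l: "l < m" by simp
    obtain \<phi> \<psi> where "aut_pair (I l) (G l) \<phi> \<psi>" "\<phi> (\<lambda>_. 0) = factor_of z l"
      using h[OF l] z l unfolding homogeneous_def mem G_def by blast
    then show "\<exists>p. aut_pair (I l) (G l) (fst p) (snd p) \<and> fst p (\<lambda>_. 0) = factor_of z l"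
      by (intro exI[of _ "(\<phi>, \<psi>)"]) simp
  qed
  from bchoice[OF this] obtain p where p: "\<forall>l\<in>{..<m}. aut_pair (I l) (G l) (fst (p l)) (snd (p l)) \<and> fst (p l) (\<lambda>_. 0) = factor_of z l" ..
  define F where "F q x = (\<lambda>(l, i). if l < m then q l (factor_of x l) i else 0)" for q :: "nat \<Rightarrow> ('i \<Rightarrow> complex) \<Rightarrow> ('i \<Rightarrow> complex)" and x
  have compF: "factor_of (F q x) l = q l (factor_of x l)" if "l < m" for q x l using that by (simp add: F_def factor_of_def)
  have Fc: "F q x \<in> P.unit_ball" if x: "x \<in> P.unit_ball" and q: "\<And>l. l < m \<Longrightarrow> q l ` G l \<subseteq> G l" for q x
  proof -
    have c: "q l (factor_of x l) \<in> G l" if "l < m" for l using q[OF that] x that by (auto simp: mem)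
    have "F q x \<in> cspace J"
      using c Gc by (force simp: F_def cspace_def product_index_def)
    then show ?thesis using c compF by (simp add: mem)
  qed
  have Fh: "holo_on J P.unit_ball (\<lambda>x. F q x j)" if j: "j \<in> J" and q: "\<And>l i. l < m \<Longrightarrow> i \<in> I l \<Longrightarrow> holo_on (I l) (G l) (\<lambda>y. q l y i)" for q j
  proof -
    obtain l i where li: "j = (l, i)" "l < m" "i \<in> I l" using j by (auto simp: product_index_def)
    have "holo_on J P.unit_ball (\<lambda>x. q l (factor_of x l) i)"
    proof (rule holo_on_compose[OF _ _ Gc[OF li(2)] q[OF li(2,3)]])
      show "holo_on J P.unit_ball (\<lambda>x. factor_of x l k)" if "k \<in> I l" for k
        unfolding factor_of_def using that li(2) by (intro holo_on_coord P.fin) (simp add: product_index_def)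
      show "(\<lambda>x. factor_of x l) ` P.unit_ball \<subseteq> G l" using li(2) by (auto simp: mem)
    qed
    then show ?thesis using li by (simp add: F_def)
  qed
  have inv: "F q (F q' x) = x" if x: "x \<in> P.unit_ball" and q: "\<And>l y. l < m \<Longrightarrow> y \<in> G l \<Longrightarrow> q l (q' l y) = y" for q q' x
  proof
    fix j :: "nat \<times> 'i"
    obtain l i where j: "j = (l, i)" by (cases j)
    show "F q (F q' x) j = x j"
    proof (cases "l < m")
      case True
      then have "F q (F q' x) j = q l (q' l (factor_of x l)) i" using compF[OF True, of q' x] by (simp add: F_def j)
      also have "\<dots> = factor_of x l i" using q[OF True] x True by (simp add: mem)
      finally show ?thesis by (simp add: factor_of_def j)
    next
      case False
      moreover have "x \<in> cspace J" using x by (simp add: mem)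
      ultimately show ?thesis by (simp add: F_def j cspace_def product_index_def)
    qed
  qed
  let ?\<phi> = "F (\<lambda>l. fst (p l))" and ?\<psi> = "F (\<lambda>l. snd (p l))"
  have pa: "\<forall>i\<in>I l. holo_on (I l) (G l) (\<lambda>y. fst (p l) y i)" "\<forall>i\<in>I l. holo_on (I l) (G l) (\<lambda>y. snd (p l) y i)"
    "fst (p l) ` G l \<subseteq> G l" "snd (p l) ` G l \<subseteq> G l"
    "\<forall>y\<in>G l. snd (p l) (fst (p l) y) = y" "\<forall>y\<in>G l. fst (p l) (snd (p l) y) = y" if "l < m" for l
    using p that unfolding aut_pair_def by simp_all
  have "aut_pair J P.unit_ball ?\<phi> ?\<psi>"
    unfolding aut_pair_def
  proof (intro conjI ballI)
    show "holo_on J P.unit_ball (\<lambda>x. ?\<phi> x j)" if "j \<in> J" for j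
      by (rule Fh[OF that]) (use pa(1) in simp)
    show "holo_on J P.unit_ball (\<lambda>x. ?\<psi> x j)" if "j \<in> J" for j
      by (rule Fh[OF that]) (use pa(2) in simp)
    show "?\<phi> ` P.unit_ball \<subseteq> P.unit_ball" by (rule image_subsetI, rule Fc) (use pa(3) in simp_all)
    show "?\<psi> ` P.unit_ball \<subseteq> P.unit_ball" by (rule image_subsetI, rule Fc) (use pa(4) in simp_all)
    show "?\<psi> (?\<phi> x) = x" if "x \<in> P.unit_ball" for x by (rule inv[OF that]) (use pa(5) in simp)
    show "?\<phi> (?\<psi> x) = x" if "x \<in> P.unit_ball" for x by (rule inv[OF that]) (use pa(6) in simp)
  qed
  moreover have "?\<phi> (\<lambda>_. 0) = z"
  proof
    fix j :: "nat \<times> 'i"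
    obtain l i where j: "j = (l, i)" by (cases j)
    have "factor_of (\<lambda>_. 0) l = (\<lambda>_. 0)" by (simp add: factor_of_def)
    moreover have "z \<in> cspace J" using z by (simp add: mem)
    ultimately show "?\<phi> (\<lambda>_. 0) j = z j"
      using p by (cases "l < m") (simp_all add: F_def j factor_of_def cspace_def product_index_def)
  qed
  ultimately show "\<exists>\<phi> \<psi>. aut_pair J P.unit_ball \<phi> \<psi> \<and> \<phi> (\<lambda>_. 0) = z" by blast
qed

end

subsection \<open>The domains of type IV\<close>

lemma pairing_commute: "pairing I x y = pairing I y x"
  unfolding pairing_def by (simp add: mult.commute)

lemma pairing_add_right: "pairing I x (\<lambda>i. f i + g i) = pairing I x f + pairing I x g"
  unfolding pairing_def by (simp add: distrib_left sum.distrib)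

lemma pairing_diff_right: "pairing I x (\<lambda>i. f i - g i) = pairing I x f - pairing I x g"
  unfolding pairing_def by (simp add: right_diff_distrib sum_subtractf)

lemma pairing_scale_right: "pairing I x (\<lambda>i. a * f i) = a * pairing I x f"
  unfolding pairing_def by (simp add: sum_distrib_left mult.left_commute)

lemma pairing_add_left: "pairing I (\<lambda>i. f i + g i) x = pairing I f x + pairing I g x"
  unfolding pairing_commute[of I _ x] by (rule pairing_add_right)

lemma pairing_diff_left: "pairing I (\<lambda>i. f i - g i) x = pairing I f x - pairing I g x"
  unfolding pairing_commute[of I _ x] by (rule pairing_diff_right)

lemma pairing_scale_left: "pairing I (\<lambda>i. a * f i) x = a * pairing I f x"
  unfolding pairing_commute[of I _ x] by (rule pairing_scale_right)

lemma pairing_divide: "pairing I x (\<lambda>i. f i / a) = pairing I x f / a" "pairing I (\<lambda>i. f i / a) x = pairing I f x / a"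
  unfolding pairing_def by (simp_all add: sum_divide_distrib)

lemmas pairing_linear = pairing_divide pairing_add_right pairing_diff_right pairing_scale_right
  pairing_add_left pairing_diff_left pairing_scale_left

definition conj_vec :: "('i \<Rightarrow> complex) \<Rightarrow> 'i \<Rightarrow> complex" where
  "conj_vec x = (\<lambda>i. cnj (x i))"

lemma conj_vec_conj_vec [simp]: "conj_vec (conj_vec x) = x" by (simp add: conj_vec_def)

lemma pairing_conj_vec: "pairing I (conj_vec x) (conj_vec y) = cnj (pairing I x y)"
  by (simp add: pairing_def conj_vec_def cnj_sum)

lemma conj_vec_lin: "conj_vec (\<lambda>i. f i + g i) = (\<lambda>i. conj_vec f i + conj_vec g i)" "conj_vec (\<lambda>i. f i - g i) = (\<lambda>i. conj_vec f i - conj_vec g i)"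
  "conj_vec (\<lambda>i. a * f i) = (\<lambda>i. cnj a * conj_vec f i)"
  by (simp_all add: conj_vec_def)

definition sq_norm :: "'i set \<Rightarrow> ('i \<Rightarrow> complex) \<Rightarrow> real" where
  "sq_norm I z = (\<Sum>i\<in>I. (norm (z i))\<^sup>2)"

lemma sq_norm_pairing: "complex_of_real (sq_norm I z) = pairing I z (conj_vec z)"
  unfolding sq_norm_def pairing_def conj_vec_def of_real_sum
  by (rule sum.cong[OF refl]) (simp only: complex_norm_square)

lemma sq_norm_cnorm: "sq_norm I z = (cnorm I z)\<^sup>2"
  by (simp add: sq_norm_def cnorm_power2)

lemma norm_pairing_self_le: "norm (pairing I z z) \<le> sq_norm I z"
  unfolding sq_norm_cnorm power2_eq_square by (rule cauchy_schwarz_pairing)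

text \<open>These are the vectors \<open>u + \<i> * v\<close> with \<open>u\<close> and
  \<open>v\<close> real and orthonormal.\<close>

definition isotropic :: "'i set \<Rightarrow> ('i \<Rightarrow> complex) set" where
  "isotropic I = {e \<in> cspace I. pairing I e e = 0 \<and> pairing I e (conj_vec e) = 2}"

lemma isotropic_conj_vec: "e \<in> isotropic I \<Longrightarrow> conj_vec e \<in> isotropic I"
  by (auto simp: isotropic_def pairing_conj_vec pairing_commute[of I "conj_vec e" e] cspace_def) (simp add: conj_vec_def)

lemma isotropic_phase: "e \<in> isotropic I \<Longrightarrow> norm a = 1 \<Longrightarrow> (\<lambda>i. a * e i) \<in> isotropic I"
proof -
  assume e: "e \<in> isotropic I" and a: "norm a = 1"
  have "a * cnj a = 1" "cnj a * a = 1" using complex_norm_square[of a] a by (simp_all add: mult.commute)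
  then show ?thesis using e
    by (simp add: isotropic_def conj_vec_lin pairing_linear cspace_def mult.assoc[symmetric])
qed

text \<open>What remains of \<open>z\<close> orthogonally to the plane of \<open>e\<close> and
  \<open>conj_vec e\<close>. The halves come from \<open>pairing I e (conj_vec e) = 2\<close>:
  pairing with \<open>e\<close> detects the coefficient of \<open>conj_vec e\<close>,
  doubled.\<close>

definition rest :: "'i set \<Rightarrow> ('i \<Rightarrow> complex) \<Rightarrow> ('i \<Rightarrow> complex) \<Rightarrow> 'i \<Rightarrow> complex" where
  "rest I e z = (\<lambda>i. z i - (pairing I e z / 2 * conj_vec e i + pairing I (conj_vec e) z / 2 * e i))"

context
  fixes I :: "'i set" and e :: "'i \<Rightarrow> complex"
  assumes e: "e \<in> isotropic I"
begin

lemma ee: "pairing I e e = 0" "pairing I e (conj_vec e) = 2" "pairing I (conj_vec e) e = 2" "pairing I (conj_vec e) (conj_vec e) = 0"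
  using e isotropic_conj_vec[OF e] by (auto simp: isotropic_def pairing_commute[of I "conj_vec e" e])

lemma combination_pairing:
  assumes "pairing I e v = 0" "pairing I (conj_vec e) v = 0"
  shows "pairing I e (\<lambda>i. a / 2 * conj_vec e i + b / 2 * e i + c * v i) = a"
    and "pairing I (conj_vec e) (\<lambda>i. a / 2 * conj_vec e i + b / 2 * e i + c * v i) = b"
    and "pairing I (\<lambda>i. a / 2 * conj_vec e i + b / 2 * e i + c * v i) (\<lambda>i. a / 2 * conj_vec e i + b / 2 * e i + c * v i) = a * b + c\<^sup>2 * pairing I v v"
    and "sq_norm I (\<lambda>i. a / 2 * conj_vec e i + b / 2 * e i + c * v i) = ((norm a)\<^sup>2 + (norm b)\<^sup>2) / 2 + (norm c)\<^sup>2 * sq_norm I v"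
proof -
  have v: "pairing I v e = 0" "pairing I v (conj_vec e) = 0" using assms by (simp_all add: pairing_commute)
  have vc: "pairing I e (conj_vec v) = 0" "pairing I (conj_vec e) (conj_vec v) = 0"
    using pairing_conj_vec[of I "conj_vec e" v] pairing_conj_vec[of I e v] assms by simp_all
  show "pairing I e (\<lambda>i. a / 2 * conj_vec e i + b / 2 * e i + c * v i) = a"
    "pairing I (conj_vec e) (\<lambda>i. a / 2 * conj_vec e i + b / 2 * e i + c * v i) = b"
    by (simp_all add: pairing_linear ee assms)
  show "pairing I (\<lambda>i. a / 2 * conj_vec e i + b / 2 * e i + c * v i) (\<lambda>i. a / 2 * conj_vec e i + b / 2 * e i + c * v i) = a * b + c\<^sup>2 * pairing I v v"
    by (simp add: pairing_linear ee assms v power2_eq_square)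
  have "complex_of_real (sq_norm I (\<lambda>i. a / 2 * conj_vec e i + b / 2 * e i + c * v i)) =
     (a * cnj a + b * cnj b) / 2 + c * cnj c * complex_of_real (sq_norm I v)"
    unfolding sq_norm_pairing conj_vec_lin by (simp add: pairing_linear ee assms v vc algebra_simps add_divide_distrib)
  also have "\<dots> = complex_of_real (((norm a)\<^sup>2 + (norm b)\<^sup>2) / 2 + (norm c)\<^sup>2 * sq_norm I v)"
    by (simp add: complex_norm_square[symmetric])
  finally show "sq_norm I (\<lambda>i. a / 2 * conj_vec e i + b / 2 * e i + c * v i) = ((norm a)\<^sup>2 + (norm b)\<^sup>2) / 2 + (norm c)\<^sup>2 * sq_norm I v"
    unfolding of_real_eq_iff .
qed

lemma rest_orthogonal: "pairing I e (rest I e z) = 0" "pairing I (conj_vec e) (rest I e z) = 0"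
  unfolding rest_def by (simp_all add: pairing_linear ee)

lemma rest_decompose:
  "z = (\<lambda>i. pairing I e z / 2 * conj_vec e i + pairing I (conj_vec e) z / 2 * e i + 1 * rest I e z i)"
  by (simp add: rest_def)

lemma rest_combination:
  assumes "pairing I e v = 0" "pairing I (conj_vec e) v = 0"
  shows "rest I e (\<lambda>i. a / 2 * conj_vec e i + b / 2 * e i + c * v i) = (\<lambda>i. c * v i)"
  unfolding rest_def combination_pairing[OF assms] by (simp add: fun_eq_iff)

lemma pairing_self_rest: "pairing I z z = pairing I e z * pairing I (conj_vec e) z + pairing I (rest I e z) (rest I e z)"
  using combination_pairing(3)[OF rest_orthogonal, of "pairing I e z" "pairing I (conj_vec e) z" 1 z]
  unfolding rest_decompose[symmetric] by simp

lemma sq_norm_rest: "sq_norm I z = ((norm (pairing I e z))\<^sup>2 + (norm (pairing I (conj_vec e) z))\<^sup>2) / 2 + sq_norm I (rest I e z)"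
  using combination_pairing(4)[OF rest_orthogonal, of "pairing I e z" "pairing I (conj_vec e) z" 1 z]
  unfolding rest_decompose[symmetric] by simp

text \<open>With \<open>\<tau>\<close> the squared length of the rest, the normalization of
  \<open>e'\<close> gives \<open>A\<^sup>2 + B\<^sup>2 = 4 - 2 * \<tau>\<close>, and its isotropy
  gives \<open>A * B \<le> \<tau>\<close>. This makes the supremum over all isotropic vectors
  computable from the plane containing \<open>z\<close>.\<close>

lemma isotropic_pairing_bound:
  assumes e': "e' \<in> isotropic I"
  shows "norm (pairing I e e') + norm (pairing I (conj_vec e) e') \<le> 2"
proof -
  define A B \<tau> where "A = norm (pairing I e e')" and "B = norm (pairing I (conj_vec e) e')" and "\<tau> = sq_norm I (rest I e e')"
  have "complex_of_real (sq_norm I e') = complex_of_real 2" unfolding sq_norm_pairing using e' by (simp add: isotropic_def)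
  then have "sq_norm I e' = 2" unfolding of_real_eq_iff .
  then have 1: "(A\<^sup>2 + B\<^sup>2) / 2 + \<tau> = 2" using sq_norm_rest[of e'] by (simp add: A_def B_def \<tau>_def)
  have "pairing I e e' * pairing I (conj_vec e) e' = - pairing I (rest I e e') (rest I e e')"
    using pairing_self_rest[of e'] e' by (simp add: isotropic_def eq_neg_iff_add_eq_0)
  then have "A * B = norm (pairing I (rest I e e') (rest I e e'))" unfolding A_def B_def norm_mult[symmetric] by simp
  then have "A * B \<le> \<tau>" unfolding \<tau>_def using norm_pairing_self_le[of I "rest I e e'"] by simp
  moreover have "A\<^sup>2 + B\<^sup>2 = 4 - 2 * \<tau>" using 1 by (simp add: field_simps)
  ultimately have "A\<^sup>2 + B\<^sup>2 + 2 * (A * B) \<le> 4" by simp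
  then have "(A + B)\<^sup>2 \<le> 2\<^sup>2" by (simp add: power2_sum mult.assoc)
  then have "A + B \<le> 2" by (rule power2_le_imp_le) simp
  then show ?thesis by (simp add: A_def B_def)
qed

end

lemma exists_normalized:
  fixes x :: "'i \<Rightarrow> real"
  assumes I: "finite I" "k \<in> I"
  obtains u a where "(\<Sum>i\<in>I. u i * u i) = 1" "\<forall>i\<in>I. x i = a * u i"
proof (cases "(\<Sum>i\<in>I. x i * x i) = 0")
  case True
  then have x: "x i = 0" if "i \<in> I" for i
    using that sum_nonneg_eq_0_iff[OF I(1), of "\<lambda>i. x i * x i"] by auto
  have "(\<Sum>i\<in>I. (if i = k then 1 else 0) * (if i = k then 1 else 0 :: real)) = (\<Sum>i\<in>I. if i = k then 1 else 0)"
    by (rule sum.cong) auto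
  then have "(\<Sum>i\<in>I. (if i = k then 1 else 0) * (if i = k then 1 else 0 :: real)) = 1"
    using I by simp
  then show ?thesis by (rule that[where a = 0]) (use x in simp)
next
  case False
  define a where "a = sqrt (\<Sum>i\<in>I. x i * x i)"
  have p: "(\<Sum>i\<in>I. x i * x i) > 0" using False sum_nonneg[of I "\<lambda>i. x i * x i"] by auto
  then have a: "a > 0" "a * a = (\<Sum>i\<in>I. x i * x i)" by (simp_all add: a_def)
  have "(\<Sum>i\<in>I. x i / a * (x i / a)) = (\<Sum>i\<in>I. x i * x i) / (a * a)" by (simp add: sum_divide_distrib)
  also have "\<dots> = 1" using a p by simp
  finally show ?thesis by (rule that[where a = a]) (use a in simp)
qed

lemma exists_orthogonal_unit:
  fixes u :: "'i \<Rightarrow> real"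
  assumes I: "finite I" "k \<in> I" "l \<in> I" "k \<noteq> l"
  obtains v where "(\<Sum>i\<in>I. v i * v i) = 1" "(\<Sum>i\<in>I. u i * v i) = 0"
proof -
  have two: "(\<Sum>i\<in>I. h i) = h k + h l" if "\<And>i. i \<noteq> k \<Longrightarrow> i \<noteq> l \<Longrightarrow> h i = 0" for h :: "'i \<Rightarrow> real"
  proof -
    have "(\<Sum>i\<in>I. h i) = (\<Sum>i\<in>{k, l}. h i)" by (rule sum.mono_neutral_right) (use I that in auto)
    then show ?thesis using I(4) by simp
  qed
  show ?thesis
  proof (cases "u k = 0 \<and> u l = 0")
    case True
    show ?thesis
      by (rule that[of "\<lambda>i. if i = k then 1 else 0"]) (subst two, use I True in auto)+
  next
    case False
    define n where "n = sqrt (u k * u k + u l * u l)"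
    have "u k * u k + u l * u l > 0" using False by (metis add_nonneg_pos add_pos_nonneg not_real_square_gt_zero zero_le_square)
    then have n: "n > 0" "n * n = u k * u k + u l * u l" by (simp_all add: n_def)
    define v where "v i = (if i = k then - u l / n else if i = l then u k / n else 0)" for i
    have "(\<Sum>i\<in>I. v i * v i) = v k * v k + v l * v l" by (rule two) (simp add: v_def)
    also have "\<dots> = (u k * u k + u l * u l) / (n * n)" using I(4) by (simp add: v_def add_divide_distrib)
    also have "\<dots> = 1" using n(1) by (simp only: n(2)[symmetric]) simp
    finally have 1: "(\<Sum>i\<in>I. v i * v i) = 1" .
    have "(\<Sum>i\<in>I. u i * v i) = u k * v k + u l * v l" by (rule two) (simp add: v_def)
    also have "\<dots> = 0" using I(4) by (simp add: v_def)
    finally show ?thesis using 1 by (intro that)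
  qed
qed

text \<open>Gram-Schmidt for two real vectors that may be dependent. In the degenerate case the
  second unit vector is chosen freely, for which two distinct indices are assumed.\<close>

lemma exists_orthonormal_span:
  fixes x y :: "'i \<Rightarrow> real"
  assumes I: "finite I" "k \<in> I" "l \<in> I" "k \<noteq> l"
  obtains u v a b c where "(\<Sum>i\<in>I. u i * u i) = 1" "(\<Sum>i\<in>I. v i * v i) = 1" "(\<Sum>i\<in>I. u i * v i) = 0"
    "\<forall>i\<in>I. x i = a * u i" "\<forall>i\<in>I. y i = b * u i + c * v i"
proof -
  obtain u a where u: "(\<Sum>i\<in>I. u i * u i) = 1" "\<forall>i\<in>I. x i = a * u i"
    by (rule exists_normalized[OF I(1,2)])
  define b where "b = (\<Sum>i\<in>I. u i * y i)"
  define p where "p i = y i - b * u i" for i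
  have up: "(\<Sum>i\<in>I. u i * p i) = 0"
  proof -
    have "(\<Sum>i\<in>I. u i * p i) = b - b * (\<Sum>i\<in>I. u i * u i)"
      unfolding p_def b_def by (simp add: right_diff_distrib sum_subtractf sum_distrib_left mult.left_commute)
    then show ?thesis using u(1) by simp
  qed
  obtain v c where v: "(\<Sum>i\<in>I. v i * v i) = 1" "\<forall>i\<in>I. p i = c * v i"
    by (rule exists_normalized[OF I(1,2)])
  show ?thesis
  proof (cases "c = 0")
    case True
    obtain w where w: "(\<Sum>i\<in>I. w i * w i) = 1" "(\<Sum>i\<in>I. u i * w i) = 0"
      by (rule exists_orthogonal_unit[OF I])
    have y: "\<forall>i\<in>I. y i = b * u i + 0 * w i" using v(2) True by (simp add: p_def)
    show ?thesis by (rule that[OF u(1) w u(2) y])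
  next
    case False
    have "(\<Sum>i\<in>I. u i * p i) = c * (\<Sum>i\<in>I. u i * v i)"
      unfolding sum_distrib_left by (rule sum.cong) (use v(2) in auto)
    then have uv: "(\<Sum>i\<in>I. u i * v i) = 0" using up False by simp
    have y: "\<forall>i\<in>I. y i = b * u i + c * v i" using v(2) by (simp add: p_def diff_eq_eq add.commute)
    show ?thesis by (rule that[OF u(1) v(1) uv u(2) y])
  qed
qed

text \<open>The real and imaginary parts of \<open>z\<close> lie in a common real plane, and an
  orthonormal basis \<open>u\<close>, \<open>v\<close> of it gives \<open>e = u + \<i> * v\<close>.
  A question about a single \<open>z\<close> thus becomes one about the pair \<open>w1\<close>,
  \<open>w2\<close>.\<close>

lemma isotropic_span:
  assumes I: "finite I" "k \<in> I" "l \<in> I" "k \<noteq> l" and z: "z \<in> cspace I"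
  obtains e w1 w2 where "e \<in> isotropic I" "z = (\<lambda>i. w1 / 2 * conj_vec e i + w2 / 2 * e i)"
proof -
  obtain u v a b c where u: "(\<Sum>i\<in>I. u i * u i) = (1::real)" and v: "(\<Sum>i\<in>I. v i * v i) = (1::real)" and uv: "(\<Sum>i\<in>I. u i * v i) = 0"
    and x: "\<forall>i\<in>I. Re (z i) = a * u i" and y: "\<forall>i\<in>I. Im (z i) = b * u i + c * v i"
    by (rule exists_orthonormal_span[OF I, of "\<lambda>i. Re (z i)" "\<lambda>i. Im (z i)"])
  define e where "e i = (if i \<in> I then Complex (u i) (v i) else 0)" for i
  have "pairing I e e = Complex ((\<Sum>i\<in>I. u i * u i) - (\<Sum>i\<in>I. v i * v i)) (2 * (\<Sum>i\<in>I. u i * v i))"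
    unfolding pairing_def e_def complex_eq_iff
    by (simp add: sum_subtractf sum_distrib_left sum.distrib)
  then have 1: "pairing I e e = 0" using u v uv by (simp add: complex_eq_iff)
  have "pairing I e (conj_vec e) = Complex ((\<Sum>i\<in>I. u i * u i) + (\<Sum>i\<in>I. v i * v i)) 0"
    unfolding pairing_def e_def conj_vec_def complex_eq_iff
    by (simp add: sum.distrib)
  then have 2: "pairing I e (conj_vec e) = 2" using u v by (simp add: complex_eq_iff)
  have e: "e \<in> isotropic I" using 1 2 by (simp add: isotropic_def cspace_def e_def)
  \<comment> \<open>The complex coefficients of \<open>z\<close> in the basis \<open>u\<close>,
    \<open>v\<close>, which are then rewritten in terms of \<open>e\<close> and
    \<open>conj_vec e\<close>.\<close>
  define \<alpha> \<beta> where "\<alpha> = Complex a b" and "\<beta> = Complex 0 c"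
  have "z = (\<lambda>i. (\<alpha> + \<i> * \<beta>) / 2 * conj_vec e i + (\<alpha> - \<i> * \<beta>) / 2 * e i)"
  proof
    fix i show "z i = (\<alpha> + \<i> * \<beta>) / 2 * conj_vec e i + (\<alpha> - \<i> * \<beta>) / 2 * e i"
    proof (cases "i \<in> I")
      case True
      then show ?thesis using bspec[OF x True] bspec[OF y True]
        by (simp add: complex_eq_iff e_def conj_vec_def \<alpha>_def \<beta>_def field_simps)
    next
      case False
      then show ?thesis using z by (simp add: e_def conj_vec_def cspace_def)
    qed
  qed
  with e show ?thesis by (rule that)
qed

section \<open>The Lie ball as the unit ball of the spin norm\<close>

definition lie_ball :: "'i set \<Rightarrow> ('i \<Rightarrow> complex) set" where
  "lie_ball I = {z \<in> cspace I. sq_norm I z < 1 \<and> 1 - 2 * sq_norm I z + (norm (pairing I z z))\<^sup>2 > 0}"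

definition spin_norm :: "'i set \<Rightarrow> ('i \<Rightarrow> complex) \<Rightarrow> real" where
  "spin_norm I z = Sup ((\<lambda>e. norm (pairing I e z)) ` isotropic I)"

lemma span_values:
  assumes e: "e \<in> isotropic I" and z: "z = (\<lambda>i. w1 / 2 * conj_vec e i + w2 / 2 * e i)"
  shows "pairing I e z = w1" "pairing I (conj_vec e) z = w2" "pairing I z z = w1 * w2" "sq_norm I z = ((norm w1)\<^sup>2 + (norm w2)\<^sup>2) / 2"
proof -
  have 0: "pairing I e (\<lambda>_. 0) = 0" "pairing I (conj_vec e) (\<lambda>_. 0) = 0" by (simp_all add: pairing_def)
  have zz: "z = (\<lambda>i. w1 / 2 * conj_vec e i + w2 / 2 * e i + 0 * 0)" by (simp add: z)
  show "pairing I e z = w1" "pairing I (conj_vec e) z = w2" "pairing I z z = w1 * w2" "sq_norm I z = ((norm w1)\<^sup>2 + (norm w2)\<^sup>2) / 2"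
    unfolding zz combination_pairing[OF e 0, of w1 w2 0] by simp_all
qed

lemma spin_norm_span:
  assumes e: "e \<in> isotropic I" and z: "z = (\<lambda>i. w1 / 2 * conj_vec e i + w2 / 2 * e i)"
  shows "spin_norm I z = max (norm w1) (norm w2)"
    and "f \<in> isotropic I \<Longrightarrow> norm (pairing I f z) \<le> max (norm w1) (norm w2)"
proof -
  let ?M = "max (norm w1) (norm w2)"
  show le: "norm (pairing I f z) \<le> ?M" if f: "f \<in> isotropic I" for f
  proof -
    have "pairing I f z = w1 / 2 * pairing I (conj_vec e) f + w2 / 2 * pairing I e f"
      unfolding z by (simp add: pairing_linear pairing_commute[of I f])
    then have "norm (pairing I f z) \<le> norm w1 / 2 * norm (pairing I (conj_vec e) f) + norm w2 / 2 * norm (pairing I e f)"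
      using norm_triangle_ineq[of "w1 / 2 * pairing I (conj_vec e) f" "w2 / 2 * pairing I e f"] by (simp add: norm_mult norm_divide)
    also have "\<dots> \<le> ?M / 2 * norm (pairing I (conj_vec e) f) + ?M / 2 * norm (pairing I e f)"
      by (intro add_mono mult_right_mono) auto
    also have "\<dots> = ?M / 2 * (norm (pairing I e f) + norm (pairing I (conj_vec e) f))" by (simp add: algebra_simps)
    also have "\<dots> \<le> ?M / 2 * 2"
      by (intro mult_left_mono isotropic_pairing_bound[OF e f]) (simp add: le_max_iff_disj)
    finally show ?thesis by simp
  qed
  show "spin_norm I z = ?M"
    unfolding spin_norm_def
  proof (rule cSup_eq_maximum)
    show "?M \<in> (\<lambda>e. norm (pairing I e z)) ` isotropic I"
      using span_values(1,2)[OF assms] e isotropic_conj_vec[OF e] by (auto simp: max_def image_iff)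
  qed (use le in auto)
qed

text \<open>The second condition is \<open>(1 - a\<^sup>2) * (1 - b\<^sup>2) > 0\<close>, and the
  first excludes that both factors are negative. So the Lie ball meets the plane of \<open>e\<close>
  and \<open>conj_vec e\<close> in a bidisc.\<close>

lemma lie_ball_span:
  assumes a: "0 \<le> (a::real)" and b: "0 \<le> b"
  shows "(a\<^sup>2 + b\<^sup>2) / 2 < 1 \<and> 1 - 2 * ((a\<^sup>2 + b\<^sup>2) / 2) + (a * b)\<^sup>2 > 0 \<longleftrightarrow> max a b < 1"
proof -
  have eq: "1 - 2 * ((a\<^sup>2 + b\<^sup>2) / 2) + (a * b)\<^sup>2 = (1 - a\<^sup>2) * (1 - b\<^sup>2)" by (simp add: algebra_simps power2_eq_square)
  have sq: "c < 1 \<longleftrightarrow> c\<^sup>2 < 1" if "0 \<le> c" for c :: real using that abs_square_less_1[of c] by simp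
  show ?thesis unfolding eq zero_less_mult_iff using sq[OF a] sq[OF b] by auto
qed

lemma spin_cnormed:
  assumes I: "finite I" "k \<in> I" "l \<in> I" "k \<noteq> l"
  shows "cnormed I (isotropic I) (spin_norm I)"
    and "{z \<in> cspace I. spin_norm I z < 1} = lie_ball I"
proof -
  show "cnormed I (isotropic I) (spin_norm I)"
  proof
    show "finite I" "I \<noteq> {}" using I by auto
    fix x assume x: "x \<in> cspace I"
    obtain e w1 w2 where e: "e \<in> isotropic I" and xe: "x = (\<lambda>i. w1 / 2 * conj_vec e i + w2 / 2 * e i)"
      by (rule isotropic_span[OF I x])
    show "norm (pairing I f x) \<le> spin_norm I x" if "f \<in> isotropic I" for f
      unfolding spin_norm_span(1)[OF e xe] by (rule spin_norm_span(2)[OF e xe that])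
    show "spin_norm I x \<le> b" if b: "\<And>f. f \<in> isotropic I \<Longrightarrow> norm (pairing I f x) \<le> b" for b
      unfolding spin_norm_span(1)[OF e xe]
      using b[OF e] b[OF isotropic_conj_vec[OF e]] unfolding span_values(1,2)[OF e xe] by simp
  next
    have "1 * cnorm I x \<le> spin_norm I x" if x: "x \<in> cspace I" for x
    proof -
      obtain e w1 w2 where e: "e \<in> isotropic I" and xe: "x = (\<lambda>i. w1 / 2 * conj_vec e i + w2 / 2 * e i)"
        by (rule isotropic_span[OF I x])
      let ?M = "max (norm w1) (norm w2)"
      have "(cnorm I x)\<^sup>2 = ((norm w1)\<^sup>2 + (norm w2)\<^sup>2) / 2"
        using span_values(4)[OF e xe] by (simp add: sq_norm_cnorm)
      also have "\<dots> \<le> (?M\<^sup>2 + ?M\<^sup>2) / 2" by (intro divide_right_mono add_mono power_mono) auto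
      finally have "(cnorm I x)\<^sup>2 \<le> ?M\<^sup>2" by simp
      then have "cnorm I x \<le> ?M" by (rule power2_le_imp_le) (simp add: le_max_iff_disj)
      then show ?thesis unfolding spin_norm_span(1)[OF e xe] by simp
    qed
    then show "\<exists>c>0. \<forall>x\<in>cspace I. c * cnorm I x \<le> spin_norm I x" by (intro exI[of _ 1]) simp
    have "spin_norm I x \<le> 2 * cnorm I x" if x: "x \<in> cspace I" for x
    proof -
      obtain e w1 w2 where e: "e \<in> isotropic I" and xe: "x = (\<lambda>i. w1 / 2 * conj_vec e i + w2 / 2 * e i)"
        by (rule isotropic_span[OF I x])
      have "norm (pairing I f x) \<le> 2 * cnorm I x" if f: "f \<in> isotropic I" for f
      proof -
        have "complex_of_real (sq_norm I f) = complex_of_real 2" unfolding sq_norm_pairing using f by (simp add: isotropic_def)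
        then have "(cnorm I f)\<^sup>2 \<le> 2\<^sup>2" unfolding of_real_eq_iff by (simp add: sq_norm_cnorm)
        then have "cnorm I f \<le> 2" by (rule power2_le_imp_le) simp
        then show ?thesis using cauchy_schwarz_pairing[of I f x] mult_right_mono[of "cnorm I f" 2 "cnorm I x"] cnorm_nonneg[of I x] by simp
      qed
      from this[OF e] this[OF isotropic_conj_vec[OF e]]
      show ?thesis unfolding spin_norm_span(1)[OF e xe] span_values(1,2)[OF e xe] by simp
    qed
    then show "\<exists>C. \<forall>x\<in>cspace I. spin_norm I x \<le> C * cnorm I x" by blast
  qed
  have "spin_norm I z < 1 \<longleftrightarrow> z \<in> lie_ball I" if z: "z \<in> cspace I" for z
  proof -
    obtain e w1 w2 where e: "e \<in> isotropic I" and ze: "z = (\<lambda>i. w1 / 2 * conj_vec e i + w2 / 2 * e i)"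
      by (rule isotropic_span[OF I z])
    show ?thesis
      unfolding spin_norm_span(1)[OF e ze] lie_ball_def mem_Collect_eq span_values(3,4)[OF e ze] norm_mult
      using z lie_ball_span[of "norm w1" "norm w2"] by auto
  qed
  then show "{z \<in> cspace I. spin_norm I z < 1} = lie_ball I" by (auto simp: lie_ball_def)
qed

section \<open>Moebius transformations of the Lie ball\<close>

text \<open>A projective linear map. Let \<open>w1\<close>, \<open>w2\<close> be the pairings of
  \<open>z\<close> with \<open>e\<close> and \<open>conj_vec e\<close>, and \<open>q\<close> the
  pairing of \<open>z\<close> with itself. The numerators mix 1 with \<open>w1\<close> and
  \<open>w2\<close> with \<open>q\<close> by the parameter \<open>t\<close>, scale the rest by
  \<open>sqrt (1 - t\<^sup>2)\<close>, and everything is divided by the new first coordinate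
  \<open>d\<close>. On \<open>w1\<close> it is a disc automorphism.\<close>

definition lie_moebius :: "'i set \<Rightarrow> ('i \<Rightarrow> complex) \<Rightarrow> real \<Rightarrow> ('i \<Rightarrow> complex) \<Rightarrow> 'i \<Rightarrow> complex" where
  "lie_moebius I e t z =
     (let d = 1 + of_real t * pairing I e z in
      (\<lambda>i. (pairing I e z + of_real t) / d / 2 * conj_vec e i
         + (pairing I (conj_vec e) z + of_real t * pairing I z z) / d / 2 * e i
         + of_real (sqrt (1 - t\<^sup>2)) / d * rest I e z i))"

lemma rest_cspace: "e \<in> isotropic I \<Longrightarrow> z \<in> cspace I \<Longrightarrow> rest I e z \<in> cspace I"
  by (auto simp: rest_def cspace_def isotropic_def conj_vec_def)

context
  fixes I :: "'i set" and e :: "'i \<Rightarrow> complex"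
  assumes e: "e \<in> isotropic I"
    and bd: "\<And>z. z \<in> lie_ball I \<Longrightarrow> norm (pairing I e z) < 1"
begin

lemma lie_moebius_den:
  assumes z: "z \<in> lie_ball I" and t: "\<bar>t\<bar> < 1"
  shows "1 + of_real t * pairing I e z \<noteq> 0"
proof
  assume "1 + of_real t * pairing I e z = 0"
  then have "of_real t * pairing I e z = -1" by (simp add: eq_neg_iff_add_eq_0 add.commute)
  then have "\<bar>t\<bar> * norm (pairing I e z) = 1" by (metis norm_minus_cancel norm_mult norm_of_real norm_one real_norm_def)
  moreover have "\<bar>t\<bar> * norm (pairing I e z) < 1 * 1"
    using bd[OF z] t by (intro mult_strict_mono') auto
  ultimately show False by simp
qed

text \<open>The last identity says that the defining expression is multiplied by a positive factor.
  It holds because \<open>1 - (norm w1)\<^sup>2\<close>,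
  \<open>(norm q)\<^sup>2 - (norm w2)\<^sup>2\<close> and the squared length of the rest are all
  multiplied by \<open>1 - t\<^sup>2\<close> up to the common denominator.\<close>

lemma lie_moebius_values:
  assumes z: "z \<in> lie_ball I" and t: "\<bar>t\<bar> < 1"
  defines "d \<equiv> 1 + of_real t * pairing I e z"
  shows "pairing I e (lie_moebius I e t z) = (pairing I e z + of_real t) / d"
    "pairing I (conj_vec e) (lie_moebius I e t z) = (pairing I (conj_vec e) z + of_real t * pairing I z z) / d"
    "rest I e (lie_moebius I e t z) = (\<lambda>i. of_real (sqrt (1 - t\<^sup>2)) / d * rest I e z i)"
    "pairing I (lie_moebius I e t z) (lie_moebius I e t z) = (pairing I z z + of_real t * pairing I (conj_vec e) z) / d"
    "1 - 2 * sq_norm I (lie_moebius I e t z) + (norm (pairing I (lie_moebius I e t z) (lie_moebius I e t z)))\<^sup>2 =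
       (1 - t\<^sup>2) * (1 - 2 * sq_norm I z + (norm (pairing I z z))\<^sup>2) / (norm d)\<^sup>2"
proof -
  define w1 w2 q v r where "w1 = pairing I e z" and "w2 = pairing I (conj_vec e) z" and "q = pairing I z z"
    and "v = rest I e z" and "r = complex_of_real (sqrt (1 - t\<^sup>2))"
  have d0: "d \<noteq> 0" unfolding d_def by (rule lie_moebius_den[OF z t])
  have d: "d = 1 + of_real t * w1" by (simp add: d_def w1_def)
  have t2: "t\<^sup>2 < 1" using t abs_square_less_1 by blast
  have r2: "r\<^sup>2 = 1 - (of_real t)\<^sup>2" unfolding r_def of_real_power[symmetric] using t2 by simp
  have nr: "(norm r)\<^sup>2 = 1 - t\<^sup>2" unfolding r_def norm_of_real using t2 by simp
  have T: "lie_moebius I e t z = (\<lambda>i. (w1 + of_real t) / d / 2 * conj_vec e i + (w2 + of_real t * q) / d / 2 * e i + r / d * v i)"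
    by (simp add: lie_moebius_def Let_def d_def w1_def w2_def q_def v_def r_def)
  have v: "pairing I e v = 0" "pairing I (conj_vec e) v = 0" unfolding v_def by (rule rest_orthogonal[OF e])+
  have qv: "q = w1 * w2 + pairing I v v" unfolding q_def w1_def w2_def v_def by (rule pairing_self_rest[OF e])
  have sv: "sq_norm I z = ((norm w1)\<^sup>2 + (norm w2)\<^sup>2) / 2 + sq_norm I v" unfolding w1_def w2_def v_def by (rule sq_norm_rest[OF e])
  show "pairing I e (lie_moebius I e t z) = (pairing I e z + of_real t) / d"
    "pairing I (conj_vec e) (lie_moebius I e t z) = (pairing I (conj_vec e) z + of_real t * pairing I z z) / d"
    "rest I e (lie_moebius I e t z) = (\<lambda>i. of_real (sqrt (1 - t\<^sup>2)) / d * rest I e z i)"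
    unfolding T combination_pairing[OF e v] rest_combination[OF e v]
    by (simp_all add: w1_def w2_def q_def v_def r_def)
  have "pairing I (lie_moebius I e t z) (lie_moebius I e t z) =
    (w1 + of_real t) / d * ((w2 + of_real t * q) / d) + (r / d)\<^sup>2 * pairing I v v"
    unfolding T combination_pairing[OF e v] ..
  also have "\<dots> = ((w1 + of_real t) * (w2 + of_real t * q) + r\<^sup>2 * (q - w1 * w2)) / (d * d)"
    using d0 qv by (simp add: field_simps power2_eq_square)
  also have "(w1 + of_real t) * (w2 + of_real t * q) + r\<^sup>2 * (q - w1 * w2) = d * (q + of_real t * w2)"
    unfolding r2 d by (simp add: algebra_simps power2_eq_square)
  also have "d * (q + of_real t * w2) / (d * d) = (q + of_real t * w2) / d" using d0 by simp
  finally have Q: "pairing I (lie_moebius I e t z) (lie_moebius I e t z) = (q + of_real t * w2) / d" .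
  then show "pairing I (lie_moebius I e t z) (lie_moebius I e t z) = (pairing I z z + of_real t * pairing I (conj_vec e) z) / d"
    by (simp add: q_def w2_def)
  have S: "sq_norm I (lie_moebius I e t z) = (((norm (w1 + of_real t))\<^sup>2 + (norm (w2 + of_real t * q))\<^sup>2) / 2 + (1 - t\<^sup>2) * sq_norm I v) / (norm d)\<^sup>2"
    unfolding T combination_pairing[OF e v] norm_divide power_divide nr
    by (simp add: add_divide_distrib)
  have nd: "(norm d)\<^sup>2 > 0" using d0 by simp
  have i1: "(norm d)\<^sup>2 - (norm (w1 + of_real t))\<^sup>2 = (1 - t\<^sup>2) * (1 - (norm w1)\<^sup>2)"
    unfolding d cmod_power2 by (simp add: power2_eq_square algebra_simps)
  have i2: "(norm (q + of_real t * w2))\<^sup>2 - (norm (w2 + of_real t * q))\<^sup>2 = (1 - t\<^sup>2) * ((norm q)\<^sup>2 - (norm w2)\<^sup>2)"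
    unfolding cmod_power2 by (simp add: power2_eq_square algebra_simps)
  have "1 - 2 * sq_norm I (lie_moebius I e t z) + (norm (pairing I (lie_moebius I e t z) (lie_moebius I e t z)))\<^sup>2 =
     (((norm d)\<^sup>2 - (norm (w1 + of_real t))\<^sup>2) + ((norm (q + of_real t * w2))\<^sup>2 - (norm (w2 + of_real t * q))\<^sup>2)
       - 2 * ((1 - t\<^sup>2) * sq_norm I v)) / (norm d)\<^sup>2"
    unfolding S Q norm_divide power_divide using nd by (simp add: field_simps)
  also have "((norm d)\<^sup>2 - (norm (w1 + of_real t))\<^sup>2) + ((norm (q + of_real t * w2))\<^sup>2 - (norm (w2 + of_real t * q))\<^sup>2)
       - 2 * ((1 - t\<^sup>2) * sq_norm I v) = (1 - t\<^sup>2) * (1 - 2 * sq_norm I z + (norm q)\<^sup>2)"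
    unfolding i1 i2 sv by (simp add: field_simps)
  finally show "1 - 2 * sq_norm I (lie_moebius I e t z) + (norm (pairing I (lie_moebius I e t z) (lie_moebius I e t z)))\<^sup>2 =
       (1 - t\<^sup>2) * (1 - 2 * sq_norm I z + (norm (pairing I z z))\<^sup>2) / (norm d)\<^sup>2"
    by (simp add: q_def)
qed

text \<open>Along the path from \<open>0\<close> to \<open>t\<close> the quadratic form \<open>1 - 2 |z|\<^sup>2 + |q(z)|\<^sup>2\<close> stays positive,
  which keeps \<open>|q|\<close> from crossing the value \<open>1\<close>.\<close>

lemma lie_moebius_in:
  assumes z: "z \<in> lie_ball I" and t: "\<bar>t\<bar> < 1"
  shows "lie_moebius I e t z \<in> lie_ball I"
proof -
  define g where "g s = norm (1 + of_real s * pairing I e z) - norm (pairing I z z + of_real s * pairing I (conj_vec e) z)" for s :: real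
  have zc: "z \<in> cspace I" and Fz: "1 - 2 * sq_norm I z + (norm (pairing I z z))\<^sup>2 > 0" and Sz: "sq_norm I z < 1"
    using z by (auto simp: lie_ball_def)
  have F: "1 - 2 * sq_norm I (lie_moebius I e s z) + (norm (pairing I (lie_moebius I e s z) (lie_moebius I e s z)))\<^sup>2 > 0" if s: "\<bar>s\<bar> < 1" for s
    unfolding lie_moebius_values(5)[OF z s] using Fz lie_moebius_den[OF z s] s abs_square_less_1[of s] by simp
  have g0: "g 0 > 0" using norm_pairing_self_le[of I z] Sz by (simp add: g_def)
  have gnz: "g s \<noteq> 0" if s: "\<bar>s\<bar> < 1" for s
  proof
    assume "g s = 0"
    then have eq: "norm (pairing I z z + of_real s * pairing I (conj_vec e) z) = norm (1 + of_real s * pairing I e z)"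
      by (simp add: g_def)
    \<comment> \<open>With this value the positive expression would be
      \<open>2 - 2 * sq_norm\<close>, so \<open>sq_norm < 1\<close>; but \<open>sq_norm\<close> is
      at least the modulus of the quadratic form, which is 1.\<close>
    have "norm (pairing I (lie_moebius I e s z) (lie_moebius I e s z)) = 1"
      unfolding lie_moebius_values(4)[OF z s] norm_divide eq using lie_moebius_den[OF z s] by simp
    then show False using F[OF s] norm_pairing_self_le[of I "lie_moebius I e s z"] by simp
  qed
  have cont: "continuous_on A g" for A unfolding g_def by (intro continuous_intros)
  have "g t > 0"
  proof (rule ccontr)
    assume "\<not> g t > 0"
    then have gt: "g t \<le> 0" by simp
    have "\<exists>s. \<bar>s\<bar> < 1 \<and> g s = 0"
    proof (cases "t \<ge> 0")
      case True
      from IVT2'[of g t 0 0, OF gt _ True cont] g0 obtain s where "0 \<le> s" "s \<le> t" "g s = 0" by auto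
      then show ?thesis using t by (intro exI[of _ s]) auto
    next
      case False
      from IVT'[of g t 0 0, OF gt _ _ cont] g0 False obtain s where "t \<le> s" "s \<le> 0" "g s = 0" by auto
      then show ?thesis using t by (intro exI[of _ s]) auto
    qed
    then show False using gnz by blast
  qed
  then have q1: "norm (pairing I (lie_moebius I e t z) (lie_moebius I e t z)) < 1"
    unfolding lie_moebius_values(4)[OF z t] norm_divide using lie_moebius_den[OF z t] by (simp add: g_def divide_less_eq_1)
  then have "(norm (pairing I (lie_moebius I e t z) (lie_moebius I e t z)))\<^sup>2 < 1"
    using abs_square_less_1[of "norm (pairing I (lie_moebius I e t z) (lie_moebius I e t z))"] by simp
  then have "sq_norm I (lie_moebius I e t z) < 1" using F[OF t] by linarith
  moreover have "lie_moebius I e t z \<in> cspace I"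
    using e rest_cspace[OF e zc] by (auto simp: lie_moebius_def Let_def cspace_def isotropic_def conj_vec_def)
  ultimately show ?thesis using F[OF t] by (simp add: lie_ball_def)
qed

lemma lie_moebius_inverse:
  assumes z: "z \<in> lie_ball I" and t: "\<bar>t\<bar> < 1"
  shows "lie_moebius I e (- t) (lie_moebius I e t z) = z"
proof -
  define d where "d = 1 + of_real t * pairing I e z"
  define w1 w2 q v r where "w1 = pairing I e z" and "w2 = pairing I (conj_vec e) z" and "q = pairing I z z"
    and "v = rest I e z" and "r = complex_of_real (sqrt (1 - t\<^sup>2))"
  have d0: "d \<noteq> 0" unfolding d_def by (rule lie_moebius_den[OF z t])
  have d: "d = 1 + of_real t * w1" by (simp add: d_def w1_def)
  have t2: "t\<^sup>2 < 1" using t abs_square_less_1 by blast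
  define p where "p = 1 - (complex_of_real t)\<^sup>2"
  have r2: "r\<^sup>2 = p" unfolding r_def p_def of_real_power[symmetric] using t2 by simp
  have "p = complex_of_real (1 - t\<^sup>2)" by (simp add: p_def)
  then have p0: "p \<noteq> 0" using t2 by (simp only: of_real_eq_0_iff)
  note V = lie_moebius_values[OF z t, folded d_def, folded w1_def w2_def q_def v_def r_def]
  have e1: "1 + of_real (- t) * ((w1 + of_real t) / d) = p / d"
    using d0 by (simp add: d p_def field_simps power2_eq_square)
  have e2: "((w1 + of_real t) / d + of_real (- t)) / (p / d) = w1"
  proof -
    have "(w1 + of_real t) / d + of_real (- t) = w1 * p / d" using d0 by (simp add: d p_def field_simps power2_eq_square)
    then show ?thesis using d0 p0 by simp
  qed
  have e3: "((w2 + of_real t * q) / d + of_real (- t) * ((q + of_real t * w2) / d)) / (p / d) = w2"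
  proof -
    have "(w2 + of_real t * q) / d + of_real (- t) * ((q + of_real t * w2) / d) = w2 * p / d"
      using d0 by (simp add: p_def field_simps power2_eq_square)
    then show ?thesis using d0 p0 by simp
  qed
  have e4: "r / (p / d) * (r / d * y) = y" for y
    using d0 p0 r2 by (simp add: power2_eq_square field_simps)
  have sq: "complex_of_real (sqrt (1 - (- t)\<^sup>2)) = r" by (simp add: r_def)
  have "lie_moebius I e (- t) (lie_moebius I e t z) = (\<lambda>i. w1 / 2 * conj_vec e i + w2 / 2 * e i + v i)"
    unfolding lie_moebius_def[of I e "- t"] Let_def V e1 e2 e3 sq e4 by (rule refl)
  also have "\<dots> = z" using rest_decompose[OF e, of z] by (simp add: w1_def w2_def v_def)
  finally show ?thesis .
qed

lemma lie_moebius_holo_on: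
  assumes I: "finite I" and j: "j \<in> I" and t: "\<bar>t\<bar> < 1"
  shows "holo_on I (lie_ball I) (\<lambda>z. lie_moebius I e t z j)"
proof -
  have p: "holo_on I G (\<lambda>z. pairing I f z)" for f G
    by (rule pairing_holo_on[OF I holo_on_coord[OF I]])
  have q: "holo_on I G (\<lambda>z. pairing I z z)" for G
    unfolding pairing_def by (intro holo_on_sum holo_on_mult holo_on_coord I)
  have two: "(2::complex) \<noteq> 0" by simp
  show ?thesis
    unfolding lie_moebius_def Let_def rest_def
    by (intro holo_on_add holo_on_mult holo_on_divide holo_on_diff holo_on_const p q holo_on_coord[OF I j] two lie_moebius_den[OF _ t])
qed

lemma lie_moebius_aut:
  assumes I: "finite I" and t: "\<bar>t\<bar> < 1"
  shows "aut_pair I (lie_ball I) (lie_moebius I e t) (lie_moebius I e (- t))"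
proof -
  have t': "\<bar>- t\<bar> < 1" using t by simp
  show ?thesis
    unfolding aut_pair_def
    using lie_moebius_holo_on[OF I _ t] lie_moebius_holo_on[OF I _ t'] lie_moebius_in[OF _ t] lie_moebius_in[OF _ t']
      lie_moebius_inverse[OF _ t] lie_moebius_inverse[OF _ t'] by (simp add: image_subset_iff)
qed

end

lemma lie_ball_rotation:
  assumes I: "finite I" and a: "norm a = 1"
  shows "aut_pair I (lie_ball I) (\<lambda>x i. a * x i) (\<lambda>x i. cnj a * x i)"
proof -
  have *: "(\<lambda>i. b * x i) \<in> lie_ball I" if b: "norm b = 1" and x: "x \<in> lie_ball I" for b x
  proof -
    have "sq_norm I (\<lambda>i. b * x i) = sq_norm I x" by (simp add: sq_norm_def norm_mult b)
    moreover have "norm (pairing I (\<lambda>i. b * x i) (\<lambda>i. b * x i)) = norm (pairing I x x)"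
      by (simp add: pairing_linear norm_mult b)
    ultimately show ?thesis using x by (auto simp: lie_ball_def cspace_def)
  qed
  have aa: "cnj a * a = 1" "a * cnj a = 1" using complex_norm_square[of a] a by (simp_all add: mult.commute)
  have ch: "holo_on I (lie_ball I) (\<lambda>x. b * x j)" if "j \<in> I" for b j
    by (intro holo_on_mult holo_on_const holo_on_coord I that)
  show ?thesis unfolding aut_pair_def
    using ch * a aa by (simp add: image_subset_iff mult.assoc[symmetric])
qed

text \<open>The maps along \<open>f\<close> and \<open>conj_vec f\<close> move 0 to a point whose
  two coordinates are the nonnegative numbers \<open>t\<close> and \<open>s\<close>. The phases of
  \<open>w1\<close> and \<open>w2\<close> come from turning \<open>e\<close> into \<open>f\<close>
  and from a rotation of the whole ball.\<close>

lemma lie_ball_homogeneous: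
  assumes I: "finite I" "k \<in> I" "l \<in> I" "k \<noteq> l"
  shows "homogeneous I (lie_ball I)"
  unfolding homogeneous_def
proof
  fix z assume z: "z \<in> lie_ball I"
  have Gc: "lie_ball I \<subseteq> cspace I" by (auto simp: lie_ball_def)
  interpret S: cnormed I "isotropic I" "spin_norm I" by (rule spin_cnormed(1)[OF I])
  have bd: "norm (pairing I f y) < 1" if "f \<in> isotropic I" "y \<in> lie_ball I" for f y
  proof -
    have "y \<in> {z \<in> cspace I. spin_norm I z < 1}" unfolding spin_cnormed(2)[OF I] by (rule that(2))
    then have "y \<in> cspace I" "spin_norm I y < 1" by simp_all
    then show ?thesis using S.pairing_le[OF _ that(1), of y] by linarith
  qed
  obtain e w1 w2 where e: "e \<in> isotropic I" and ze: "z = (\<lambda>i. w1 / 2 * conj_vec e i + w2 / 2 * e i)"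
    by (rule isotropic_span[OF I]) (use z Gc in auto)
  have w: "norm w1 < 1" "norm w2 < 1"
    using bd[OF e z] bd[OF isotropic_conj_vec[OF e] z] unfolding span_values(1,2)[OF e ze] by auto
  have ph: "\<exists>\<alpha>. norm \<alpha> = 1 \<and> w = complex_of_real (norm w) * \<alpha>" for w
    by (rule exI[of _ "if w = 0 then 1 else w / complex_of_real (norm w)"]) (auto simp: norm_divide)
  obtain \<alpha> where \<alpha>: "norm \<alpha> = 1" "w1 = complex_of_real (norm w1) * \<alpha>" using ph by blast
  obtain \<beta> where \<beta>: "norm \<beta> = 1" "w2 = complex_of_real (norm w2) * \<beta>" using ph by blast
  \<comment> \<open>Turning \<open>e\<close> by \<open>\<mu>\<close> affects the two coordinates by
    opposite phases, rotating by \<open>\<theta>\<close> affects them equally. The wanted phases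
    thus require \<open>\<theta> * cnj \<mu> = \<alpha>\<close> and
    \<open>\<theta> * \<mu> = \<beta>\<close>, which forces
    \<open>\<theta> * \<theta> = \<alpha> * \<beta>\<close>.\<close>
  define \<theta> where "\<theta> = csqrt (\<alpha> * \<beta>)"
  define \<mu> where "\<mu> = \<beta> * cnj \<theta>"
  have l2: "\<theta> * \<theta> = \<alpha> * \<beta>" unfolding \<theta>_def power2_eq_square[symmetric] by simp
  have "(norm \<theta>)\<^sup>2 = 1" using arg_cong[OF l2, of norm] \<alpha> \<beta> by (simp add: norm_mult power2_eq_square)
  then have nl: "norm \<theta> = 1" using norm_ge_zero[of \<theta>] by (simp add: power2_eq_1_iff)
  have nm: "norm \<mu> = 1" using nl \<beta> by (simp add: \<mu>_def norm_mult)
  have ll: "\<theta> * cnj \<theta> = 1" using complex_norm_square[of \<theta>] nl by simp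
  have bb: "\<beta> * cnj \<beta> = 1" using complex_norm_square[of \<beta>] \<beta> by simp
  have lm: "\<theta> * \<mu> = \<beta>" using ll by (simp add: \<mu>_def mult.left_commute)
  have lm': "\<theta> * cnj \<mu> = \<alpha>"
  proof -
    have "\<theta> * cnj \<mu> = \<theta> * \<theta> * cnj \<beta>" by (simp add: \<mu>_def mult.commute)
    then show ?thesis unfolding l2 using bb by (simp add: mult.assoc)
  qed
  define f where "f = (\<lambda>i. \<mu> * e i)"
  have f: "f \<in> isotropic I" unfolding f_def by (rule isotropic_phase[OF e nm])
  have f': "conj_vec f \<in> isotropic I" by (rule isotropic_conj_vec[OF f])
  define t s where "t = norm w1" and "s = norm w2"
  have ts: "\<bar>t\<bar> < 1" "\<bar>s\<bar> < 1" using w by (simp_all add: t_def s_def)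
  define \<phi> where "\<phi> x = (\<lambda>i. \<theta> * lie_moebius I (conj_vec f) s (lie_moebius I f t x) i)" for x
  have "\<exists>\<psi>. aut_pair I (lie_ball I) \<phi> \<psi>"
    using aut_pair_compose[OF Gc lie_ball_rotation[OF I(1) nl]
      aut_pair_compose[OF Gc lie_moebius_aut[OF f' bd[OF f'] I(1) ts(2)] lie_moebius_aut[OF f bd[OF f] I(1) ts(1)]]]
    unfolding \<phi>_def by blast
  moreover have "\<phi> (\<lambda>_. 0) = z"
  proof -
    have z0: "pairing I g (\<lambda>_. 0) = 0" "rest I g (\<lambda>_. 0) = (\<lambda>_. 0)" for g
      by (simp_all add: pairing_def rest_def fun_eq_iff)
    have 1: "lie_moebius I f t (\<lambda>_. 0) = (\<lambda>i. complex_of_real t / 2 * conj_vec f i + 0 / 2 * f i)"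
      unfolding lie_moebius_def Let_def z0 by (simp add: fun_eq_iff)
    note v = span_values[OF f 1]
    have r: "rest I (conj_vec f) (lie_moebius I f t (\<lambda>_. 0)) = (\<lambda>_. 0)"
      unfolding rest_def v conj_vec_conj_vec by (simp add: 1 fun_eq_iff)
    have "lie_moebius I (conj_vec f) s (lie_moebius I f t (\<lambda>_. 0)) = (\<lambda>i. complex_of_real s / 2 * f i + complex_of_real t / 2 * conj_vec f i)"
      unfolding lie_moebius_def[of I "conj_vec f"] Let_def r conj_vec_conj_vec v by (simp add: fun_eq_iff)
    then have "\<phi> (\<lambda>_. 0) = (\<lambda>i. complex_of_real s / 2 * (\<theta> * \<mu>) * e i + complex_of_real t / 2 * (\<theta> * cnj \<mu>) * conj_vec e i)"
      by (simp add: \<phi>_def f_def conj_vec_def fun_eq_iff algebra_simps)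
    also have "\<dots> = z" unfolding lm lm' ze using \<alpha>(2) \<beta>(2) by (simp add: t_def s_def fun_eq_iff)
    finally show ?thesis .
  qed
  ultimately show "\<exists>\<phi> \<psi>. aut_pair I (lie_ball I) \<phi> \<psi> \<and> \<phi> (\<lambda>_. 0) = z" by blast
qed

text \<open>In dimension one there are no isotropic vectors, so the type IV domain is treated
  directly as a disc.\<close>

lemma one_dim_ball_homogeneous:
  "homogeneous {p} (cball0 {p} 1)"
  unfolding homogeneous_def
proof
  fix z assume z: "z \<in> cball0 {p} 1"
  have mem: "x \<in> cball0 {p} 1 \<longleftrightarrow> (\<forall>i. i \<noteq> p \<longrightarrow> x i = 0) \<and> norm (x p) < 1" for x :: "'a \<Rightarrow> complex"
    by (auto simp: cball0_def cspace_def cnorm_def)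
  define M where "M a x = (\<lambda>i. if i = p then Moebius_function 0 a (x p) else 0)" for a and x :: "'a \<Rightarrow> complex"
  have zp: "norm (z p) < 1" using z by (simp add: mem)
  have im: "M a x \<in> cball0 {p} 1" if "norm a < 1" "x \<in> cball0 {p} 1" for a x
    using that Moebius_function_norm_lt_1[of a "x p"] by (simp add: mem M_def)
  have inv: "M a (M b x) = x" if "norm a < 1" "- a = b" "x \<in> cball0 {p} 1" for a b x
    using that Moebius_function_compose[of a b "x p"] by (auto simp: M_def mem fun_eq_iff)
  have ch: "holo_on {p} (cball0 {p} 1) (\<lambda>x. M a x j)" if a: "norm a < 1" and j: "j \<in> {p}" for a j
  proof -
    have nz: "1 - cnj a * x p \<noteq> 0" if "x \<in> cball0 {p} 1" for x
    proof
      assume "1 - cnj a * x p = 0"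
      then have "norm a * norm (x p) = 1" by (metis complex_mod_cnj eq_iff_diff_eq_0 norm_mult norm_one)
      moreover have "norm a * norm (x p) < 1 * 1" using a that by (intro mult_strict_mono') (auto simp: mem)
      ultimately show False by simp
    qed
    have "holo_on {p} (cball0 {p} 1) (\<lambda>x. (x p - a) / (1 - cnj a * x p))"
      by (intro holo_on_divide holo_on_diff holo_on_mult holo_on_const holo_on_coord nz) auto
    then show ?thesis using j by (simp add: M_def Moebius_function_simple)
  qed
  have "aut_pair {p} (cball0 {p} 1) (M (- z p)) (M (z p))"
    unfolding aut_pair_def using ch im inv zp by (simp add: image_subset_iff)
  moreover have "M (- z p) (\<lambda>_. 0) = z"
    using z by (auto simp: M_def Moebius_function_of_zero mem fun_eq_iff)
  ultimately show "\<exists>\<phi> \<psi>. aut_pair {p} (cball0 {p} 1) \<phi> \<psi> \<and> \<phi> (\<lambda>_. 0) = z" by blast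
qed

lemma injective_lin_invertible:
  assumes "finite I" "\<And>x. x \<in> cspace I \<Longrightarrow> lin I A x = (\<lambda>_. 0) \<Longrightarrow> x = (\<lambda>_. 0)"
  shows "\<exists>B. \<forall>x\<in>cspace I. lin I B (lin I A x) = x \<and> lin I A (lin I B x) = x"
proof (rule lin_invertible[OF assms(1)])
  show "x = (\<lambda>_. 0)" if "x \<in> cspace I" "lin I A x = (\<lambda>_. 0)" for x by (rule assms(2)[OF that])
  fix B assume B: "\<And>x. x \<in> cspace I \<Longrightarrow> lin I B (lin I A x) = x" "\<And>x. x \<in> cspace I \<Longrightarrow> lin I A (lin I B x) = x"
  then show ?thesis by (intro exI[of _ B] ballI conjI)
qed

subsection \<open>Matrices as operators\<close>

definition mat_app :: "nat \<Rightarrow> nat \<Rightarrow> (nat \<Rightarrow> nat \<Rightarrow> complex) \<Rightarrow> (nat \<Rightarrow> complex) \<Rightarrow> nat \<Rightarrow> complex" where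
  "mat_app n m A x = (\<lambda>i. if i < n then \<Sum>j<m. A i j * x j else 0)"

definition adj :: "(nat \<Rightarrow> nat \<Rightarrow> complex) \<Rightarrow> nat \<Rightarrow> nat \<Rightarrow> complex" where
  "adj A = (\<lambda>i j. cnj (A j i))"

definition herm_prod :: "nat \<Rightarrow> (nat \<Rightarrow> complex) \<Rightarrow> (nat \<Rightarrow> complex) \<Rightarrow> complex" where
  "herm_prod n x y = (\<Sum>i<n. cnj (x i) * y i)"

abbreviation vec_norm :: "nat \<Rightarrow> (nat \<Rightarrow> complex) \<Rightarrow> real" where
  "vec_norm n \<equiv> cnorm {..<n}"

text \<open>Strictness is demanded vector by vector. That this amounts to an operator norm below one
  is the content of \<open>op_norm_less_1_iff\<close>.\<close>

definition strict_contr :: "nat \<Rightarrow> nat \<Rightarrow> (nat \<Rightarrow> nat \<Rightarrow> complex) \<Rightarrow> bool" where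
  "strict_contr n m A \<longleftrightarrow> (\<forall>x\<in>cspace {..<m}. x \<noteq> (\<lambda>_. 0) \<longrightarrow> vec_norm n (mat_app n m A x) < vec_norm m x)"

lemma mat_app_cspace [simp]: "mat_app n m A x \<in> cspace {..<n}"
  by (simp add: mat_app_def cspace_def)

lemma lin_mat_app: "lin {..<n} A x = mat_app n n A x"
  by (simp add: lin_def mat_app_def)

lemma mat_app_diff: "mat_app n m A (\<lambda>i. x i - y i) = (\<lambda>i. mat_app n m A x i - mat_app n m A y i)"
  by (auto simp: mat_app_def right_diff_distrib sum_subtractf)

lemma mat_app_zero [simp]: "mat_app n m A (\<lambda>_. 0) = (\<lambda>_. 0)"
  by (auto simp: mat_app_def)

lemma mat_app_compose: "mat_app n m (\<lambda>i j. \<Sum>k<r. A i k * C k j) x = mat_app n r A (mat_app r m C x)"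
proof
  fix i
  have "(\<Sum>j<m. (\<Sum>k<r. A i k * C k j) * x j) = (\<Sum>k<r. A i k * (\<Sum>j<m. C k j * x j))"
    unfolding sum_distrib_left sum_distrib_right by (subst sum.swap) (simp add: mult.assoc)
  then show "mat_app n m (\<lambda>i j. \<Sum>k<r. A i k * C k j) x i = mat_app n r A (mat_app r m C x) i" by (simp add: mat_app_def)
qed

lemma mat_app_basis: "j < m \<Longrightarrow> i < n \<Longrightarrow> mat_app n m A (\<lambda>k. if k = j then 1 else 0) i = A i j"
  by (simp add: mat_app_def if_distrib[of "\<lambda>x. _ * x"] cong: if_cong)

lemma basis_cspace: "j < m \<Longrightarrow> (\<lambda>k. if k = j then 1 else 0) \<in> cspace {..<m}"
  by (simp add: cspace_def)

lemma mat_app_eqI: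
  assumes "\<And>x. x \<in> cspace {..<m} \<Longrightarrow> mat_app n m A x = mat_app n m C x" "i < n" "j < m"
  shows "A i j = C i j"
  using fun_cong[OF assms(1)[OF basis_cspace[OF assms(3)]], of i] by (simp add: mat_app_basis assms)

lemma mat_app_cong: "(\<And>i j. i < n \<Longrightarrow> j < m \<Longrightarrow> A i j = C i j) \<Longrightarrow> mat_app n m A x = mat_app n m C x"
  by (auto simp: mat_app_def)

lemma adj_adj [simp]: "adj (adj A) = A" by (simp add: adj_def)

lemma herm_prod_adj: "herm_prod n y (mat_app n m A x) = herm_prod m (mat_app m n (adj A) y) x"
proof -
  have "herm_prod n y (mat_app n m A x) = (\<Sum>i<n. \<Sum>j<m. cnj (y i) * (A i j * x j))"
    by (simp add: herm_prod_def mat_app_def sum_distrib_left)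
  also have "\<dots> = (\<Sum>j<m. \<Sum>i<n. cnj (y i) * (A i j * x j))" by (rule sum.swap)
  also have "\<dots> = herm_prod m (mat_app m n (adj A) y) x"
    unfolding herm_prod_def mat_app_def adj_def by (simp add: cnj_sum sum_distrib_right) (simp only: mult.left_commute mult.commute mult.assoc)
  finally show ?thesis .
qed

lemma herm_prod_cnj: "herm_prod n y x = cnj (herm_prod n x y)"
  by (simp add: herm_prod_def cnj_sum mult.commute)

lemma herm_prod_norm: "herm_prod n x x = complex_of_real ((vec_norm n x)\<^sup>2)"
  unfolding herm_prod_def cnorm_power2 of_real_sum
  by (rule sum.cong[OF refl]) (simp only: complex_norm_square mult.commute)

lemma herm_prod_le: "norm (herm_prod n x y) \<le> vec_norm n x * vec_norm n y"
proof -
  have "herm_prod n x y = pairing {..<n} (\<lambda>i. cnj (x i)) y" by (simp add: herm_prod_def pairing_def)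
  moreover have "vec_norm n (\<lambda>i. cnj (x i)) = vec_norm n x" by (simp add: cnorm_def)
  ultimately show ?thesis using cauchy_schwarz_pairing[of "{..<n}" "\<lambda>i. cnj (x i)" y] by simp
qed

lemma norm_diff_sq: "(vec_norm n (\<lambda>i. x i - y i))\<^sup>2 = (vec_norm n x)\<^sup>2 + (vec_norm n y)\<^sup>2 - 2 * Re (herm_prod n x y)"
proof -
  have "(norm (a - b))\<^sup>2 = (norm a)\<^sup>2 + (norm b)\<^sup>2 - 2 * Re (cnj a * b)" for a b :: complex
    unfolding cmod_power2 by (simp add: power2_eq_square algebra_simps)
  then show ?thesis unfolding cnorm_power2 herm_prod_def by (simp add: sum.distrib sum_subtractf sum_distrib_left)
qed

lemma vec_norm_pos: "x \<in> cspace {..<n} \<Longrightarrow> x \<noteq> (\<lambda>_. 0) \<Longrightarrow> 0 < vec_norm n x"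
proof -
  assume x: "x \<in> cspace {..<n}" "x \<noteq> (\<lambda>_. 0)"
  have "vec_norm n x \<noteq> 0"
  proof
    assume "vec_norm n x = 0"
    then have "x = (\<lambda>_. 0)" using x(1) by (intro cspace_eqI[of _ "{..<n}"]) (auto simp: cnorm_eq_0_iff)
    with x(2) show False by simp
  qed
  then show ?thesis using cnorm_nonneg[of "{..<n}" x] by simp
qed

lemma strict_contr_le: "strict_contr n m A \<Longrightarrow> x \<in> cspace {..<m} \<Longrightarrow> vec_norm n (mat_app n m A x) \<le> vec_norm m x"
  unfolding strict_contr_def by (cases "x = (\<lambda>_. 0)") (auto intro: less_imp_le)

text \<open>For \<open>x\<close> the image of \<open>y\<close> under the adjoint, the squared length
  of \<open>x\<close> is the product of \<open>y\<close> with \<open>A x\<close>; Cauchy-Schwarz and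
  strictness at \<open>x\<close> leave a factor of \<open>x\<close> to cancel.\<close>

lemma strict_contr_adj:
  assumes c: "strict_contr n m A"
  shows "strict_contr m n (adj A)"
  unfolding strict_contr_def
proof (intro ballI impI)
  fix y assume y: "y \<in> cspace {..<n}" "y \<noteq> (\<lambda>_. 0)"
  define x where "x = mat_app m n (adj A) y"
  show "vec_norm m (mat_app m n (adj A) y) < vec_norm n y"
  proof (cases "x = (\<lambda>_. 0)")
    case True
    then show ?thesis using vec_norm_pos[OF y] by (simp add: x_def)
  next
    case False
    have xc: "x \<in> cspace {..<m}" by (simp add: x_def)
    have px: "0 < vec_norm m x" by (rule vec_norm_pos[OF xc False])
    have "complex_of_real ((vec_norm m x)\<^sup>2) = herm_prod n y (mat_app n m A x)"
      unfolding herm_prod_adj x_def[symmetric] herm_prod_norm ..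
    then have "(vec_norm m x)\<^sup>2 = norm (herm_prod n y (mat_app n m A x))" by (metis norm_of_real abs_of_nonneg zero_le_power2)
    also have "\<dots> \<le> vec_norm n y * vec_norm n (mat_app n m A x)" by (rule herm_prod_le)
    also have "\<dots> < vec_norm n y * vec_norm m x"
      using c xc False vec_norm_pos[OF y] unfolding strict_contr_def by (intro mult_strict_left_mono) auto
    finally have "vec_norm m x * vec_norm m x < vec_norm n y * vec_norm m x" by (simp add: power2_eq_square)
    then show ?thesis using px by (simp add: x_def)
  qed
qed

text \<open>The two cross terms are equal by adjointness. The identity compares the contraction gap
  of a matrix that sends \<open>u - B* y\<close> to \<open>y - B u\<close> with that of its Moebius
  transform, which sends \<open>H u\<close> to \<open>K y\<close>.\<close>

lemma mobius_identity:
  "(vec_norm q (\<lambda>i. u i - mat_app q p (adj B) y i))\<^sup>2 - (vec_norm p (\<lambda>i. y i - mat_app p q B u i))\<^sup>2 =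
   ((vec_norm q u)\<^sup>2 - (vec_norm p (mat_app p q B u))\<^sup>2) - ((vec_norm p y)\<^sup>2 - (vec_norm q (mat_app q p (adj B) y))\<^sup>2)"
proof -
  have "Re (herm_prod q u (mat_app q p (adj B) y)) = Re (herm_prod p y (mat_app p q B u))"
    unfolding herm_prod_adj[of p y] by (subst herm_prod_cnj) simp
  then show ?thesis unfolding norm_diff_sq by simp
qed

text \<open>The existence half of Cramer's rule: a nonzero determinant provides a solution, and
  \<open>fun_det_cramer\<close> identifies its entries.\<close>

lemma fun_det_solve:
  assumes "fun_det n M \<noteq> 0" "i < n"
  shows "(\<Sum>k<n. M i k * (fun_det n (\<lambda>r s. if s = k then w r else M r s) / fun_det n M)) = w i"
proof -
  have inj: "x = (\<lambda>_. 0)" if x: "x \<in> cspace {..<n}" "lin {..<n} M x = (\<lambda>_. 0)" for x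
  proof (rule ccontr)
    assume "x \<noteq> (\<lambda>_. 0)"
    then obtain i where "x i \<noteq> 0" by (auto simp: fun_eq_iff)
    then have ex: "\<exists>i<n. x i \<noteq> 0" using x(1) by (intro exI[of _ i]) (auto simp: cspace_def)
    have z: "(\<Sum>j<n. M r j * x j) = 0" if "r < n" for r
      using fun_cong[OF x(2), of r] that by (simp add: lin_def)
    have "fun_det n M = 0" unfolding fun_det_eq_0_iff using ex z by (intro exI[of _ x]) simp
    with assms(1) show False by simp
  qed
  define w' where "w' = (\<lambda>r. if r < n then w r else 0)"
  have w': "w' \<in> cspace {..<n}" by (simp add: w'_def cspace_def)
  have "\<exists>C. \<forall>x\<in>cspace {..<n}. lin {..<n} C (lin {..<n} M x) = x \<and> lin {..<n} M (lin {..<n} C x) = x"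
    by (rule injective_lin_invertible[OF finite_lessThan]) (rule inj)
  then obtain C where C0: "\<forall>x\<in>cspace {..<n}. lin {..<n} C (lin {..<n} M x) = x \<and> lin {..<n} M (lin {..<n} C x) = x" ..
  have C: "lin {..<n} M (lin {..<n} C w') = w'" by (rule conjunct2[OF bspec[OF C0 w']])
  define v where "v = lin {..<n} C w'"
  have v: "(\<Sum>j<n. M r j * v j) = w r" if "r < n" for r
    using fun_cong[OF C, of r] that unfolding v_def[symmetric] by (simp add: lin_def w'_def)
  have "v k = fun_det n (\<lambda>r s. if s = k then w r else M r s) / fun_det n M" if "k < n" for k
    using fun_det_cramer[OF v that] assms(1) by (simp add: eq_divide_eq)
  then have "(\<Sum>k<n. M i k * (fun_det n (\<lambda>r s. if s = k then w r else M r s) / fun_det n M)) = (\<Sum>k<n. M i k * v k)"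
    by (intro sum.cong refl) simp
  then show ?thesis using v[OF assms(2)] by simp
qed

subsection \<open>Moebius transformations of the matrix ball\<close>

text \<open>The conditions on \<open>K\<close> and \<open>H\<close> are stated as identities of
  squared norms, the form in which they meet \<open>mobius_identity\<close>. They leave a unitary
  freedom, which is used later to respect symmetry.\<close>

locale mobius =
  fixes p q :: nat and B K Ki H Hi :: "nat \<Rightarrow> nat \<Rightarrow> complex"
  assumes B: "strict_contr p q B"
    and K: "\<And>y. y \<in> cspace {..<p} \<Longrightarrow> (vec_norm p (mat_app p p K y))\<^sup>2 = (vec_norm p y)\<^sup>2 - (vec_norm q (mat_app q p (adj B) y))\<^sup>2"
    and H: "\<And>x. x \<in> cspace {..<q} \<Longrightarrow> (vec_norm q (mat_app q q H x))\<^sup>2 = (vec_norm q x)\<^sup>2 - (vec_norm p (mat_app p q B x))\<^sup>2"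
    and KK: "\<And>y. y \<in> cspace {..<p} \<Longrightarrow> mat_app p p Ki (mat_app p p K y) = y" "\<And>y. y \<in> cspace {..<p} \<Longrightarrow> mat_app p p K (mat_app p p Ki y) = y"
    and HH: "\<And>y. y \<in> cspace {..<q} \<Longrightarrow> mat_app q q Hi (mat_app q q H y) = y" "\<And>y. y \<in> cspace {..<q} \<Longrightarrow> mat_app q q H (mat_app q q Hi y) = y"
begin

text \<open>
  Inverses are expressed by Cramer's rule, which makes the maps visibly holomorphic: \<open>W1 Z\<close> is
  \<open>(1 + Z B\<^sup>*)\<^sup>-\<^sup>1 (Z + B)\<close> and \<open>fwd Z\<close> is \<open>K W1 H\<^sup>-\<^sup>1\<close>, where \<open>K\<^sup>* K = 1 - B B\<^sup>*\<close> and \<open>H\<^sup>* H = 1 - B\<^sup>* B\<close>;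
  conversely \<open>bwd V\<close> is \<open>(W2 - B) (1 - B\<^sup>* W2)\<^sup>-\<^sup>1\<close> with \<open>W2 = K\<^sup>-\<^sup>1 V H\<close>. The matrices \<open>Ki\<close> and \<open>Hi\<close> are
  the inverses of \<open>K\<close> and \<open>H\<close>.
\<close>

definition M1 :: "(nat \<Rightarrow> nat \<Rightarrow> complex) \<Rightarrow> nat \<Rightarrow> nat \<Rightarrow> complex" where
  "M1 Z = (\<lambda>i l. (if i = l then 1 else 0) + (\<Sum>m<q. Z i m * adj B m l))"

definition W1 :: "(nat \<Rightarrow> nat \<Rightarrow> complex) \<Rightarrow> nat \<Rightarrow> nat \<Rightarrow> complex" where
  "W1 Z = (\<lambda>k j. fun_det p (\<lambda>r s. if s = k then Z r j + B r j else M1 Z r s) / fun_det p (M1 Z))"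

definition fwd :: "(nat \<Rightarrow> nat \<Rightarrow> complex) \<Rightarrow> nat \<Rightarrow> nat \<Rightarrow> complex" where
  "fwd Z = (\<lambda>i j. \<Sum>k<p. K i k * (\<Sum>l<q. W1 Z k l * Hi l j))"

definition W2 :: "(nat \<Rightarrow> nat \<Rightarrow> complex) \<Rightarrow> nat \<Rightarrow> nat \<Rightarrow> complex" where
  "W2 V = (\<lambda>i j. \<Sum>k<p. Ki i k * (\<Sum>l<q. V k l * H l j))"

text \<open>The transpose of \<open>1 - B* W2\<close>: in the equation for \<open>bwd V\<close> that
  matrix stands on the right, and Cramer's rule is applied to each row of unknowns.\<close>

definition M2 :: "(nat \<Rightarrow> nat \<Rightarrow> complex) \<Rightarrow> nat \<Rightarrow> nat \<Rightarrow> complex" where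
  "M2 V = (\<lambda>k l. (if k = l then 1 else 0) - (\<Sum>m<p. adj B l m * W2 V m k))"

definition bwd :: "(nat \<Rightarrow> nat \<Rightarrow> complex) \<Rightarrow> nat \<Rightarrow> nat \<Rightarrow> complex" where
  "bwd V = (\<lambda>i j. fun_det q (\<lambda>r s. if s = j then W2 V i r - B i r else M2 V r s) / fun_det q (M2 V))"

lemma adjB: "strict_contr q p (adj B)"
  by (rule strict_contr_adj[OF B])

text \<open>A kernel vector would satisfy \<open>y = - Z B* y\<close>, where \<open>Z\<close> does
  not expand and \<open>B*\<close> strictly contracts.\<close>

lemma det1: assumes Z: "strict_contr p q Z" shows "fun_det p (M1 Z) \<noteq> 0"
proof
  assume "fun_det p (M1 Z) = 0"
  then obtain v where ex: "\<exists>i<p. v i \<noteq> 0" and z: "\<forall>i<p. (\<Sum>l<p. M1 Z i l * v l) = 0"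
    unfolding fun_det_eq_0_iff by blast
  define y where "y = (\<lambda>i. if i < p then v i else 0)"
  have y: "y \<in> cspace {..<p}" "y \<noteq> (\<lambda>_. 0)" using ex by (auto simp: y_def cspace_def fun_eq_iff)
  have "mat_app p p (M1 Z) y = (\<lambda>i. y i + mat_app p q Z (mat_app q p (adj B) y) i)"
  proof
    fix i
    have "mat_app p p (\<lambda>i l. \<Sum>m<q. Z i m * adj B m l) y i = mat_app p q Z (mat_app q p (adj B) y) i" unfolding mat_app_compose ..
    then show "mat_app p p (M1 Z) y i = y i + mat_app p q Z (mat_app q p (adj B) y) i"
      by (cases "i < p") (simp_all add: mat_app_def M1_def distrib_right sum.distrib if_distrib[of "\<lambda>x. x * _"] y_def cong: if_cong)
  qed
  moreover have "mat_app p p (M1 Z) y = (\<lambda>_. 0)"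
    using z by (auto simp: mat_app_def y_def)
  ultimately have "y = (\<lambda>i. - mat_app p q Z (mat_app q p (adj B) y) i)"
    by (auto simp: fun_eq_iff eq_neg_iff_add_eq_0)
  then have "vec_norm p y = vec_norm p (\<lambda>i. - mat_app p q Z (mat_app q p (adj B) y) i)" by simp
  also have "\<dots> = vec_norm p (mat_app p q Z (mat_app q p (adj B) y))" by (simp add: cnorm_def)
  also have "\<dots> \<le> vec_norm q (mat_app q p (adj B) y)" by (rule strict_contr_le[OF Z mat_app_cspace])
  also have "\<dots> < vec_norm p y" using adjB y unfolding strict_contr_def by blast
  finally show False by simp
qed

text \<open>The transformation as a relation between graphs: with \<open>y = W1 Z u\<close>, the
  matrix \<open>Z\<close> sends \<open>u - B* y\<close> to \<open>y - B u\<close>. The later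
  arguments use this relation in place of the explicit inverse.\<close>

lemma rel1:
  assumes Z: "strict_contr p q Z" and u: "u \<in> cspace {..<q}"
  shows "mat_app p q Z (\<lambda>i. u i - mat_app q p (adj B) (mat_app p q (W1 Z) u) i) = (\<lambda>i. mat_app p q (W1 Z) u i - mat_app p q B u i)"
proof -
  have ent: "(\<Sum>k<p. M1 Z i k * W1 Z k j) = Z i j + B i j" if "i < p" for i j
    unfolding W1_def by (rule fun_det_solve[OF det1[OF Z] that])
  have "mat_app p p (M1 Z) (mat_app p q (W1 Z) u) = (\<lambda>i. mat_app p q Z u i + mat_app p q B u i)"
    unfolding mat_app_compose[symmetric] by (auto simp: mat_app_def ent distrib_right sum.distrib)
  moreover have "mat_app p p (M1 Z) y = (\<lambda>i. y i + mat_app p q Z (mat_app q p (adj B) y) i)" if y: "y \<in> cspace {..<p}" for y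
  proof
    fix i
    have "mat_app p p (\<lambda>i l. \<Sum>m<q. Z i m * adj B m l) y i = mat_app p q Z (mat_app q p (adj B) y) i" unfolding mat_app_compose ..
    then show "mat_app p p (M1 Z) y i = y i + mat_app p q Z (mat_app q p (adj B) y) i"
      using y by (cases "i < p") (simp_all add: mat_app_def M1_def distrib_right sum.distrib if_distrib[of "\<lambda>x. x * _"] cspace_def cong: if_cong)
  qed
  ultimately have "(\<lambda>i. mat_app p q (W1 Z) u i + mat_app p q Z (mat_app q p (adj B) (mat_app p q (W1 Z) u)) i) = (\<lambda>i. mat_app p q Z u i + mat_app p q B u i)"
    by simp
  then show ?thesis unfolding mat_app_diff by (auto simp: fun_eq_iff algebra_simps)
qed

lemma fwd_op: "mat_app p q (fwd Z) x = mat_app p p K (mat_app p q (W1 Z) (mat_app q q Hi x))"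
  unfolding fwd_def mat_app_compose ..

lemma W2_op: "mat_app p q (W2 V) x = mat_app p p Ki (mat_app p q V (mat_app q q H x))"
  unfolding W2_def mat_app_compose ..

lemma nonexp: "u \<in> cspace {..<q} \<Longrightarrow> u \<noteq> (\<lambda>_. 0) \<Longrightarrow> mat_app q p (adj B) (mat_app p q B u) \<noteq> u"
  using strict_contr_le[OF adjB mat_app_cspace, of q B u] B unfolding strict_contr_def by fastforce

text \<open>A vanishing argument of \<open>Z\<close> would give \<open>y = B u\<close> and
  \<open>u = B* y\<close>, hence \<open>u = B* B u\<close>, against strict contraction.\<close>

lemma injective1:
  assumes rel: "mat_app p q Z (\<lambda>i. u i - mat_app q p (adj B) y i) = (\<lambda>i. y i - mat_app p q B u i)"
    and u: "u \<in> cspace {..<q}" "(\<lambda>i. u i - mat_app q p (adj B) y i) = (\<lambda>_. 0)"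
  shows "u = (\<lambda>_. 0)"
proof (rule ccontr)
  assume "u \<noteq> (\<lambda>_. 0)"
  have "y = mat_app p q B u" using rel unfolding u(2) by (auto simp: fun_eq_iff)
  moreover have "u = mat_app q p (adj B) y" using u(2) by (auto simp: fun_eq_iff)
  ultimately show False using nonexp[OF u(1) \<open>u \<noteq> (\<lambda>_. 0)\<close>] by simp
qed

text \<open>\<open>fwd Z\<close> sends \<open>H u\<close> to \<open>K y\<close>. By
  \<open>mobius_identity\<close> and the norm identities for \<open>K\<close> and \<open>H\<close>,
  its strictness at \<open>H u\<close> is the strictness of \<open>Z\<close> at
  \<open>u - B* y\<close>.\<close>

lemma fwd_strict_contr:
  assumes Z: "strict_contr p q Z"
  shows "strict_contr p q (fwd Z)"
  unfolding strict_contr_def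
proof (intro ballI impI)
  fix x assume x: "x \<in> cspace {..<q}" "x \<noteq> (\<lambda>_. 0)"
  define u where "u = mat_app q q Hi x"
  define y where "y = mat_app p q (W1 Z) u"
  define s where "s = (\<lambda>i. u i - mat_app q p (adj B) y i)"
  have u: "u \<in> cspace {..<q}" "mat_app q q H u = x" using HH(2)[OF x(1)] by (simp_all add: u_def)
  have sc: "s \<in> cspace {..<q}" using u(1) by (simp add: s_def cspace_def mat_app_def)
  have rel: "mat_app p q Z s = (\<lambda>i. y i - mat_app p q B u i)" unfolding s_def y_def by (rule rel1[OF Z u(1)])
  have "s \<noteq> (\<lambda>_. 0)"
  proof
    assume "s = (\<lambda>_. 0)"
    then have "u = (\<lambda>_. 0)" using injective1[of Z u y] rel u(1) by (simp add: s_def)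
    then show False using x(2) u(2) by simp
  qed
  then have "vec_norm p (mat_app p q Z s) < vec_norm q s" using Z sc unfolding strict_contr_def by blast
  then have "(vec_norm p (mat_app p q Z s))\<^sup>2 < (vec_norm q s)\<^sup>2" by (intro power_strict_mono cnorm_nonneg) auto
  then have "(vec_norm p (mat_app p p K y))\<^sup>2 < (vec_norm q x)\<^sup>2"
    using mobius_identity[of q u p B y] H[OF u(1)] K[of y] unfolding rel u(2) s_def[symmetric] by (simp add: y_def)
  then have "vec_norm p (mat_app p p K y) < vec_norm q x" by (rule power2_less_imp_less) (rule cnorm_nonneg)
  then show "vec_norm p (mat_app p q (fwd Z) x) < vec_norm q x" by (simp add: fwd_op y_def u_def)
qed

text \<open>The same comparison read backwards. It also shows that \<open>u - B* W2 u\<close> is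
  nonzero, which makes \<open>1 - B* W2\<close> invertible.\<close>

lemma W2_small:
  assumes V: "strict_contr p q V" and u: "u \<in> cspace {..<q}" "u \<noteq> (\<lambda>_. 0)"
  shows "vec_norm p (\<lambda>i. mat_app p q (W2 V) u i - mat_app p q B u i) < vec_norm q (\<lambda>i. u i - mat_app q p (adj B) (mat_app p q (W2 V) u) i)"
proof -
  define y where "y = mat_app p q (W2 V) u"
  have Ky: "mat_app p p K y = mat_app p q V (mat_app q q H u)" unfolding y_def W2_op by (rule KK(2)) simp
  have "mat_app q q H u \<noteq> (\<lambda>_. 0)" using HH(1)[OF u(1)] u(2) by (metis mat_app_zero)
  then have "vec_norm p (mat_app p p K y) < vec_norm q (mat_app q q H u)" using V unfolding strict_contr_def Ky by simp
  then have "(vec_norm p (mat_app p p K y))\<^sup>2 < (vec_norm q (mat_app q q H u))\<^sup>2" by (intro power_strict_mono cnorm_nonneg) auto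
  then have "(vec_norm p (\<lambda>i. y i - mat_app p q B u i))\<^sup>2 < (vec_norm q (\<lambda>i. u i - mat_app q p (adj B) y i))\<^sup>2"
    using mobius_identity[of q u p B y] H[OF u(1)] K[of y] by (simp add: y_def)
  then show ?thesis unfolding y_def by (rule power2_less_imp_less) (rule cnorm_nonneg)
qed

lemma M2_op: "u \<in> cspace {..<q} \<Longrightarrow> mat_app q q (\<lambda>l k. M2 V k l) u = (\<lambda>i. u i - mat_app q p (adj B) (mat_app p q (W2 V) u) i)"
proof
  fix i assume u: "u \<in> cspace {..<q}"
  have "mat_app q q (\<lambda>l k. \<Sum>m<p. adj B l m * W2 V m k) u i = mat_app q p (adj B) (mat_app p q (W2 V) u) i" unfolding mat_app_compose ..
  then show "mat_app q q (\<lambda>l k. M2 V k l) u i = u i - mat_app q p (adj B) (mat_app p q (W2 V) u) i"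
    using u by (cases "i < q") (simp_all add: mat_app_def M2_def left_diff_distrib sum_subtractf if_distrib[of "\<lambda>x. x * _"] cspace_def cong: if_cong)
qed

lemma fun_det_transpose: "fun_det n (\<lambda>i j. a j i) = fun_det n a"
proof -
  have "mat n n (\<lambda>(i, j). a j i) = transpose_mat (mat n n (\<lambda>(i, j). a i j))" by (intro eq_matI) auto
  then show ?thesis unfolding fun_det_def by (simp add: det_transpose[of _ n])
qed

lemma det2: assumes V: "strict_contr p q V" shows "fun_det q (M2 V) \<noteq> 0"
proof
  assume "fun_det q (M2 V) = 0"
  then have "fun_det q (\<lambda>l k. M2 V k l) = 0" by (subst fun_det_transpose)
  then obtain v where ex: "\<exists>i<q. v i \<noteq> 0" and z: "\<forall>i<q. (\<Sum>l<q. M2 V l i * v l) = 0"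
    unfolding fun_det_eq_0_iff by blast
  define u where "u = (\<lambda>i. if i < q then v i else 0)"
  have u: "u \<in> cspace {..<q}" "u \<noteq> (\<lambda>_. 0)" using ex by (auto simp: u_def cspace_def fun_eq_iff)
  have "mat_app q q (\<lambda>l k. M2 V k l) u = (\<lambda>_. 0)" using z by (auto simp: mat_app_def u_def)
  then have "vec_norm q (\<lambda>i. u i - mat_app q p (adj B) (mat_app p q (W2 V) u) i) = 0" unfolding M2_op[OF u(1)] by simp
  then show False using W2_small[OF V u] cnorm_nonneg[of "{..<p}" "\<lambda>i. mat_app p q (W2 V) u i - mat_app p q B u i"] by linarith
qed

lemma rel2:
  assumes V: "strict_contr p q V" and u: "u \<in> cspace {..<q}"
  shows "mat_app p q (bwd V) (\<lambda>i. u i - mat_app q p (adj B) (mat_app p q (W2 V) u) i) = (\<lambda>i. mat_app p q (W2 V) u i - mat_app p q B u i)"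
proof -
  have ent: "(\<Sum>l<q. bwd V i l * M2 V k l) = W2 V i k - B i k" if "k < q" for i k
    using fun_det_solve[OF det2[OF V] that, of "\<lambda>r. W2 V i r - B i r"] unfolding bwd_def by (simp add: mult.commute)
  show ?thesis
    unfolding M2_op[OF u, symmetric] unfolding mat_app_compose[symmetric]
    by (auto simp: mat_app_def ent left_diff_distrib sum_subtractf)
qed

text \<open>Being injective on a finite-dimensional space, \<open>1 - B* W2\<close> is onto, so
  \<open>rel2\<close> describes \<open>bwd V\<close> on all vectors.\<close>

lemma surj2:
  assumes V: "strict_contr p q V" and s: "s \<in> cspace {..<q}"
  obtains u where "u \<in> cspace {..<q}" "s = (\<lambda>i. u i - mat_app q p (adj B) (mat_app p q (W2 V) u) i)"
proof -
  have inj: "x = (\<lambda>_. 0)" if x: "x \<in> cspace {..<q}" "lin {..<q} (\<lambda>l k. M2 V k l) x = (\<lambda>_. 0)" for x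
  proof (rule ccontr)
    assume x0: "x \<noteq> (\<lambda>_. 0)"
    have "vec_norm q (\<lambda>i. x i - mat_app q p (adj B) (mat_app p q (W2 V) x) i) = 0"
      using x(2) unfolding lin_mat_app M2_op[OF x(1)] by simp
    then show False using W2_small[OF V x(1) x0] cnorm_nonneg[of "{..<p}" "\<lambda>i. mat_app p q (W2 V) x i - mat_app p q B x i"] by linarith
  qed
  let ?M = "\<lambda>l k. M2 V k l"
  have "\<exists>C. \<forall>x\<in>cspace {..<q}. lin {..<q} C (lin {..<q} ?M x) = x \<and> lin {..<q} ?M (lin {..<q} C x) = x"
    by (rule injective_lin_invertible[OF finite_lessThan]) (rule inj)
  then obtain C where C: "\<forall>x\<in>cspace {..<q}. lin {..<q} C (lin {..<q} ?M x) = x \<and> lin {..<q} ?M (lin {..<q} C x) = x" ..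
  have "s = lin {..<q} ?M (lin {..<q} C s)" by (rule conjunct2[OF bspec[OF C s], symmetric])
  then have "s = mat_app q q ?M (lin {..<q} C s)" unfolding lin_mat_app .
  also have "\<dots> = (\<lambda>i. lin {..<q} C s i - mat_app q p (adj B) (mat_app p q (W2 V) (lin {..<q} C s)) i)" by (rule M2_op) simp
  finally show ?thesis by (rule that[OF lin_cspace])
qed

lemma bwd_strict_contr:
  assumes V: "strict_contr p q V"
  shows "strict_contr p q (bwd V)"
  unfolding strict_contr_def
proof (intro ballI impI)
  fix s assume s: "s \<in> cspace {..<q}" "s \<noteq> (\<lambda>_. 0)"
  obtain u where u: "u \<in> cspace {..<q}" "s = (\<lambda>i. u i - mat_app q p (adj B) (mat_app p q (W2 V) u) i)" by (rule surj2[OF V s(1)])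
  have "u \<noteq> (\<lambda>_. 0)" using s(2) u(2) by auto
  from W2_small[OF V u(1) this] show "vec_norm p (mat_app p q (bwd V) s) < vec_norm q s"
    unfolding u(2) rel2[OF V u(1)] .
qed

lemma W2_fwd:
  assumes Z: "strict_contr p q Z" and x: "x \<in> cspace {..<q}"
  shows "mat_app p q (W2 (fwd Z)) x = mat_app p q (W1 Z) x"
  unfolding W2_op fwd_op HH(1)[OF x] by (rule KK(1)) simp

lemma bwd_fwd:
  assumes Z: "strict_contr p q Z" and ij: "i < p" "j < q"
  shows "bwd (fwd Z) i j = Z i j"
proof (rule mat_app_eqI[OF _ ij])
  fix s assume s: "s \<in> cspace {..<q}"
  note V = fwd_strict_contr[OF Z]
  obtain u where u: "u \<in> cspace {..<q}" "s = (\<lambda>i. u i - mat_app q p (adj B) (mat_app p q (W2 (fwd Z)) u) i)" by (rule surj2[OF V s])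
  show "mat_app p q (bwd (fwd Z)) s = mat_app p q Z s"
    unfolding u(2) rel2[OF V u(1)] unfolding W2_fwd[OF Z u(1)] rel1[OF Z u(1)] ..
qed

text \<open>Both sides solve the same affine equation, and their difference satisfies
  \<open>y = - Z B* y\<close> with \<open>Z = bwd V\<close>; it vanishes as in
  \<open>det1\<close>.\<close>

lemma W1_bwd:
  assumes V: "strict_contr p q V" and x: "x \<in> cspace {..<q}"
  shows "mat_app p q (W1 (bwd V)) x = mat_app p q (W2 V) x"
proof -
  note Z = bwd_strict_contr[OF V]
  define a b where "a = mat_app p q (W1 (bwd V)) x" and "b = mat_app p q (W2 V) x"
  define y where "y = (\<lambda>i. a i - b i)"
  have yc: "y \<in> cspace {..<p}" by (simp add: y_def a_def b_def cspace_def mat_app_def)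
  have ea: "mat_app p q (bwd V) x i - mat_app p q (bwd V) (mat_app q p (adj B) a) i = a i - mat_app p q B x i" for i
    using fun_cong[OF rel1[OF Z x], of i] unfolding mat_app_diff a_def .
  have eb: "mat_app p q (bwd V) x i - mat_app p q (bwd V) (mat_app q p (adj B) b) i = b i - mat_app p q B x i" for i
    using fun_cong[OF rel2[OF V x], of i] unfolding mat_app_diff b_def .
  have "- mat_app p q (bwd V) (mat_app q p (adj B) y) i = y i" for i
    unfolding y_def mat_app_diff using ea[of i] eb[of i] by (simp add: algebra_simps)
  then have eq: "y = (\<lambda>i. - mat_app p q (bwd V) (mat_app q p (adj B) y) i)" by auto
  have "y = (\<lambda>_. 0)"
  proof (rule ccontr)
    assume y0: "y \<noteq> (\<lambda>_. 0)"
    have "vec_norm p y = vec_norm p (\<lambda>i. - mat_app p q (bwd V) (mat_app q p (adj B) y) i)" using eq by simp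
    also have "\<dots> = vec_norm p (mat_app p q (bwd V) (mat_app q p (adj B) y))" by (simp add: cnorm_def)
    also have "\<dots> \<le> vec_norm q (mat_app q p (adj B) y)" by (rule strict_contr_le[OF Z mat_app_cspace])
    also have "\<dots> < vec_norm p y" using adjB yc y0 unfolding strict_contr_def by blast
    finally show False by simp
  qed
  then show ?thesis by (auto simp: y_def a_def b_def fun_eq_iff)
qed

lemma fwd_bwd:
  assumes V: "strict_contr p q V" and ij: "i < p" "j < q"
  shows "fwd (bwd V) i j = V i j"
proof (rule mat_app_eqI[OF _ ij])
  fix x assume x: "x \<in> cspace {..<q}"
  show "mat_app p q (fwd (bwd V)) x = mat_app p q V x"
    unfolding fwd_op W1_bwd[OF V mat_app_cspace] W2_op HH(2)[OF x] by (rule KK(2)) simp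
qed

text \<open>At \<open>Z = - B\<close> the numerator \<open>Z + B\<close> is zero. Since
  \<open>bwd\<close> inverts \<open>fwd\<close>, it therefore sends 0 to \<open>- B\<close>.\<close>

lemma fwd_neg: "i < p \<Longrightarrow> j < q \<Longrightarrow> fwd (\<lambda>i j. - B i j) i j = 0"
proof -
  have "W1 (\<lambda>i j. - B i j) k l = 0" if "k < p" for k l
  proof -
    have "strict_contr p q (\<lambda>i j. - B i j)"
    proof -
      have "mat_app p q (\<lambda>i j. - B i j) x = (\<lambda>i. - mat_app p q B x i)" for x by (auto simp: mat_app_def sum_negf)
      then show ?thesis using B by (simp add: strict_contr_def cnorm_def)
    qed
    from det1[OF this] have "fun_det p (M1 (\<lambda>i j. - B i j)) \<noteq> 0" .
    have "0 * fun_det p (M1 (\<lambda>i j. - B i j)) = fun_det p (\<lambda>r s. if s = k then 0 else M1 (\<lambda>i j. - B i j) r s)"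
      using fun_det_cramer[of p "M1 (\<lambda>i j. - B i j)" "\<lambda>_. 0" "\<lambda>_. 0" k] that by simp
    moreover have "(\<lambda>r s. if s = k then - B r l + B r l else M1 (\<lambda>i j. - B i j) r s) =
        (\<lambda>r s. if s = k then 0 else M1 (\<lambda>i j. - B i j) r s)" by (auto simp: fun_eq_iff)
    ultimately show ?thesis unfolding W1_def by simp
  qed
  then show "fwd (\<lambda>i j. - B i j) i j = 0" by (simp add: fwd_def)
qed

end

section \<open>Preservation of symmetry and skew-symmetry\<close>

definition eps_symmetric :: "complex \<Rightarrow> nat \<Rightarrow> (nat \<Rightarrow> nat \<Rightarrow> complex) \<Rightarrow> bool" where
  "eps_symmetric \<epsilon> p Z \<longleftrightarrow> (\<forall>i<p. \<forall>j<p. Z j i = \<epsilon> * Z i j)"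

lemma esymD: "eps_symmetric \<epsilon> p Z \<Longrightarrow> i < p \<Longrightarrow> j < p \<Longrightarrow> Z j i = \<epsilon> * Z i j"
  unfolding eps_symmetric_def by (elim allE impE)

abbreviation bilinear :: "nat \<Rightarrow> (nat \<Rightarrow> complex) \<Rightarrow> (nat \<Rightarrow> complex) \<Rightarrow> complex" where
  "bilinear p \<equiv> pairing {..<p}"

text \<open>Symmetry is tested with the bilinear form, without conjugation, so that it can be
  checked on the vectors of the graph description in \<open>rel1\<close> and
  \<open>rel2\<close>.\<close>

lemma bilinear_eps_symmetric:
  assumes "eps_symmetric \<epsilon> p Z"
  shows "bilinear p x (mat_app p p Z y) = \<epsilon> * bilinear p (mat_app p p Z x) y"
proof -
  have "bilinear p x (mat_app p p Z y) = (\<Sum>i<p. \<Sum>j<p. x i * (Z i j * y j))"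
    by (simp add: pairing_def mat_app_def sum_distrib_left)
  also have "\<dots> = (\<Sum>j<p. \<Sum>i<p. x i * (Z i j * y j))" by (rule sum.swap)
  also have "\<dots> = (\<Sum>j<p. \<Sum>i<p. \<epsilon> * (Z j i * x i * y j))"
  proof (intro sum.cong refl)
    fix j i assume "j \<in> {..<p}" "i \<in> {..<p}"
    then have "Z i j = \<epsilon> * Z j i" by (intro esymD[OF assms]) simp_all
    then show "x i * (Z i j * y j) = \<epsilon> * (Z j i * x i * y j)" by (simp only: mult_ac)
  qed
  also have "\<dots> = \<epsilon> * bilinear p (mat_app p p Z x) y"
    by (simp add: pairing_def mat_app_def sum_distrib_left sum_distrib_right)
  finally show ?thesis .
qed

lemma esymI_bilinear:
  assumes "\<And>x y. x \<in> cspace {..<p} \<Longrightarrow> y \<in> cspace {..<p} \<Longrightarrow> bilinear p x (mat_app p p Z y) = \<epsilon> * bilinear p (mat_app p p Z x) y"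
  shows "eps_symmetric \<epsilon> p Z"
  unfolding eps_symmetric_def
proof (intro allI impI)
  fix i j assume ij: "i < p" "j < p"
  let ?e = "\<lambda>i k. if k = i then 1 else 0 :: complex"
  have l: "bilinear p (?e j) y = y j" for y using ij by (simp add: pairing_def if_distrib[of "\<lambda>x. x * _"] cong: if_cong)
  have r: "bilinear p y (?e i) = y i" for y using ij by (simp add: pairing_def if_distrib[of "\<lambda>x. _ * x"] cong: if_cong)
  have "bilinear p (?e j) (mat_app p p Z (?e i)) = \<epsilon> * bilinear p (mat_app p p Z (?e j)) (?e i)"
    by (rule assms) (use ij basis_cspace in auto)
  then show "Z j i = \<epsilon> * Z i j" unfolding l r using ij by (simp add: mat_app_basis)
qed

lemma bilinear_diff_right: "bilinear p x (\<lambda>i. f i - g i) = bilinear p x f - bilinear p x g"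
  unfolding pairing_def by (simp add: right_diff_distrib sum_subtractf)

lemma bilinear_diff_left: "bilinear p (\<lambda>i. f i - g i) x = bilinear p f x - bilinear p g x"
  unfolding pairing_def by (simp add: left_diff_distrib sum_subtractf)

lemma bilinear_commute: "bilinear p x y = bilinear p y x"
  unfolding pairing_def by (simp add: mult.commute)

lemma eps_symmetric_adj: "eps_symmetric \<epsilon> p B \<Longrightarrow> cnj \<epsilon> = \<epsilon> \<Longrightarrow> eps_symmetric \<epsilon> p (adj B)"
proof -
  assume B: "eps_symmetric \<epsilon> p B" and e: "cnj \<epsilon> = \<epsilon>"
  show ?thesis unfolding eps_symmetric_def adj_def
  proof (intro allI impI)
    fix i j assume "i < p" "j < p"
    then have "B i j = \<epsilon> * B j i" by (intro esymD[OF B])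
    then have "cnj (B i j) = cnj (\<epsilon> * B j i)" by (rule arg_cong)
    then show "cnj (B i j) = \<epsilon> * cnj (B j i)" unfolding complex_cnj_mult e .
  qed
qed

text \<open>As \<open>H\<close> is the entrywise conjugate of \<open>K\<close>, its transpose is the
  adjoint of \<open>K\<close>; the bilinear product of \<open>H \<alpha>\<close> and
  \<open>K y\<close> therefore involves \<open>K* K = 1 - B B*\<close>, as \<open>bpHK\<close>
  states.\<close>

locale mobius_sym = mobius p p B K Ki H Hi for p B K Ki H Hi +
  fixes \<epsilon> :: complex
  assumes \<epsilon>: "\<epsilon> = 1 \<or> \<epsilon> = -1" and symB: "eps_symmetric \<epsilon> p B"
    and Kform: "\<And>i j. i < p \<Longrightarrow> j < p \<Longrightarrow> (\<Sum>k<p. cnj (K k i) * K k j) = (if i = j then 1 else 0) - (\<Sum>m<p. B i m * adj B m j)"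
    and HK: "H = (\<lambda>i j. cnj (K i j))"
begin

lemma ee: "\<epsilon> * \<epsilon> = 1" "cnj \<epsilon> = \<epsilon>" using \<epsilon> by auto

lemma bpB: "bilinear p x (mat_app p p B y) = \<epsilon> * bilinear p (mat_app p p B x) y" by (rule bilinear_eps_symmetric[OF symB])

lemma bpB': "bilinear p x (mat_app p p (adj B) y) = \<epsilon> * bilinear p (mat_app p p (adj B) x) y" by (rule bilinear_eps_symmetric[OF eps_symmetric_adj[OF symB ee(2)]])

lemma bpHK:
  assumes "y \<in> cspace {..<p}"
  shows "bilinear p (mat_app p p H \<alpha>) (mat_app p p K y) = bilinear p \<alpha> y - bilinear p \<alpha> (mat_app p p B (mat_app p p (adj B) y))"
proof -
  have "bilinear p (mat_app p p H \<alpha>) (mat_app p p K y) = (\<Sum>k<p. (\<Sum>i<p. cnj (K k i) * \<alpha> i) * (\<Sum>j<p. K k j * y j))"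
    by (simp add: pairing_def mat_app_def HK)
  also have "\<dots> = (\<Sum>k<p. \<Sum>i<p. \<Sum>j<p. \<alpha> i * (cnj (K k i) * K k j) * y j)"
    unfolding sum_product by (intro sum.cong refl) (simp add: mult.assoc mult.left_commute)
  also have "\<dots> = (\<Sum>i<p. \<Sum>k<p. \<Sum>j<p. \<alpha> i * (cnj (K k i) * K k j) * y j)" by (rule sum.swap)
  also have "\<dots> = (\<Sum>i<p. \<Sum>j<p. \<Sum>k<p. \<alpha> i * (cnj (K k i) * K k j) * y j)"
    by (rule sum.cong[OF refl]) (rule sum.swap)
  also have "\<dots> = (\<Sum>i<p. \<Sum>j<p. \<alpha> i * (\<Sum>k<p. cnj (K k i) * K k j) * y j)"
    by (intro sum.cong refl) (simp add: sum_distrib_left sum_distrib_right)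
  also have "\<dots> = (\<Sum>i<p. \<Sum>j<p. \<alpha> i * ((if i = j then 1 else 0) - (\<Sum>m<p. B i m * adj B m j)) * y j)"
    by (intro sum.cong refl) (simp add: Kform)
  also have "\<dots> = (\<Sum>i<p. \<alpha> i * (y i - (\<Sum>j<p. (\<Sum>m<p. B i m * adj B m j) * y j)))"
  proof (rule sum.cong[OF refl])
    fix i assume i: "i \<in> {..<p}"
    have "(\<Sum>j<p. \<alpha> i * ((if i = j then 1 else 0) - (\<Sum>m<p. B i m * adj B m j)) * y j) =
      \<alpha> i * ((\<Sum>j<p. (if i = j then 1 else 0) * y j) - (\<Sum>j<p. (\<Sum>m<p. B i m * adj B m j) * y j))"
      unfolding sum_subtractf[symmetric] sum_distrib_left by (intro sum.cong refl) (simp add: algebra_simps)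
    also have "(\<Sum>j<p. (if i = j then 1 else 0) * y j) = y i"
      using i by (simp add: if_distrib[of "\<lambda>x. x * _"] cong: if_cong)
    finally show "(\<Sum>j<p. \<alpha> i * ((if i = j then 1 else 0) - (\<Sum>m<p. B i m * adj B m j)) * y j) =
       \<alpha> i * (y i - (\<Sum>j<p. (\<Sum>m<p. B i m * adj B m j) * y j))" .
  qed
  also have "\<dots> = bilinear p \<alpha> y - bilinear p \<alpha> (mat_app p p (\<lambda>i j. \<Sum>m<p. B i m * adj B m j) y)"
    by (simp add: pairing_def mat_app_def right_diff_distrib sum_subtractf)
  finally show ?thesis unfolding mat_app_compose .
qed

text \<open>Expanding the left-hand condition, the terms with one factor \<open>B\<close> or
  \<open>B*\<close> cancel when these matrices are moved across the form. The remaining terms form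
  the condition for the transform, which sends \<open>H \<alpha>\<close> to \<open>K a\<close> and
  \<open>H \<beta>\<close> to \<open>K b\<close>.\<close>

lemma sym_equivalence:
  assumes "\<alpha> \<in> cspace {..<p}" "\<beta> \<in> cspace {..<p}"
    and ra: "mat_app p p Z (\<lambda>i. \<alpha> i - mat_app p p (adj B) a i) = (\<lambda>i. a i - mat_app p p B \<alpha> i)"
    and rb: "mat_app p p Z (\<lambda>i. \<beta> i - mat_app p p (adj B) b i) = (\<lambda>i. b i - mat_app p p B \<beta> i)"
    and ab: "a \<in> cspace {..<p}" "b \<in> cspace {..<p}"
  shows "bilinear p (\<lambda>i. \<alpha> i - mat_app p p (adj B) a i) (mat_app p p Z (\<lambda>i. \<beta> i - mat_app p p (adj B) b i)) =
      \<epsilon> * bilinear p (mat_app p p Z (\<lambda>i. \<alpha> i - mat_app p p (adj B) a i)) (\<lambda>i. \<beta> i - mat_app p p (adj B) b i)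
    \<longleftrightarrow> bilinear p (mat_app p p H \<alpha>) (mat_app p p K b) = \<epsilon> * bilinear p (mat_app p p K a) (mat_app p p H \<beta>)"
proof -
  define B' where "B' = mat_app p p (adj B)"
  define B0 where "B0 = mat_app p p B"
  have s1: "bilinear p x (B0 y) = \<epsilon> * bilinear p (B0 x) y" for x y unfolding B0_def by (rule bpB)
  have s2: "bilinear p x (B' y) = \<epsilon> * bilinear p (B' x) y" for x y unfolding B'_def by (rule bpB')
  have h1: "bilinear p (mat_app p p H \<alpha>) (mat_app p p K b) = bilinear p \<alpha> b - bilinear p \<alpha> (B0 (B' b))"
    unfolding B0_def B'_def by (rule bpHK[OF ab(2)])
  have h2: "bilinear p (mat_app p p K a) (mat_app p p H \<beta>) = bilinear p a \<beta> - bilinear p (B0 (B' a)) \<beta>"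
    unfolding bilinear_commute[of p "mat_app p p K a"] bpHK[OF ab(1)] B0_def B'_def by (simp add: bilinear_commute)
  have l: "bilinear p (\<lambda>i. \<alpha> i - B' a i) (\<lambda>i. b i - B0 \<beta> i) =
     bilinear p \<alpha> b - bilinear p \<alpha> (B0 \<beta>) - bilinear p (B' a) b + bilinear p (B' a) (B0 \<beta>)"
    by (simp add: bilinear_diff_left bilinear_diff_right)
  have r: "bilinear p (\<lambda>i. a i - B0 \<alpha> i) (\<lambda>i. \<beta> i - B' b i) =
     bilinear p a \<beta> - bilinear p a (B' b) - bilinear p (B0 \<alpha>) \<beta> + bilinear p (B0 \<alpha>) (B' b)"
    by (simp add: bilinear_diff_left bilinear_diff_right)
  have c1: "\<epsilon> * bilinear p (B0 \<alpha>) \<beta> = bilinear p \<alpha> (B0 \<beta>)" by (rule s1[symmetric])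
  have c2: "\<epsilon> * bilinear p a (B' b) = bilinear p (B' a) b" unfolding s2[of a b] using ee(1) by (simp add: mult.assoc[symmetric])
  have c3: "\<epsilon> * bilinear p (B0 (B' a)) \<beta> = bilinear p (B' a) (B0 \<beta>)" by (rule s1[symmetric])
  have c4: "bilinear p \<alpha> (B0 (B' b)) = \<epsilon> * bilinear p (B0 \<alpha>) (B' b)" by (rule s1)
  have rr: "\<epsilon> * bilinear p (\<lambda>i. a i - B0 \<alpha> i) (\<lambda>i. \<beta> i - B' b i) =
     \<epsilon> * bilinear p a \<beta> - bilinear p (B' a) b - bilinear p \<alpha> (B0 \<beta>) + bilinear p \<alpha> (B0 (B' b))"
    unfolding r by (simp only: right_diff_distrib distrib_left c1 c2 c4)
  have "bilinear p (\<lambda>i. \<alpha> i - B' a i) (\<lambda>i. b i - B0 \<beta> i) = \<epsilon> * bilinear p (\<lambda>i. a i - B0 \<alpha> i) (\<lambda>i. \<beta> i - B' b i)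
     \<longleftrightarrow> bilinear p \<alpha> b + bilinear p (B' a) (B0 \<beta>) = \<epsilon> * bilinear p a \<beta> + bilinear p \<alpha> (B0 (B' b))"
    unfolding l rr by (auto simp: algebra_simps)
  also have "\<dots> \<longleftrightarrow> bilinear p \<alpha> b - bilinear p \<alpha> (B0 (B' b)) = \<epsilon> * (bilinear p a \<beta> - bilinear p (B0 (B' a)) \<beta>)"
    unfolding right_diff_distrib c3 by (auto simp: algebra_simps)
  finally show ?thesis unfolding ra rb h1 h2 unfolding B0_def B'_def .
qed

lemma fwd_eps_symmetric:
  assumes Z: "strict_contr p p Z" "eps_symmetric \<epsilon> p Z"
  shows "eps_symmetric \<epsilon> p (fwd Z)"
proof (rule esymI_bilinear)
  fix x y assume x: "x \<in> cspace {..<p}" and y: "y \<in> cspace {..<p}"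
  let ?\<alpha> = "mat_app p p Hi x" and ?\<beta> = "mat_app p p Hi y"
  have "bilinear p (mat_app p p H ?\<alpha>) (mat_app p p K (mat_app p p (W1 Z) ?\<beta>)) = \<epsilon> * bilinear p (mat_app p p K (mat_app p p (W1 Z) ?\<alpha>)) (mat_app p p H ?\<beta>)"
    by (subst sym_equivalence[OF _ _ rel1[OF Z(1)] rel1[OF Z(1)], symmetric]) (simp_all add: bilinear_eps_symmetric[OF Z(2)])
  then show "bilinear p x (mat_app p p (fwd Z) y) = \<epsilon> * bilinear p (mat_app p p (fwd Z) x) y"
    unfolding fwd_op HH(2)[OF x] HH(2)[OF y] .
qed

lemma bwd_eps_symmetric:
  assumes V: "strict_contr p p V" "eps_symmetric \<epsilon> p V"
  shows "eps_symmetric \<epsilon> p (bwd V)"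
proof (rule esymI_bilinear)
  fix s r assume s: "s \<in> cspace {..<p}" and r: "r \<in> cspace {..<p}"
  obtain \<alpha> where a: "\<alpha> \<in> cspace {..<p}" "s = (\<lambda>i. \<alpha> i - mat_app p p (adj B) (mat_app p p (W2 V) \<alpha>) i)" by (rule surj2[OF V(1) s])
  obtain \<beta> where b: "\<beta> \<in> cspace {..<p}" "r = (\<lambda>i. \<beta> i - mat_app p p (adj B) (mat_app p p (W2 V) \<beta>) i)" by (rule surj2[OF V(1) r])
  have KW: "mat_app p p K (mat_app p p (W2 V) z) = mat_app p p V (mat_app p p H z)" for z unfolding W2_op by (rule KK(2)) simp
  show "bilinear p s (mat_app p p (bwd V) r) = \<epsilon> * bilinear p (mat_app p p (bwd V) s) r"
    unfolding a(2) b(2)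
    by (subst sym_equivalence[OF a(1) b(1) rel2[OF V(1) a(1)] rel2[OF V(1) b(1)]]) (simp_all add: KW bilinear_eps_symmetric[OF V(2)])
qed

end

text \<open>A Cholesky factor of \<open>1 - B B*\<close> serves as its square root. Strict
  contraction makes the form positive definite and the factor invertible.\<close>

lemma cholesky_factors:
  assumes B: "strict_contr p q B"
  obtains K Ki where
    "\<forall>i<p. \<forall>j<p. (\<Sum>k<p. cnj (K k i) * K k j) = (if i = j then 1 else 0) - (\<Sum>m<q. B i m * adj B m j)"
    "\<forall>y\<in>cspace {..<p}. (vec_norm p (mat_app p p K y))\<^sup>2 = (vec_norm p y)\<^sup>2 - (vec_norm q (mat_app q p (adj B) y))\<^sup>2"
    "\<forall>y\<in>cspace {..<p}. mat_app p p Ki (mat_app p p K y) = y \<and> mat_app p p K (mat_app p p Ki y) = y"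
proof -
  define h where "h i j = (if i = j then 1 else 0) - (\<Sum>m<q. B i m * adj B m j)" for i j
  have form: "(\<Sum>i<p. \<Sum>j<p. cnj (x i) * h i j * x j) = complex_of_real ((vec_norm p x)\<^sup>2 - (vec_norm q (mat_app q p (adj B) x))\<^sup>2)" for x
  proof -
    have "(\<Sum>i<p. \<Sum>j<p. cnj (x i) * h i j * x j) =
       (\<Sum>i<p. cnj (x i) * ((\<Sum>j<p. (if i = j then 1 else 0) * x j) - (\<Sum>j<p. (\<Sum>m<q. B i m * adj B m j) * x j)))"
      unfolding h_def sum_subtractf[symmetric] sum_distrib_left by (intro sum.cong refl) (simp add: algebra_simps)
    also have "\<dots> = (\<Sum>i<p. cnj (x i) * (x i - mat_app p p (\<lambda>i j. \<Sum>m<q. B i m * adj B m j) x i))"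
      by (intro sum.cong refl) (simp add: mat_app_def if_distrib[of "\<lambda>x. x * _"] cong: if_cong)
    also have "\<dots> = herm_prod p x x - herm_prod p x (mat_app p q B (mat_app q p (adj B) x))"
      unfolding mat_app_compose by (simp add: herm_prod_def right_diff_distrib sum_subtractf)
    finally show ?thesis unfolding herm_prod_adj herm_prod_norm by simp
  qed
  have "\<exists>A. \<forall>i\<in>{..<p}. \<forall>j\<in>{..<p}. (\<Sum>k<p. cnj (A k i) * A k j) = h i j"
  proof (rule cholesky[OF finite_lessThan])
    show "h j i = cnj (h i j)" for i j by (simp add: h_def adj_def cnj_sum mult.commute)
    fix x :: "nat \<Rightarrow> complex" assume x: "\<exists>i\<in>{..<p}. x i \<noteq> 0"
    define y where "y i = (if i < p then x i else 0)" for i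
    have y: "y \<in> cspace {..<p}" "y \<noteq> (\<lambda>_. 0)" using x by (auto simp: y_def cspace_def fun_eq_iff)
    have "vec_norm q (mat_app q p (adj B) y) < vec_norm p y" using strict_contr_adj[OF B] y unfolding strict_contr_def by blast
    then have "(vec_norm q (mat_app q p (adj B) y))\<^sup>2 < (vec_norm p y)\<^sup>2" by (intro power_strict_mono cnorm_nonneg) auto
    moreover have "(\<Sum>i<p. \<Sum>j<p. cnj (x i) * h i j * x j) = (\<Sum>i<p. \<Sum>j<p. cnj (y i) * h i j * y j)"
      by (intro sum.cong refl) (simp add: y_def)
    ultimately show "Re (\<Sum>i<p. \<Sum>j<p. cnj (x i) * h i j * x j) > 0" unfolding form by simp
  qed
  then obtain K where K: "\<forall>i\<in>{..<p}. \<forall>j\<in>{..<p}. (\<Sum>k<p. cnj (K k i) * K k j) = h i j" ..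
  have nK: "(vec_norm p (mat_app p p K y))\<^sup>2 = (vec_norm p y)\<^sup>2 - (vec_norm q (mat_app q p (adj B) y))\<^sup>2" for y
  proof -
    have "complex_of_real ((vec_norm p (mat_app p p K y))\<^sup>2) = herm_prod p (mat_app p p K y) (mat_app p p K y)" by (rule herm_prod_norm[symmetric])
    also have "\<dots> = (\<Sum>k<p. (\<Sum>i<p. cnj (K k i) * cnj (y i)) * (\<Sum>j<p. K k j * y j))"
      by (simp add: herm_prod_def mat_app_def cnj_sum)
    also have "\<dots> = (\<Sum>k<p. \<Sum>i<p. \<Sum>j<p. cnj (y i) * (cnj (K k i) * K k j) * y j)"
      unfolding sum_product by (intro sum.cong refl) (simp add: mult.assoc mult.left_commute)
    also have "\<dots> = (\<Sum>i<p. \<Sum>k<p. \<Sum>j<p. cnj (y i) * (cnj (K k i) * K k j) * y j)" by (rule sum.swap)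
    also have "\<dots> = (\<Sum>i<p. \<Sum>j<p. \<Sum>k<p. cnj (y i) * (cnj (K k i) * K k j) * y j)"
      by (rule sum.cong[OF refl]) (rule sum.swap)
    also have "\<dots> = (\<Sum>i<p. \<Sum>j<p. cnj (y i) * (\<Sum>k<p. cnj (K k i) * K k j) * y j)"
      by (intro sum.cong refl) (simp add: sum_distrib_left sum_distrib_right)
    also have "\<dots> = (\<Sum>i<p. \<Sum>j<p. cnj (y i) * h i j * y j)"
      by (intro sum.cong refl) (use K in simp)
    finally show ?thesis unfolding form of_real_eq_iff .
  qed
  have inj: "y = (\<lambda>_. 0)" if y: "y \<in> cspace {..<p}" "lin {..<p} K y = (\<lambda>_. 0)" for y
  proof (rule ccontr)
    assume y0: "y \<noteq> (\<lambda>_. 0)"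
    have "vec_norm q (mat_app q p (adj B) y) < vec_norm p y" using strict_contr_adj[OF B] y(1) y0 unfolding strict_contr_def by blast
    then have "(vec_norm q (mat_app q p (adj B) y))\<^sup>2 < (vec_norm p y)\<^sup>2" by (intro power_strict_mono cnorm_nonneg) auto
    then show False using nK[of y] y(2) by (simp add: lin_mat_app)
  qed
  have "\<exists>C. \<forall>x\<in>cspace {..<p}. lin {..<p} C (lin {..<p} K x) = x \<and> lin {..<p} K (lin {..<p} C x) = x"
    by (rule injective_lin_invertible[OF finite_lessThan]) (rule inj)
  then obtain Ki where Ki: "\<forall>x\<in>cspace {..<p}. lin {..<p} Ki (lin {..<p} K x) = x \<and> lin {..<p} K (lin {..<p} Ki x) = x" ..
  show ?thesis
  proof (rule that[of K Ki])
    show "\<forall>i<p. \<forall>j<p. (\<Sum>k<p. cnj (K k i) * K k j) = (if i = j then 1 else 0) - (\<Sum>m<q. B i m * adj B m j)"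
      using K unfolding h_def by simp
    show "\<forall>y\<in>cspace {..<p}. (vec_norm p (mat_app p p K y))\<^sup>2 = (vec_norm p y)\<^sup>2 - (vec_norm q (mat_app q p (adj B) y))\<^sup>2"
      by (intro ballI) (rule nK)
    show "\<forall>y\<in>cspace {..<p}. mat_app p p Ki (mat_app p p K y) = y \<and> mat_app p p K (mat_app p p Ki y) = y"
      using Ki unfolding lin_mat_app .
  qed
qed

subsection \<open>The domains of types I, II and III\<close>

text \<open>Uniformly bounded functionals give the upper comparison with the Euclidean norm; the
  lower one holds because every coordinate has the modulus of some pairing.\<close>

lemma cnormedI_SUP:
  assumes I: "finite I" "I \<noteq> {}" and ne: "\<Lambda> \<noteq> {}"
    and C: "\<And>l k. l \<in> \<Lambda> \<Longrightarrow> k \<in> I \<Longrightarrow> norm (l k) \<le> C"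
    and coord: "\<And>x k. x \<in> cspace I \<Longrightarrow> k \<in> I \<Longrightarrow> \<exists>l\<in>\<Lambda>. norm (pairing I l x) = norm (x k)"
  shows "cnormed I \<Lambda> (\<lambda>x. SUP l\<in>\<Lambda>. norm (pairing I l x))"
proof
  have le: "norm (pairing I l x) \<le> (card I * C) * cnorm I x" if "l \<in> \<Lambda>" for l x
  proof -
    have "cnorm I l \<le> (\<Sum>k\<in>I. norm (l k))" unfolding cnorm_def by (rule L2_set_le_sum) simp
    also have "\<dots> \<le> card I * C" using sum_bounded_above[of I "\<lambda>k. norm (l k)" C] C[OF that] by simp
    finally have "cnorm I l * cnorm I x \<le> (card I * C) * cnorm I x" by (rule mult_right_mono) (rule cnorm_nonneg)
    then show ?thesis using cauchy_schwarz_pairing[of I l x] by linarith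
  qed
  have bdd: "bdd_above ((\<lambda>l. norm (pairing I l x)) ` \<Lambda>)" for x
    by (rule bdd_aboveI2) (rule le)
  show upper: "norm (pairing I l x) \<le> (SUP l\<in>\<Lambda>. norm (pairing I l x))" if "l \<in> \<Lambda>" for x l
    by (rule cSUP_upper[OF that bdd])
  show "(SUP l\<in>\<Lambda>. norm (pairing I l x)) \<le> b" if "\<And>l. l \<in> \<Lambda> \<Longrightarrow> norm (pairing I l x) \<le> b" for x b
    by (rule cSUP_least[OF ne that])
  show "\<exists>C. \<forall>x\<in>cspace I. (SUP l\<in>\<Lambda>. norm (pairing I l x)) \<le> C * cnorm I x"
    by (intro exI[of _ "card I * C"] ballI cSUP_least[OF ne] le)
  have card: "real (card I) > 0" using I by (simp add: card_gt_0_iff)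
  show "\<exists>c>0. \<forall>x\<in>cspace I. c * cnorm I x \<le> (SUP l\<in>\<Lambda>. norm (pairing I l x))"
  proof (intro exI[of _ "1 / card I"] conjI ballI)
    fix x assume x: "x \<in> cspace I"
    let ?S = "SUP l\<in>\<Lambda>. norm (pairing I l x)"
    have "norm (x k) \<le> ?S" if k: "k \<in> I" for k
    proof -
      obtain l where "l \<in> \<Lambda>" "norm (pairing I l x) = norm (x k)" using coord[OF x k] ..
      then show ?thesis using upper[of l x] by simp
    qed
    then have "(\<Sum>k\<in>I. norm (x k)) \<le> card I * ?S" using sum_bounded_above[of I "\<lambda>k. norm (x k)" ?S] by simp
    moreover have "cnorm I x \<le> (\<Sum>k\<in>I. norm (x k))" unfolding cnorm_def by (rule L2_set_le_sum) simp
    ultimately have "cnorm I x \<le> card I * ?S" by linarith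
    then show "1 / card I * cnorm I x \<le> ?S" using card by (simp add: field_simps)
  qed (use card in simp)
qed (use I in auto)

lemma fun_det_cong: "(\<And>i j. i < n \<Longrightarrow> j < n \<Longrightarrow> a i j = b i j) \<Longrightarrow> fun_det n a = fun_det n b"
  unfolding fun_det_def by (rule arg_cong[where f = det], rule eq_matI) auto

lemma strict_contr_cong:
  assumes "\<And>i j. i < n \<Longrightarrow> j < m \<Longrightarrow> A i j = C i j"
  shows "strict_contr n m A \<longleftrightarrow> strict_contr n m C"
proof -
  have "mat_app n m A x = mat_app n m C x" for x by (rule mat_app_cong) (rule assms)
  then show ?thesis by (simp add: strict_contr_def)
qed

lemma strict_contr_adj_iff: "strict_contr p q Z \<longleftrightarrow> strict_contr q p (adj Z)"
  using strict_contr_adj[of p q Z] strict_contr_adj[of q p "adj Z"] by auto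

lemma vec_norm_mat_app_le: "\<exists>C>0. \<forall>x. vec_norm n (mat_app n m A x) \<le> C * vec_norm m x"
proof (intro exI[of _ "1 + (\<Sum>i<n. \<Sum>j<m. norm (A i j))"] conjI allI)
  show "0 < 1 + (\<Sum>i<n. \<Sum>j<m. norm (A i j))" by (simp add: add_pos_nonneg sum_nonneg)
  fix x
  have e: "norm (mat_app n m A x i) \<le> (\<Sum>j<m. norm (A i j)) * vec_norm m x" if "i < n" for i
  proof -
    have "norm (mat_app n m A x i) \<le> (\<Sum>j<m. norm (A i j * x j))" using that by (simp add: mat_app_def norm_sum)
    also have "\<dots> \<le> (\<Sum>j<m. norm (A i j) * vec_norm m x)"
      unfolding norm_mult cnorm_def
      by (intro sum_mono mult_left_mono member_le_L2_set[of "{..<m}" _ "\<lambda>j. norm (x j)"]) auto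
    finally show ?thesis by (simp add: sum_distrib_right)
  qed
  have "vec_norm n (mat_app n m A x) \<le> (\<Sum>i<n. norm (mat_app n m A x i))" unfolding cnorm_def by (rule L2_set_le_sum) simp
  also have "\<dots> \<le> (\<Sum>i<n. (\<Sum>j<m. norm (A i j)) * vec_norm m x)" by (intro sum_mono e) simp
  also have "\<dots> \<le> (1 + (\<Sum>i<n. \<Sum>j<m. norm (A i j))) * vec_norm m x"
    unfolding sum_distrib_right[symmetric] by (intro mult_right_mono cnorm_nonneg) simp
  finally show "vec_norm n (mat_app n m A x) \<le> (1 + (\<Sum>i<n. \<Sum>j<m. norm (A i j))) * vec_norm m x" .
qed

text \<open>
  The entry at \<open>(i, j)\<close> is a coordinate if \<open>(i, j) \<in> I\<close>; otherwise it is determined by the entry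
  at \<open>(j, i)\<close>. Type I is \<open>\<epsilon> = 0\<close>, type II is \<open>\<epsilon> = - 1\<close> and type III is \<open>\<epsilon> = 1\<close>.
\<close>

locale matrix_domain =
  fixes p q :: nat and I :: "(nat \<times> nat) set" and \<epsilon> :: complex
  assumes I_sub: "I \<subseteq> {..<p} \<times> {..<q}" and I_ne: "I \<noteq> {}"
    and types: "\<epsilon> = 0 \<and> I = {..<p} \<times> {..<q} \<or>
      p = q \<and> (\<epsilon> = 1 \<or> \<epsilon> = -1) \<and> (\<forall>i j. (i, j) \<in> I \<longrightarrow> (j, i) \<in> I \<longrightarrow> i = j \<and> \<epsilon> = 1) \<and>
      (\<forall>i<p. \<forall>j<p. (i, j) \<in> I \<or> (j, i) \<in> I \<or> i = j \<and> \<epsilon> = -1)"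
begin

definition to_matrix :: "(nat \<times> nat \<Rightarrow> complex) \<Rightarrow> nat \<Rightarrow> nat \<Rightarrow> complex" where
  "to_matrix x i j = (if (i, j) \<in> I then x (i, j) else if (j, i) \<in> I then \<epsilon> * x (j, i) else 0)"

definition to_coords :: "(nat \<Rightarrow> nat \<Rightarrow> complex) \<Rightarrow> nat \<times> nat \<Rightarrow> complex" where
  "to_coords Z k = (if k \<in> I then Z (fst k) (snd k) else 0)"

definition good :: "(nat \<Rightarrow> nat \<Rightarrow> complex) \<Rightarrow> bool" where
  "good Z \<longleftrightarrow> \<epsilon> = 0 \<or> eps_symmetric \<epsilon> p Z"

lemma type_cases:
  obtains (rectangular) "\<epsilon> = 0" "I = {..<p} \<times> {..<q}"
    | (square) "p = q" "\<epsilon> = 1 \<or> \<epsilon> = -1" "\<forall>i j. (i, j) \<in> I \<longrightarrow> (j, i) \<in> I \<longrightarrow> i = j \<and> \<epsilon> = 1"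
      "\<forall>i<p. \<forall>j<p. (i, j) \<in> I \<or> (j, i) \<in> I \<or> i = j \<and> \<epsilon> = -1"
  using types by (elim disjE conjE) simp_all

lemma fin_I: "finite I"
  using I_sub by (rule finite_subset) simp

lemma I_less: "(i, j) \<in> I \<Longrightarrow> i < p \<and> j < q"
  using I_sub by blast

lemma to_coords_cspace [simp]: "to_coords Z \<in> cspace I"
  by (simp add: cspace_def to_coords_def)

lemma to_matrix_to_coords:
  assumes Z: "good Z" and ij: "i < p" "j < q"
  shows "to_matrix (to_coords Z) i j = Z i j"
proof (cases rule: type_cases)
  case rectangular
  from this(2) show ?thesis unfolding to_matrix_def to_coords_def using ij by simp
next
  case a: square
  have s: "eps_symmetric \<epsilon> p Z" using Z a(2) unfolding good_def by auto
  have "Z i j = \<epsilon> * Z j i" by (rule esymD[OF s]) (use ij a(1) in simp_all)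
  moreover have "(i, j) \<in> I \<or> (j, i) \<in> I \<or> i = j \<and> \<epsilon> = -1" using a(1,4) ij by blast
  ultimately show ?thesis using a(2) unfolding to_matrix_def to_coords_def by auto
qed

lemma good_to_matrix: "good (to_matrix x)"
proof (cases rule: type_cases)
  case a: square
  have "to_matrix x j i = \<epsilon> * to_matrix x i j" for i j
  proof (cases "(i, j) \<in> I \<and> (j, i) \<in> I")
    case True
    then have "i = j \<and> \<epsilon> = 1" using a(3) by blast
    then show ?thesis by simp
  next
    case False
    then show ?thesis using a(2) unfolding to_matrix_def by auto
  qed
  then have "eps_symmetric \<epsilon> p (to_matrix x)" unfolding eps_symmetric_def by (intro allI impI)
  then show ?thesis unfolding good_def by (rule disjI2)
next
  case rectangular
  from this(1) show ?thesis unfolding good_def by (rule disjI1)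
qed

text \<open>The coefficients of the linear functional that sends \<open>x\<close> to the Hermitian
  product of \<open>v\<close> with \<open>to_matrix x\<close> applied to \<open>w\<close>, found by
  evaluation at unit vectors. Over \<open>v\<close> and \<open>w\<close> of length at most one it
  yields the operator norm.\<close>

definition functional :: "(nat \<Rightarrow> complex) \<Rightarrow> (nat \<Rightarrow> complex) \<Rightarrow> nat \<times> nat \<Rightarrow> complex" where
  "functional v w k = herm_prod p v (mat_app p q (to_matrix (\<lambda>l. if l = k then 1 else 0)) w)"

definition functionals :: "(nat \<times> nat \<Rightarrow> complex) set" where
  "functionals = {functional v w | v w. v \<in> cspace {..<p} \<and> w \<in> cspace {..<q} \<and> vec_norm p v \<le> 1 \<and> vec_norm q w \<le> 1}"

definition op_norm :: "(nat \<times> nat \<Rightarrow> complex) \<Rightarrow> real" where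
  "op_norm x = (SUP l\<in>functionals. norm (pairing I l x))"

lemma to_matrix_expand: "to_matrix x i j = (\<Sum>k\<in>I. to_matrix (\<lambda>l. if l = k then 1 else 0) i j * x k)"
proof -
  have d: "(\<Sum>k\<in>I. (if l = k then 1 else 0) * x k) = x l" if "l \<in> I" for l
    using fin_I that by (simp add: if_distrib[of "\<lambda>x. x * _"] cong: if_cong)
  have d': "(\<Sum>k\<in>I. \<epsilon> * (if l = k then 1 else 0) * x k) = \<epsilon> * x l" if "l \<in> I" for l
    using d[OF that] by (simp only: mult.assoc sum_distrib_left[symmetric])
  consider "(i, j) \<in> I" | "(i, j) \<notin> I" "(j, i) \<in> I" | "(i, j) \<notin> I" "(j, i) \<notin> I" by argo
  then show ?thesis
  proof cases
    case 1
    then show ?thesis unfolding to_matrix_def by (simp only: if_True d)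
  next
    case 2
    then show ?thesis unfolding to_matrix_def by (simp only: if_True if_False d')
  next
    case 3
    then show ?thesis by (simp add: to_matrix_def)
  qed
qed

lemma pairing_functional: "pairing I (functional v w) x = herm_prod p v (mat_app p q (to_matrix x) w)"
proof -
  let ?e = "\<lambda>k l. if l = k then 1 else 0 :: complex"
  have 1: "herm_prod p v (mat_app p q A w) = (\<Sum>i<p. \<Sum>j<q. A i j * (cnj (v i) * w j))" for A
    by (simp add: herm_prod_def mat_app_def sum_distrib_left mult_ac)
  have "pairing I (functional v w) x = (\<Sum>k\<in>I. \<Sum>i<p. \<Sum>j<q. to_matrix (?e k) i j * x k * (cnj (v i) * w j))"
    unfolding pairing_def functional_def 1 sum_distrib_right by (simp only: mult_ac)
  also have "\<dots> = (\<Sum>i<p. \<Sum>k\<in>I. \<Sum>j<q. to_matrix (?e k) i j * x k * (cnj (v i) * w j))" by (rule sum.swap)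
  also have "\<dots> = (\<Sum>i<p. \<Sum>j<q. \<Sum>k\<in>I. to_matrix (?e k) i j * x k * (cnj (v i) * w j))"
    by (rule sum.cong[OF refl]) (rule sum.swap)
  also have "\<dots> = (\<Sum>i<p. \<Sum>j<q. to_matrix x i j * (cnj (v i) * w j))"
    unfolding to_matrix_expand[of x] sum_distrib_right ..
  finally show ?thesis unfolding 1 .
qed

lemma norm_eps: "norm \<epsilon> \<le> 1"
  using types by auto

lemma vec_norm_basis: "i < n \<Longrightarrow> vec_norm n (\<lambda>k. if k = i then 1 else 0) = 1"
proof -
  assume i: "i < n"
  have "(vec_norm n (\<lambda>k. if k = i then 1 else 0))\<^sup>2 = (\<Sum>k<n. if k = i then 1 else 0)"
    unfolding cnorm_power2 by (rule sum.cong) auto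
  also have "\<dots> = 1" using i by simp
  finally show ?thesis using cnorm_nonneg[of "{..<n}" "\<lambda>k. if k = i then 1 else 0"] by (simp add: power2_eq_1_iff)
qed

sublocale cnormed I functionals op_norm
proof -
  have "cnormed I functionals (\<lambda>x. SUP l\<in>functionals. norm (pairing I l x))"
  proof (rule cnormedI_SUP[OF fin_I I_ne, where C = "real q * real p"])
    have "functional (\<lambda>_. 0) (\<lambda>_. 0) \<in> functionals"
      unfolding functionals_def by (intro CollectI exI[of _ "\<lambda>_. 0"]) (simp add: cspace_def)
    then show "functionals \<noteq> {}" by blast
  next
    fix l k assume "l \<in> functionals" "k \<in> I"
    then obtain v w where l: "l = functional v w" and vw: "vec_norm p v \<le> 1" "vec_norm q w \<le> 1"
      unfolding functionals_def by blast
    define A where "A = to_matrix (\<lambda>l. if l = k then 1 else 0)"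
    have A: "norm (A i j) \<le> 1" for i j using norm_eps by (auto simp: A_def to_matrix_def)
    have v: "norm (v i) \<le> 1" if "i < p" for i
      using member_le_L2_set[of "{..<p}" i "\<lambda>i. norm (v i)"] vw(1) that by (simp add: cnorm_def)
    have w: "norm (w i) \<le> 1" if "i < q" for i
      using member_le_L2_set[of "{..<q}" i "\<lambda>i. norm (w i)"] vw(2) that by (simp add: cnorm_def)
    have a: "norm (mat_app p q A w i) \<le> q" for i
    proof -
      have "norm (\<Sum>j<q. A i j * w j) \<le> (\<Sum>j<q. 1)"
        by (intro sum_norm_le) (use A w in \<open>auto simp: norm_mult intro!: mult_le_one\<close>)
      then show ?thesis by (simp add: mat_app_def)
    qed
    have "norm (l k) \<le> (\<Sum>i<p. norm (v i) * norm (mat_app p q A w i))"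
      unfolding l functional_def A_def[symmetric] herm_prod_def by (intro sum_norm_le) (simp add: norm_mult)
    also have "\<dots> \<le> (\<Sum>i<p. 1 * real q)" by (intro sum_mono mult_mono a) (use v in auto)
    finally show "norm (l k) \<le> real q * real p" by (simp add: mult.commute)
  next
    fix x and k assume x: "x \<in> cspace I" and k: "k \<in> I"
    obtain i j where ij: "k = (i, j)" "i < p" "j < q" using k I_less by (cases k) auto
    let ?v = "\<lambda>l. if l = i then 1 else 0 :: complex" and ?w = "\<lambda>l. if l = j then 1 else 0 :: complex"
    have "herm_prod p ?v (mat_app p q (to_matrix x) ?w) = mat_app p q (to_matrix x) ?w i"
      using ij(2) by (simp add: herm_prod_def if_distrib[of cnj] if_distrib[of "\<lambda>x. x * _"] cong: if_cong)
    also have "\<dots> = to_matrix x i j" using ij by (simp only: mat_app_basis)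
    also have "\<dots> = x k" using k ij(1) by (simp add: to_matrix_def)
    finally have "pairing I (functional ?v ?w) x = x k" unfolding pairing_functional .
    moreover have "functional ?v ?w \<in> functionals"
      unfolding functionals_def
      by (intro CollectI exI[of _ ?v] exI[of _ ?w] conjI refl basis_cspace)
        (simp_all only: ij(2,3) vec_norm_basis order.refl)
    ultimately show "\<exists>l\<in>functionals. norm (pairing I l x) = norm (x k)" by (intro bexI[of _ "functional ?v ?w"]) simp_all
  qed
  then show "cnormed I functionals op_norm" unfolding op_norm_def[abs_def] .
qed

lemma herm_prod_le_op_norm:
  assumes x: "x \<in> cspace I" and v: "v \<in> cspace {..<p}" and w: "w \<in> cspace {..<q}"
  shows "norm (herm_prod p v (mat_app p q (to_matrix x) w)) \<le> op_norm x * (vec_norm p v * vec_norm q w)"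
proof (cases "v = (\<lambda>_. 0) \<or> w = (\<lambda>_. 0)")
  case True
  then have "herm_prod p v (mat_app p q (to_matrix x) w) = 0" by (auto simp: herm_prod_def)
  then show ?thesis by (simp add: N_nonneg[OF x] cnorm_nonneg)
next
  case False
  then have pos: "0 < vec_norm p v" "0 < vec_norm q w" using vec_norm_pos v w by blast+
  define a b where "a = complex_of_real (1 / vec_norm p v)" and "b = complex_of_real (1 / vec_norm q w)"
  have n: "norm a = 1 / vec_norm p v" "norm b = 1 / vec_norm q w"
    using pos unfolding a_def b_def norm_of_real by simp_all
  have "norm (pairing I (functional (\<lambda>i. a * v i) (\<lambda>i. b * w i)) x) \<le> op_norm x"
  proof (rule pairing_le[OF x])
    show "functional (\<lambda>i. a * v i) (\<lambda>i. b * w i) \<in> functionals"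
      unfolding functionals_def using v w pos
      by (intro CollectI exI[of _ "\<lambda>i. a * v i"] exI[of _ "\<lambda>i. b * w i"])
        (simp add: cspace_def cnorm_scale n)
  qed
  moreover have "herm_prod p (\<lambda>i. a * v i) (mat_app p q (to_matrix x) (\<lambda>i. b * w i)) = cnj a * b * herm_prod p v (mat_app p q (to_matrix x) w)"
    unfolding herm_prod_def mat_app_def sum_distrib_left by (intro sum.cong refl) (simp add: sum_distrib_left mult_ac)
  ultimately have "norm a * norm b * norm (herm_prod p v (mat_app p q (to_matrix x) w)) \<le> op_norm x"
    unfolding pairing_functional by (simp only: norm_mult complex_mod_cnj)
  then show ?thesis unfolding n using pos by (simp add: divide_simps mult_ac)
qed

text \<open>Write \<open>X\<close> for the matrix. From left to right, pair \<open>v\<close> with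
  \<open>X X* v\<close>. From right to left a uniform gap is required: the Cholesky factor
  \<open>K\<close> of \<open>1 - X X*\<close> is invertible, so
  \<open>norm v \<le> C * norm (K v)\<close>, and this bounds the square of \<open>X* v\<close> by
  \<open>1 - 1 / C\<^sup>2\<close> times that of \<open>v\<close>.\<close>

lemma op_norm_less_1_iff:
  assumes x: "x \<in> cspace I"
  shows "op_norm x < 1 \<longleftrightarrow> strict_contr p q (to_matrix x)"
proof
  assume N: "op_norm x < 1"
  have "strict_contr q p (adj (to_matrix x))"
    unfolding strict_contr_def
  proof (intro ballI impI)
    fix v assume v: "v \<in> cspace {..<p}" "v \<noteq> (\<lambda>_. 0)"
    define w where "w = mat_app q p (adj (to_matrix x)) v"
    have w: "w \<in> cspace {..<q}" by (simp add: w_def)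
    have pv: "0 < vec_norm p v" by (rule vec_norm_pos[OF v])
    show "vec_norm q (mat_app q p (adj (to_matrix x)) v) < vec_norm p v"
    proof (cases "w = (\<lambda>_. 0)")
      case True
      then show ?thesis using pv by (simp add: w_def)
    next
      case False
      have pw: "0 < vec_norm q w" by (rule vec_norm_pos[OF w False])
      have "herm_prod p v (mat_app p q (to_matrix x) w) = complex_of_real ((vec_norm q w)\<^sup>2)"
        unfolding herm_prod_adj w_def[symmetric] by (rule herm_prod_norm)
      then have "(vec_norm q w)\<^sup>2 = norm (herm_prod p v (mat_app p q (to_matrix x) w))" by (simp only: norm_of_real) simp
      also have "\<dots> \<le> op_norm x * (vec_norm p v * vec_norm q w)" by (rule herm_prod_le_op_norm[OF x v(1) w])
      also have "\<dots> < 1 * (vec_norm p v * vec_norm q w)" using N pv pw by (intro mult_strict_right_mono) simp_all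
      finally have "vec_norm q w * vec_norm q w < vec_norm p v * vec_norm q w" by (simp add: power2_eq_square)
      then show ?thesis using pw by (simp add: w_def)
    qed
  qed
  then show "strict_contr p q (to_matrix x)" by (simp add: strict_contr_adj_iff[of p q])
next
  assume c: "strict_contr p q (to_matrix x)"
  obtain K Ki where
    K: "\<forall>y\<in>cspace {..<p}. (vec_norm p (mat_app p p K y))\<^sup>2 = (vec_norm p y)\<^sup>2 - (vec_norm q (mat_app q p (adj (to_matrix x)) y))\<^sup>2"
    and KK: "\<forall>y\<in>cspace {..<p}. mat_app p p Ki (mat_app p p K y) = y \<and> mat_app p p K (mat_app p p Ki y) = y"
    by (rule cholesky_factors[OF c])
  obtain C where C: "0 < C" "\<forall>y. vec_norm p (mat_app p p Ki y) \<le> C * vec_norm p y" using vec_norm_mat_app_le[of p p Ki] by blast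
  \<comment> \<open>Taking the maximum with 0 makes the radicand nonnegative without a comparison of
    \<open>C\<close> with 1.\<close>
  define t where "t = sqrt (max 0 (1 - 1 / C\<^sup>2))"
  have t: "t < 1" "0 \<le> t" using C(1) by (simp_all add: t_def real_sqrt_lt_1_iff)
  have adj_le: "vec_norm q (mat_app q p (adj (to_matrix x)) v) \<le> t" if v: "v \<in> cspace {..<p}" "vec_norm p v \<le> 1" for v
  proof -
    have "vec_norm p (mat_app p p Ki (mat_app p p K v)) \<le> C * vec_norm p (mat_app p p K v)" using C(2) by (rule spec)
    then have "vec_norm p v \<le> C * vec_norm p (mat_app p p K v)" using KK v(1) by simp
    then have "(vec_norm p v)\<^sup>2 \<le> (C * vec_norm p (mat_app p p K v))\<^sup>2" by (rule power_mono) (rule cnorm_nonneg)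
    also have "\<dots> = C\<^sup>2 * ((vec_norm p v)\<^sup>2 - (vec_norm q (mat_app q p (adj (to_matrix x)) v))\<^sup>2)"
      using K v(1) by (simp add: power_mult_distrib)
    finally have "(vec_norm q (mat_app q p (adj (to_matrix x)) v))\<^sup>2 \<le> (1 - 1 / C\<^sup>2) * (vec_norm p v)\<^sup>2"
      using C(1) by (simp add: field_simps)
    also have "\<dots> \<le> max 0 (1 - 1 / C\<^sup>2) * (vec_norm p v)\<^sup>2" by (intro mult_right_mono) auto
    also have "\<dots> \<le> max 0 (1 - 1 / C\<^sup>2) * 1" using v(2) cnorm_nonneg[of "{..<p}" v] by (intro mult_left_mono power_le_one) auto
    finally show ?thesis unfolding t_def by (intro real_le_rsqrt) simp
  qed
  have "op_norm x \<le> t"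
  proof (rule N_le[OF x])
    fix l assume "l \<in> functionals"
    then obtain v w where l: "l = functional v w" "v \<in> cspace {..<p}" "vec_norm p v \<le> 1" "vec_norm q w \<le> 1"
      unfolding functionals_def by blast
    have "norm (pairing I l x) \<le> vec_norm q (mat_app q p (adj (to_matrix x)) v) * vec_norm q w"
      unfolding l(1) pairing_functional herm_prod_adj by (rule herm_prod_le)
    also have "\<dots> \<le> t * 1" by (intro mult_mono adj_le l t cnorm_nonneg)
    finally show "norm (pairing I l x) \<le> t" by simp
  qed
  then show "op_norm x < 1" using t(1) by linarith
qed

lemma unit_ball_strict_contr: "unit_ball = {x \<in> cspace I. strict_contr p q (to_matrix x)}"
  unfolding unit_ball_def using op_norm_less_1_iff by auto

lemma to_matrix_holo_on: "holo_on I G (\<lambda>x. to_matrix x i j)"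
proof (cases "(i, j) \<in> I \<or> (j, i) \<in> I")
  case True
  then show ?thesis
    by (cases "(i, j) \<in> I") (simp_all add: to_matrix_def holo_on_coord[OF fin_I] holo_on_mult holo_on_const)
qed (simp add: to_matrix_def holo_on_const)

end

section \<open>Homogeneity of the matrix domains\<close>

text \<open>The two assumptions isolate what depends on the type: they are immediate in the
  rectangular case and come from \<open>mobius_sym\<close> in the square case.\<close>

locale matrix_mobius = matrix_domain p q I \<epsilon> + mobius p q B K Ki H Hi for p q I \<epsilon> B K Ki H Hi +
  assumes good_fwd: "strict_contr p q Z \<Longrightarrow> good Z \<Longrightarrow> good (fwd Z)"
    and good_bwd: "strict_contr p q Z \<Longrightarrow> good Z \<Longrightarrow> good (bwd Z)"
begin

text \<open>\<open>to_matrix (to_coords Z)\<close> agrees with \<open>Z\<close> on the index range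
  only, so \<open>fwd\<close> must be seen to read no other entries.\<close>

lemma fwd_cong:
  assumes "\<And>i j. i < p \<Longrightarrow> j < q \<Longrightarrow> Z i j = Z' i j"
  shows "fwd Z = fwd Z'"
proof -
  have M: "M1 Z r s = M1 Z' r s" if "r < p" for r s using assms that by (simp add: M1_def)
  have "fun_det p (M1 Z) = fun_det p (M1 Z')" by (rule fun_det_cong) (rule M)
  moreover have "fun_det p (\<lambda>r s. if s = k then Z r j + B r j else M1 Z r s) =
      fun_det p (\<lambda>r s. if s = k then Z' r j + B r j else M1 Z' r s)" if "j < q" for j k
    by (rule fun_det_cong) (simp add: M assms that)
  ultimately have "W1 Z k j = W1 Z' k j" if "j < q" for k j using that by (simp add: W1_def)
  then show ?thesis unfolding fwd_def by simp
qed

lemma bwd_cong: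
  assumes "\<And>i j. i < p \<Longrightarrow> j < q \<Longrightarrow> V i j = V' i j"
  shows "bwd V = bwd V'"
proof -
  have "W2 V = W2 V'" unfolding W2_def using assms by simp
  then show ?thesis unfolding bwd_def M2_def by (simp only:)
qed

lemma mem_unit_ball: "x \<in> unit_ball \<Longrightarrow> x \<in> cspace I" "x \<in> unit_ball \<Longrightarrow> strict_contr p q (to_matrix x)"
  by (simp_all add: unit_ball_strict_contr)

lemma to_coords_unit_ball: "strict_contr p q Z \<Longrightarrow> good Z \<Longrightarrow> to_coords Z \<in> unit_ball"
  unfolding unit_ball_strict_contr using strict_contr_cong[of p q "to_matrix (to_coords Z)" Z] by (simp add: to_matrix_to_coords)

lemma fwd_holo_on: "i < p \<Longrightarrow> j < q \<Longrightarrow> holo_on I unit_ball (\<lambda>x. fwd (to_matrix x) i j)"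
proof -
  have M: "holo_on I unit_ball (\<lambda>x. M1 (to_matrix x) r s)" for r s
    unfolding M1_def by (intro holo_on_add holo_on_const holo_on_sum holo_on_mult to_matrix_holo_on)
  have "holo_on I unit_ball (\<lambda>x. if s = k then to_matrix x r l + B r l else M1 (to_matrix x) r s)" for r s k l
    by (cases "s = k") (simp_all add: M holo_on_add holo_on_const to_matrix_holo_on)
  then have "holo_on I unit_ball (\<lambda>x. W1 (to_matrix x) k l)" for k l
    unfolding W1_def by (intro holo_on_divide holo_on_fun_det M) (simp_all add: det1 mem_unit_ball)
  then show "holo_on I unit_ball (\<lambda>x. fwd (to_matrix x) i j)"
    unfolding fwd_def by (intro holo_on_sum holo_on_mult holo_on_const)
qed

lemma bwd_holo_on: "i < p \<Longrightarrow> j < q \<Longrightarrow> holo_on I unit_ball (\<lambda>x. bwd (to_matrix x) i j)"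
proof -
  have W: "holo_on I unit_ball (\<lambda>x. W2 (to_matrix x) r s)" for r s
    unfolding W2_def by (intro holo_on_const holo_on_sum holo_on_mult to_matrix_holo_on)
  have M: "holo_on I unit_ball (\<lambda>x. M2 (to_matrix x) r s)" for r s
    unfolding M2_def by (intro holo_on_diff holo_on_const holo_on_sum holo_on_mult W)
  have "holo_on I unit_ball (\<lambda>x. if s = j then W2 (to_matrix x) i r - B i r else M2 (to_matrix x) r s)" for r s
    by (cases "s = j") (simp_all add: M W holo_on_diff holo_on_const)
  then show "holo_on I unit_ball (\<lambda>x. bwd (to_matrix x) i j)"
    unfolding bwd_def by (intro holo_on_divide holo_on_fun_det M) (simp_all add: det2 mem_unit_ball)
qed

lemma to_coords_eqI: "x \<in> cspace I \<Longrightarrow> (\<And>i j. i < p \<Longrightarrow> j < q \<Longrightarrow> Z i j = to_matrix x i j) \<Longrightarrow> to_coords Z = x"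
proof
  fix k assume x: "x \<in> cspace I" and Z: "\<And>i j. i < p \<Longrightarrow> j < q \<Longrightarrow> Z i j = to_matrix x i j"
  show "to_coords Z k = x k"
  proof (cases k)
    case (Pair i j)
    show ?thesis
    proof (cases "k \<in> I")
      case True
      then have "Z i j = to_matrix x i j" using Z I_less Pair by simp
      then show ?thesis using True Pair by (simp add: to_coords_def to_matrix_def)
    next
      case False
      then have "x k = 0" using x unfolding cspace_def by blast
      then show ?thesis using False by (simp add: to_coords_def)
    qed
  qed
qed

lemma to_coords_bwd_fwd:
  assumes x: "x \<in> unit_ball"
  shows "to_coords (bwd (to_matrix (to_coords (fwd (to_matrix x))))) = x"
proof -
  note x' = mem_unit_ball[OF x]
  have "bwd (to_matrix (to_coords (fwd (to_matrix x)))) = bwd (fwd (to_matrix x))"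
    by (rule bwd_cong) (rule to_matrix_to_coords[OF good_fwd[OF x'(2) good_to_matrix]])
  then show ?thesis by (simp only:) (rule to_coords_eqI[OF x'(1) bwd_fwd[OF x'(2)]])
qed

lemma aut_pair_mobius: "aut_pair I unit_ball (\<lambda>x. to_coords (bwd (to_matrix x))) (\<lambda>x. to_coords (fwd (to_matrix x)))"
  unfolding aut_pair_def
proof (intro conjI ballI)
  fix k assume k: "k \<in> I"
  then have "fst k < p" "snd k < q" using I_less[of "fst k" "snd k"] by simp_all
  then show "holo_on I unit_ball (\<lambda>x. to_coords (bwd (to_matrix x)) k)" "holo_on I unit_ball (\<lambda>x. to_coords (fwd (to_matrix x)) k)"
    using k by (simp_all add: to_coords_def fwd_holo_on bwd_holo_on)
next
  show "(\<lambda>x. to_coords (bwd (to_matrix x))) ` unit_ball \<subseteq> unit_ball"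
    by (intro image_subsetI to_coords_unit_ball bwd_strict_contr good_bwd good_to_matrix mem_unit_ball)
  show "(\<lambda>x. to_coords (fwd (to_matrix x))) ` unit_ball \<subseteq> unit_ball"
    by (intro image_subsetI to_coords_unit_ball fwd_strict_contr good_fwd good_to_matrix mem_unit_ball)
next
  fix x assume x: "x \<in> unit_ball"
  note x' = mem_unit_ball[OF x]
  have "fwd (to_matrix (to_coords (bwd (to_matrix x)))) = fwd (bwd (to_matrix x))"
    by (rule fwd_cong) (rule to_matrix_to_coords[OF good_bwd[OF x'(2) good_to_matrix]])
  then show "to_coords (fwd (to_matrix (to_coords (bwd (to_matrix x))))) = x"
    by (simp only:) (rule to_coords_eqI[OF x'(1) fwd_bwd[OF x'(2)]])
  show "to_coords (bwd (to_matrix (to_coords (fwd (to_matrix x))))) = x" by (rule to_coords_bwd_fwd[OF x])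
qed

lemma aut_pair_zero:
  assumes b: "b \<in> unit_ball" and B: "B = (\<lambda>i j. - to_matrix b i j)"
  shows "to_coords (bwd (to_matrix (\<lambda>_. 0))) = b"
proof -
  have mb: "(\<lambda>i j. - B i j) = to_matrix b" by (simp add: B)
  have "fwd (to_matrix b) i j = 0" if "i < p" "j < q" for i j using fwd_neg[OF that] unfolding mb .
  then have "to_coords (fwd (to_matrix b)) = (\<lambda>_. 0)" by (intro to_coords_eqI) (simp_all add: cspace_def to_matrix_def)
  moreover have "to_coords (bwd (to_matrix (to_coords (fwd (to_matrix b))))) = b"
    by (rule to_coords_bwd_fwd[OF b])
  ultimately show ?thesis by simp
qed

end

context matrix_domain
begin

text \<open>\<open>B = - b\<close> is chosen so that \<open>bwd\<close> sends 0 to \<open>b\<close>.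
  For type I, \<open>K\<close> and \<open>H\<close> are independent Cholesky factors; for the square
  types they have to be compatible.\<close>

lemma homogeneous_unit_ball: "homogeneous I unit_ball"
  unfolding homogeneous_def
proof
  fix b assume b: "b \<in> unit_ball"
  define B where "B = (\<lambda>i j. - to_matrix b i j)"
  have cb: "strict_contr p q (to_matrix b)" using b by (simp add: unit_ball_strict_contr)
  have "mat_app p q B x = (\<lambda>i. - mat_app p q (to_matrix b) x i)" for x by (auto simp: mat_app_def B_def sum_negf)
  then have cB: "strict_contr p q B" using cb by (simp add: strict_contr_def cnorm_def)
  obtain K Ki where
    Kf: "\<forall>i<p. \<forall>j<p. (\<Sum>k<p. cnj (K k i) * K k j) = (if i = j then 1 else 0) - (\<Sum>m<q. B i m * adj B m j)"
    and K: "\<forall>y\<in>cspace {..<p}. (vec_norm p (mat_app p p K y))\<^sup>2 = (vec_norm p y)\<^sup>2 - (vec_norm q (mat_app q p (adj B) y))\<^sup>2"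
    and KK: "\<forall>y\<in>cspace {..<p}. mat_app p p Ki (mat_app p p K y) = y \<and> mat_app p p K (mat_app p p Ki y) = y"
    by (rule cholesky_factors[OF cB])
  have "\<exists>H Hi. matrix_mobius p q I \<epsilon> B K Ki H Hi"
  proof (cases rule: type_cases)
    case rectangular
    obtain H Hi where
      H: "\<forall>y\<in>cspace {..<q}. (vec_norm q (mat_app q q H y))\<^sup>2 = (vec_norm q y)\<^sup>2 - (vec_norm p (mat_app p q (adj (adj B)) y))\<^sup>2"
      and HH: "\<forall>y\<in>cspace {..<q}. mat_app q q Hi (mat_app q q H y) = y \<and> mat_app q q H (mat_app q q Hi y) = y"
      by (rule cholesky_factors[OF strict_contr_adj[OF cB]])
    interpret mobius p q B K Ki H Hi
      by unfold_locales (use cB K KK H HH in simp_all)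
    have "matrix_mobius p q I \<epsilon> B K Ki H Hi" 
      by unfold_locales (unfold good_def, (rule disjI1, rule rectangular(1))+)
    then show ?thesis by (intro exI)
  next
    case square
    note pq = square(1) and e = square(2)
    \<comment> \<open>If \<open>B\<close> is symmetric or skew-symmetric, the entrywise conjugate of
      \<open>1 - B B*\<close> is \<open>1 - B* B\<close>, so the conjugate of \<open>K\<close> is an
      admissible \<open>H\<close>.\<close>
    define H Hi where "H = (\<lambda>i j. cnj (K i j))" and "Hi = (\<lambda>i j. cnj (Ki i j))"
    have cap: "mat_app p p (\<lambda>i j. cnj (A i j)) x = (\<lambda>i. cnj (mat_app p p A (\<lambda>j. cnj (x j)) i))" for A x
      by (auto simp: mat_app_def cnj_sum)
    have cc: "(\<lambda>j. cnj (x j)) \<in> cspace {..<p}" if "x \<in> cspace {..<p}" for x using that by (simp add: cspace_def)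
    have cn: "vec_norm p (\<lambda>i. cnj (x i)) = vec_norm p x" for x by (simp add: cnorm_def)
    have ee: "\<epsilon> * \<epsilon> = 1" "cnj \<epsilon> = \<epsilon>" "norm \<epsilon> = 1" using e by auto
    have e0: "\<epsilon> \<noteq> 0" using e by auto
    have sb: "eps_symmetric \<epsilon> p (to_matrix b)" using good_to_matrix[of b] e0 by (simp add: good_def)
    have sB: "eps_symmetric \<epsilon> p B" unfolding eps_symmetric_def B_def
    proof (intro allI impI)
      fix i j assume "i < p" "j < p"
      then show "- to_matrix b j i = \<epsilon> * - to_matrix b i j" using esymD[OF sb, of i j] by simp
    qed
    have aB: "vec_norm p (mat_app p p (adj B) (\<lambda>j. cnj (x j))) = vec_norm p (mat_app p p B x)" for x
    proof -
      have "mat_app p p (adj B) (\<lambda>j. cnj (x j)) = (\<lambda>i. \<epsilon> * cnj (mat_app p p B x i))"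
      proof
        fix i
        have "adj B i j * cnj (x j) = \<epsilon> * cnj (B i j * x j)" if "i < p" "j < p" for j
          unfolding adj_def esymD[OF sB that] by (simp add: ee)
        then have "(\<Sum>j<p. adj B i j * cnj (x j)) = (\<Sum>j<p. \<epsilon> * cnj (B i j * x j))" if "i < p"
          using that by (intro sum.cong refl) (simp only: lessThan_iff)
        then show "mat_app p p (adj B) (\<lambda>j. cnj (x j)) i = \<epsilon> * cnj (mat_app p p B x i)"
          unfolding mat_app_def cnj_sum sum_distrib_left[symmetric] by (cases "i < p") simp_all
      qed
      then show ?thesis by (simp add: cnorm_scale cn ee)
    qed
    have mob: "mobius p p B K Ki H Hi"
    proof
      show "strict_contr p p B" using cB pq by simp
      show "(vec_norm p (mat_app p p K y))\<^sup>2 = (vec_norm p y)\<^sup>2 - (vec_norm p (mat_app p p (adj B) y))\<^sup>2" if "y \<in> cspace {..<p}" for y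
        using K that pq by simp
      show "(vec_norm p (mat_app p p H x))\<^sup>2 = (vec_norm p x)\<^sup>2 - (vec_norm p (mat_app p p B x))\<^sup>2" if x: "x \<in> cspace {..<p}" for x
        using bspec[OF K cc[OF x]] unfolding H_def cap cn pq[symmetric] aB .
      show "mat_app p p Ki (mat_app p p K y) = y" "mat_app p p K (mat_app p p Ki y) = y" if "y \<in> cspace {..<p}" for y using KK that by simp_all
      show "mat_app p p Hi (mat_app p p H y) = y" "mat_app p p H (mat_app p p Hi y) = y" if "y \<in> cspace {..<p}" for y
        unfolding H_def Hi_def cap using bspec[OF KK cc[OF that]] by simp_all
    qed
    interpret mobius p p B K Ki H Hi by (rule mob)
    interpret mobius_sym p B K Ki H Hi \<epsilon>
      by unfold_locales (use e sB Kf pq in \<open>simp_all add: H_def\<close>)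
    interpret D: matrix_domain p p I \<epsilon> using matrix_domain_axioms pq by simp
    have good: "D.good Z \<longleftrightarrow> eps_symmetric \<epsilon> p Z" for Z using e0 by (simp add: D.good_def)
    have "matrix_mobius p p I \<epsilon> B K Ki H Hi" by unfold_locales (simp_all add: good fwd_eps_symmetric bwd_eps_symmetric)
    then show ?thesis unfolding pq[symmetric] by (intro exI)
  qed
  then obtain H Hi where "matrix_mobius p q I \<epsilon> B K Ki H Hi" by (elim exE)
  then interpret matrix_mobius p q I \<epsilon> B K Ki H Hi .
  show "\<exists>\<phi> \<psi>. aut_pair I unit_ball \<phi> \<psi> \<and> \<phi> (\<lambda>_. 0) = b"
    by (rule exI, rule exI, rule conjI, rule aut_pair_mobius) (rule aut_pair_zero[OF b B_def])
qed

end

section \<open>From the defining conditions to unit balls\<close>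

lemma mat_adjoint_index:
  assumes "Z \<in> carrier_mat p q"
  shows "mat_adjoint Z \<in> carrier_mat q p" "i < q \<Longrightarrow> j < p \<Longrightarrow> mat_adjoint Z $$ (i, j) = cnj (Z $$ (j, i))"
  using assms by (auto simp: mat_adjoint_def mat_of_rows_def)

lemma mult_mat_vec_mat_app:
  assumes "A \<in> carrier_mat n m"
  shows "A *\<^sub>v vec m y = vec n (mat_app n m (\<lambda>i j. A $$ (i, j)) y)"
  using assms by (intro eq_vecI) (auto simp: mat_app_def scalar_prod_def lessThan_atLeast0)

text \<open>The form of \<open>1 - Z Z*\<close> at a vector is its squared length minus that of its
  image under \<open>Z*\<close>; strict contraction then passes from \<open>Z*\<close> to
  \<open>Z\<close>.\<close>

lemma positive_definite_iff_strict_contr: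
  assumes Z: "Z \<in> carrier_mat p q"
  shows "positive_definite (1\<^sub>m p - Z * mat_adjoint Z) \<longleftrightarrow> strict_contr p q (\<lambda>i j. Z $$ (i, j))"
proof -
  define z where "z = (\<lambda>i j. Z $$ (i, j))"
  define W where "W = mat_adjoint Z"
  define A where "A = 1\<^sub>m p - Z * W"
  have W: "W \<in> carrier_mat q p" and Wij: "\<And>i j. i < q \<Longrightarrow> j < p \<Longrightarrow> W $$ (i, j) = cnj (Z $$ (j, i))"
    unfolding W_def using mat_adjoint_index[OF Z] by auto
  have A: "A \<in> carrier_mat p p" unfolding A_def by (rule minus_carrier_mat) (rule mult_carrier_mat[OF Z W])
  have Aij: "A $$ (i, j) = (if i = j then 1 else 0) - (\<Sum>k<q. Z $$ (i, k) * cnj (Z $$ (j, k)))" if "i < p" "j < p" for i j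
    using that Z W unfolding A_def by (simp add: scalar_prod_def Wij lessThan_atLeast0)
  have herm: "mat_adjoint A = A"
  proof (rule eq_matI)
    fix i j assume "i < dim_row A" "j < dim_col A"
    then have ij: "i < p" "j < p" using A by auto
    have "cnj (A $$ (j, i)) = A $$ (i, j)"
      unfolding Aij[OF ij] Aij[OF ij(2,1)] by (simp add: cnj_sum mult.commute)
    then show "mat_adjoint A $$ (i, j) = A $$ (i, j)" using mat_adjoint_index(2)[OF A ij] by simp
  qed (use mat_adjoint_index(1)[OF A] A in auto)
  have quad: "(A *\<^sub>v vec p y) \<bullet>c vec p y = complex_of_real ((vec_norm p y)\<^sup>2 - (vec_norm q (mat_app q p (adj z) y))\<^sup>2)" for y
  proof -
    have "(\<lambda>i j. W $$ (i, j)) i j = adj z i j" if "i < q" "j < p" for i j using that by (simp add: Wij adj_def z_def)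
    then have aW: "mat_app q p (\<lambda>i j. W $$ (i, j)) y = mat_app q p (adj z) y" by (rule mat_app_cong)
    have "A *\<^sub>v vec p y = vec p y - Z *\<^sub>v (W *\<^sub>v vec p y)"
      unfolding A_def using Z W
      by (subst minus_mult_distrib_mat_vec[of _ p p]) (auto simp: assoc_mult_mat_vec[of _ p q _ p])
    also have "\<dots> = vec p (\<lambda>i. y i - mat_app p q z (mat_app q p (adj z) y) i)"
      unfolding mult_mat_vec_mat_app[OF W] aW mult_mat_vec_mat_app[OF Z] by (intro eq_vecI) (auto simp: z_def)
    finally have "(A *\<^sub>v vec p y) \<bullet>c vec p y = herm_prod p y y - herm_prod p y (mat_app p q z (mat_app q p (adj z) y))"
      by (simp add: scalar_prod_def herm_prod_def lessThan_atLeast0 sum_subtractf[symmetric] algebra_simps)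
    then show ?thesis unfolding herm_prod_adj herm_prod_norm by simp
  qed
  have ex: "v = vec p (\<lambda>i. if i < p then v $ i else 0)" if "v \<in> carrier_vec p" for v
    using that by (intro eq_vecI) auto
  have "positive_definite A \<longleftrightarrow> (\<forall>v\<in>carrier_vec p. v \<noteq> 0\<^sub>v p \<longrightarrow> (A *\<^sub>v v) \<bullet>c v > 0)"
    unfolding positive_definite_def using A herm by auto
  also have "\<dots> \<longleftrightarrow> strict_contr q p (adj z)"
    unfolding strict_contr_def
  proof (intro iffI ballI impI)
    fix y assume h: "\<forall>v\<in>carrier_vec p. v \<noteq> 0\<^sub>v p \<longrightarrow> (A *\<^sub>v v) \<bullet>c v > 0" and y: "y \<in> cspace {..<p}" "y \<noteq> (\<lambda>_. 0)"
    have "vec p y \<noteq> 0\<^sub>v p"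
    proof
      assume "vec p y = 0\<^sub>v p"
      then have "y i = 0" if "i < p" for i using that by (metis index_vec index_zero_vec(1))
      then have "y = (\<lambda>_. 0)" by (intro cspace_eqI[OF y(1)]) (auto simp: cspace_def)
      with y(2) show False by simp
    qed
    then have "(A *\<^sub>v vec p y) \<bullet>c vec p y > 0" using h by simp
    then have "(vec_norm q (mat_app q p (adj z) y))\<^sup>2 < (vec_norm p y)\<^sup>2" unfolding quad by (simp add: less_complex_def)
    then show "vec_norm q (mat_app q p (adj z) y) < vec_norm p y" by (rule power2_less_imp_less) (rule cnorm_nonneg)
  next
    fix v :: "complex vec" assume h: "\<forall>x\<in>cspace {..<p}. x \<noteq> (\<lambda>_. 0) \<longrightarrow> vec_norm q (mat_app q p (adj z) x) < vec_norm p x"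
      and v: "v \<in> carrier_vec p" "v \<noteq> 0\<^sub>v p"
    define y where "y = (\<lambda>i. if i < p then v $ i else 0)"
    have vy: "v = vec p y" unfolding y_def by (rule ex[OF v(1)])
    have "y \<noteq> (\<lambda>_. 0)" using v(2) unfolding vy by (auto simp: zero_vec_def)
    moreover have "y \<in> cspace {..<p}" by (simp add: y_def cspace_def)
    ultimately have "vec_norm q (mat_app q p (adj z) y) < vec_norm p y" using h by simp
    then have "(vec_norm q (mat_app q p (adj z) y))\<^sup>2 < (vec_norm p y)\<^sup>2" by (intro power_strict_mono cnorm_nonneg) auto
    then show "(A *\<^sub>v v) \<bullet>c v > 0" unfolding vy quad by (simp add: less_complex_def)
  qed
  finally show ?thesis unfolding A_def W_def z_def strict_contr_adj_iff[of p q] .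
qed

context matrix_domain
begin

text \<open>\<open>S\<close> stands for the symmetry condition of the type at hand, so that types I,
  II and III share one argument.\<close>

lemma mat_coords_image:
  assumes S: "\<And>Z. Z \<in> carrier_mat p q \<Longrightarrow> S Z \<longleftrightarrow> good (\<lambda>i j. Z $$ (i, j))"
  shows "mat_coords I ` {Z \<in> carrier_mat p q. S Z \<and> positive_definite (1\<^sub>m p - Z * mat_adjoint Z)} = unit_ball"
proof (intro subset_antisym subsetI)
  fix x assume "x \<in> mat_coords I ` {Z \<in> carrier_mat p q. S Z \<and> positive_definite (1\<^sub>m p - Z * mat_adjoint Z)}"
  then obtain Z where Z: "Z \<in> carrier_mat p q" "S Z" "positive_definite (1\<^sub>m p - Z * mat_adjoint Z)" and x: "x = mat_coords I Z"
    by blast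
  let ?z = "\<lambda>i j. Z $$ (i, j)"
  have xz: "x = to_coords ?z" by (auto simp: x mat_coords_def to_coords_def fun_eq_iff)
  have g: "good ?z" using S[OF Z(1)] Z(2) by simp
  have "strict_contr p q ?z" using Z(3) unfolding positive_definite_iff_strict_contr[OF Z(1)] .
  then have "strict_contr p q (to_matrix x)" unfolding xz by (subst strict_contr_cong[of p q _ ?z]) (rule to_matrix_to_coords[OF g])
  then show "x \<in> unit_ball" unfolding unit_ball_strict_contr xz by simp
next
  fix x assume "x \<in> unit_ball"
  then have x: "x \<in> cspace I" and c: "strict_contr p q (to_matrix x)" by (simp_all add: unit_ball_strict_contr)
  define Z where "Z = mat p q (\<lambda>(i, j). to_matrix x i j)"
  let ?z = "\<lambda>i j. Z $$ (i, j)"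
  have Z: "Z \<in> carrier_mat p q" by (simp add: Z_def)
  have e: "Z $$ (i, j) = to_matrix x i j" if "i < p" "j < q" for i j using that by (simp add: Z_def)
  have "strict_contr p q ?z" using c by (subst strict_contr_cong[of p q _ "to_matrix x"]) (rule e)
  \<comment> \<open>The local name \<open>partial_deriv\<close> stands for positive
    definiteness.\<close>
  then have partial_deriv: "positive_definite (1\<^sub>m p - Z * mat_adjoint Z)" unfolding positive_definite_iff_strict_contr[OF Z] .
  have "good ?z"
  proof (cases rule: type_cases)
    case rectangular
    from this(1) show ?thesis unfolding good_def by (rule disjI1)
  next
    case square
    then have "eps_symmetric \<epsilon> p (to_matrix x)" using good_to_matrix[of x] unfolding good_def by auto
    note s = this
    have "eps_symmetric \<epsilon> p ?z"
      unfolding eps_symmetric_def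
    proof (intro allI impI)
      fix i j assume ij: "i < p" "j < p"
      show "Z $$ (j, i) = \<epsilon> * Z $$ (i, j)"
        using e[of i j] e[of j i] ij square(1) esymD[OF s ij] by (simp only:)
    qed
    then show ?thesis unfolding good_def by (rule disjI2)
  qed
  then have "S Z" using S[OF Z] by simp
  moreover have "mat_coords I Z = x"
  proof
    fix k :: "nat \<times> nat"
    obtain i j where k: "k = (i, j)" by (cases k)
    show "mat_coords I Z k = x k"
    proof (cases "k \<in> I")
      case True
      then have "i < p" "j < q" using I_less k by simp_all
      then show ?thesis using True by (simp add: k mat_coords_def e to_matrix_def)
    next
      case False
      then have "x k = 0" using x unfolding cspace_def by blast
      then show ?thesis using False by (simp add: mat_coords_def)
    qed
  qed
  ultimately show "x \<in> mat_coords I ` {Z \<in> carrier_mat p q. S Z \<and> positive_definite (1\<^sub>m p - Z * mat_adjoint Z)}"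
    using Z partial_deriv by blast
qed

lemma matrix_type_unit_ball:
  assumes "\<And>Z. Z \<in> carrier_mat p q \<Longrightarrow> S Z \<longleftrightarrow> good (\<lambda>i j. Z $$ (i, j))"
    and "D = mat_coords I ` {Z \<in> carrier_mat p q. S Z \<and> positive_definite (1\<^sub>m p - Z * mat_adjoint Z)}"
  shows "\<exists>\<Lambda> N. cnormed I \<Lambda> N \<and> D = cnormed.unit_ball I N \<and> homogeneous I D"
proof -
  have D: "D = unit_ball" unfolding assms(2) by (rule mat_coords_image) (rule assms(1))
  show ?thesis unfolding D
    by (intro exI[of _ functionals] exI[of _ op_norm] conjI refl cnormed_axioms homogeneous_unit_ball)
qed

end

lemma classical_cartan_domain_unit_ball:
  assumes "classical_cartan_domain I D"
  shows "\<exists>\<Lambda> N. cnormed I \<Lambda> N \<and> D = cnormed.unit_ball I N \<and> homogeneous I D"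
  using assms
proof cases
  case (type_I p q)
  have "(0, 0) \<in> I" using type_I by simp
  then have ne: "I \<noteq> {}" by blast
  interpret matrix_domain p q I 0 by unfold_locales (use type_I ne in auto)
  show ?thesis by (rule matrix_type_unit_ball[where S = "\<lambda>_. True"]) (simp_all add: good_def type_I(4))
next
  case (type_II p)
  have "(0, 1) \<in> I" using type_II by simp
  then have ne: "I \<noteq> {}" by blast
  interpret matrix_domain p p I "-1" by unfold_locales (use ne in \<open>auto simp: type_II(2)\<close>)
  have S: "transpose_mat Z = - Z \<longleftrightarrow> good (\<lambda>i j. Z $$ (i, j))" if Z: "Z \<in> carrier_mat p p" for Z
  proof
    assume h: "transpose_mat Z = - Z"
    have "Z $$ (j, i) = - 1 * Z $$ (i, j)" if "i < p" "j < p" for i j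
      using arg_cong[OF h, of "\<lambda>A. A $$ (i, j)"] Z that by simp
    then show "good (\<lambda>i j. Z $$ (i, j))" unfolding good_def eps_symmetric_def by blast
  next
    assume "good (\<lambda>i j. Z $$ (i, j))"
    then have s: "eps_symmetric (- 1) p (\<lambda>i j. Z $$ (i, j))" unfolding good_def by simp
    show "transpose_mat Z = - Z"
    proof (rule eq_matI)
      fix i j assume "i < dim_row (- Z)" "j < dim_col (- Z)"
      then have ij: "i < p" "j < p" using Z by auto
      then show "transpose_mat Z $$ (i, j) = (- Z) $$ (i, j)" using Z esymD[OF s ij] by simp
    qed (use Z in auto)
  qed
  show ?thesis by (rule matrix_type_unit_ball[OF S type_II(3)])
next
  case (type_III p)
  have "(0, 0) \<in> I" using type_III by simp
  then have ne: "I \<noteq> {}" by blast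
  interpret matrix_domain p p I 1 by unfold_locales (use ne in \<open>auto simp: type_III(2)\<close>)
  have S: "transpose_mat Z = Z \<longleftrightarrow> good (\<lambda>i j. Z $$ (i, j))" if Z: "Z \<in> carrier_mat p p" for Z
  proof
    assume h: "transpose_mat Z = Z"
    have "Z $$ (j, i) = 1 * Z $$ (i, j)" if "i < p" "j < p" for i j
      using arg_cong[OF h, of "\<lambda>A. A $$ (i, j)"] Z that by simp
    then show "good (\<lambda>i j. Z $$ (i, j))" unfolding good_def eps_symmetric_def by blast
  next
    assume "good (\<lambda>i j. Z $$ (i, j))"
    then have s: "eps_symmetric 1 p (\<lambda>i j. Z $$ (i, j))" unfolding good_def by simp
    show "transpose_mat Z = Z"
    proof (rule eq_matI)
      fix i j assume "i < dim_row Z" "j < dim_col Z"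
      then have ij: "i < p" "j < p" using Z by auto
      have "Z $$ (j, i) = Z $$ (i, j)" using esymD[OF s ij] by (simp only: mult_1_left)
      then show "transpose_mat Z $$ (i, j) = Z $$ (i, j)" using Z ij by simp
    qed (use Z in auto)
  qed
  show ?thesis by (rule matrix_type_unit_ball[OF S type_III(3)])
next
  case (type_IV n)
  have fin: "finite I" using type_IV by simp
  have sq: "(\<Sum>i\<in>I. (norm (z i))\<^sup>2) = sq_norm I z" for z by (simp add: sq_norm_def)
  have D: "D = lie_ball I"
    unfolding type_IV(3) lie_ball_def sq pairing_def power2_eq_square[of "_ :: complex"] ..
  show ?thesis
  proof (cases "n = 1")
    case False
    have I: "finite I" "(0, 0) \<in> I" "(0, 1) \<in> I" "(0, 0) \<noteq> (0::nat, 1::nat)" using type_IV False by auto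
    note c = spin_cnormed(1)[OF I]
    show ?thesis
    proof (intro exI conjI)
      show "cnormed I (isotropic I) (spin_norm I)" by (rule c)
      show "D = cnormed.unit_ball I (spin_norm I)" unfolding D cnormed.unit_ball_def[OF c] spin_cnormed(2)[OF I] ..
      show "homogeneous I D" unfolding D by (rule lie_ball_homogeneous[OF I])
    qed
  next
    case True
    have I: "I = {(0, 0)}" using type_IV True by auto
    have c: "cnormed I {l. cnorm I l \<le> 1} (cnorm I)" by (rule cnormed_cnorm) (simp_all add: I)
    have "x \<in> lie_ball I \<longleftrightarrow> x \<in> cball0 I 1" for x
    proof (cases "x \<in> cspace I")
      case xc: True
      let ?a = "norm (x (0, 0))"
      have 1: "sq_norm I x = ?a\<^sup>2" "norm (pairing I x x) = ?a\<^sup>2" "cnorm I x = ?a"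
        by (simp_all add: I sq_norm_def pairing_def norm_mult power2_eq_square cnorm_def)
      \<comment> \<open>In one variable the second defining condition is the positivity of a square,
        so together with the first it just says that the modulus is below one.\<close>
      have 2: "1 - 2 * ?a\<^sup>2 + (?a\<^sup>2)\<^sup>2 = (1 - ?a\<^sup>2)\<^sup>2" by (simp add: power2_eq_square algebra_simps)
      have "?a\<^sup>2 < 1 \<and> (1 - ?a\<^sup>2)\<^sup>2 > 0 \<longleftrightarrow> ?a < 1" using abs_square_less_1[of ?a] by auto
      then show ?thesis using xc unfolding lie_ball_def cball0_def mem_Collect_eq 1 2 by simp
    qed (simp add: lie_ball_def cball0_def)
    then have DB: "D = cball0 I 1" unfolding D by (simp only: set_eq_iff simp_thms)
    show ?thesis
    proof (intro exI conjI)
      show "cnormed I {l. cnorm I l \<le> 1} (cnorm I)" by (rule c)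
      show "D = cnormed.unit_ball I (cnorm I)" unfolding DB cnormed.unit_ball_def[OF c] cball0_def ..
      show "homogeneous I D" unfolding DB I by (rule one_dim_ball_homogeneous)
    qed
  qed
qed

section \<open>The formula for \<open>rho\<close>\<close>

context cnormed_family
begin

lemma rho_product:
  assumes h: "\<And>l. l < m \<Longrightarrow> homogeneous (I l) (cnormed.unit_ball (I l) (N l))"
  shows "rho J P.unit_ball = (\<Sum>l<m. rho (I l) (cnormed.unit_ball (I l) (N l)) powr (- 2)) powr (- 1 / 2)"
proof -
  have sq: "r powr (- 2) = 1 / r\<^sup>2" if "0 < r" for r :: real
    using that by (simp add: powr_minus_divide)
  define S where "S = Sup (hilbert_ratios J product_norm)"
  have S: "0 < S" unfolding S_def by (rule P.Sup_hilbert_ratios_pos)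
  have R: "rho (I l) (cnormed.unit_ball (I l) (N l)) powr (- 2) = 1 / (R l)\<^sup>2" if l: "l < m" for l
    unfolding cnormed.rho_unit_ball[OF cn[OF l] h[OF l]] R_def[symmetric] by (rule sq[OF R_pos[OF l]])
  have "(\<Sum>l<m. rho (I l) (cnormed.unit_ball (I l) (N l)) powr (- 2)) = (\<Sum>l<m. 1 / (R l)\<^sup>2)"
    by (intro sum.cong refl R) simp
  also have "\<dots> = S powr (- 2)" unfolding sq[OF S] unfolding S_def by (rule Sup_hilbert_ratios_product[symmetric])
  finally have "(\<Sum>l<m. rho (I l) (cnormed.unit_ball (I l) (N l)) powr (- 2)) powr (- 1 / 2) = S"
    using S by (simp add: powr_powr)
  moreover have "homogeneous J P.unit_ball" by (rule homogeneous_product) (rule h)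
  ultimately show ?thesis using P.rho_unit_ball by (simp add: S_def)
qed

end

theorem corollary5:
  fixes m :: nat
    and I :: "nat \<Rightarrow> (nat \<times> nat) set"
    and D :: "nat \<Rightarrow> (nat \<times> nat \<Rightarrow> complex) set"
  assumes "m \<ge> 1"
    and "\<And>l. l < m \<Longrightarrow> classical_cartan_domain (I l) (D l)"
  shows "rho (product_index m I) (product_domain m I D) =
           (\<Sum>l<m. rho (I l) (D l) powr (- 2)) powr (- 1 / 2)"
proof -
  \<comment> \<open>The functionals and the norm of each factor are packed into one pair, so that a
    single choice selects both.\<close>
  have "\<forall>l\<in>{..<m}. \<exists>p. cnormed (I l) (fst p) (snd p) \<and> D l = cnormed.unit_ball (I l) (snd p) \<and> homogeneous (I l) (D l)"
  proof
    fix l assume "l \<in> {..<m}"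
    then have "classical_cartan_domain (I l) (D l)" by (simp add: assms(2))
    then have "\<exists>\<Lambda> N. cnormed (I l) \<Lambda> N \<and> D l = cnormed.unit_ball (I l) N \<and> homogeneous (I l) (D l)"
      by (rule classical_cartan_domain_unit_ball)
    then show "\<exists>p. cnormed (I l) (fst p) (snd p) \<and> D l = cnormed.unit_ball (I l) (snd p) \<and> homogeneous (I l) (D l)"
      unfolding split_paired_Ex fst_conv snd_conv .
  qed
  from bchoice[OF this] obtain p where p: "\<forall>l\<in>{..<m}. cnormed (I l) (fst (p l)) (snd (p l)) \<and>
    D l = cnormed.unit_ball (I l) (snd (p l)) \<and> homogeneous (I l) (D l)" ..
  have c: "cnormed (I l) (fst (p l)) (snd (p l))" and Dl: "D l = cnormed.unit_ball (I l) (snd (p l))"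
    and h: "homogeneous (I l) (cnormed.unit_ball (I l) (snd (p l)))" if "l < m" for l
    using bspec[OF p, of l] that by auto
  interpret cnormed_family m I "\<lambda>l. fst (p l)" "\<lambda>l. snd (p l)"
    by (rule cnormed_family.intro) (rule assms(1), rule c)
  have "product_domain m I D = P.unit_ball"
    unfolding unit_ball_product product_domain_def by (auto simp: Dl)
  moreover have "(\<Sum>l<m. rho (I l) (D l) powr (- 2)) =
      (\<Sum>l<m. rho (I l) (cnormed.unit_ball (I l) (snd (p l))) powr (- 2))"
    by (intro sum.cong refl) (simp add: Dl)
  ultimately show ?thesis using rho_product[OF h] by simp
qed

end
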